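(* Let $(T,E)$ be the infinite regular tree in which each vertex has degree 3, let $(\mathcal U,\vec F)$ be the pair, unique in law, described in the context, and let $F:=\big\{\{v,w\}\in E:(v,w)\in\vec F\text{ or }(w,v)\in\vec F\big\}$. Let $F'$ be a copy of $F$, conditionally independent of $F$ given $\mathcal U$ (i.e. $(\mathcal U,F')$ has the same law as $(\mathcal U,F)$, and $F,F'$ are conditionally independent given $\mathcal U$). Then $F\ne F'$ almost surely. In particular, the random variable $F$ is not measurable with respect to the $\sigma$-field generated by $\mathcal U$.
   Context: Notation. $\vec E:=\{(v,w),(w,v):\{v,w\}\in E\}$. $\mathcal U=(U_e)_{e\in E}$ are i.i.d. uniformly distributed on $[0,1]$. For $t\in[0,1]$, $\vec E_t:=\{(v,w)\in\vec E:U_{\{v,w\}}\le t\}$. A ray is an infinite sequence of oriented edges $(v_n,w_n)_{n\ge0}$ with $v_n=w_{n-1}$ and $w_n\ne v_{n-1}$ for all $n\ge1$. For $(v,w)\in\vec E$, $\vec E_{(v,w)}$ is the set of all oriented edges lying on some ray starting with $(v_0,w_0)=(v,w)$, and $E_{(v,w)}$ is the associated set of unoriented edges. For a set $S$ of vertices, $\partial S:=\{(v,w)\in\vec E:v\in S,\ w\in T\setminus S\}$, $E_S:=\{\{v,w\}\in E:v,w\in S\}$, and $S$ is a subtree if $(S,E_S)$ is a tree. It is known that there exists a pair $(\mathcal U,\vec F)$, with $\vec F\subset\vec E$ a random subset, unique in law, such that: (i) almost surely, for all $(v,w)\in\vec E$, $(v,w)\in\vec F$ if and only if there exists a ray $(v_n,w_n)_{n\ge0}$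 with $(v_0,w_0)=(v,w)$ and $(v_n,w_n)\in\vec E_{U_{\{v,w\}}}\setminus\vec F$ for all $n\ge1$; (ii) the law of $(\mathcal U,\vec F)$ is invariant under automorphisms of the tree; (iii) for each finite subtree $S\subset T$, the random variables $\big((U_e)_{e\in E_{(v,w)}},\vec F\cap\vec E_{(v,w)}\big)_{(v,w)\in\partial S}$ are independent of each other and of $(U_e)_{e\in E_S}$. This is the pair $(\mathcal U,\vec F)$ of the statement. *)

theory Defs
  imports "HOL-Probability.Probability"
begin

text \<open>
  A graph is given by a vertex set and a set of unordered edges, each edge being a
  two-element set of vertices.
\<close>

definition orient :: "'v set set \<Rightarrow> ('v \<times> 'v) set" where
  "orient E = {(v, w). {v, w} \<in> E}"

definition unorient :: "('v \<times> 'v) set \<Rightarrow> 'v set set" where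
  "unorient D = {{v, w} | v w. (v, w) \<in> D}"

definition simple_graph :: "'v set \<Rightarrow> 'v set set \<Rightarrow> bool" where
  "simple_graph V E \<longleftrightarrow> (\<forall>e\<in>E. \<exists>v\<in>V. \<exists>w\<in>V. v \<noteq> w \<and> e = {v, w})"

definition connected_graph :: "'v set \<Rightarrow> 'v set set \<Rightarrow> bool" where
  "connected_graph V E \<longleftrightarrow> (\<forall>v\<in>V. \<forall>w\<in>V. (v, w) \<in> (orient E)\<^sup>*)"

definition graph_cycle :: "'v set set \<Rightarrow> 'v list \<Rightarrow> bool" where
  "graph_cycle E p \<longleftrightarrow> length p \<ge> 3 \<and> distinct p \<and>
     (\<forall>i < length p. {p ! i, p ! (Suc i mod length p)} \<in> E)"

definition tree :: "'v set \<Rightarrow> 'v set set \<Rightarrow> bool" where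
  "tree V E \<longleftrightarrow> V \<noteq> {} \<and> simple_graph V E \<and> connected_graph V E \<and> (\<nexists>p. graph_cycle E p)"

definition infinite_regular_tree :: "nat \<Rightarrow> 'v set \<Rightarrow> 'v set set \<Rightarrow> bool" where
  "infinite_regular_tree d T E \<longleftrightarrow>
     tree T E \<and> infinite T \<and> (\<forall>v\<in>T. card {w. {v, w} \<in> E} = d)"

definition automorphism :: "'v set \<Rightarrow> 'v set set \<Rightarrow> ('v \<Rightarrow> 'v) \<Rightarrow> bool" where
  "automorphism V E \<phi> \<longleftrightarrow>
     bij_betw \<phi> V V \<and> (\<forall>v\<in>V. \<forall>w\<in>V. {\<phi> v, \<phi> w} \<in> E \<longleftrightarrow> {v, w} \<in> E)"

definition edges_within :: "'v set set \<Rightarrow> 'v set \<Rightarrow> 'v set set" where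
  "edges_within E S = {e \<in> E. e \<subseteq> S}"

definition subtree :: "'v set \<Rightarrow> 'v set set \<Rightarrow> 'v set \<Rightarrow> bool" where
  "subtree T E S \<longleftrightarrow> S \<subseteq> T \<and> tree S (edges_within E S)"

definition boundary :: "'v set \<Rightarrow> 'v set set \<Rightarrow> 'v set \<Rightarrow> ('v \<times> 'v) set" where
  "boundary T E S = {(v, w) \<in> orient E. v \<in> S \<and> w \<in> T - S}"

definition ray :: "'v set set \<Rightarrow> (nat \<Rightarrow> 'v \<times> 'v) \<Rightarrow> bool" where
  "ray E r \<longleftrightarrow> (\<forall>n. r n \<in> orient E) \<and>
     (\<forall>n\<ge>1. fst (r n) = snd (r (n - 1)) \<and> snd (r n) \<noteq> fst (r (n - 1)))"

definition descendants :: "'v set set \<Rightarrow> 'v \<times> 'v \<Rightarrow> ('v \<times> 'v) set" where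
  "descendants E a = {r n | r n. ray E r \<and> r 0 = a}"

text \<open>
  The measurable space of subsets of \<open>A\<close>, i.e. the product \<open>\<sigma>\<close>-algebra on \<open>{0,1}\<^sup>A\<close>
  under the identification of sets with their indicator functions.
\<close>

definition subset_space :: "'b set \<Rightarrow> 'b set measure" where
  "subset_space A = sigma (Pow A) ((\<lambda>a. {B \<in> Pow A. a \<in> B}) ` A)"

definition labels :: "('v set \<Rightarrow> 'a \<Rightarrow> real) \<Rightarrow> 'v set set \<Rightarrow> 'a \<Rightarrow> 'v set \<Rightarrow> real" where
  "labels U D \<omega> = (\<lambda>e\<in>D. U e \<omega>)"

abbreviation label_space :: "'v set set \<Rightarrow> ('v set \<Rightarrow> real) measure" where
  "label_space D \<equiv> Pi\<^sub>M D (\<lambda>_. borel)"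

definition label_algebra ::
  "'a measure \<Rightarrow> ('v set \<Rightarrow> 'a \<Rightarrow> real) \<Rightarrow> 'v set set \<Rightarrow> 'a measure" where
  "label_algebra M U D = vimage_algebra (space M) (labels U D) (label_space D)"

definition joint_law ::
  "'a measure \<Rightarrow> 'v set set \<Rightarrow> 'b set \<Rightarrow> ('v set \<Rightarrow> 'a \<Rightarrow> real) \<Rightarrow> ('a \<Rightarrow> 'b set)
     \<Rightarrow> (('v set \<Rightarrow> real) \<times> 'b set) measure" where
  "joint_law M E A U G =
     distr M (label_space E \<Otimes>\<^sub>M subset_space A) (\<lambda>\<omega>. (labels U E \<omega>, G \<omega>))"

definition opened :: "('v set \<Rightarrow> 'a \<Rightarrow> real) \<Rightarrow> 'v set set \<Rightarrow> 'a \<Rightarrow> real \<Rightarrow> ('v \<times> 'v) set" where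
  "opened U E \<omega> t = {(v, w) \<in> orient E. U {v, w} \<omega> \<le> t}"

definition cond_indep_given ::
  "'a measure \<Rightarrow> 'a measure \<Rightarrow> 'b measure \<Rightarrow> ('a \<Rightarrow> 'b) \<Rightarrow> 'c measure \<Rightarrow> ('a \<Rightarrow> 'c) \<Rightarrow> bool" where
  "cond_indep_given M N MX X MY Y \<longleftrightarrow>
     (\<forall>A\<in>sets MX. \<forall>B\<in>sets MY. AE \<omega> in M.
        real_cond_exp M N (indicator {x \<in> space M. X x \<in> A \<and> Y x \<in> B}) \<omega> =
        real_cond_exp M N (indicator {x \<in> space M. X x \<in> A}) \<omega> *
        real_cond_exp M N (indicator {x \<in> space M. Y x \<in> B}) \<omega>)"

text \<open>
  In \<open>invariant\<close>, the automorphism acts on the pair by pullback; as automorphisms form a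
  group, this amounts to invariance under pushforward. In \<open>markov\<close>, the index \<open>None\<close> stands
  for the labels inside \<open>S\<close> and \<open>Some a\<close> for the labels and the part of \<open>F\<close> beyond the
  boundary edge \<open>a\<close>; the \<open>\<sigma>\<close>-algebras generated by these random variables are jointly
  independent. (These random variables have different types, so \<open>indep_vars\<close> does not apply.)
\<close>

locale frozen_percolation = prob_space M
  for M :: "'a measure" +
  fixes T :: "'v set"
    and E :: "'v set set"
    and U :: "'v set \<Rightarrow> 'a \<Rightarrow> real"
    and F :: "'a \<Rightarrow> ('v \<times> 'v) set"
  assumes labels_indep: "indep_vars (\<lambda>_. borel) U E"
    and labels_uniform: "\<And>e. e \<in> E \<Longrightarrow> distr M borel (U e) = uniform_measure lborel {0..1}"
    and F_measurable: "F \<in> M \<rightarrow>\<^sub>M subset_space (orient E)"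
    and frozen_iff:
      "AE \<omega> in M. \<forall>(v, w) \<in> orient E. (v, w) \<in> F \<omega> \<longleftrightarrow>
         (\<exists>r. ray E r \<and> r 0 = (v, w) \<and> (\<forall>n\<ge>1. r n \<in> opened U E \<omega> (U {v, w} \<omega>) - F \<omega>))"
    and invariant:
      "\<And>\<phi>. automorphism T E \<phi> \<Longrightarrow>
         joint_law M E (orient E) (\<lambda>e. U (\<phi> ` e)) (\<lambda>\<omega>. {(v, w) \<in> orient E. (\<phi> v, \<phi> w) \<in> F \<omega>}) =
         joint_law M E (orient E) U F"
    and markov:
      "\<And>S. subtree T E S \<Longrightarrow> finite S \<Longrightarrow>
         indep_sets
           (\<lambda>i. case i of
              None \<Rightarrow> sets (label_algebra M U (edges_within E S))
            | Some a \<Rightarrow> sets (vimage_algebra (space M)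
                (\<lambda>\<omega>. (labels U (unorient (descendants E a)) \<omega>, F \<omega> \<inter> descendants E a))
                (label_space (unorient (descendants E a)) \<Otimes>\<^sub>M subset_space (descendants E a))))
           (insert None (Some ` boundary T E S))"

definition cond_indep_copy ::
  "'a measure \<Rightarrow> 'v set set \<Rightarrow> ('v set \<Rightarrow> 'a \<Rightarrow> real) \<Rightarrow> ('a \<Rightarrow> 'v set set) \<Rightarrow> ('a \<Rightarrow> 'v set set)
     \<Rightarrow> bool" where
  "cond_indep_copy M E U F F' \<longleftrightarrow>
     F' \<in> M \<rightarrow>\<^sub>M subset_space E \<and>
     joint_law M E E U F' = joint_law M E E U F \<and>
     cond_indep_given M (label_algebra M U E) (subset_space E) F (subset_space E) F'"

end

theory Submission imports Defs "HOL-Library.Sublist" begin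

text \<open>
  Beyond an oriented edge the tree is binary, and the labels and frozen edges there form a random
  binary tree. Let \<open>X\<close> be the time at which the root edge joins an open unfrozen infinite path (2 if
  this never happens). With the label \<open>u\<close> of the root and the corresponding times \<open>X\<^sub>1\<close>, \<open>X\<^sub>2\<close> of its
  two successors, \<open>X\<close> is \<open>min X\<^sub>1 X\<^sub>2\<close> if this exceeds \<open>u\<close>, and 2 otherwise (the edge is
  frozen). This distributional equation has many solutions, but in the tree the law of
  \<open>X\<close> is forced: at time \<open>t\<close> the open unfrozen clusters are Galton-Watson trees with mean offspring
  \<open>2t P(X > t)\<close>. They are finite until they join infinity, so this mean is at most 1, and the
  equation then gives \<open>P(X > t) = 1 / (2t)\<close> on \<open>[1/2, 1]\<close>.

  The bivariate equation, in which two solutions are driven by the same labels, has besides the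
  diagonal solution an explicit one that charges \<open>{X \<noteq> X'}\<close>. Iterating it down the tree yields two
  copies of \<open>X\<close> with the same labels in the first \<open>n\<close> generations but different values at the root,
  with a probability that does not depend on \<open>n\<close>. So no event of the labels agrees with the event
  that a given oriented edge is frozen up to probability less than some constant \<open>c > 0\<close>.

  Given all labels, the events that the boundary edges of a finite subtree are frozen are
  independent, and each of their conditional probabilities \<open>\<beta>\<close> satisfies
  \<open>E (\<beta>\<^sup>2 + (1 - \<beta>)\<^sup>2) \<le> 1 - c\<close>. Two conditionally independent copies therefore agree on \<open>m\<close>
  boundary edges with probability at most \<open>(1 - c)\<^sup>m\<close>. Orientations do no harm, since the
  oriented frozen edges can be read off from the unoriented ones.
\<close>

section \<open>An explicit solution of the bivariate equation\<close>

text \<open>The explicit solution comes from a homogeneity. Write \<open>K x y\<close> for P(X \<le>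
  x, y < X') with x \<le> y. Differentiated in x, the bivariate equation says that
  \<open>1 - x / y + 2 * x * K x y\<close> times the x-derivative of \<open>K\<close> is a function
  of x alone. In the coordinate \<open>2 - 1 / x\<close>, in which a finite time is uniform on
  [0, 1], this becomes homogeneous if that function is a multiple of \<open>(2 - 1 / x) / x\<close>,
  so \<open>K\<close> can be sought as a scaling function of a ratio. One ordinary differential
  equation remains, with a parameter \<gamma> that enters both the equation and its boundary value.
  The value \<gamma> = 1 is the diagonal solution; a second one is needed.

  For a single edge, non-measurability only gives P(F \<noteq> F') > 0. Probability one takes many
  edges that are independent given the labels, and one bound c for all of them; c comes from the
  coupling alone. The copy F' carries no orientations and is known only through its joint law with
  the labels and conditional independence, so the copies are compared through a measurable function
  of labels and unoriented frozen edges.\<close>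

lemma exponent_exists:
  "\<exists>p::real. 1 < p \<and> p < 3/2 \<and>
     (p - 1) * ln (p * (p - 1)) + ln ((1 + sqrt (1 + 8 * (p * (p - 1)))) / 2 + p - 1) = 0"
proof -
  define f where "f = (\<lambda>p::real. (p - 1) * ln (p * (p - 1)) +
      ln ((1 + sqrt (1 + 8 * (p * (p - 1)))) / 2 + p - 1))"
  define e :: real where "e = exp (-4)"
  have e0: "0 < e" by (simp add: e_def)
  have e1: "e < 1/4"
  proof -
    have "4 < exp (4::real)" using exp_ge_add_one_self[of 4] by simp
    then show ?thesis by (simp add: e_def exp_minus field_simps)
  qed
  have cont: "continuous_on {1 + e .. 3/2} f"
  proof -
    have nz: "x * (x - 1) \<noteq> 0" and nz2: "(1 + sqrt (1 + 8 * (x * (x - 1)))) / 2 + x - 1 \<noteq> 0"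
      if "x \<in> {1 + e .. 3/2}" for x
    proof -
      have x: "x > 1" using that e0 by auto
      then show "x * (x - 1) \<noteq> 0" by simp
      have "sqrt (1 + 8 * (x * (x - 1))) \<ge> 0" using x by simp
      moreover have "0 < (1 + s) / 2 + x - 1" if "0 \<le> s" for s :: real using x that by (simp add: field_simps)
      ultimately have "0 < (1 + sqrt (1 + 8 * (x * (x - 1)))) / 2 + x - 1" by blast
      then show "(1 + sqrt (1 + 8 * (x * (x - 1)))) / 2 + x - 1 \<noteq> 0" by simp
    qed
    show ?thesis unfolding f_def
      by (intro continuous_intros) (use nz nz2 in auto)
  qed
  \<comment> \<open>The limit p = 1, where \<gamma> = 1, is the degenerate root. Just beyond it, (p
    - 1) ln (p - 1) is negative and outweighs the second logarithm, which is about 3 (p - 1); since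
    ln \<open>e\<close> = -4, the point 1 + \<open>e\<close> is already close enough.\<close>
  have low: "f (1 + e) < 0"
  proof -
    have s: "sqrt (1 + 8 * ((1 + e) * e)) \<le> 1 + 4 * ((1 + e) * e)"
      by (rule real_le_lsqrt) (use e0 in \<open>auto simp: power2_eq_square algebra_simps\<close>)
    have pos: "0 < (1 + sqrt (1 + 8 * ((1 + e) * e))) / 2 + e"
      using e0 by (auto intro!: add_nonneg_pos add_pos_nonneg)
    have "ln ((1 + sqrt (1 + 8 * ((1 + e) * e))) / 2 + e) \<le> (1 + sqrt (1 + 8 * ((1 + e) * e))) / 2 + e - 1"
      using ln_le_minus_one[OF pos] .
    also have "\<dots> \<le> 3 * e + 2 * e * e" using s by (simp add: algebra_simps)
    finally have a: "ln ((1 + sqrt (1 + 8 * ((1 + e) * e))) / 2 + e) \<le> 3 * e + 2 * e * e" .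
    have "ln ((1 + e) * e) = ln (1 + e) + ln e" using e0 by (simp add: ln_mult)
    also have "\<dots> \<le> e - 4" using ln_add_one_self_le_self[of e] e0 by (simp add: e_def)
    finally have "e * ln ((1 + e) * e) \<le> e * (e - 4)" using e0 by (intro mult_left_mono) auto
    with a have "f (1 + e) \<le> e * (e - 4) + (3 * e + 2 * e * e)" unfolding f_def by simp
    also have "\<dots> = e * (3 * e - 1)" by (simp add: algebra_simps)
    also have "\<dots> < 0" using e0 e1 by (simp add: mult_less_0_iff)
    finally show ?thesis .
  qed
  have high: "f (3/2) > 0"
  proof -
    have s: "2 \<le> sqrt (7::real)" by (rule real_le_rsqrt) simp
    have "f (3/2) = (1/2) * ln (3/4) + ln ((1 + sqrt 7) / 2 + 1/2)" by (simp add: f_def add.commute)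
    moreover have "ln 2 \<le> ln ((1 + sqrt 7) / 2 + 1/2)" using s by (intro ln_mono) (auto simp: add_divide_distrib)
    moreover have "ln (1/2) \<le> ln (3/4::real)" by (intro ln_mono) auto
    moreover have "ln (1/2) = - ln (2::real)" by (simp add: ln_div)
    moreover have "ln (2::real) > 0" by simp
    ultimately show ?thesis by argo
  qed
  have "\<exists>p\<ge>1 + e. p \<le> 3/2 \<and> f p = 0"
    by (rule IVT') (use low high cont e1 in auto)
  then obtain p where p: "1 + e \<le> p" "p \<le> 3/2" "f p = 0" by blast
  then have "p \<noteq> 3/2" using high by (metis less_irrefl)
  with p e0 show ?thesis unfolding f_def by (intro exI[of _ p]) auto
qed

text \<open>The function \<open>G\<close> solves the homogeneous equation \<open>G' = \<sigma> x / (G - x)\<close> with \<open>\<sigma> = \<gamma> (\<gamma> - 1) / 2\<close> on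
  \<open>[0, 1]\<close>. Substituting \<open>G x = x q\<close> separates the variables; with \<open>\<sigma> = p (p - 1)\<close>, the conditions
  \<open>G 0 = 1\<close> and \<open>G 1 = \<gamma>\<close> amount to the equation for \<open>p\<close> above.\<close>

lemma profile_exists:
  obtains \<gamma> :: real and \<phi> \<tau> G :: "real \<Rightarrow> real" where
    "1 < \<gamma>" "\<gamma> < 2"
    "\<phi> \<in> borel_measurable borel" "\<tau> \<in> borel_measurable borel"
    "\<And>w x. 0 < w \<Longrightarrow> w < 1 \<Longrightarrow> 0 < x \<Longrightarrow> x \<le> 1 \<Longrightarrow> 1 < x * \<phi> w \<longleftrightarrow> w < \<tau> x"
    "\<And>x. 0 < x \<Longrightarrow> x \<le> 1 \<Longrightarrow> 0 < \<tau> x \<and> \<tau> x \<le> 1" "\<tau> 1 = 1"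
    "continuous_on {0..1} G" "G 0 = 1" "G 1 = \<gamma>"
    "\<And>x. 0 \<le> x \<Longrightarrow> x \<le> 1 \<Longrightarrow> x < G x"
    "\<And>x. 0 < x \<Longrightarrow> x \<le> 1 \<Longrightarrow> \<tau> x * (G x - x) = (\<gamma> - 1) * x"
    "\<And>x. 0 < x \<Longrightarrow> x < 1 \<Longrightarrow> (G has_real_derivative (\<gamma> / 2 * \<tau> x)) (at x)"
proof -
  obtain p :: real where p: "1 < p" "p < 3/2"
    and eq: "(p - 1) * ln (p * (p - 1)) + ln ((1 + sqrt (1 + 8 * (p * (p - 1)))) / 2 + p - 1) = 0"
    using exponent_exists by blast
  define \<gamma> where "\<gamma> = (1 + sqrt (1 + 8 * (p * (p - 1)))) / 2"
  define \<sigma> where "\<sigma> = p * (p - 1)"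
  have \<sigma>: "0 < \<sigma>" "\<sigma> < 1"
  proof -
    show "0 < \<sigma>" using p by (simp add: \<sigma>_def)
    have "p * (p - 1) \<le> (3/2) * (1/2)" using p by (intro mult_mono) auto
    then show "\<sigma> < 1" by (simp add: \<sigma>_def)
  qed
  have g2: "\<gamma> * (\<gamma> - 1) = 2 * \<sigma>"
  proof -
    have "sqrt (1 + 8 * \<sigma>) * sqrt (1 + 8 * \<sigma>) = 1 + 8 * \<sigma>" using \<sigma> by simp
    then show ?thesis unfolding \<gamma>_def \<sigma>_def[symmetric] by (simp add: field_simps)
  qed
  have g1: "1 < \<gamma>" using \<sigma> unfolding \<gamma>_def \<sigma>_def[symmetric] by simp
  have gl2: "\<gamma> < 2"
  proof (rule ccontr)
    assume "\<not> ?thesis"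
    then have "2 * 1 \<le> \<gamma> * (\<gamma> - 1)" by (intro mult_mono) auto
    with g2 \<sigma> show False by simp
  qed
  have gp: "p < \<gamma>"
  proof (rule ccontr)
    assume "\<not> ?thesis"
    then have "\<gamma> * (\<gamma> - 1) \<le> p * (p - 1)" using g1 p by (intro mult_mono) auto
    with g2 \<sigma> show False by (simp add: \<sigma>_def)
  qed
  \<comment> \<open>Separating the variables for q = G x / x gives ln x = - h q / (2 p - 1) up to a
    constant. As x tends to 0, q is large and h q behaves like (2 p - 1) ln q, so x q tends to 1
    only if the constant is 0. The condition G 1 = \<gamma> is then
    \<open>h \<gamma> = 0\<close>.\<close>
  define h where "h = (\<lambda>q. (p - 1) * ln (q - p) + p * ln (q + p - 1))"
  define r where "r = (\<lambda>q. exp (- h q / (2 * p - 1)))"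
  have hg: "h \<gamma> = 0"
  proof -
    have "(\<gamma> - p) * (\<gamma> + p - 1) = \<gamma> * (\<gamma> - 1) - p * (p - 1)" by (simp add: algebra_simps)
    also have "\<dots> = \<sigma>" using g2 by (simp add: \<sigma>_def)
    finally have "ln ((\<gamma> - p) * (\<gamma> + p - 1)) = ln \<sigma>" by simp
    then have "ln (\<gamma> - p) + ln (\<gamma> + p - 1) = ln \<sigma>" using gp p by (simp add: ln_mult)
    moreover have "(p - 1) * ln \<sigma> + ln (\<gamma> + p - 1) = 0" using eq by (simp add: \<gamma>_def \<sigma>_def)
    moreover have "h \<gamma> = (p - 1) * (ln (\<gamma> - p) + ln (\<gamma> + p - 1)) + ln (\<gamma> + p - 1)"
      by (simp add: h_def algebra_simps)
    ultimately show ?thesis by simp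
  qed
  have rg: "r \<gamma> = 1" by (simp add: r_def hg)
  have rpos: "r q > 0" for q by (simp add: r_def)
  have hder: "(h has_real_derivative (2 * p - 1) * (q - 1) / ((q - p) * (q + p - 1))) (at q)" if "q > p" for q
  proof -
    have nz: "q - p \<noteq> 0" "q + p - 1 \<noteq> 0" using that p by auto
    have "(h has_real_derivative (p - 1) / (q - p) + p / (q + p - 1)) (at q)"
      unfolding h_def using that p by (auto intro!: derivative_eq_intros)
    also have "(p - 1) / (q - p) + p / (q + p - 1) = ((p - 1) * (q + p - 1) + p * (q - p)) / ((q - p) * (q + p - 1))"
      using nz by (rule add_frac_eq)
    also have "(p - 1) * (q + p - 1) + p * (q - p) = (2 * p - 1) * (q - 1)"
      by (simp add: algebra_simps)
    finally show ?thesis .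
  qed
  have rder: "(r has_real_derivative - r q * (q - 1) / ((q - p) * (q + p - 1))) (at q)" if "q > p" for q
  proof -
    have "(r has_real_derivative exp (- h q / (2 * p - 1)) *
        (- ((2 * p - 1) * (q - 1) / ((q - p) * (q + p - 1))) / (2 * p - 1))) (at q)"
      unfolding r_def using p by (auto intro!: derivative_eq_intros hder[OF that])
    moreover have "(- ((2 * p - 1) * (q - 1) / ((q - p) * (q + p - 1))) / (2 * p - 1)) =
        - ((q - 1) / ((q - p) * (q + p - 1)))" using p by simp
    ultimately show ?thesis by (simp add: r_def)
  qed
  have rmono: "r y < r x" if "p < x" "x < y" for x y
  proof (rule DERIV_neg_imp_decreasing[OF that(2)])
    fix z assume z: "x \<le> z" "z \<le> y"
    then have "z > p" using that by simp
    then have "- r z * (z - 1) / ((z - p) * (z + p - 1)) < 0" using p rpos[of z]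
      by (auto intro!: divide_neg_pos)
    with rder[OF \<open>z > p\<close>] show "\<exists>y. (r has_real_derivative y) (at z) \<and> y < 0" by blast
  qed
  have rinj: "inj_on r {p<..}"
    by (rule linorder_inj_onI) (use rmono in \<open>force+\<close>)
  define Q where "Q = inv_into {p<..} r"
  have Qr: "Q (r z) = z" if "z > p" for z
    unfolding Q_def using rinj that by simp
  have rcont: "isCont r z" if "z > p" for z using rder[OF that] DERIV_isCont by blast
  have Qcont: "isCont Q (r z)" if "z > p" for z
    using isCont_inverse_function2[of "(p + z)/2" z "z + 1" Q r] that Qr rcont by auto
  \<comment> \<open>A point strictly between p and \<gamma>: the inverse of \<open>r\<close> is then
    available on (0, x1) with 1 < x1, which makes x = 1 an interior point.\<close>
  define q0 where "q0 = (p + \<gamma>) / 2"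
  define x1 where "x1 = r q0"
  have q0: "p < q0" "q0 < \<gamma>" using gp by (auto simp: q0_def)
  have x1: "1 < x1" using rmono[OF q0] rg by (simp add: x1_def)
  have ex: "\<exists>z>p. r z = x" if "0 < x" "x < x1" for x
  proof -
    \<comment> \<open>Far enough out that both logarithms in \<open>h\<close> are at least ln (1 /
      x), whence r q2 \<le> x.\<close>
    define q2 where "q2 = max \<gamma> (p + 1 / x)"
    have "(2 * p - 1) * ln (1 / x) \<le> h q2"
    proof -
      have "ln (1 / x) \<le> ln (q2 - p)" "ln (1 / x) \<le> ln (q2 + p - 1)"
        using that p by (auto intro!: ln_mono simp: q2_def)
      then have "(p - 1) * ln (1 / x) + p * ln (1 / x) \<le> h q2"
        unfolding h_def using p by (intro add_mono mult_left_mono) auto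
      then show ?thesis by (simp add: algebra_simps)
    qed
    then have "- h q2 / (2 * p - 1) \<le> ln x" using p that by (simp add: field_simps ln_div)
    then have "r q2 \<le> x" unfolding r_def using that by (metis exp_le_cancel_iff exp_ln)
    moreover have "x \<le> r q0" using that by (simp add: x1_def)
    moreover have "continuous_on {q0..q2} r"
      by (intro continuous_at_imp_continuous_on ballI rcont) (use q0 in auto)
    ultimately have "\<exists>z\<ge>q0. z \<le> q2 \<and> r z = x"
      using q0 by (intro IVT2') (auto simp: q2_def)
    then obtain z where "q0 \<le> z" "r z = x" by blast
    with q0 show ?thesis by (intro exI[of _ z]) auto
  qed
  have rQ: "r (Q x) = x" "p < Q x" if "0 < x" "x < x1" for x
    using ex[OF that] Qr by auto
  have Qge: "\<gamma> \<le> Q x" if "0 < x" "x \<le> 1" for x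
  proof (rule ccontr)
    assume "\<not> ?thesis"
    then have "r \<gamma> < r (Q x)" using rQ[of x] that x1 by (intro rmono) auto
    with rQ[of x] that x1 rg show False by auto
  qed
  \<comment> \<open>Replacing both logarithms in \<open>h\<close> by the smaller or by the larger
    one squeezes x * Q x between 1 - (p - 1) x and 1 + p x. This gives G its limit 1 at 0, where
    \<open>Q\<close> itself blows up.\<close>
  have Qb: "Q x - p \<le> 1 / x" "1 / x \<le> Q x + p - 1" if "0 < x" "x \<le> 1" for x
  proof -
    have qp: "Q x > p" and rq: "r (Q x) = x" using rQ[of x] that x1 by auto
    have "ln x = - h (Q x) / (2 * p - 1)" using rq by (metis ln_exp r_def)
    then have e: "(2 * p - 1) * ln (1 / x) = h (Q x)" using p that by (simp add: ln_div field_simps)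
    have mono: "ln (Q x - p) \<le> ln (Q x + p - 1)" using qp p by (intro ln_mono) auto
    have "(2 * p - 1) * ln (Q x - p) = (p - 1) * ln (Q x - p) + p * ln (Q x - p)"
      by (simp add: algebra_simps)
    also have "\<dots> \<le> h (Q x)" unfolding h_def using mono p by (intro add_mono mult_left_mono) auto
    finally have "ln (Q x - p) \<le> ln (1 / x)" using p unfolding e[symmetric] by simp
    then show "Q x - p \<le> 1 / x" using that qp by (subst (asm) ln_le_cancel_iff) auto
    have "h (Q x) \<le> (p - 1) * ln (Q x + p - 1) + p * ln (Q x + p - 1)"
      unfolding h_def using mono p by (intro add_mono mult_left_mono) auto
    also have "\<dots> = (2 * p - 1) * ln (Q x + p - 1)"
      by (simp add: algebra_simps)
    finally have "ln (1 / x) \<le> ln (Q x + p - 1)" using p unfolding e[symmetric] by simp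
    then show "1 / x \<le> Q x + p - 1" using that qp p by (subst (asm) ln_le_cancel_iff) auto
  qed
  define G where "G = (\<lambda>x. if x = 0 then 1 else x * Q x)"
  define \<tau> where "\<tau> = (\<lambda>x. if 0 < x \<and> x \<le> 1 then (\<gamma> - 1) / (Q x - 1) else 0)"
  \<comment> \<open>\<open>1 / \<phi> w\<close> inverts \<tau> at w: solving \<tau> x = w for
    \<open>Q x\<close> gives 1 + (\<gamma> - 1) / w, and \<open>r\<close> returns to x.\<close>
  define \<phi> where "\<phi> = (\<lambda>w. 1 / r (1 + (\<gamma> - 1) / w))"
  have Qc: "isCont Q x" if "0 < x" "x < x1" for x
    using Qcont[of "Q x"] rQ[OF that] by simp
  have Qder: "(Q has_real_derivative inverse (- x * (Q x - 1) / ((Q x - p) * (Q x + p - 1)))) (at x)"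
    if "0 < x" "x < x1" for x
  proof (rule DERIV_inverse_function[where f = r and a = 0 and b = x1])
    show "(r has_real_derivative - x * (Q x - 1) / ((Q x - p) * (Q x + p - 1))) (at (Q x))"
      using rder[of "Q x"] rQ[OF that] by simp
    show "- x * (Q x - 1) / ((Q x - p) * (Q x + p - 1)) \<noteq> 0"
      using rQ[OF that] that p by auto
  qed (use that rQ Qc in auto)
  have "continuous_on {0..1} G"
  proof -
    show ?thesis
      unfolding continuous_on_eq_continuous_within
    proof
      fix x :: real assume x: "x \<in> {0..1}"
      show "continuous (at x within {0..1}) G"
      proof (cases "x = 0")
        case True
        have "(G \<longlongrightarrow> 1) (at 0 within {0..1})"
        proof (rule tendsto_sandwich)
          show "((\<lambda>x. 1 - (p - 1) * x) \<longlongrightarrow> 1) (at 0 within {0..1})"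
            by (auto intro!: tendsto_eq_intros)
          show "((\<lambda>x. 1 + p * x) \<longlongrightarrow> 1) (at 0 within {0..1})"
            by (auto intro!: tendsto_eq_intros)
          show "\<forall>\<^sub>F x in at 0 within {0..1}. 1 - (p - 1) * x \<le> G x"
            unfolding eventually_at_filter
            by (rule always_eventually) (use Qb in \<open>auto simp: G_def field_simps\<close>)
          show "\<forall>\<^sub>F x in at 0 within {0..1}. G x \<le> 1 + p * x"
            unfolding eventually_at_filter
            by (rule always_eventually) (use Qb in \<open>auto simp: G_def field_simps\<close>)
        qed
        with True show ?thesis by (simp add: continuous_within G_def)
      next
        case False
        with x have x: "0 < x" "x \<le> 1" by auto
        have "isCont (\<lambda>x. x * Q x) x" using Qc[of x] x x1 by (intro continuous_intros) auto
        moreover have "\<forall>\<^sub>F y in nhds x. G y = y * Q y"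
          using eventually_nhds_in_open[of "{0<..}" x] x
          by (auto elim!: eventually_mono simp: G_def)
        ultimately have "isCont G x" using isCont_cong[of G "\<lambda>y. y * Q y" x] by simp
        then show ?thesis by (rule continuous_at_imp_continuous_at_within)
      qed
    qed
  qed
  note Gcont = this
  have "\<And>x. 0 < x \<Longrightarrow> x < 1 \<Longrightarrow> (G has_real_derivative (\<gamma> / 2 * \<tau> x)) (at x)"
  proof -
    fix x :: real assume x: "0 < x" "x < 1"
    let ?D = "inverse (- x * (Q x - 1) / ((Q x - p) * (Q x + p - 1)))"
    have "((\<lambda>x. x * Q x) has_real_derivative (Q x + x * ?D)) (at x)"
      using Qder[of x] x x1 by (auto intro!: derivative_eq_intros)
    moreover have "Q x + x * ?D = \<gamma> / 2 * \<tau> x"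
    proof -
      have qp: "Q x > p" using rQ[of x] x x1 by auto
      have "x * ?D = - ((Q x - p) * (Q x + p - 1)) / (Q x - 1)"
        using x qp p by (simp add: field_simps)
      moreover have "(Q x - p) * (Q x + p - 1) = Q x * (Q x - 1) - \<sigma>"
        by (simp add: \<sigma>_def algebra_simps)
      ultimately have "Q x + x * ?D = \<sigma> / (Q x - 1)" using qp p by (simp add: field_simps)
      also have "\<dots> = \<gamma> / 2 * \<tau> x" using g2 x by (simp add: \<tau>_def)
      finally show ?thesis .
    qed
    ultimately have "((\<lambda>x. x * Q x) has_real_derivative (\<gamma> / 2 * \<tau> x)) (at x)" by (simp only:)
    moreover have "\<forall>\<^sub>F y in nhds x. G y = y * Q y"
      using eventually_nhds_in_open[of "{0<..}" x] x
      by (auto elim!: eventually_mono simp: G_def)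
    ultimately show "(G has_real_derivative (\<gamma> / 2 * \<tau> x)) (at x)"
      using DERIV_cong_ev[of x x G "\<lambda>y. y * Q y"] by simp
  qed
  note Gder = this
  have Qg: "Q 1 = \<gamma>" using Qr[of \<gamma>] gp rg by simp
  have hm: "h \<in> borel_measurable borel" unfolding h_def by measurable
  have rm: "r \<in> borel_measurable borel" unfolding r_def using hm by measurable
  have \<phi>m: "\<phi> \<in> borel_measurable borel" unfolding \<phi>_def using rm by measurable
  have \<tau>m: "\<tau> \<in> borel_measurable borel"
  proof -
    have "continuous_on {0<..1} (\<lambda>x. (\<gamma> - 1) / (Q x - 1))"
    proof (rule continuous_at_imp_continuous_on, rule ballI)
      fix x :: real assume "x \<in> {0<..1}"
      then show "isCont (\<lambda>x. (\<gamma> - 1) / (Q x - 1)) x"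
        using Qc[of x] x1 Qge[of x] g1 by (intro continuous_intros) auto
    qed
    then have "(\<lambda>x. indicator {0<..1} x *\<^sub>R ((\<gamma> - 1) / (Q x - 1))) \<in> borel_measurable borel"
      by (intro borel_measurable_continuous_on_indicator) auto
    moreover have "(\<lambda>x. indicator {0<..1} x *\<^sub>R ((\<gamma> - 1) / (Q x - 1))) = \<tau>"
      by (auto simp: fun_eq_iff \<tau>_def indicator_def)
    ultimately show ?thesis by simp
  qed
  have key: "1 < x * \<phi> w \<longleftrightarrow> w < \<tau> x" if "0 < w" "w < 1" "0 < x" "x \<le> 1" for w x
  proof -
    let ?q = "1 + (\<gamma> - 1) / w"
    have "\<gamma> - 1 < (\<gamma> - 1) / w"
      using mult_strict_left_mono[of w 1 "\<gamma> - 1"] that g1 by (simp add: less_divide_eq)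
    then have q: "?q > p" using gp by simp
    have "1 < x * \<phi> w \<longleftrightarrow> r ?q < x" using rpos[of ?q] that by (simp add: \<phi>_def field_simps)
    also have "\<dots> \<longleftrightarrow> r ?q < r (Q x)" using rQ[of x] that x1 by simp
    also have "\<dots> \<longleftrightarrow> Q x < ?q"
      using rmono[of "Q x" ?q] rmono[of ?q "Q x"] q rQ[of x] that x1
      by (smt (verit))
    also have "\<dots> \<longleftrightarrow> w < (\<gamma> - 1) / (Q x - 1)"
      using Qge[of x] that g1 by (simp add: field_simps)
    also have "\<dots> \<longleftrightarrow> w < \<tau> x" using that by (simp add: \<tau>_def)
    finally show ?thesis .
  qed
  show thesis
  proof (rule that[of \<gamma> \<phi> \<tau> G])
    show "0 < \<tau> x \<and> \<tau> x \<le> 1" if "0 < x" "x \<le> 1" for x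
      using Qge[OF that] that g1 by (simp add: \<tau>_def field_simps)
    show "\<tau> 1 = 1" using g1 by (simp add: \<tau>_def Qg)
    show "G 1 = \<gamma>" by (simp add: G_def Qg)
    show "x < G x" if "0 \<le> x" "x \<le> 1" for x
      using Qge[of x] that g1 by (auto simp: G_def)
    show "\<tau> x * (G x - x) = (\<gamma> - 1) * x" if "0 < x" "x \<le> 1" for x
      using Qge[OF that] that g1 by (simp add: \<tau>_def G_def field_simps)
  qed (use g1 gl2 \<phi>m \<tau>m key Gcont Gder in \<open>auto simp: G_def\<close>)
qed

section \<open>Uniform labels and the fixed-point equations for the times\<close>

abbreviation unif :: "real measure" where
  "unif \<equiv> uniform_measure lborel {0..1}"

lemma prob_space_unif: "prob_space unif"
  by (rule prob_space_uniform_measure) auto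

lemma nn_integral_unif:
  assumes "f \<in> borel_measurable borel"
  shows "(\<integral>\<^sup>+u. f u \<partial>unif) = (\<integral>\<^sup>+u. f u * indicator {0..1} u \<partial>lborel)"
  using assms by (subst nn_integral_uniform_measure) (auto simp: divide_ennreal_def)

lemma AE_unif: "AE u in unif. 0 < u \<and> u < 1"
proof (rule AE_uniform_measureI)
  have "AE u in lborel. u \<noteq> 0 \<and> u \<noteq> (1::real)"
    using AE_lborel_singleton[of "0::real"] AE_lborel_singleton[of "1::real"] by auto
  then show "AE u in lborel. u \<in> {0..1} \<longrightarrow> 0 < u \<and> u < (1::real)" by auto
qed auto

lemma unif_lessThan:
  assumes "0 \<le> t" "t \<le> 1"
  shows "emeasure unif {..<t} = ennreal t" "emeasure unif {..t} = ennreal t"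
proof -
  have "{0..1} \<inter> {..<t} = {0..<t}" "{0..1} \<inter> {..t} = {0..t}" using assms by auto
  then show "emeasure unif {..<t} = ennreal t" "emeasure unif {..t} = ennreal t"
    using assms by (auto simp: divide_ennreal_def)
qed

text \<open>Fubini, with the uniform coordinate integrated as a gauge integral: in this form the
  fundamental theorem of calculus can evaluate it.\<close>

lemma has_integral_measure_unif_pair:
  assumes "prob_space N" and T: "T \<in> sets (unif \<Otimes>\<^sub>M N)"
  shows "((\<lambda>u. measure N (Pair u -` T)) has_integral measure (unif \<Otimes>\<^sub>M N) T) {0..1}"
proof -
  interpret N: prob_space N by fact
  interpret U: prob_space unif by (rule prob_space_unif)
  interpret P: pair_prob_space unif N ..
  have m: "(\<lambda>u. measure N (Pair u -` T)) \<in> borel_measurable borel"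
    using N.measurable_emeasure_Pair[OF T] unfolding measure_def by simp
  have "emeasure (unif \<Otimes>\<^sub>M N) T = (\<integral>\<^sup>+u. emeasure N (Pair u -` T) \<partial>unif)"
    using T by (rule N.emeasure_pair_measure_alt)
  also have "\<dots> = (\<integral>\<^sup>+u. ennreal (measure N (Pair u -` T)) \<partial>unif)"
    by (simp add: N.emeasure_eq_measure)
  also have "\<dots> = (\<integral>\<^sup>+u. ennreal (measure N (Pair u -` T)) * indicator {0..1} u \<partial>lborel)"
    using m by (intro nn_integral_unif) auto
  also have "\<dots> = (\<integral>\<^sup>+u. ennreal (measure N (Pair u -` T) * indicator {0..1} u) \<partial>lborel)"
    by (intro nn_integral_cong) (auto simp: indicator_def)
  finally have "((\<lambda>u. measure N (Pair u -` T) * indicator {0..1} u) has_integral measure (unif \<Otimes>\<^sub>M N) T) UNIV"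
    using m by (intro nn_integral_has_integral) (auto simp: P.emeasure_eq_measure)
  moreover have "(\<lambda>u. measure N (Pair u -` T) * indicator {0..1} u) =
      (\<lambda>u. if u \<in> {0..1} then measure N (Pair u -` T) else 0)"
    by (auto simp: indicator_def fun_eq_iff)
  ultimately have "((\<lambda>u. if u \<in> {0..1} then measure N (Pair u -` T) else 0) has_integral
      measure (unif \<Otimes>\<^sub>M N) T) UNIV" by (simp only:)
  then show ?thesis by (rule iffD1[OF has_integral_restrict_UNIV])
qed

text \<open>The value 2 stands for infinity, that is, for an edge that never percolates.\<close>

definition freeze :: "real \<Rightarrow> real \<Rightarrow> real" where
  "freeze u y = (if u < y then y else 2)"

lemma freeze_measurable [measurable]:
  "(\<lambda>(u, y). freeze u y) \<in> borel_measurable (borel \<Otimes>\<^sub>M borel)"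
  unfolding freeze_def by measurable

text \<open>Density 1 / (2 x^2) on [1/2, 1] and an atom of mass 1/2 at 2, the share of edges that
  never percolate.\<close>

definition time_cdf :: "real \<Rightarrow> real" where
  "time_cdf x = (if x < 1/2 then 0 else if x \<le> 1 then 1 - 1 / (2 * x) else if x < 2 then 1/2 else 1)"

text \<open>The coupled times are \<open>X = 1 / (2 - h)\<close> and \<open>X' = 1 / (2 - h * \<phi> w)\<close> for uniform \<open>h\<close> and \<open>w\<close>, with
  \<open>X' = \<infinity>\<close> if \<open>1 < h * \<phi> w\<close>, taken with probability \<open>\<gamma> / 4\<close> in each of the two orders; otherwise
  both are infinite. For \<open>x \<le> y\<close> this makes \<open>P(X \<le> x, y < X')\<close> equal to the function \<open>K x y\<close> below;
  \<open>k x y\<close> is the same probability for the minima of two independent copies.\<close>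

locale profile =
  fixes \<gamma> :: real and \<phi> \<tau> G :: "real \<Rightarrow> real"
  assumes gam: "1 < \<gamma>" "\<gamma> < 2"
    and meas: "\<phi> \<in> borel_measurable borel" "\<tau> \<in> borel_measurable borel"
    and phi: "\<And>w x. 0 < w \<Longrightarrow> w < 1 \<Longrightarrow> 0 < x \<Longrightarrow> x \<le> 1 \<Longrightarrow> 1 < x * \<phi> w \<longleftrightarrow> w < \<tau> x"
    and tau: "\<And>x. 0 < x \<Longrightarrow> x \<le> 1 \<Longrightarrow> 0 < \<tau> x \<and> \<tau> x \<le> 1" "\<tau> 1 = 1"
    and G_cont: "continuous_on {0..1} G" and G0: "G 0 = 1" and G1: "G 1 = \<gamma>"
    and G_gt: "\<And>x. 0 \<le> x \<Longrightarrow> x \<le> 1 \<Longrightarrow> x < G x"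
    and tau_G: "\<And>x. 0 < x \<Longrightarrow> x \<le> 1 \<Longrightarrow> \<tau> x * (G x - x) = (\<gamma> - 1) * x"
    and G_der: "\<And>x. 0 < x \<Longrightarrow> x < 1 \<Longrightarrow> (G has_real_derivative (\<gamma> / 2 * \<tau> x)) (at x)"
begin

text \<open>On [1/2, 1] this is twice \<open>time_cdf x\<close>: the coordinate in which a finite
  time is uniform and the equation for \<open>K\<close> is homogeneous.\<close>

definition hat :: "real \<Rightarrow> real" where "hat x = 2 - 1 / x"

definition K :: "real \<Rightarrow> real \<Rightarrow> real" where
  "K x y = (if x < 1/2 then 0 else (hat y * G (hat x / hat y) - hat y) / 2)"

definition k :: "real \<Rightarrow> real \<Rightarrow> real" where "k x y = K x y / y - (K x y)\<^sup>2"

text \<open>The primitive, zero at 1/2, of \<gamma> (\<gamma> - 1) / 2 * (1 / x - 1 / (2 x^2)),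
  which is the right side of the equation for \<open>K\<close> differentiated in x. Since y does not
  occur in it, the equation can be solved for each y separately.\<close>

definition \<Sigma> :: "real \<Rightarrow> real" where
  "\<Sigma> x = \<gamma> * (\<gamma> - 1) / 2 * (ln x + 1 / (2 * x) - ln (1/2) - 1)"

lemma hat_bounds: "1/2 \<le> x \<Longrightarrow> x \<le> 1 \<Longrightarrow> 0 \<le> hat x \<and> hat x \<le> 1"
  by (auto simp: hat_def field_simps)

lemma hat_pos: "1/2 < x \<Longrightarrow> 0 < hat x"
  by (auto simp: hat_def field_simps)

lemma hat_mono: "1/2 \<le> x \<Longrightarrow> x \<le> y \<Longrightarrow> hat x \<le> hat y"
  by (auto simp: hat_def field_simps)

lemma hat_strict_mono: "1/2 \<le> x \<Longrightarrow> x < y \<Longrightarrow> hat x < hat y"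
  by (auto simp: hat_def field_simps)

lemma hat_half [simp]: "hat (1/2) = 0" by (simp add: hat_def)

lemma K_half: "K (1/2) y = 0" by (simp add: K_def G0)

lemma K_zero: "x \<le> 1/2 \<Longrightarrow> K x y = 0"
proof (cases "x = 1/2")
  case True
  show ?thesis unfolding True by (rule K_half)
qed (simp add: K_def)

lemma K_diag: "1/2 \<le> x \<Longrightarrow> K x x = hat x * (\<gamma> - 1) / 2"
  by (cases "hat x = 0") (auto simp: K_def G1 algebra_simps)

text \<open>The expression on the right, as a function of x, is a primitive of \<open>k u y\<close>
  exactly because \<open>K\<close> solves the differentiated equation, the fact \<open>ode\<close>
  in the proof.\<close>

lemma k_integral:
  assumes x: "1/2 \<le> x" "x \<le> y" "y \<le> 1"
  shows "((\<lambda>u. k u y) has_integral (x * k x y - K x y + \<Sigma> x)) {0..x}"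
proof (cases "y = 1/2")
  case True
  with x have "x = 1/2" by simp
  have "((\<lambda>u::real. 0::real) has_integral 0) {0..x}" by simp
  then have "((\<lambda>u. k u y) has_integral 0) {0..x}"
    by (rule has_integral_eq[rotated]) (use \<open>x = 1/2\<close> in \<open>auto simp: k_def K_zero\<close>)
  moreover have "x * k x y - K x y + \<Sigma> x = 0"
    unfolding \<open>x = 1/2\<close> k_def K_half by (simp add: \<Sigma>_def)
  ultimately show ?thesis by simp
next
  case False
  with x have y: "1/2 < y" by simp
  then have hy: "0 < hat y" by (rule hat_pos)
  define KK where "KK = (\<lambda>u. (hat y * G (hat u / hat y) - hat y) / 2)"
  define F where "F = (\<lambda>u. u * (KK u / y - (KK u)\<^sup>2) - KK u + \<Sigma> u)"
  have eq: "KK u = K u y" if "u \<ge> 1/2" for u using that by (simp add: KK_def K_def)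
  have cont: "continuous_on {1/2..x} KK"
  proof -
    have "continuous_on {1/2..x} (\<lambda>u. G (hat u / hat y))"
    proof (rule continuous_on_compose2[OF G_cont])
      show "continuous_on {1/2..x} (\<lambda>u. hat u / hat y)"
        unfolding hat_def by (intro continuous_intros) (use hy in \<open>auto simp: hat_def\<close>)
      show "(\<lambda>u. hat u / hat y) ` {1/2..x} \<subseteq> {0..1}"
        using hat_bounds hat_mono x hy by (auto simp: divide_le_eq)
    qed
    then show ?thesis unfolding KK_def by (intro continuous_intros) auto
  qed
  have "((\<lambda>u. k u y) has_integral (F x - F (1/2))) {1/2..x}"
  proof (rule fundamental_theorem_of_calculus_interior)
    show "continuous_on {1/2..x} F"
      unfolding F_def \<Sigma>_def using x by (intro continuous_intros cont) auto
    fix u assume u: "u \<in> {1/2<..<x}"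
    define r where "r = hat u / hat y"
    have r: "0 < r" "r < 1"
      using u x hy hat_pos[of u] hat_strict_mono[of u y] by (auto simp: r_def)
    define D where "D = \<gamma> / 4 * \<tau> r / u\<^sup>2"
    have hd: "((\<lambda>u. hat u / hat y) has_real_derivative (1 / u\<^sup>2 / hat y)) (at u)"
    proof (rule DERIV_cdivide)
      show "(hat has_real_derivative (1 / u\<^sup>2)) (at u)"
        unfolding hat_def[abs_def] using u
        by (auto intro!: derivative_eq_intros simp: power2_eq_square)
    qed
    have "((\<lambda>u. G (hat u / hat y)) has_real_derivative (\<gamma> / 2 * \<tau> r) * (1 / u\<^sup>2 / hat y)) (at u)"
      using DERIV_chain2[OF G_der[OF r, unfolded r_def] hd] by (simp add: r_def)
    then have KD: "(KK has_real_derivative D) (at u)"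
      unfolding KK_def using hy
      by (auto intro!: derivative_eq_intros simp: D_def)
    define S where "S = \<gamma> * (\<gamma> - 1) / 2 * (1 / u - 1 / (2 * u\<^sup>2))"
    have SD: "(\<Sigma> has_real_derivative S) (at u)"
      unfolding \<Sigma>_def S_def using u
      by (auto intro!: derivative_eq_intros simp: power2_eq_square field_simps)
    \<comment> \<open>Here 1 / u - 1 / y = hat y - hat u, so the first factor is u * hat y * (G r -
      r), and the relation \<open>tau_G\<close> between \<tau> and G reduces everything to hat
      u.\<close>
    have ode: "(1 - u / y + 2 * u * KK u) * D = S"
    proof -
      have "1 - u / y + 2 * u * KK u = u * (1 / u - 1 / y + hat y * G r - hat y)"
        using u by (simp add: KK_def r_def field_simps)
      also have "1 / u - 1 / y = hat y - hat u" by (simp add: hat_def)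
      also have "hat u = hat y * r" using hy by (simp add: r_def)
      finally have "1 - u / y + 2 * u * KK u = u * hat y * (G r - r)" by (simp add: algebra_simps)
      then have "(1 - u / y + 2 * u * KK u) * D = (\<tau> r * (G r - r)) * hat y * \<gamma> / 4 / u"
        using u by (simp add: D_def power2_eq_square)
      also have "\<dots> = (\<gamma> - 1) * (hat y * r) * \<gamma> / 4 / u" using tau_G[of r] r by simp
      also have "hat y * r = hat u" using hy by (simp add: r_def)
      finally show ?thesis using u
        by (simp add: S_def hat_def power2_eq_square field_simps)
    qed
    have "(F has_real_derivative ((KK u / y - (KK u)\<^sup>2) + u * (D / y - 2 * KK u * D) - D + S)) (at u)"
      unfolding F_def using y
      by (auto intro!: derivative_eq_intros KD SD)
    moreover have "(KK u / y - (KK u)\<^sup>2) + u * (D / y - 2 * KK u * D) - D + S = k u y"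
    proof -
      have "u * (D / y - 2 * KK u * D) - D = - ((1 - u / y + 2 * u * KK u) * D)"
        by (simp add: algebra_simps)
      then show ?thesis using u ode eq[of u] by (simp add: k_def)
    qed
    ultimately have "(F has_real_derivative (k u y)) (at u)" by simp
    then show "(F has_vector_derivative (k u y)) (at u)"
      by (simp add: has_real_derivative_iff_has_vector_derivative)
  qed (use x in auto)
  moreover have "F x - F (1/2) = x * k x y - K x y + \<Sigma> x"
    using x eq[of x] eq[of "1/2"] K_half[of y] by (simp add: F_def k_def \<Sigma>_def)
  ultimately have "((\<lambda>u. k u y) has_integral (x * k x y - K x y + \<Sigma> x)) {1/2..x}" by simp
  moreover have "((\<lambda>u. k u y) has_integral 0) {0..1/2}"
    by (rule has_integral_eq[where f = "\<lambda>_. 0"])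
       (auto simp: k_def K_zero)
  ultimately show ?thesis
    using has_integral_combine[of 0 "1/2" x "\<lambda>u. k u y"] x by fastforce
qed

text \<open>On the diagonal \<open>K\<close> is linear in \<open>hat u\<close>, with slope (\<gamma>
  - 1) / 2 because G 1 = \<gamma>. The primitive is right only because this slope fits the
  coefficient \<gamma> (\<gamma> - 1) / 2 in \<open>\<Sigma>\<close>: here the boundary value and
  the differential equation have to agree.\<close>

lemma k_diag_integral:
  assumes x: "1/2 \<le> x" "x \<le> 1"
  shows "((\<lambda>u. k u u) has_integral (2 * \<Sigma> x - x * (K x x)\<^sup>2)) {0..x}"
proof -
  define F where "F = (\<lambda>u. 2 * \<Sigma> u - u * ((2 - 1 / u) * (\<gamma> - 1) / 2)\<^sup>2)"
  have "((\<lambda>u. k u u) has_integral (F x - F (1/2))) {1/2..x}"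
  proof (rule fundamental_theorem_of_calculus_interior)
    show "continuous_on {1/2..x} F"
      unfolding F_def \<Sigma>_def using x by (intro continuous_intros) auto
    fix u assume u: "u \<in> {1/2<..<x}"
    define S where "S = \<gamma> * (\<gamma> - 1) / 2 * (1 / u - 1 / (2 * u\<^sup>2))"
    have SD: "(\<Sigma> has_real_derivative S) (at u)"
      unfolding \<Sigma>_def S_def using u
      by (auto intro!: derivative_eq_intros simp: power2_eq_square field_simps)
    define d where "d = (2 - 1 / u) * (\<gamma> - 1) / 2"
    have dD: "((\<lambda>u. (2 - 1 / u) * (\<gamma> - 1) / 2) has_real_derivative ((\<gamma> - 1) / (2 * u\<^sup>2))) (at u)"
      using u by (auto intro!: derivative_eq_intros simp: power2_eq_square field_simps)
    have "(F has_real_derivative (2 * S - (d\<^sup>2 + u * (2 * d * ((\<gamma> - 1) / (2 * u\<^sup>2)))))) (at u)"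
      unfolding F_def d_def
      by (rule derivative_eq_intros SD dD refl | simp)+
    moreover have "2 * S - (d\<^sup>2 + u * (2 * d * ((\<gamma> - 1) / (2 * u\<^sup>2)))) = k u u"
    proof -
      have "K u u = d" using u by (simp add: K_diag d_def hat_def)
      moreover have "2 * S - u * (2 * d * ((\<gamma> - 1) / (2 * u\<^sup>2))) = d / u"
        using u by (simp add: S_def d_def power2_eq_square field_simps)
      ultimately show ?thesis by (simp add: k_def)
    qed
    ultimately have "(F has_real_derivative (k u u)) (at u)" by simp
    then show "(F has_vector_derivative (k u u)) (at u)"
      by (simp add: has_real_derivative_iff_has_vector_derivative)
  qed (use x in auto)
  moreover have "F x - F (1/2) = 2 * \<Sigma> x - x * (K x x)\<^sup>2"
    using x by (simp add: F_def K_diag hat_def \<Sigma>_def)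
  ultimately have "((\<lambda>u. k u u) has_integral (2 * \<Sigma> x - x * (K x x)\<^sup>2)) {1/2..x}" by simp
  moreover have "((\<lambda>u. k u u) has_integral 0) {0..1/2}"
    by (rule has_integral_eq[where f = "\<lambda>_. 0"])
       (auto simp: k_def K_zero)
  ultimately show ?thesis
    using has_integral_combine[of 0 "1/2" x "\<lambda>u. k u u"] x by fastforce
qed

text \<open>For the minima Y and Y' the integrand is the probability that u < Y \<le> x while Y' > y
  or Y' \<le> u; in the latter case the second edge freezes and its time is 2. In the sum of the
  four integrals the \<open>\<Sigma>\<close> terms cancel, with coefficients -1, 2 and -1, and the
  terms on the diagonal cancel as well.\<close>

lemma K_fixed_point:
  assumes x: "1/2 \<le> x" "x \<le> y" "y \<le> 1"
  shows "((\<lambda>u. if u < x then k x y - k u y + k u u - k u x else 0) has_integral K x y) {0..1}"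
proof -
  have "((\<lambda>u. k x y - k u y + k u u - k u x) has_integral
     (x * k x y - (x * k x y - K x y + \<Sigma> x) + (2 * \<Sigma> x - x * (K x x)\<^sup>2)
       - (x * k x x - K x x + \<Sigma> x))) {0..x}"
    using x has_integral_const_real[of "k x y" 0 x]
    by (intro has_integral_diff has_integral_add k_integral k_diag_integral) auto
  moreover have "x * k x x = K x x - x * (K x x)\<^sup>2" using x by (simp add: k_def field_simps)
  ultimately have "((\<lambda>u. k x y - k u y + k u u - k u x) has_integral K x y) {0..x}" by simp
  then have "((\<lambda>u. if u < x then k x y - k u y + k u u - k u x else 0) has_integral K x y) {0..x}"
    by (rule has_integral_spike_finite[of "{x}", rotated 2]) auto
  moreover have "((\<lambda>u. if u < x then k x y - k u y + k u u - k u x else 0) has_integral 0) {x..1}"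
    by (rule has_integral_eq[where f = "\<lambda>_. 0"]) auto
  ultimately show ?thesis
    using has_integral_combine[of 0 x 1 "\<lambda>u. if u < x then k x y - k u y + k u u - k u x else 0"] x
    by fastforce
qed


text \<open>Only mixed probabilities with x \<le> y in [1/2, 1] are prescribed, in both orders.
  Together with the marginals they determine the law (\<open>pair_law_eqI\<close>), so a step of the
  recursion that preserves \<open>coupled\<close> leaves the law itself fixed.\<close>

definition coupled :: "(real \<times> real) measure \<Rightarrow> bool" where
  "coupled N \<longleftrightarrow> prob_space N \<and> sets N = sets borel \<and>
     (\<forall>x. measure N {z. fst z \<le> x} = time_cdf x) \<and> (\<forall>x. measure N {z. snd z \<le> x} = time_cdf x) \<and>
     (\<forall>x y. 1/2 \<le> x \<longrightarrow> x \<le> y \<longrightarrow> y \<le> 1 \<longrightarrow>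
        measure N {z. fst z \<le> x \<and> y < snd z} = K x y \<and> measure N {z. snd z \<le> x \<and> y < fst z} = K x y)"

lemma freeze_joint:
  assumes "prob_space \<kappa>" and [measurable]: "Y \<in> borel_measurable \<kappa>" "Y' \<in> borel_measurable \<kappa>"
    and k1: "\<And>u v. u \<le> v \<Longrightarrow> v \<le> 1 \<Longrightarrow> measure \<kappa> {\<omega> \<in> space \<kappa>. Y \<omega> \<le> u \<and> v < Y' \<omega>} = k u v"
    and k2: "\<And>u v. u \<le> v \<Longrightarrow> v \<le> 1 \<Longrightarrow> measure \<kappa> {\<omega> \<in> space \<kappa>. Y' \<omega> \<le> u \<and> v < Y \<omega>} = k u v"
    and x: "1/2 \<le> x" "x \<le> y" "y \<le> 1"
  shows "measure (unif \<Otimes>\<^sub>M \<kappa>)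
     {p \<in> space (unif \<Otimes>\<^sub>M \<kappa>). freeze (fst p) (Y (snd p)) \<le> x \<and> y < freeze (fst p) (Y' (snd p))} = K x y"
    (is "measure _ ?T = _")
proof -
  interpret prob_space \<kappa> by fact
  have T: "?T \<in> sets (unif \<Otimes>\<^sub>M \<kappa>)" unfolding freeze_def by measurable
  have sec: "measure \<kappa> (Pair u -` ?T) = (if u < x then k x y - k u y + k u u - k u x else 0)"
    if "u \<in> {0..1}" for u
  proof (cases "u < x")
    case True
    let ?S1 = "{\<omega> \<in> space \<kappa>. Y \<omega> \<le> x \<and> y < Y' \<omega>}"
    let ?S2 = "{\<omega> \<in> space \<kappa>. Y \<omega> \<le> u \<and> y < Y' \<omega>}"
    let ?S3 = "{\<omega> \<in> space \<kappa>. Y' \<omega> \<le> u \<and> u < Y \<omega>}"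
    let ?S4 = "{\<omega> \<in> space \<kappa>. Y' \<omega> \<le> u \<and> x < Y \<omega>}"
    \<comment> \<open>The first component lies in (u, x]. The second one exceeds y if Y' > y, and
      also if Y' \<le> u, since it is then set to 2 > y.\<close>
    have eq: "Pair u -` ?T = (?S1 - ?S2) \<union> (?S3 - ?S4)"
      using True x by (auto simp: freeze_def space_pair_measure split: if_splits)
    have "measure \<kappa> (Pair u -` ?T) = measure \<kappa> (?S1 - ?S2) + measure \<kappa> (?S3 - ?S4)"
      unfolding eq by (rule finite_measure_Union) (use True x in auto)
    also have "measure \<kappa> (?S1 - ?S2) = measure \<kappa> ?S1 - measure \<kappa> ?S2"
      by (rule finite_measure_Diff) (use True in auto)
    also have "measure \<kappa> (?S3 - ?S4) = measure \<kappa> ?S3 - measure \<kappa> ?S4"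
      by (rule finite_measure_Diff) (use True in auto)
    finally show ?thesis using True x by (simp add: k1 k2)
  next
    case False
    then have "Pair u -` ?T = {}" using x by (auto simp: freeze_def split: if_splits)
    show ?thesis unfolding \<open>Pair u -` ?T = {}\<close> using False by (simp only: if_False measure_empty)
  qed
  have "((\<lambda>u. if u < x then k x y - k u y + k u u - k u x else 0) has_integral
      measure (unif \<Otimes>\<^sub>M \<kappa>) ?T) {0..1}"
    by (rule has_integral_eq[rotated], rule has_integral_measure_unif_pair[OF assms(1) T]) (use sec in auto)
  then show ?thesis using K_fixed_point[OF x] has_integral_unique by blast
qed

end

text \<open>The univariate equation. With \<open>c\<close> the distribution function of the minimum
  of two independent times, the probability is the integral over u in [0, x] of c x - c u. As c u
  vanishes below 1/2 and is 1 - 1 / (4 u^2) on [1/2, 1], this comes to 1 - 1 / (2 x).\<close>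

lemma freeze_marginal:
  assumes "prob_space \<kappa>" and [measurable]: "Y \<in> borel_measurable \<kappa>"
    and Y: "\<And>x. measure \<kappa> {\<omega> \<in> space \<kappa>. Y \<omega> \<le> x} = 1 - (1 - time_cdf x)\<^sup>2"
  shows "measure (unif \<Otimes>\<^sub>M \<kappa>) {p \<in> space (unif \<Otimes>\<^sub>M \<kappa>). freeze (fst p) (Y (snd p)) \<le> x} = time_cdf x"
    (is "measure _ (?T x) = _")
proof -
  interpret prob_space \<kappa> by fact
  interpret U: prob_space unif by (rule prob_space_unif)
  interpret P: pair_prob_space unif \<kappa> ..
  define c where "c = (\<lambda>x::real. 1 - (1 - time_cdf x)\<^sup>2)"
  have T: "?T x \<in> sets (unif \<Otimes>\<^sub>M \<kappa>)" for x unfolding freeze_def by measurable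
  have sec: "measure \<kappa> (Pair u -` ?T x) = (if u < x then c x - c u else 0)"
    if "u \<in> {0..1}" "x < 2" for u x
  proof (cases "u < x")
    case True
    let ?S1 = "{\<omega> \<in> space \<kappa>. Y \<omega> \<le> x}"
    let ?S2 = "{\<omega> \<in> space \<kappa>. Y \<omega> \<le> u}"
    have "Pair u -` ?T x = ?S1 - ?S2"
      using True that by (auto simp: freeze_def space_pair_measure split: if_splits)
    moreover have "measure \<kappa> (?S1 - ?S2) = measure \<kappa> ?S1 - measure \<kappa> ?S2"
      by (rule finite_measure_Diff) (use True in auto)
    ultimately show ?thesis using True by (simp add: Y c_def)
  next
    case False
    then have "Pair u -` ?T x = {}" using that by (auto simp: freeze_def split: if_splits)
    show ?thesis unfolding \<open>Pair u -` ?T x = {}\<close> using False by (simp only: if_False measure_empty)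
  qed
  have int: "((\<lambda>u. if u < x then c x - c u else 0) has_integral
      measure (unif \<Otimes>\<^sub>M \<kappa>) (?T x)) {0..1}" if "x < 2" for x
    by (rule has_integral_eq[rotated], rule has_integral_measure_unif_pair[OF assms(1) T]) (use sec that in auto)
  have mid: "measure (unif \<Otimes>\<^sub>M \<kappa>) (?T x) = time_cdf x" if x: "1/2 \<le> x" "x \<le> 1" for x
  proof -
    have "((\<lambda>u. c x - (1 - 1 / (4 * u\<^sup>2))) has_integral
       ((c x * x - (x + 1 / (4 * x))) - (c x * (1/2) - (1/2 + 1 / (4 * (1/2)))))) {1/2..x}"
    proof (rule fundamental_theorem_of_calculus_interior)
      show "continuous_on {1/2..x} (\<lambda>u. c x * u - (u + 1 / (4 * u)))"
        by (intro continuous_intros) auto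
      fix u assume u: "u \<in> {1/2<..<x}"
      have "((\<lambda>u. c x * u - (u + 1 / (4 * u))) has_real_derivative (c x - (1 - 1 / (4 * u\<^sup>2)))) (at u)"
        using u by (auto intro!: derivative_eq_intros simp: power2_eq_square)
      then show "((\<lambda>u. c x * u - (u + 1 / (4 * u))) has_vector_derivative (c x - (1 - 1 / (4 * u\<^sup>2)))) (at u)"
        by (simp add: has_real_derivative_iff_has_vector_derivative)
    qed (use x in auto)
    moreover have "1/2 + 1 / (4 * (1/2)) = (1::real)" by simp
    ultimately have "((\<lambda>u. c x - (1 - 1 / (4 * u\<^sup>2))) has_integral
       ((c x * x - (x + 1 / (4 * x))) - (c x * (1/2) - 1))) {1/2..x}" by (simp only:)
    then have "((\<lambda>u. if u < x then c x - c u else 0) has_integral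
       ((c x * x - (x + 1 / (4 * x))) - (c x * (1/2) - 1))) {1/2..x}"
      by (rule has_integral_spike_finite[of "{x}", rotated 2])
         (use x in \<open>auto simp: c_def time_cdf_def power2_eq_square\<close>)
    note A = this
    have B: "((\<lambda>u. if u < x then c x - c u else 0) has_integral (c x * (1/2))) {0..1/2}"
    proof (rule has_integral_spike_finite[of "{1/2}", rotated 2])
      show "((\<lambda>u. c x) has_integral (c x * (1/2))) {0..1/2 :: real}"
        using has_integral_const_real[of "c x" 0 "1/2"] by simp
      show "(if u < x then c x - c u else 0) = c x" if "u \<in> {0..1/2} - {1/2}" for u
        using that x by (auto simp: c_def time_cdf_def)
    qed simp
    have C: "((\<lambda>u. if u < x then c x - c u else 0) has_integral 0) {x..1}"
      by (rule has_integral_eq[where f = "\<lambda>_. 0"]) auto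
    have "((\<lambda>u. if u < x then c x - c u else 0) has_integral
       ((c x * (1/2) + ((c x * x - (x + 1 / (4 * x))) - (c x * (1/2) - 1))) + 0)) {0..1}"
      by (rule has_integral_combine[OF _ _ has_integral_combine[OF _ _ B A] C]) (use x in auto)
    then have "measure (unif \<Otimes>\<^sub>M \<kappa>) (?T x) =
        (c x * (1/2) + ((c x * x - (x + 1 / (4 * x))) - (c x * (1/2) - 1))) + 0"
      using x by (intro has_integral_unique[OF int]) auto
    also have "(c x * (1/2) + ((c x * x - (x + 1 / (4 * x))) - (c x * (1/2) - 1))) + 0 = time_cdf x"
      using x by (simp add: c_def time_cdf_def power2_eq_square field_simps)
    finally show ?thesis .
  qed
  show ?thesis
  proof -
    consider "x < 1/2" | "1/2 \<le> x" "x \<le> 1" | "1 < x" "x < 2" | "2 \<le> x" by linarith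
    then show ?thesis
    proof cases
      case 1
      have "((\<lambda>u. if u < x then c x - c u else 0) has_integral 0) {0..1}"
        by (rule has_integral_eq[where f = "\<lambda>_. 0"]) (use 1 in \<open>auto simp: c_def time_cdf_def\<close>)
      then have "measure (unif \<Otimes>\<^sub>M \<kappa>) (?T x) = 0"
        using 1 by (intro has_integral_unique[OF int]) auto
      then show ?thesis using 1 by (simp add: time_cdf_def)
    next
      case 2 then show ?thesis by (rule mid)
    next
      case 3
      have "((\<lambda>u. if u < x then c x - c u else 0) has_integral measure (unif \<Otimes>\<^sub>M \<kappa>) (?T 1)) {0..1}"
        by (rule has_integral_spike_finite[of "{1}", rotated 2], rule int[of 1])
           (use 3 in \<open>auto simp: c_def time_cdf_def\<close>)
      then have "measure (unif \<Otimes>\<^sub>M \<kappa>) (?T x) = measure (unif \<Otimes>\<^sub>M \<kappa>) (?T 1)"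
        using 3 by (intro has_integral_unique[OF int]) auto
      then show ?thesis using mid[of 1] 3 by (simp add: time_cdf_def)
    next
      case 4
      have Y1: "AE \<omega> in \<kappa>. Y \<omega> \<le> x"
      proof -
        have "prob {\<omega> \<in> space \<kappa>. Y \<omega> \<le> x} = 1" using Y[of x] 4 by (simp add: time_cdf_def)
        then show ?thesis by (subst (asm) prob_Collect_eq_1) measurable
      qed
      have "AE p in unif \<Otimes>\<^sub>M \<kappa>. freeze (fst p) (Y (snd p)) \<le> x"
      proof (rule P.AE_pair_measure)
        show "{p \<in> space (unif \<Otimes>\<^sub>M \<kappa>). freeze (fst p) (Y (snd p)) \<le> x} \<in> sets (unif \<Otimes>\<^sub>M \<kappa>)" by (rule T)
        have "AE \<omega> in \<kappa>. freeze (fst (u, \<omega>)) (Y (snd (u, \<omega>))) \<le> x" for u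
          using Y1 by eventually_elim (use 4 in \<open>simp add: freeze_def\<close>)
        then show "AE u in unif. AE \<omega> in \<kappa>. freeze (fst (u, \<omega>)) (Y (snd (u, \<omega>))) \<le> x"
          by (rule AE_I2)
      qed
      then have "measure (unif \<Otimes>\<^sub>M \<kappa>) (?T x) = 1" using T by (subst P.prob_Collect_eq_1) auto
      then show ?thesis using 4 by (simp add: time_cdf_def)
    qed
  qed
qed


section \<open>Uniqueness and invariance of the coupled law\<close>

text \<open>Each coordinate lives on [1/2, 1] and the point 2. The joint distribution function at
  (a, b) is therefore trivial or a marginal outside this range, and after clamping a and b to at
  most 1 it is a marginal minus one of the two kinds of mixed probability, according to the order of
  a and b.\<close>

lemma pair_law_eqI:
  fixes M N :: "(real \<times> real) measure"
  assumes "prob_space M" "prob_space N" and sM: "sets M = sets borel" and sN: "sets N = sets borel"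
    and M1: "\<And>x. measure M {z. fst z \<le> x} = time_cdf x" and M2: "\<And>x. measure M {z. snd z \<le> x} = time_cdf x"
    and N1: "\<And>x. measure N {z. fst z \<le> x} = time_cdf x" and N2: "\<And>x. measure N {z. snd z \<le> x} = time_cdf x"
    and j1: "\<And>x y. 1/2 \<le> x \<Longrightarrow> x \<le> y \<Longrightarrow> y \<le> 1 \<Longrightarrow>
       measure M {z. fst z \<le> x \<and> y < snd z} = measure N {z. fst z \<le> x \<and> y < snd z}"
    and j2: "\<And>x y. 1/2 \<le> x \<Longrightarrow> x \<le> y \<Longrightarrow> y \<le> 1 \<Longrightarrow>
       measure M {z. snd z \<le> x \<and> y < fst z} = measure N {z. snd z \<le> x \<and> y < fst z}"
  shows "M = N"
proof -
  interpret M: prob_space M by fact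
  interpret N: prob_space N by fact
  have clamp: "measure L {z. fst z \<le> a \<and> snd z \<le> b} =
      (if a < 1/2 \<or> b < 1/2 then 0 else if 2 \<le> a then time_cdf b else if 2 \<le> b then time_cdf a
       else if min a 1 \<le> min b 1 then time_cdf (min a 1) - measure L {z. fst z \<le> min a 1 \<and> min b 1 < snd z}
       else time_cdf (min b 1) - measure L {z. snd z \<le> min b 1 \<and> min a 1 < fst z})"
    if "prob_space L" and sL: "sets L = sets borel"
      and L1: "\<And>x. measure L {z. fst z \<le> x} = time_cdf x" and L2: "\<And>x. measure L {z. snd z \<le> x} = time_cdf x"
    for L :: "(real \<times> real) measure" and a b
  proof -
    interpret L: prob_space L by fact
    have sL' [measurable_cong]: "sets L = sets (borel \<Otimes>\<^sub>M borel)" by (simp only: sL borel_prod)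
    have sp: "space L = UNIV" using sL sets_eq_imp_space_eq by fastforce
    have le: "AE z in L. f z \<le> v \<longrightarrow> f z \<le> u"
      if [measurable]: "f \<in> borel_measurable L" and "time_cdf u = time_cdf v" "u \<le> v"
        and f: "\<And>x. measure L {z. f z \<le> x} = time_cdf x" for f :: "real \<times> real \<Rightarrow> real" and u v
    proof -
      have S: "{z. f z \<le> x} \<in> sets L" for x
      proof -
        have "{z \<in> space L. f z \<le> x} \<in> sets L" by measurable
        then show ?thesis by (simp add: sp)
      qed
      have "measure L ({z. f z \<le> v} - {z. f z \<le> u}) = 0"
        using that S by (subst L.finite_measure_Diff) (auto simp: f)
      then have "AE z in L. z \<notin> {z. f z \<le> v} - {z. f z \<le> u}"
        using S by (subst (asm) L.prob_eq_0) auto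
      then show ?thesis by eventually_elim auto
    qed
    have zero: "AE z in L. \<not> f z \<le> v"
      if [measurable]: "f \<in> borel_measurable L" and "time_cdf v = 0"
        and f: "\<And>x. measure L {z. f z \<le> x} = time_cdf x" for f :: "real \<times> real \<Rightarrow> real" and v
    proof -
      have "measure L {z \<in> space L. f z \<le> v} = 0" using that by (simp add: sp)
      then show ?thesis by (subst (asm) L.prob_Collect_eq_0) measurable
    qed
    have one: "AE z in L. f z \<le> v"
      if [measurable]: "f \<in> borel_measurable L" and "time_cdf v = 1"
        and f: "\<And>x. measure L {z. f z \<le> x} = time_cdf x" for f :: "real \<times> real \<Rightarrow> real" and v
    proof -
      have "measure L {z \<in> space L. f z \<le> v} = 1" using that by (simp add: sp)
      then show ?thesis by (subst (asm) L.prob_Collect_eq_1) measurable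
    qed
    have m [measurable]: "fst \<in> borel_measurable L" "snd \<in> borel_measurable L" by measurable
    have S: "{z. P z} \<in> sets L" if "{z \<in> space L. P z} \<in> sets L" for P using that by (simp add: sp)
    have S1: "{z. fst z \<le> x \<and> snd z \<le> y} \<in> sets L" for x y by (rule S) measurable
    have S2: "{z. fst z \<le> x} \<in> sets L" for x by (rule S) measurable
    have S3: "{z. snd z \<le> x} \<in> sets L" for x by (rule S) measurable
    have S4: "{z. fst z \<le> x \<and> y < snd z} \<in> sets L" for x y by (rule S) measurable
    have S5: "{z. snd z \<le> x \<and> y < fst z} \<in> sets L" for x y by (rule S) measurable
    consider "a < 1/2" | "b < 1/2" | "1/2 \<le> a" "1/2 \<le> b" "2 \<le> a" | "1/2 \<le> a" "1/2 \<le> b" "a < 2" "2 \<le> b"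
      | "1/2 \<le> a" "1/2 \<le> b" "a < 2" "b < 2" by linarith
    then show ?thesis
    proof cases
      case 1
      have "AE z in L. \<not> fst z \<le> a" by (rule zero) (use 1 L1 in \<open>auto simp: time_cdf_def\<close>)
      then have "measure L {z. fst z \<le> a \<and> snd z \<le> b} = measure L {}"
        by (intro L.finite_measure_eq_AE S1) auto
      then show ?thesis using 1 by simp
    next
      case 2
      have "AE z in L. \<not> snd z \<le> b" by (rule zero) (use 2 L2 in \<open>auto simp: time_cdf_def\<close>)
      then have "measure L {z. fst z \<le> a \<and> snd z \<le> b} = measure L {}"
        by (intro L.finite_measure_eq_AE S1) auto
      then show ?thesis using 2 by simp
    next
      case 3
      have "AE z in L. fst z \<le> a" by (rule one) (use 3 L1 in \<open>auto simp: time_cdf_def\<close>)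
      then have "measure L {z. fst z \<le> a \<and> snd z \<le> b} = measure L {z. snd z \<le> b}"
        by (intro L.finite_measure_eq_AE S1 S3) auto
      then show ?thesis using 3 by (simp add: L2)
    next
      case 4
      have "AE z in L. snd z \<le> b" by (rule one) (use 4 L2 in \<open>auto simp: time_cdf_def\<close>)
      then have "measure L {z. fst z \<le> a \<and> snd z \<le> b} = measure L {z. fst z \<le> a}"
        by (intro L.finite_measure_eq_AE S1 S2) auto
      then show ?thesis using 4 by (simp add: L1)
    next
      case 5
      define a' where "a' = min a 1"
      define b' where "b' = min b 1"
      have ab: "1/2 \<le> a'" "a' \<le> 1" "1/2 \<le> b'" "b' \<le> 1" "a' \<le> a" "b' \<le> b"
        using 5 by (auto simp: a'_def b'_def)
      have "AE z in L. fst z \<le> a \<longrightarrow> fst z \<le> a'"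
        by (rule le) (use 5 L1 in \<open>auto simp: time_cdf_def a'_def\<close>)
      moreover have "AE z in L. snd z \<le> b \<longrightarrow> snd z \<le> b'"
        by (rule le) (use 5 L2 in \<open>auto simp: time_cdf_def b'_def\<close>)
      ultimately have "AE z in L. (fst z \<le> a \<and> snd z \<le> b) = (fst z \<le> a' \<and> snd z \<le> b')"
        by eventually_elim (use ab in auto)
      then have e: "measure L {z. fst z \<le> a \<and> snd z \<le> b} = measure L {z. fst z \<le> a' \<and> snd z \<le> b'}"
        by (intro L.finite_measure_eq_AE S1) auto
      have "measure L {z. fst z \<le> a' \<and> snd z \<le> b'} =
         measure L ({z. fst z \<le> a'} - {z. fst z \<le> a' \<and> b' < snd z})"
        by (rule arg_cong[of _ _ "measure L"]) auto
      also have "\<dots> = time_cdf a' - measure L {z. fst z \<le> a' \<and> b' < snd z}"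
        by (subst L.finite_measure_Diff) (use S2 S4 L1 in auto)
      finally have e1: "measure L {z. fst z \<le> a' \<and> snd z \<le> b'} = \<dots>" .
      have "measure L {z. fst z \<le> a' \<and> snd z \<le> b'} =
         measure L ({z. snd z \<le> b'} - {z. snd z \<le> b' \<and> a' < fst z})"
        by (rule arg_cong[of _ _ "measure L"]) auto
      also have "\<dots> = time_cdf b' - measure L {z. snd z \<le> b' \<and> a' < fst z}"
        by (subst L.finite_measure_Diff) (use S3 S5 L2 in auto)
      finally have e2: "measure L {z. fst z \<le> a' \<and> snd z \<le> b'} = \<dots>" .
      show ?thesis using 5 e e1 e2 by (auto simp flip: a'_def b'_def)
    qed
  qed
  have eq: "measure M {z. fst z \<le> a \<and> snd z \<le> b} = measure N {z. fst z \<le> a \<and> snd z \<le> b}" for a b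
  proof (cases "a < 1/2 \<or> b < 1/2")
    case True
    then show ?thesis
      unfolding clamp[OF \<open>prob_space M\<close> sM M1 M2] clamp[OF \<open>prob_space N\<close> sN N1 N2] by (simp only: if_True)
  next
    case False
    define a' b' where "a' = min a 1" and "b' = min b 1"
    have ab: "1/2 \<le> a'" "a' \<le> 1" "1/2 \<le> b'" "b' \<le> 1" using False by (auto simp: a'_def b'_def)
    show ?thesis
      unfolding clamp[OF \<open>prob_space M\<close> sM M1 M2] clamp[OF \<open>prob_space N\<close> sN N1 N2] a'_def[symmetric] b'_def[symmetric]
    proof (intro if_cong refl)
      show "time_cdf a' - measure M {z. fst z \<le> a' \<and> b' < snd z} = time_cdf a' - measure N {z. fst z \<le> a' \<and> b' < snd z}"
        if "a' \<le> b'" using j1[of a' b'] ab that by (simp only:)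
      show "time_cdf b' - measure M {z. snd z \<le> b' \<and> a' < fst z} = time_cdf b' - measure N {z. snd z \<le> b' \<and> a' < fst z}"
        if "\<not> a' \<le> b'" using j2[of b' a'] ab that by (simp only: linear not_le less_imp_le)
    qed
  qed
  let ?E = "range (\<lambda>a::real \<times> real. {..a})"
  have at: "{..p} = {z. fst z \<le> fst p \<and> snd z \<le> snd p}" for p :: "real \<times> real"
    by (auto simp: less_eq_prod_def)
  have gen: "sets (borel :: (real \<times> real) measure) = sigma_sets UNIV ?E"
    by (subst borel_eq_atMost) simp
  show ?thesis
  proof (rule measure_eqI_generator_eq[where E = ?E and \<Omega> = UNIV and A = "\<lambda>i. {..(real i, real i)}"])
    show "Int_stable ?E"
    proof (rule Int_stableI_image)
      fix i j :: "real \<times> real"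
      show "\<exists>k\<in>UNIV. {..i} \<inter> {..j} = {..k}"
        by (intro bexI[of _ "(min (fst i) (fst j), min (snd i) (snd j))"]) (auto simp: less_eq_prod_def)
    qed
    show "(\<Union>i. {..(real i, real i)}) = UNIV"
    proof (intro equalityI subset_UNIV subsetI)
      fix p :: "real \<times> real"
      obtain n where "max (fst p) (snd p) \<le> real n" using real_arch_simple by blast
      then have "p \<in> {..(real n, real n)}" by (auto simp: less_eq_prod_def)
      then show "p \<in> (\<Union>i. {..(real i, real i)})" by blast
    qed
    show "emeasure M X = emeasure N X" if "X \<in> ?E" for X
      using that eq by (auto simp: at M.emeasure_eq_measure N.emeasure_eq_measure)
    show "sets M = sigma_sets UNIV ?E" "sets N = sigma_sets UNIV ?E" by (simp_all only: sM sN gen)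
    show "emeasure M {..(real i, real i)} \<noteq> \<infinity>" for i by simp
  qed auto
qed

lemma measure_Times_pair:
  assumes "prob_space M" "prob_space N" "A \<in> sets M" "B \<in> sets N"
  shows "measure (M \<Otimes>\<^sub>M N) (A \<times> B) = measure M A * measure N B"
proof -
  interpret M: prob_space M by fact
  interpret N: prob_space N by fact
  show ?thesis using assms by (simp add: measure_def N.emeasure_pair_measure_Times enn2real_mult)
qed

text \<open>One generation of the bivariate recursion: both components see the same label u, each
  takes the minimum over its own two successors.\<close>

definition step_pair :: "real \<times> (real \<times> real) \<times> (real \<times> real) \<Rightarrow> real \<times> real" where
  "step_pair = (\<lambda>(u, z1, z2). (freeze u (min (fst z1) (fst z2)), freeze u (min (snd z1) (snd z2))))"

context profile
begin

text \<open>For the mixed probabilities, remove from the event that both second coordinates exceed v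
  the part on which both first coordinates also exceed u. Both are product sets, which gives (1 / (2
  v))^2 - (1 / (2 v) - K u v)^2 = k u v.\<close>

lemma coupled_min:
  assumes N: "coupled N"
  shows "u \<le> v \<Longrightarrow> v \<le> 1 \<Longrightarrow> measure (N \<Otimes>\<^sub>M N)
       {\<omega> \<in> space (N \<Otimes>\<^sub>M N). min (fst (fst \<omega>)) (fst (snd \<omega>)) \<le> u \<and> v < min (snd (fst \<omega>)) (snd (snd \<omega>))} = k u v"
    and "u \<le> v \<Longrightarrow> v \<le> 1 \<Longrightarrow> measure (N \<Otimes>\<^sub>M N)
       {\<omega> \<in> space (N \<Otimes>\<^sub>M N). min (snd (fst \<omega>)) (snd (snd \<omega>)) \<le> u \<and> v < min (fst (fst \<omega>)) (fst (snd \<omega>))} = k u v"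
    and "measure (N \<Otimes>\<^sub>M N)
       {\<omega> \<in> space (N \<Otimes>\<^sub>M N). min (fst (fst \<omega>)) (fst (snd \<omega>)) \<le> x} = 1 - (1 - time_cdf x)\<^sup>2"
    and "measure (N \<Otimes>\<^sub>M N)
       {\<omega> \<in> space (N \<Otimes>\<^sub>M N). min (snd (fst \<omega>)) (snd (snd \<omega>)) \<le> x} = 1 - (1 - time_cdf x)\<^sup>2"
proof -
  interpret N: prob_space N using N by (simp add: coupled_def)
  interpret P: pair_prob_space N N ..
  have sN: "sets N = sets borel" using N by (simp add: coupled_def)
  have sN' [measurable_cong]: "sets N = sets (borel \<Otimes>\<^sub>M borel)" by (simp only: sN borel_prod)
  have sp: "space N = UNIV" using sN sets_eq_imp_space_eq by fastforce
  have S: "{z. P z} \<in> sets N" if "{z \<in> space N. P z} \<in> sets N" for P using that by (simp add: sp)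
  have marg: "measure (N \<Otimes>\<^sub>M N) {\<omega> \<in> space (N \<Otimes>\<^sub>M N). min (f (fst \<omega>)) (f (snd \<omega>)) \<le> x} = 1 - (1 - time_cdf x)\<^sup>2"
    if f [measurable]: "f \<in> borel_measurable N" and fd: "\<And>x. measure N {z. f z \<le> x} = time_cdf x" for f x
  proof -
    have A: "{z. f z \<le> x} \<in> sets N" by (rule S) measurable
    have c: "measure N (- {z. f z \<le> x}) = 1 - time_cdf x"
      using N.prob_compl[OF A] by (simp add: sp Compl_eq_Diff_UNIV fd)
    have "{\<omega> \<in> space (N \<Otimes>\<^sub>M N). min (f (fst \<omega>)) (f (snd \<omega>)) \<le> x} =
       space (N \<Otimes>\<^sub>M N) - (- {z. f z \<le> x}) \<times> (- {z. f z \<le> x})"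
      by (auto simp: space_pair_measure sp)
    moreover have "- {z. f z \<le> x} \<in> sets N" using A by (metis Compl_eq_Diff_UNIV sets.compl_sets sp)
    ultimately show ?thesis
      using P.prob_compl[of "(- {z. f z \<le> x}) \<times> (- {z. f z \<le> x})"]
      by (simp add: measure_Times_pair N.prob_space_axioms c power2_eq_square)
  qed
  have joint: "measure (N \<Otimes>\<^sub>M N)
       {\<omega> \<in> space (N \<Otimes>\<^sub>M N). min (f (fst \<omega>)) (f (snd \<omega>)) \<le> u \<and> v < min (g (fst \<omega>)) (g (snd \<omega>))} = k u v"
    if [measurable]: "f \<in> borel_measurable N" "g \<in> borel_measurable N"
      and fd: "\<And>x. measure N {z. f z \<le> x} = time_cdf x" and gd: "\<And>x. measure N {z. g z \<le> x} = time_cdf x"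
      and j: "\<And>x y. 1/2 \<le> x \<Longrightarrow> x \<le> y \<Longrightarrow> y \<le> 1 \<Longrightarrow> measure N {z. f z \<le> x \<and> y < g z} = K x y"
      and uv: "u \<le> v" "v \<le> 1" for f g u v
  proof (cases "u < 1/2")
    case True
    let ?A = "{\<omega> \<in> space (N \<Otimes>\<^sub>M N). min (f (fst \<omega>)) (f (snd \<omega>)) \<le> u}"
    have "P.prob {\<omega> \<in> space (N \<Otimes>\<^sub>M N). min (f (fst \<omega>)) (f (snd \<omega>)) \<le> u \<and> v < min (g (fst \<omega>)) (g (snd \<omega>))}
        \<le> P.prob ?A" by (rule P.finite_measure_mono) auto
    also have "\<dots> = 0" using True marg[of f u] that by (simp add: time_cdf_def)
    finally show ?thesis using True by (simp add: k_def K_zero measure_le_0_iff)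
  next
    case False
    let ?G = "{z. v < g z}" let ?H = "{z. u < f z \<and> v < g z}" let ?J = "{z. f z \<le> u \<and> v < g z}"
    let ?L = "{z. g z \<le> v}"
    have m: "?G \<in> sets N" "?H \<in> sets N" "?J \<in> sets N" "?L \<in> sets N" by (rule S; measurable)+
    have v: "1/2 \<le> v" using False uv by simp
    have "measure N ?G = measure N (space N - ?L)" by (rule arg_cong[of _ _ "measure N"]) (auto simp: sp)
    also have "\<dots> = 1 / (2 * v)" using N.prob_compl[OF m(4)] gd[of v] v uv by (simp add: time_cdf_def)
    finally have G: "measure N ?G = 1 / (2 * v)" .
    have "measure N ?H = measure N (?G - ?J)" by (rule arg_cong[of _ _ "measure N"]) auto
    also have "\<dots> = 1 / (2 * v) - K u v"
      using j[of u v] False uv G m by (subst N.finite_measure_Diff) auto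
    finally have H: "measure N ?H = 1 / (2 * v) - K u v" .
    have "{\<omega> \<in> space (N \<Otimes>\<^sub>M N). min (f (fst \<omega>)) (f (snd \<omega>)) \<le> u \<and> v < min (g (fst \<omega>)) (g (snd \<omega>))} =
        ?G \<times> ?G - ?H \<times> ?H"
      by (auto simp: space_pair_measure sp)
    moreover have "measure (N \<Otimes>\<^sub>M N) (?G \<times> ?G - ?H \<times> ?H) =
        measure (N \<Otimes>\<^sub>M N) (?G \<times> ?G) - measure (N \<Otimes>\<^sub>M N) (?H \<times> ?H)"
      using m by (intro P.finite_measure_Diff) auto
    moreover have "\<dots> = (1 / (2 * v))\<^sup>2 - (1 / (2 * v) - K u v)\<^sup>2"
      using m by (simp add: measure_Times_pair N.prob_space_axioms G H power2_eq_square)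
    moreover have "a\<^sup>2 - (a - b)\<^sup>2 = 2 * a * b - b\<^sup>2" for a b :: real
      by (simp add: power2_eq_square algebra_simps)
    then have "(1 / (2 * v))\<^sup>2 - (1 / (2 * v) - K u v)\<^sup>2 = k u v" by (simp add: k_def)
    ultimately show ?thesis by simp
  qed
  have m [measurable]: "fst \<in> borel_measurable N" "snd \<in> borel_measurable N" by measurable
  have d: "\<And>x. measure N {z. fst z \<le> x} = time_cdf x" "\<And>x. measure N {z. snd z \<le> x} = time_cdf x"
    "\<And>x y. 1/2 \<le> x \<Longrightarrow> x \<le> y \<Longrightarrow> y \<le> 1 \<Longrightarrow> measure N {z. fst z \<le> x \<and> y < snd z} = K x y"
    "\<And>x y. 1/2 \<le> x \<Longrightarrow> x \<le> y \<Longrightarrow> y \<le> 1 \<Longrightarrow> measure N {z. snd z \<le> x \<and> y < fst z} = K x y"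
    using N by (auto simp: coupled_def)
  show "u \<le> v \<Longrightarrow> v \<le> 1 \<Longrightarrow> measure (N \<Otimes>\<^sub>M N)
       {\<omega> \<in> space (N \<Otimes>\<^sub>M N). min (fst (fst \<omega>)) (fst (snd \<omega>)) \<le> u \<and> v < min (snd (fst \<omega>)) (snd (snd \<omega>))} = k u v"
    by (rule joint[OF m d(1,2,3)])
  show "u \<le> v \<Longrightarrow> v \<le> 1 \<Longrightarrow> measure (N \<Otimes>\<^sub>M N)
       {\<omega> \<in> space (N \<Otimes>\<^sub>M N). min (snd (fst \<omega>)) (snd (snd \<omega>)) \<le> u \<and> v < min (fst (fst \<omega>)) (fst (snd \<omega>))} = k u v"
    by (rule joint[OF m(2,1) d(2,1,4)])
  show "measure (N \<Otimes>\<^sub>M N)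
       {\<omega> \<in> space (N \<Otimes>\<^sub>M N). min (fst (fst \<omega>)) (fst (snd \<omega>)) \<le> x} = 1 - (1 - time_cdf x)\<^sup>2"
    by (rule marg[OF m(1) d(1)])
  show "measure (N \<Otimes>\<^sub>M N)
       {\<omega> \<in> space (N \<Otimes>\<^sub>M N). min (snd (fst \<omega>)) (snd (snd \<omega>)) \<le> x} = 1 - (1 - time_cdf x)\<^sup>2"
    by (rule marg[OF m(2) d(2)])
qed

lemma coupled_step:
  assumes N: "coupled N"
  shows "coupled (distr (unif \<Otimes>\<^sub>M (N \<Otimes>\<^sub>M N)) borel step_pair)"
proof -
  interpret N: prob_space N using N by (simp add: coupled_def)
  interpret P: pair_prob_space N N ..
  interpret U: prob_space unif by (rule prob_space_unif)
  interpret Q: pair_prob_space unif "N \<Otimes>\<^sub>M N" ..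
  have sN: "sets N = sets borel" using N by (simp add: coupled_def)
  have sN' [measurable_cong]: "sets N = sets (borel \<Otimes>\<^sub>M borel)" by (simp only: sN borel_prod)
  have b: "(borel :: (real \<times> real) measure) = borel \<Otimes>\<^sub>M borel" by (simp only: borel_prod)
  have sm [measurable]: "step_pair \<in> measurable (unif \<Otimes>\<^sub>M (N \<Otimes>\<^sub>M N)) (borel \<Otimes>\<^sub>M borel)"
    unfolding step_pair_def freeze_def by measurable
  have S: "{z. Q z} \<in> sets (borel \<Otimes>\<^sub>M borel)" if "{z \<in> space (borel \<Otimes>\<^sub>M borel). Q z} \<in> sets (borel \<Otimes>\<^sub>M borel)"
    for Q :: "real \<times> real \<Rightarrow> bool" using that by (simp add: space_pair_measure)
  have m: "measure (distr (unif \<Otimes>\<^sub>M (N \<Otimes>\<^sub>M N)) borel step_pair) {z. Q z} =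
     measure (unif \<Otimes>\<^sub>M (N \<Otimes>\<^sub>M N)) {p \<in> space (unif \<Otimes>\<^sub>M (N \<Otimes>\<^sub>M N)). Q (step_pair p)}"
    if "{z \<in> space (borel \<Otimes>\<^sub>M borel). Q z} \<in> sets (borel \<Otimes>\<^sub>M borel)" for Q :: "real \<times> real \<Rightarrow> bool"
    unfolding b using S[OF that] sm
    by (subst measure_distr) (auto intro!: arg_cong[of _ _ "measure _"])
  have sp: "fst (step_pair p) = freeze (fst p) (min (fst (fst (snd p))) (fst (snd (snd p))))"
    "snd (step_pair p) = freeze (fst p) (min (snd (fst (snd p))) (snd (snd (snd p))))" for p
    by (auto simp: step_pair_def split_beta)
  show ?thesis
    unfolding coupled_def
  proof (intro conjI allI impI)
    show "prob_space (distr (unif \<Otimes>\<^sub>M (N \<Otimes>\<^sub>M N)) borel step_pair)"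
      unfolding b using sm by (rule Q.prob_space_distr)
    fix x
    show "measure (distr (unif \<Otimes>\<^sub>M (N \<Otimes>\<^sub>M N)) borel step_pair) {z. fst z \<le> x} = time_cdf x"
      by (subst m, measurable, unfold sp, rule freeze_marginal)
         (use coupled_min(3)[OF N] P.prob_space_axioms in auto)
    show "measure (distr (unif \<Otimes>\<^sub>M (N \<Otimes>\<^sub>M N)) borel step_pair) {z. snd z \<le> x} = time_cdf x"
      by (subst m, measurable, unfold sp, rule freeze_marginal)
         (use coupled_min(4)[OF N] P.prob_space_axioms in auto)
    fix y assume xy: "1/2 \<le> x" "x \<le> y" "y \<le> 1"
    show "measure (distr (unif \<Otimes>\<^sub>M (N \<Otimes>\<^sub>M N)) borel step_pair) {z. fst z \<le> x \<and> y < snd z} = K x y"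
      by (subst m, measurable, unfold sp, rule freeze_joint[OF P.prob_space_axioms _ _ coupled_min(1,2)[OF N] xy])
         (measurable)
    show "measure (distr (unif \<Otimes>\<^sub>M (N \<Otimes>\<^sub>M N)) borel step_pair) {z. snd z \<le> x \<and> y < fst z} = K x y"
      by (subst m, measurable, unfold sp, rule freeze_joint[OF P.prob_space_axioms _ _ coupled_min(2,1)[OF N] xy])
         (measurable)
  qed simp
qed

lemma coupled_fixed:
  assumes N: "coupled N"
  shows "distr (unif \<Otimes>\<^sub>M (N \<Otimes>\<^sub>M N)) borel step_pair = N"
  using coupled_step[OF N] N unfolding coupled_def
  by (intro pair_law_eqI) auto

text \<open>The probability is the integral of \<open>k u u\<close>, and it is positive because
  \<gamma> > 1: this is what distinguishes the solution from the diagonal one.\<close>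

lemma coupled_gap_pos:
  assumes N: "coupled N"
  shows "0 < measure (unif \<Otimes>\<^sub>M (N \<Otimes>\<^sub>M N)) {p \<in> space (unif \<Otimes>\<^sub>M (N \<Otimes>\<^sub>M N)).
     min (fst (fst (snd p))) (fst (snd (snd p))) \<le> fst p \<and> fst p < min (snd (fst (snd p))) (snd (snd (snd p)))}"
    (is "0 < measure _ ?T")
proof -
  interpret N: prob_space N using N by (simp add: coupled_def)
  interpret P: pair_prob_space N N ..
  interpret U: prob_space unif by (rule prob_space_unif)
  interpret Q: pair_prob_space unif "N \<Otimes>\<^sub>M N" ..
  have sN: "sets N = sets borel" using N by (simp add: coupled_def)
  have sN' [measurable_cong]: "sets N = sets (borel \<Otimes>\<^sub>M borel)" by (simp only: sN borel_prod)
  have T: "?T \<in> sets (unif \<Otimes>\<^sub>M (N \<Otimes>\<^sub>M N))" by measurable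
  have sec: "measure (N \<Otimes>\<^sub>M N) (Pair u -` ?T) = k u u" if "u \<in> {0..1}" for u
  proof -
    have "Pair u -` ?T = {\<omega> \<in> space (N \<Otimes>\<^sub>M N). min (fst (fst \<omega>)) (fst (snd \<omega>)) \<le> u \<and> u < min (snd (fst \<omega>)) (snd (snd \<omega>))}"
      by (auto simp: space_pair_measure)
    then show ?thesis using coupled_min(1)[OF N, of u u] that by simp
  qed
  have I: "((\<lambda>u. k u u) has_integral measure (unif \<Otimes>\<^sub>M (N \<Otimes>\<^sub>M N)) ?T) {0..1}"
    by (rule has_integral_eq[rotated], rule has_integral_measure_unif_pair[OF P.prob_space_axioms T]) (use sec in auto)
  have kpos: "0 \<le> k u u" if "u \<le> 1" for u
  proof -
    have "k u u = measure (N \<Otimes>\<^sub>M N)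
       {\<omega> \<in> space (N \<Otimes>\<^sub>M N). min (fst (fst \<omega>)) (fst (snd \<omega>)) \<le> u \<and> u < min (snd (fst \<omega>)) (snd (snd \<omega>))}"
      using coupled_min(1)[OF N, of u u] that by simp
    then show ?thesis by simp
  qed
  \<comment> \<open>Any positive bound would do. On [3/4, 1] one has hat u \<ge> 2/3, so
    \<open>K u u\<close> lies between (\<gamma> - 1) / 3 and 1/2, and \<open>k u u\<close> is at
    least half of it, hence at least (\<gamma> - 1) / 6.\<close>
  define c where "c = (\<gamma> - 1) / 8"
  have low: "((\<lambda>u. if u \<in> {3/4..1::real} then c else 0) has_integral (c * (1/4))) {0..1}"
  proof -
    have "((\<lambda>u. c) has_integral (c * (1/4))) {3/4..1::real}"
      using has_integral_const_real[of c "3/4" 1] by simp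
    then show ?thesis by (subst has_integral_restrict) auto
  qed
  have kc: "(if u \<in> {3/4..1::real} then c else 0) \<le> k u u" if u: "u \<in> {0..1}" for u
  proof (cases "3/4 \<le> u")
    case True
    define d where "d = K u u"
    have h: "2/3 \<le> hat u" "hat u \<le> 1" using True u by (auto simp: hat_def field_simps)
    have d: "d = hat u * ((\<gamma> - 1) / 2)" using True by (simp add: d_def K_diag)
    have d1: "2/3 * ((\<gamma> - 1) / 2) \<le> d" unfolding d using h gam by (intro mult_right_mono) auto
    have d2: "d \<le> 1 * (1 / 2)" unfolding d using h gam by (intro mult_mono) auto
    have "1 \<le> 1 / u" using True u by (simp add: field_simps)
    then have "d * 1 \<le> d / u" using d1 gam mult_left_mono[of 1 "1/u" d] by simp
    then have "d - d * d \<le> k u u" by (simp add: k_def d_def[symmetric] power2_eq_square)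
    moreover have "d * d \<le> d * (1/2)" using d1 d2 gam by (intro mult_left_mono) auto
    ultimately have "d / 2 \<le> k u u" by simp
    then show ?thesis using d1 True u gam by (simp add: c_def)
  qed (use kpos u in auto)
  have "c * (1/4) \<le> measure (unif \<Otimes>\<^sub>M (N \<Otimes>\<^sub>M N)) ?T"
    by (rule has_integral_le[OF low I kc])
  then show ?thesis using gam by (simp add: c_def)
qed


section \<open>Construction of the coupled law\<close>

text \<open>The section at h has measure \<tau> (h / y), and G is, up to the factor \<gamma> / 2,
  the primitive of \<tau>. This is how the scaling function in \<open>K\<close> arises from a
  conditional probability.\<close>

lemma region_measure:
  assumes xy: "0 \<le> x" "x \<le> y" "y \<le> 1" "0 < y"
  shows "measure (unif \<Otimes>\<^sub>M unif) {p \<in> space (unif \<Otimes>\<^sub>M unif). 0 < fst p \<and> fst p \<le> x \<and> snd p < \<tau> (fst p / y)}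
    = 2 / \<gamma> * (y * G (x / y) - y)" (is "measure _ ?T = _")
proof -
  note [measurable] = meas
  have T: "?T \<in> sets (unif \<Otimes>\<^sub>M unif)" by measurable
  have sec: "measure unif (Pair h -` ?T) = (if 0 < h \<and> h \<le> x then \<tau> (h / y) else 0)" for h
  proof (cases "0 < h \<and> h \<le> x")
    case True
    then have t: "0 < \<tau> (h / y)" "\<tau> (h / y) \<le> 1" using tau(1)[of "h / y"] xy by auto
    have "Pair h -` ?T = {..<\<tau> (h / y)}" using True by (auto simp: space_pair_measure)
    then show ?thesis using True unif_lessThan(1)[of "\<tau> (h / y)"] t by (simp only: measure_def) simp
  next
    case False
    then have "Pair h -` ?T = {}" by auto
    show ?thesis unfolding \<open>Pair h -` ?T = {}\<close> using False by (simp only: if_False measure_empty)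
  qed
  have "((\<lambda>h. \<tau> (h / y)) has_integral (2 / \<gamma> * (y * G (x / y)) - 2 / \<gamma> * (y * G (0 / y)))) {0..x}"
  proof (rule fundamental_theorem_of_calculus_interior)
    show "continuous_on {0..x} (\<lambda>h. 2 / \<gamma> * (y * G (h / y)))"
      by (intro continuous_intros continuous_on_compose2[OF G_cont]) (use xy in auto)
    fix h assume h: "h \<in> {0<..<x}"
    have "((\<lambda>h. h / y) has_real_derivative (1 / y)) (at h)" by (rule DERIV_cdivide) simp
    from DERIV_chain2[OF G_der this] have "((\<lambda>h. G (h / y)) has_real_derivative (\<gamma> / 2 * \<tau> (h / y) * (1 / y))) (at h)"
      using h xy by simp
    then have "((\<lambda>h. 2 / \<gamma> * (y * G (h / y))) has_real_derivative (2 / \<gamma> * (y * (\<gamma> / 2 * \<tau> (h / y) * (1 / y))))) (at h)"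
      by (intro DERIV_cmult)
    moreover have "2 / \<gamma> * (y * (\<gamma> / 2 * \<tau> (h / y) * (1 / y))) = \<tau> (h / y)" using gam xy by simp
    ultimately show "((\<lambda>h. 2 / \<gamma> * (y * G (h / y))) has_vector_derivative (\<tau> (h / y))) (at h)"
      by (simp only: has_real_derivative_iff_has_vector_derivative)
  qed (use xy in auto)
  then have "((\<lambda>h. if 0 < h \<and> h \<le> x then \<tau> (h / y) else 0) has_integral
      (2 / \<gamma> * (y * G (x / y)) - 2 / \<gamma> * (y * G (0 / y)))) {0..x}"
    by (rule has_integral_spike_finite[of "{0}", rotated 2]) auto
  note A = this
  have B: "((\<lambda>h. if 0 < h \<and> h \<le> x then \<tau> (h / y) else 0) has_integral 0) {x..1}"
    by (rule has_integral_spike_finite[of "{x}" _ _ "\<lambda>_. 0"]) auto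
  have "((\<lambda>h. if 0 < h \<and> h \<le> x then \<tau> (h / y) else 0) has_integral
      (2 / \<gamma> * (y * G (x / y)) - 2 / \<gamma> * (y * G (0 / y)) + 0)) {0..1}"
    by (rule has_integral_combine[OF _ _ A B]) (use xy in auto)
  moreover have "((\<lambda>h. if 0 < h \<and> h \<le> x then \<tau> (h / y) else 0) has_integral measure (unif \<Otimes>\<^sub>M unif) ?T) {0..1}"
    using has_integral_measure_unif_pair[OF prob_space_unif T] by (simp only: sec)
  ultimately have "measure (unif \<Otimes>\<^sub>M unif) ?T = 2 / \<gamma> * (y * G (x / y)) - 2 / \<gamma> * (y * G (0 / y)) + 0"
    using has_integral_unique by blast
  then show ?thesis by (simp add: G0 algebra_simps)
qed

text \<open>Homogeneity of \<open>K\<close> suggests the construction: the ratio of the two times in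
  the coordinate \<open>hat\<close> is \<phi> w, independent of the smaller one, and what overshoots
  1 is sent to 2. The remaining mass 1 - \<gamma> / 2 at (2, 2) is positive because \<gamma> <
  2.\<close>

lemma coupled_exists: "\<exists>N. coupled N"
proof -
  note [measurable] = meas
  define a where "a = (\<lambda>p::real \<times> real. 1 / (2 - fst p))"
  define b where "b = (\<lambda>p. if fst p * \<phi> (snd p) \<le> 1 then 1 / (2 - fst p * \<phi> (snd p)) else 2)"
  define pr where "pr = (\<lambda>q. if fst q < \<gamma> / 4 then (a (snd q), b (snd q))
      else if fst q < \<gamma> / 2 then (b (snd q), a (snd q)) else (2, 2))"
  let ?U = "unif \<Otimes>\<^sub>M unif"
  interpret U: prob_space unif by (rule prob_space_unif)
  interpret P: pair_prob_space unif unif ..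
  interpret Q: pair_prob_space unif ?U ..
  have am [measurable]: "a \<in> borel_measurable ?U" unfolding a_def by measurable
  have bm [measurable]: "b \<in> borel_measurable ?U" unfolding b_def by measurable
  have bp: "(borel :: (real \<times> real) measure) = borel \<Otimes>\<^sub>M borel" by (simp only: borel_prod)
  have pm [measurable]: "pr \<in> measurable (unif \<Otimes>\<^sub>M ?U) (borel \<Otimes>\<^sub>M borel)"
    unfolding pr_def by measurable
  have ae: "AE p in ?U. 0 < fst p \<and> fst p < 1 \<and> 0 < snd p \<and> snd p < 1"
  proof (rule P.AE_pair_measure)
    show "{p \<in> space ?U. 0 < fst p \<and> fst p < 1 \<and> 0 < snd p \<and> snd p < 1} \<in> sets ?U" by measurable
    show "AE x in unif. AE y in unif. 0 < fst (x, y) \<and> fst (x, y) < 1 \<and> 0 < snd (x, y) \<and> snd (x, y) < 1"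
      using AE_unif
    proof eventually_elim
      case (elim x)
      from AE_unif show ?case by eventually_elim (use elim in auto)
    qed
  qed
  define L where "L = distr (unif \<Otimes>\<^sub>M ?U) borel pr"
  have c1: "measure unif {..<\<gamma> / 4} = \<gamma> / 4" using unif_lessThan(1)[of "\<gamma> / 4"] gam by (simp add: measure_def)
  have c2: "measure unif {\<gamma> / 4..<\<gamma> / 2} = \<gamma> / 4"
  proof -
    have "measure unif ({..<\<gamma> / 2} - {..<\<gamma> / 4}) = measure unif {..<\<gamma> / 2} - measure unif {..<\<gamma> / 4}"
      using gam by (intro U.finite_measure_Diff) auto
    also have "measure unif {..<\<gamma> / 2} = \<gamma> / 2" using unif_lessThan(1)[of "\<gamma> / 2"] gam by (simp add: measure_def)
    finally show ?thesis using c1 by (simp add: ivl_disj_un lessThan_minus_lessThan)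
  qed
  have Lm: "measure L {z. R z} = \<gamma> / 4 * measure ?U {p \<in> space ?U. R (a p, b p)} +
      \<gamma> / 4 * measure ?U {p \<in> space ?U. R (b p, a p)}"
    if R [measurable]: "{z \<in> space (borel \<Otimes>\<^sub>M borel). R z} \<in> sets (borel \<Otimes>\<^sub>M borel)" and "\<not> R (2, 2)"
    for R :: "real \<times> real \<Rightarrow> bool"
  proof -
    have R': "{z. R z} \<in> sets (borel \<Otimes>\<^sub>M borel)" using R by (simp add: space_pair_measure)
    have ab: "(\<lambda>p. (a p, b p)) \<in> measurable ?U (borel \<Otimes>\<^sub>M borel)" "(\<lambda>p. (b p, a p)) \<in> measurable ?U (borel \<Otimes>\<^sub>M borel)"
      by measurable
    have A1: "{p \<in> space ?U. R (a p, b p)} \<in> sets ?U" using measurable_sets[OF ab(1) R']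
      by (simp add: vimage_def Int_def conj_commute)
    have A2: "{p \<in> space ?U. R (b p, a p)} \<in> sets ?U" using measurable_sets[OF ab(2) R']
      by (simp add: vimage_def Int_def conj_commute)
    have "measure L {z. R z} = measure (unif \<Otimes>\<^sub>M ?U) (pr -` {z. R z} \<inter> space (unif \<Otimes>\<^sub>M ?U))"
      unfolding L_def bp using pm R' by (rule measure_distr)
    also have "pr -` {z. R z} \<inter> space (unif \<Otimes>\<^sub>M ?U) =
        {..<\<gamma> / 4} \<times> {p \<in> space ?U. R (a p, b p)} \<union> {\<gamma> / 4..<\<gamma> / 2} \<times> {p \<in> space ?U. R (b p, a p)}"
      using \<open>\<not> R (2, 2)\<close> gam by (auto simp: pr_def space_pair_measure split: if_splits)
    also have "measure (unif \<Otimes>\<^sub>M ?U) \<dots> = measure (unif \<Otimes>\<^sub>M ?U) ({..<\<gamma> / 4} \<times> {p \<in> space ?U. R (a p, b p)})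
       + measure (unif \<Otimes>\<^sub>M ?U) ({\<gamma> / 4..<\<gamma> / 2} \<times> {p \<in> space ?U. R (b p, a p)})"
      using A1 A2 by (intro Q.finite_measure_Union) auto
    finally show ?thesis
      using A1 A2 by (simp add: measure_Times_pair U.prob_space_axioms P.prob_space_axioms c1 c2)
  qed
  have a_le: "a p \<le> x \<longleftrightarrow> fst p \<le> hat x" if "0 < fst p" "fst p < 1" "0 < x" for p x
    using that by (simp add: a_def hat_def field_simps)
  have b_le: "b p \<le> x \<longleftrightarrow> fst p * \<phi> (snd p) \<le> hat x"
    if "0 < fst p" "fst p < 1" "0 < x" "x \<le> 1" for p x
  proof -
    have "hat x \<le> 1" using that by (simp add: hat_def field_simps)
    show ?thesis
    proof (cases "fst p * \<phi> (snd p) \<le> 1")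
      case True
      then show ?thesis using that by (simp add: b_def hat_def field_simps)
    next
      case False
      with \<open>hat x \<le> 1\<close> that show ?thesis by (simp add: b_def)
    qed
  qed
  have b_phi: "b p \<le> x \<longleftrightarrow> \<not> (snd p < \<tau> (fst p / hat x))"
    if "0 < fst p" "fst p < 1" "0 < snd p" "snd p < 1" "1/2 < x" "x \<le> 1" "fst p \<le> hat x" for p x
  proof -
    have h: "0 < hat x" using that by (intro hat_pos) auto
    have "1 < fst p / hat x * \<phi> (snd p) \<longleftrightarrow> snd p < \<tau> (fst p / hat x)"
      using that h by (intro phi) auto
    then show ?thesis using b_le[of p x] that h by (auto simp: field_simps)
  qed
  \<comment> \<open>Since \<tau> 1 = 1, the ratio \<phi> w exceeds 1 for w in (0, 1). So
    \<open>a\<close> is always the earlier time, and the mixed events in the other order are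
    null.\<close>
  have b_gt: "b p \<le> x \<Longrightarrow> a p < x" if "0 < fst p" "fst p < 1" "0 < snd p" "snd p < 1" "0 < x" "x \<le> 1" for p x
  proof -
    assume bx: "b p \<le> x"
    have "1 < \<phi> (snd p)" using phi[of "snd p" 1] tau(2) that by simp
    then have "fst p < fst p * \<phi> (snd p)" using that by simp
    also have "\<dots> \<le> hat x" using b_le[of p x] bx that by blast
    finally have "fst p < hat x" .
    then show "a p < x" using that by (simp add: a_def hat_def field_simps)
  qed
  have a_gt: "1/2 < a p \<and> a p < 1" if "0 < fst p" "fst p < 1" for p
    using that by (simp add: a_def field_simps)
  have b_12: "1 < b p \<Longrightarrow> b p = 2" if "0 < fst p" "fst p < 1" for p
    using that by (auto simp: b_def field_simps split: if_splits)
  have Ma: "measure ?U {p \<in> space ?U. a p \<le> x} = hat x" if x: "1/2 \<le> x" "x \<le> 1" for x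
  proof -
    have "measure ?U {p \<in> space ?U. a p \<le> x} = measure ?U ({..hat x} \<times> space unif)"
    proof (rule P.finite_measure_eq_AE)
      show "AE p in ?U. (p \<in> {p \<in> space ?U. a p \<le> x}) = (p \<in> {..hat x} \<times> space unif)"
        using ae
      proof eventually_elim
        case (elim p)
        then show ?case using a_le[of p x] x by (cases p) (auto simp: space_pair_measure)
      qed
      show "{p \<in> space ?U. a p \<le> x} \<in> sets ?U" by measurable
      show "{..hat x} \<times> space unif \<in> sets ?U" by (intro pair_measureI) auto
    qed
    also have "\<dots> = hat x"
      using unif_lessThan(2)[of "hat x"] hat_bounds[OF x] U.prob_space
      by (subst measure_Times_pair) (auto simp: U.prob_space_axioms measure_def)
    finally show ?thesis .
  qed
  have Mab: "measure ?U {p \<in> space ?U. a p \<le> x \<and> y < b p} = 4 / \<gamma> * K x y" if x: "1/2 \<le> x" "x \<le> y" "y \<le> 1" for x y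
  proof (cases "y = 1/2")
    case True
    then have "x = 1/2" using x by simp
    have "measure ?U {p \<in> space ?U. a p \<le> x \<and> y < b p} = measure ?U {}"
    proof (rule P.finite_measure_eq_AE)
      show "AE p in ?U. (p \<in> {p \<in> space ?U. a p \<le> x \<and> y < b p}) = (p \<in> {})"
        using ae by eventually_elim (use a_gt \<open>x = 1/2\<close> in fastforce)
    qed measurable
    then show ?thesis unfolding \<open>x = 1/2\<close> K_half by simp
  next
    case False
    then have y: "1/2 < y" using x by simp
    have "measure ?U {p \<in> space ?U. a p \<le> x \<and> y < b p} =
       measure ?U {p \<in> space ?U. 0 < fst p \<and> fst p \<le> hat x \<and> snd p < \<tau> (fst p / hat y)}"
    proof (rule P.finite_measure_eq_AE)
      show "AE p in ?U. (p \<in> {p \<in> space ?U. a p \<le> x \<and> y < b p}) =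
         (p \<in> {p \<in> space ?U. 0 < fst p \<and> fst p \<le> hat x \<and> snd p < \<tau> (fst p / hat y)})"
        using ae
      proof eventually_elim
        case (elim p)
        then show ?case using a_le[of p x] b_phi[of p y] hat_mono[of x y] x y by auto
      qed
    qed measurable
    also have "\<dots> = 2 / \<gamma> * (hat y * G (hat x / hat y) - hat y)"
      using x y hat_bounds[of x] hat_bounds[of y] hat_mono[of x y] hat_pos[of y] by (intro region_measure) auto
    also have "hat y * G (hat x / hat y) - hat y = 2 * K x y" using x by (simp add: K_def)
    finally show ?thesis by simp
  qed
  have Mb: "measure ?U {p \<in> space ?U. b p \<le> x} = hat x - 4 / \<gamma> * K x x" if x: "1/2 \<le> x" "x \<le> 1" for x
  proof -
    have "measure ?U {p \<in> space ?U. b p \<le> x} = measure ?U ({p \<in> space ?U. a p \<le> x} - {p \<in> space ?U. a p \<le> x \<and> x < b p})"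
    proof (rule P.finite_measure_eq_AE)
      show "AE p in ?U. (p \<in> {p \<in> space ?U. b p \<le> x}) =
         (p \<in> {p \<in> space ?U. a p \<le> x} - {p \<in> space ?U. a p \<le> x \<and> x < b p})"
        using ae
      proof eventually_elim
        case (elim p)
        then have "b p \<le> x \<Longrightarrow> a p < x" using b_gt[of p x] x by simp
        then show ?case by auto
      qed
    qed measurable
    also have "\<dots> = measure ?U {p \<in> space ?U. a p \<le> x} - measure ?U {p \<in> space ?U. a p \<le> x \<and> x < b p}"
    proof (rule P.finite_measure_Diff)
      show "{p \<in> space ?U. a p \<le> x} \<in> sets ?U" "{p \<in> space ?U. a p \<le> x \<and> x < b p} \<in> sets ?U" by measurable
    qed auto
    finally show ?thesis using x by (simp add: Ma Mab)
  qed
  have Mba: "measure ?U {p \<in> space ?U. b p \<le> x \<and> y < a p} = 0" if x: "1/2 \<le> x" "x \<le> y" "y \<le> 1" for x y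
  proof -
    have "measure ?U {p \<in> space ?U. b p \<le> x \<and> y < a p} = measure ?U {}"
    proof (rule P.finite_measure_eq_AE)
      show "AE p in ?U. (p \<in> {p \<in> space ?U. b p \<le> x \<and> y < a p}) = (p \<in> {})"
        using ae
      proof eventually_elim
        case (elim p)
        then have "b p \<le> y \<Longrightarrow> a p < y" using b_gt[of p y] x by simp
        then show ?case using x by auto
      qed
    qed measurable
    then show ?thesis by simp
  qed
  \<comment> \<open>On [1/2, 1] the two terms add up to \<gamma> / 2 * hat x - K x x, and K x x =
    (\<gamma> - 1) / 2 * hat x leaves hat x / 2.\<close>
  have sum: "\<gamma> / 4 * measure ?U {p \<in> space ?U. a p \<le> x} + \<gamma> / 4 * measure ?U {p \<in> space ?U. b p \<le> x} = time_cdf x"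
    if "x < 2" for x
  proof -
    have mid: "\<gamma> / 4 * measure ?U {p \<in> space ?U. a p \<le> x} + \<gamma> / 4 * measure ?U {p \<in> space ?U. b p \<le> x} = time_cdf x"
      if "1/2 \<le> x" "x \<le> 1" for x
      using that gam by (simp add: Ma Mb K_diag time_cdf_def hat_def field_simps)
    consider "x < 1/2" | "1/2 \<le> x" "x \<le> 1" | "1 < x" using that by linarith
    then show ?thesis
    proof cases
      case 1
      have "measure ?U {p \<in> space ?U. a p \<le> x} = measure ?U {}"
      proof (rule P.finite_measure_eq_AE)
        show "AE p in ?U. (p \<in> {p \<in> space ?U. a p \<le> x}) = (p \<in> {})"
          using ae by eventually_elim (use a_gt 1 in fastforce)
      qed measurable
      moreover have "measure ?U {p \<in> space ?U. b p \<le> x} = measure ?U {}"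
      proof (rule P.finite_measure_eq_AE)
        show "AE p in ?U. (p \<in> {p \<in> space ?U. b p \<le> x}) = (p \<in> {})"
          using ae
        proof eventually_elim
          case (elim p)
          then show ?case using b_gt[of p "1/2"] a_gt[of p] 1 by fastforce
        qed
      qed measurable
      ultimately show ?thesis using 1 by (simp add: time_cdf_def)
    next
      case 2 then show ?thesis by (rule mid)
    next
      case 3
      have "measure ?U {p \<in> space ?U. a p \<le> x} = measure ?U {p \<in> space ?U. a p \<le> 1}"
      proof (rule P.finite_measure_eq_AE)
        show "AE p in ?U. (p \<in> {p \<in> space ?U. a p \<le> x}) = (p \<in> {p \<in> space ?U. a p \<le> 1})"
          using ae by eventually_elim (use a_gt 3 in fastforce)
      qed measurable
      moreover have "measure ?U {p \<in> space ?U. b p \<le> x} = measure ?U {p \<in> space ?U. b p \<le> 1}"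
      proof (rule P.finite_measure_eq_AE)
        show "AE p in ?U. (p \<in> {p \<in> space ?U. b p \<le> x}) = (p \<in> {p \<in> space ?U. b p \<le> 1})"
          using ae by eventually_elim (use b_12 3 that in fastforce)
      qed measurable
      ultimately show ?thesis using mid[of 1] 3 that by (simp add: time_cdf_def)
    qed
  qed
  have top: "measure L {z. f z \<le> x} = 1" if "2 \<le> x" "f = fst \<or> f = snd" for f x
  proof -
    have S: "{q \<in> space (unif \<Otimes>\<^sub>M ?U). f (pr q) \<le> x} \<in> sets (unif \<Otimes>\<^sub>M ?U)"
      using that(2) by (elim disjE) (simp only:, measurable)+
    have "AE q in unif \<Otimes>\<^sub>M ?U. f (pr q) \<le> x"
    proof (rule Q.AE_pair_measure)
      show "{q \<in> space (unif \<Otimes>\<^sub>M ?U). f (pr q) \<le> x} \<in> sets (unif \<Otimes>\<^sub>M ?U)" by (rule S)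
      show "AE c in unif. AE p in ?U. f (pr (c, p)) \<le> x"
      proof (rule AE_I2)
        fix c
        show "AE p in ?U. f (pr (c, p)) \<le> x"
          using ae
        proof eventually_elim
          case (elim p)
          have "a p \<le> 2" "b p \<le> 2" using a_gt[of p] b_12[of p] elim by linarith+
          then show ?case using that by (auto simp: pr_def)
        qed
      qed
    qed
    then have "measure (unif \<Otimes>\<^sub>M ?U) {q \<in> space (unif \<Otimes>\<^sub>M ?U). f (pr q) \<le> x} = 1"
      using iffD2[OF Q.prob_Collect_eq_1[OF S]] by blast
    moreover have "measure L {z. f z \<le> x} = measure (unif \<Otimes>\<^sub>M ?U) (pr -` {z. f z \<le> x} \<inter> space (unif \<Otimes>\<^sub>M ?U))"
    proof -
      have "{z \<in> space (borel \<Otimes>\<^sub>M borel). f z \<le> x} \<in> sets (borel \<Otimes>\<^sub>M borel)"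
        using that(2) by (elim disjE) (simp only:, measurable)+
      then have "{z. f z \<le> x} \<in> sets (borel \<Otimes>\<^sub>M borel)" by (simp add: space_pair_measure)
      then show ?thesis unfolding L_def bp using pm by (intro measure_distr)
    qed
    moreover have "pr -` {z. f z \<le> x} \<inter> space (unif \<Otimes>\<^sub>M ?U) = {q \<in> space (unif \<Otimes>\<^sub>M ?U). f (pr q) \<le> x}" by auto
    ultimately show ?thesis by simp
  qed
  have "coupled L"
    unfolding coupled_def
  proof (intro conjI allI impI)
    show "prob_space L" unfolding L_def bp using pm by (rule Q.prob_space_distr)
    show "sets L = sets borel" by (simp add: L_def)
    fix x
    show "measure L {z. fst z \<le> x} = time_cdf x"
    proof (cases "x < 2")
      case True
      have "measure L {z. fst z \<le> x} = \<gamma> / 4 * measure ?U {p \<in> space ?U. fst (a p, b p) \<le> x} +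
        \<gamma> / 4 * measure ?U {p \<in> space ?U. fst (b p, a p) \<le> x}"
        by (rule Lm, measurable) (use True in simp)
      then show ?thesis using sum[OF True] by (simp only: fst_conv)
    next
      case False
      then show ?thesis using top[of x fst] by (simp add: time_cdf_def)
    qed
    show "measure L {z. snd z \<le> x} = time_cdf x"
    proof (cases "x < 2")
      case True
      have "measure L {z. snd z \<le> x} = \<gamma> / 4 * measure ?U {p \<in> space ?U. snd (a p, b p) \<le> x} +
        \<gamma> / 4 * measure ?U {p \<in> space ?U. snd (b p, a p) \<le> x}"
        by (rule Lm, measurable) (use True in simp)
      then show ?thesis using sum[OF True] by (simp only: snd_conv add.commute)
    next
      case False
      then show ?thesis using top[of x snd] by (simp add: time_cdf_def)
    qed
    fix y assume xy: "1/2 \<le> x" "x \<le> y" "y \<le> 1"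
    have "measure L {z. fst z \<le> x \<and> y < snd z} =
        \<gamma> / 4 * measure ?U {p \<in> space ?U. fst (a p, b p) \<le> x \<and> y < snd (a p, b p)} +
        \<gamma> / 4 * measure ?U {p \<in> space ?U. fst (b p, a p) \<le> x \<and> y < snd (b p, a p)}"
      by (rule Lm, measurable) (use xy in simp)
    then show "measure L {z. fst z \<le> x \<and> y < snd z} = K x y"
      using Mab[OF xy] Mba[OF xy] gam by (simp only: fst_conv snd_conv) simp
    have "measure L {z. snd z \<le> x \<and> y < fst z} =
        \<gamma> / 4 * measure ?U {p \<in> space ?U. snd (a p, b p) \<le> x \<and> y < fst (a p, b p)} +
        \<gamma> / 4 * measure ?U {p \<in> space ?U. snd (b p, a p) \<le> x \<and> y < fst (b p, a p)}"
      by (rule Lm, measurable) (use xy in simp)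
    then show "measure L {z. snd z \<le> x \<and> y < fst z} = K x y"
      using Mab[OF xy] Mba[OF xy] gam by (simp only: fst_conv snd_conv) simp
  qed
  then show ?thesis by blast
qed

end

theorem bivariate_fixed_point:
  obtains N :: "(real \<times> real) measure" where
    "prob_space N" "sets N = sets borel"
    "\<And>x. measure N {z. fst z \<le> x} = time_cdf x" "\<And>x. measure N {z. snd z \<le> x} = time_cdf x"
    "distr (unif \<Otimes>\<^sub>M (N \<Otimes>\<^sub>M N)) borel step_pair = N"
    "0 < measure (unif \<Otimes>\<^sub>M (N \<Otimes>\<^sub>M N)) {p \<in> space (unif \<Otimes>\<^sub>M (N \<Otimes>\<^sub>M N)).
     min (fst (fst (snd p))) (fst (snd (snd p))) \<le> fst p \<and> fst p < min (snd (fst (snd p))) (snd (snd (snd p)))}"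
proof -
  obtain \<gamma> \<phi> \<tau> G where "profile \<gamma> \<phi> \<tau> G"
    by (rule profile_exists) (unfold profile_def, blast)
  then interpret profile \<gamma> \<phi> \<tau> G .
  obtain N where "coupled N" using coupled_exists by blast
  with that[of N] coupled_fixed[of N] coupled_gap_pos[of N] show thesis
    by (auto simp: coupled_def)
qed

section \<open>Percolation on the binary tree\<close>

definition sub :: "bool \<Rightarrow> (bool list \<Rightarrow> 'a) \<Rightarrow> bool list \<Rightarrow> 'a" where
  "sub b z = (\<lambda>l. z (b # l))"

text \<open>A list of turns stands for the oriented edge that it leads to, carrying its label and
  its frozen state. The root edge, n = 0, is exempt, just as in the rule that defines frozen
  edges.\<close>

definition opn :: "(bool list \<Rightarrow> real \<times> bool) \<Rightarrow> real \<Rightarrow> bool" where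
  "opn z t \<longleftrightarrow> (\<exists>s::nat \<Rightarrow> bool. \<forall>n\<ge>1. fst (z (map s [0..<n])) \<le> t \<and> \<not> snd (z (map s [0..<n])))"

lemma konig_bool:
  assumes "\<And>n. \<exists>l::bool list. length l = n \<and> (\<forall>i\<le>n. P (take i l))"
  shows "\<exists>s. \<forall>n. P (map s [0..<n])"
proof -
  \<comment> \<open>Lists with good extensions of every length. If neither child of \<open>l\<close>
    had this property, an extension of \<open>l\<close> of length max n1 n2 would contradict one of
    the two failures.\<close>
  define ext where "ext = (\<lambda>l. \<forall>n\<ge>length l. \<exists>l'. length l' = n \<and> take (length l) l' = l \<and> (\<forall>i\<le>n. P (take i l')))"
  have ext0: "ext []" using assms by (simp add: ext_def)
  have ext_Suc: "\<exists>b. ext (l @ [b])" if "ext l" for l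
  proof (rule ccontr)
    assume "\<nexists>b. ext (l @ [b])"
    then have nF: "\<not> ext (l @ [False])" and nT: "\<not> ext (l @ [True])" by blast+
    have nx: "\<exists>n\<ge>length k. \<forall>m. length m = n \<longrightarrow> take (length k) m = k \<longrightarrow> (\<exists>i\<le>n. \<not> P (take i m))"
      if "\<not> ext k" for k using that unfolding ext_def by blast
    from nx[OF nF] obtain n1 where n1': "n1 \<ge> Suc (length l)"
      and n1: "\<And>l'. length l' = n1 \<Longrightarrow> take (Suc (length l)) l' = l @ [False] \<Longrightarrow> \<exists>i\<le>n1. \<not> P (take i l')"
      by (simp only: length_append_singleton) blast
    from nx[OF nT] obtain n2 where n2': "n2 \<ge> Suc (length l)"
      and n2: "\<And>l'. length l' = n2 \<Longrightarrow> take (Suc (length l)) l' = l @ [True] \<Longrightarrow> \<exists>i\<le>n2. \<not> P (take i l')"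
      by (simp only: length_append_singleton) blast
    note n = n1' n2'
    define n where "n = max n1 n2"
    obtain l' where l': "length l' = n" "take (length l) l' = l" "\<forall>i\<le>n. P (take i l')"
    proof -
      have "length l \<le> n" using n by (simp add: n_def)
      with \<open>ext l\<close> that show thesis unfolding ext_def by blast
    qed
    have lt: "length l < n" using n by (auto simp: n_def)
    have t: "take (Suc (length l)) l' = l @ [l' ! length l]"
      using take_Suc_conv_app_nth[of "length l" l'] l' lt by simp
    show False
    proof (cases "l' ! length l")
      case True
      have "take (Suc (length l)) (take n2 l') = l @ [True]" "length (take n2 l') = n2"
        using t True n l' by (auto simp: n_def min_absorb1)
      from n2[OF this(2,1)] obtain i where "i \<le> n2" "\<not> P (take i l')" by (auto simp: min_absorb1)
      then show False using l' by (simp add: n_def)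
    next
      case False
      have "take (Suc (length l)) (take n1 l') = l @ [False]" "length (take n1 l') = n1"
        using t False n l' by (auto simp: n_def min_absorb1)
      from n1[OF this(2,1)] obtain i where "i \<le> n1" "\<not> P (take i l')" by (auto simp: min_absorb1)
      then show False using l' by (simp add: n_def)
    qed
  qed
  define f where "f = rec_nat [] (\<lambda>_ l. l @ [SOME b. ext (l @ [b])])"
  define s where "s = (\<lambda>n. SOME b. ext (f n @ [b]))"
  have f: "f 0 = []" "f (Suc n) = f n @ [s n]" for n by (simp_all add: f_def s_def)
  have fs: "f n = map s [0..<n]" for n by (induction n) (simp_all add: f)
  have "ext (f n)" for n
  proof (induction n)
    case 0 then show ?case by (simp add: f ext0)
  next
    case (Suc n)
    then show ?case using someI_ex[OF ext_Suc[OF Suc]] by (simp add: f s_def)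
  qed
  then have "P (f n)" for n
  proof -
    have "ext (f n)" by fact
    then obtain l' where "length l' = length (f n)" "take (length (f n)) l' = f n" "\<forall>i\<le>length (f n). P (take i l')"
      unfolding ext_def by blast
    then show ?thesis by (metis le_refl)
  qed
  then show ?thesis by (auto simp: fs)
qed

text \<open>Compactness replaces the uncountable choice of an infinite path by a countable
  condition. Measurability of \<open>opn\<close> and its closedness in t both rest on this.\<close>

lemma opn_iff:
  "opn z t \<longleftrightarrow> (\<forall>n. \<exists>l. length l = n \<and> (\<forall>i\<in>{1..n}. fst (z (take i l)) \<le> t \<and> \<not> snd (z (take i l))))"
proof
  assume "opn z t"
  then obtain s where s: "\<And>n. n \<ge> 1 \<Longrightarrow> fst (z (map s [0..<n])) \<le> t \<and> \<not> snd (z (map s [0..<n]))"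
    unfolding opn_def by blast
  show "\<forall>n. \<exists>l. length l = n \<and> (\<forall>i\<in>{1..n}. fst (z (take i l)) \<le> t \<and> \<not> snd (z (take i l)))"
  proof
    fix n
    show "\<exists>l. length l = n \<and> (\<forall>i\<in>{1..n}. fst (z (take i l)) \<le> t \<and> \<not> snd (z (take i l)))"
      by (rule exI[of _ "map s [0..<n]"]) (use s in \<open>auto simp: take_map min_def\<close>)
  qed
next
  assume *: "\<forall>n. \<exists>l. length l = n \<and> (\<forall>i\<in>{1..n}. fst (z (take i l)) \<le> t \<and> \<not> snd (z (take i l)))"
  have "\<exists>s. \<forall>n. map s [0..<n] = [] \<or> fst (z (map s [0..<n])) \<le> t \<and> \<not> snd (z (map s [0..<n]))"
  proof (rule konig_bool)
    fix n
    obtain l where l: "length l = n" "\<forall>i\<in>{1..n}. fst (z (take i l)) \<le> t \<and> \<not> snd (z (take i l))"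
      using * by blast
    show "\<exists>l. length l = n \<and> (\<forall>i\<le>n. take i l = [] \<or> fst (z (take i l)) \<le> t \<and> \<not> snd (z (take i l)))"
    proof (intro exI[of _ l] conjI allI impI l(1))
      fix i assume "i \<le> n"
      then show "take i l = [] \<or> fst (z (take i l)) \<le> t \<and> \<not> snd (z (take i l))"
        using l by (cases "i = 0") auto
    qed
  qed
  then obtain s where s: "\<And>n. map s [0..<n] = [] \<or> fst (z (map s [0..<n])) \<le> t \<and> \<not> snd (z (map s [0..<n]))"
    by blast
  have "fst (z (map s [0..<n])) \<le> t \<and> \<not> snd (z (map s [0..<n]))" if "n \<ge> 1" for n
    using s[of n] that by simp
  then show "opn z t" unfolding opn_def by blast
qed

lemma opn_mono: "opn z s \<Longrightarrow> s \<le> t \<Longrightarrow> opn z t"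
  unfolding opn_def by (meson order_trans)

text \<open>Up to depth n only finitely many labels occur, so some t' > t has none of them in (t,
  t']. A path of length n that is open at t' is then open at t.\<close>

lemma opn_closed:
  assumes "\<And>t'. t < t' \<Longrightarrow> opn z t'"
  shows "opn z t"
  unfolding opn_iff
proof
  fix n
  define A where "A = {fst (z l) | l. length l \<le> n \<and> t < fst (z l)}"
  have "finite {l::bool list. length l \<le> n}"
    using finite_lists_length_le[of "UNIV :: bool set" n] by simp
  moreover have "A \<subseteq> (\<lambda>l. fst (z l)) ` {l. length l \<le> n}" by (auto simp: A_def)
  ultimately have fin: "finite A" using finite_surj by blast
  have "\<exists>t'>t. \<forall>x\<in>A. t' < x"
  proof (cases "A = {}")
    case True then show ?thesis by (intro exI[of _ "t + 1"]) auto
  next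
    case False
    have "t < Min A" using fin False by (auto simp: A_def)
    then obtain t' where "t < t'" "t' < Min A" using dense by blast
    then show ?thesis using fin by (intro exI[of _ t']) (auto simp: less_le_trans)
  qed
  then obtain t' where t': "t < t'" "\<And>x. x \<in> A \<Longrightarrow> t' < x" by blast
  obtain l where l: "length l = n" "\<forall>i\<in>{1..n}. fst (z (take i l)) \<le> t' \<and> \<not> snd (z (take i l))"
    using assms[OF t'(1)] unfolding opn_iff by blast
  have "fst (z (take i l)) \<le> t" if "i \<in> {1..n}" for i
  proof (rule ccontr)
    assume "\<not> ?thesis"
    then have "fst (z (take i l)) \<in> A" using that l by (auto simp: A_def)
    then show False using t'(2) l that by fastforce
  qed
  with l show "\<exists>l. length l = n \<and> (\<forall>i\<in>{1..n}. fst (z (take i l)) \<le> t \<and> \<not> snd (z (take i l)))" by blast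
qed

lemma opn_step:
  "opn z t \<longleftrightarrow> (\<exists>b. fst (sub b z []) \<le> t \<and> \<not> snd (sub b z []) \<and> opn (sub b z) t)"
proof
  assume "opn z t"
  then obtain s where s: "\<And>n. n \<ge> 1 \<Longrightarrow> fst (z (map s [0..<n])) \<le> t \<and> \<not> snd (z (map s [0..<n]))"
    unfolding opn_def by blast
  have m: "map s [0..<Suc n] = s 0 # map (\<lambda>i. s (Suc i)) [0..<n]" for n
    by (simp add: upt_conv_Cons map_Suc_upt[symmetric] del: upt_Suc)
  have "opn (sub (s 0) z) t"
    unfolding opn_def sub_def using s[of "Suc _"] by (intro exI[of _ "\<lambda>i. s (Suc i)"]) (simp add: m[symmetric] del: upt_Suc)
  then show "\<exists>b. fst (sub b z []) \<le> t \<and> \<not> snd (sub b z []) \<and> opn (sub b z) t"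
    using s[of 1] by (intro exI[of _ "s 0"]) (simp add: sub_def)
next
  assume "\<exists>b. fst (sub b z []) \<le> t \<and> \<not> snd (sub b z []) \<and> opn (sub b z) t"
  then obtain b s where b: "fst (z [b]) \<le> t" "\<not> snd (z [b])"
    and s: "\<And>n. n \<ge> 1 \<Longrightarrow> fst (z (b # map s [0..<n])) \<le> t \<and> \<not> snd (z (b # map s [0..<n]))"
    unfolding opn_def sub_def by blast
  have m: "map (case_nat b s) [0..<Suc n] = b # map s [0..<n]" for n
    by (simp add: upt_conv_Cons map_Suc_upt[symmetric] del: upt_Suc)
  show "opn z t"
    unfolding opn_def
  proof (intro exI[of _ "case_nat b s"] allI impI)
    fix n :: nat assume "n \<ge> 1"
    then obtain k where k: "n = Suc k" by (cases n) auto
    show "fst (z (map (case_nat b s) [0..<n])) \<le> t \<and> \<not> snd (z (map (case_nat b s) [0..<n]))"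
      unfolding k m using b s[of k] by (cases k) auto
  qed
qed

section \<open>Times at which vertices and edges join infinity\<close>

text \<open>By \<open>opn_closed\<close> the infimum is attained. The extra element 2 keeps the set
  nonempty and is the value when no path appears up to time 1.\<close>

definition branch_time :: "(bool list \<Rightarrow> real \<times> bool) \<Rightarrow> real" where
  "branch_time z = Inf (insert 2 {t \<in> {0..1}. opn z t})"

definition edge_time :: "(bool list \<Rightarrow> real \<times> bool) \<Rightarrow> real" where
  "edge_time z = freeze (fst (z [])) (branch_time z)"

lemma branch_time_le_iff:
  assumes "0 \<le> t" "t \<le> 1"
  shows "branch_time z \<le> t \<longleftrightarrow> opn z t"
proof
  let ?S = "insert 2 {t \<in> {0..1}. opn z t}"
  have bdd: "bdd_below ?S" by (rule bdd_belowI[of _ 0]) auto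
  assume "opn z t"
  then show "branch_time z \<le> t" unfolding branch_time_def using assms by (intro cInf_lower bdd) simp
next
  let ?S = "insert 2 {t \<in> {0..1}. opn z t}"
  assume le: "branch_time z \<le> t"
  show "opn z t"
  proof (rule opn_closed)
    fix t' assume "t < t'"
    then have "Inf ?S < min t' 2" using le assms unfolding branch_time_def by simp
    from cInf_lessD[OF _ this] obtain s where "s \<in> ?S" "s < min t' 2" by blast
    then have "opn z s" "s \<le> t'" by auto
    then show "opn z t'" by (rule opn_mono)
  qed
qed

lemma branch_time_cases: "0 \<le> branch_time z \<and> branch_time z \<le> 1 \<or> branch_time z = 2"
proof (cases "{t \<in> {0..1}. opn z t} = {}")
  case True
  show ?thesis unfolding branch_time_def True by simp
next
  case False
  then obtain t where t: "0 \<le> t" "t \<le> 1" "opn z t" by auto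
  then have "branch_time z \<le> t" by (simp add: branch_time_le_iff)
  moreover have "0 \<le> branch_time z" unfolding branch_time_def by (rule cInf_greatest) auto
  ultimately show ?thesis using t by simp
qed

lemma edge_time_cases: "0 \<le> edge_time z \<and> edge_time z \<le> 1 \<or> edge_time z = 2"
  using branch_time_cases[of z] by (auto simp: edge_time_def freeze_def)

text \<open>The freezing rule as a deterministic property of one configuration, required at every
  edge of the binary tree; the tree recursion for the times then holds without any
  probability.\<close>

definition legal :: "(bool list \<Rightarrow> real \<times> bool) \<Rightarrow> bool" where
  "legal z \<longleftrightarrow> (\<forall>l. 0 \<le> fst (z l) \<and> fst (z l) \<le> 1 \<and> (snd (z l) \<longleftrightarrow> opn (\<lambda>l'. z (l @ l')) (fst (z l))))"

lemma legal_sub: "legal z \<Longrightarrow> legal (sub b z)"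
proof -
  assume "legal z"
  then have "0 \<le> fst (z (b # l)) \<and> fst (z (b # l)) \<le> 1 \<and>
      (snd (z (b # l)) \<longleftrightarrow> opn (\<lambda>l'. z ((b # l) @ l')) (fst (z (b # l))))" for l
    unfolding legal_def by (rule spec)
  then show "legal (sub b z)" by (simp add: legal_def sub_def)
qed

lemma legal_root:
  assumes "legal z"
  shows "0 \<le> fst (z [])" "fst (z []) \<le> 1" "snd (z []) \<longleftrightarrow> branch_time z \<le> fst (z [])"
proof -
  have "0 \<le> fst (z [])" "fst (z []) \<le> 1" "snd (z []) \<longleftrightarrow> opn z (fst (z []))"
    using spec[OF assms[unfolded legal_def], of "[]"] by simp_all
  then show "0 \<le> fst (z [])" "fst (z []) \<le> 1" "snd (z []) \<longleftrightarrow> branch_time z \<le> fst (z [])"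
    by (simp_all add: branch_time_le_iff)
qed

text \<open>At a legal successor, being unfrozen means that its label is below its
  \<open>branch_time\<close>. So being open by t, unfrozen and joined to infinity by t is exactly
  \<open>edge_time\<close> \<le> t. Comparing at t in [0, 1] suffices, because both sides are in
  [0, 1] or equal to 2.\<close>

lemma branch_time_eq:
  assumes "legal z"
  shows "branch_time z = min (edge_time (sub False z)) (edge_time (sub True z))"
proof -
  have le: "edge_time z' \<le> t \<longleftrightarrow> fst (z' []) \<le> t \<and> \<not> snd (z' []) \<and> opn z' t"
    if "legal z'" "0 \<le> t" "t \<le> 1" for z' t
  proof -
    have "edge_time z' \<le> t \<longleftrightarrow> fst (z' []) < branch_time z' \<and> branch_time z' \<le> t"
      using that(3) by (simp add: edge_time_def freeze_def)
    also have "\<dots> \<longleftrightarrow> fst (z' []) \<le> t \<and> \<not> snd (z' []) \<and> opn z' t"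
      using legal_root(3)[OF that(1)] branch_time_le_iff[OF that(2,3), of z'] by linarith
    finally show ?thesis .
  qed
  define m where "m = min (edge_time (sub False z)) (edge_time (sub True z))"
  have iff: "branch_time z \<le> t \<longleftrightarrow> m \<le> t" if t: "0 \<le> t" "t \<le> 1" for t
  proof -
    have "branch_time z \<le> t \<longleftrightarrow> (\<exists>b. fst (sub b z []) \<le> t \<and> \<not> snd (sub b z []) \<and> opn (sub b z) t)"
      by (simp only: branch_time_le_iff[OF t] opn_step[of z t])
    also have "\<dots> \<longleftrightarrow> (\<exists>b. edge_time (sub b z) \<le> t)"
      by (simp only: le[OF legal_sub[OF assms] t])
    also have "\<dots> \<longleftrightarrow> m \<le> t" unfolding m_def by (simp only: ex_bool_eq min_le_iff_disj disj_commute)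
    finally show ?thesis .
  qed
  have m: "0 \<le> m \<and> m \<le> 1 \<or> m = 2"
    unfolding m_def using edge_time_cases[of "sub False z"] edge_time_cases[of "sub True z"] by linarith
  show ?thesis unfolding m_def[symmetric]
  proof (cases "m \<le> 1")
    case True
    with m have m01: "0 \<le> m" "m \<le> 1" by auto
    have "branch_time z \<le> m" using iff[OF m01] by simp
    with branch_time_cases[of z] True have "0 \<le> branch_time z" "branch_time z \<le> 1" by auto
    from iff[OF this] \<open>branch_time z \<le> m\<close> show "branch_time z = m" by simp
  next
    case False
    then have "\<not> branch_time z \<le> 1" using iff[of 1] by simp
    then show "branch_time z = m" using branch_time_cases[of z] m False by auto
  qed
qed

abbreviation trees :: "(bool list \<Rightarrow> real \<times> bool) measure" where
  "trees \<equiv> PiM UNIV (\<lambda>_. borel \<Otimes>\<^sub>M count_space UNIV)"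

lemma space_trees [simp]: "space trees = UNIV"
  by (simp add: space_PiM space_pair_measure)

lemma sub_measurable [measurable]: "sub b \<in> measurable trees trees"
  unfolding sub_def by (rule measurable_PiM_single') (auto simp: space_pair_measure)

lemma opn_measurable [measurable]: "Measurable.pred trees (\<lambda>z. opn z t)"
  unfolding opn_iff by measurable

lemma branch_time_measurable [measurable]: "branch_time \<in> borel_measurable trees"
proof (rule borel_measurableI_le)
  fix c :: real
  consider "c < 0" | "0 \<le> c" "c \<le> 1" | "1 < c" "c < 2" | "2 \<le> c" by linarith
  then show "{z \<in> space trees. branch_time z \<le> c} \<in> sets trees"
  proof cases
    case 1
    then have "\<not> branch_time z \<le> c" for z using branch_time_cases[of z] by linarith
    then have "{z \<in> space trees. branch_time z \<le> c} = {}" by blast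
    then show ?thesis by (simp only: sets.empty_sets)
  next
    case 2
    then show ?thesis by (simp only: branch_time_le_iff) measurable
  next
    case 3
    then have "branch_time z \<le> c \<longleftrightarrow> opn z 1" for z
      using branch_time_cases[of z] branch_time_le_iff[of 1 z] by auto
    then have "{z \<in> space trees. branch_time z \<le> c} = {z \<in> space trees. opn z 1}" by blast
    then show ?thesis by (simp only:) measurable
  next
    case 4
    then have "branch_time z \<le> c" for z using branch_time_cases[of z] by linarith
    then have "{z \<in> space trees. branch_time z \<le> c} = space trees" by blast
    then show ?thesis by (simp only: sets.top)
  qed
qed

lemma edge_time_measurable [measurable]: "edge_time \<in> borel_measurable trees"
  unfolding edge_time_def[abs_def] freeze_def by measurable

definition root_split :: "(bool list \<Rightarrow> real \<times> bool) \<Rightarrow>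
    real \<times> (bool list \<Rightarrow> real \<times> bool) \<times> (bool list \<Rightarrow> real \<times> bool)" where
  "root_split z = (fst (z []), sub False z, sub True z)"

lemma root_label_measurable [measurable]: "(\<lambda>z. fst (z l)) \<in> borel_measurable trees"
  by measurable

lemma root_split_measurable [measurable]:
  "root_split \<in> measurable trees (borel \<Otimes>\<^sub>M (trees \<Otimes>\<^sub>M trees))"
  unfolding root_split_def[abs_def] by measurable

abbreviation mins :: "(bool list \<Rightarrow> real \<times> bool) \<times> (bool list \<Rightarrow> real \<times> bool) \<Rightarrow> real" where
  "mins zz \<equiv> min (edge_time (fst zz)) (edge_time (snd zz))"

section \<open>The law of the time is forced\<close>

text \<open>The self-similarity of the configuration beyond an oriented edge: \<open>split\<close>
  says that the root label is uniform and independent of the two subtrees, which are independent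
  copies of the whole.\<close>

locale coded_percolation = prob_space Z for Z :: "(bool list \<Rightarrow> real \<times> bool) measure" +
  assumes sets_Z: "sets Z = sets trees"
    and split: "distr Z (borel \<Otimes>\<^sub>M (trees \<Otimes>\<^sub>M trees)) root_split = unif \<Otimes>\<^sub>M (Z \<Otimes>\<^sub>M Z)"
    and AE_legal: "AE z in Z. legal z"
begin

lemma space_Z [simp]: "space Z = UNIV"
  using sets_eq_imp_space_eq[OF sets_Z] by simp

lemma sets_Z' [measurable_cong]: "sets Z = sets trees" by (rule sets_Z)

sublocale ZZ: pair_prob_space Z Z ..

lemma prob_root_split:
  assumes A: "A \<in> sets borel" and B: "B \<in> sets (trees \<Otimes>\<^sub>M trees)"
  shows "prob {z. fst (z []) \<in> A \<and> (sub False z, sub True z) \<in> B} = measure unif A * measure (Z \<Otimes>\<^sub>M Z) B"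
proof -
  have sZ: "sets (Z \<Otimes>\<^sub>M Z) = sets (trees \<Otimes>\<^sub>M trees)" by (intro sets_pair_measure_cong sets_Z)
  have "measure (unif \<Otimes>\<^sub>M (Z \<Otimes>\<^sub>M Z)) (A \<times> B) = measure unif A * measure (Z \<Otimes>\<^sub>M Z) B"
    using A B by (intro measure_Times_pair prob_space_unif ZZ.prob_space_axioms) (auto simp: sZ)
  also have "measure (unif \<Otimes>\<^sub>M (Z \<Otimes>\<^sub>M Z)) (A \<times> B) = prob (root_split -` (A \<times> B) \<inter> space Z)"
    unfolding split[symmetric] using A B by (intro measure_distr) auto
  also have "root_split -` (A \<times> B) \<inter> space Z = {z. fst (z []) \<in> A \<and> (sub False z, sub True z) \<in> B}"
    by (auto simp: root_split_def)
  finally show ?thesis by simp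
qed

lemma prob_root_sub:
  assumes B: "B \<in> sets (trees \<Otimes>\<^sub>M trees)"
  shows "prob {z. (sub False z, sub True z) \<in> B} = measure (Z \<Otimes>\<^sub>M Z) B"
  using prob_root_split[of UNIV B] B prob_space.prob_space[OF prob_space_unif] by simp

lemma sets_Collect_Z: "Measurable.pred trees P \<Longrightarrow> {z. P z} \<in> sets Z"
  using measurable_sets[of P trees "count_space UNIV" "{True}"] by (simp add: sets_Z vimage_def)

lemma sets_Collect_ZZ: "Measurable.pred (trees \<Otimes>\<^sub>M trees) P \<Longrightarrow> {z. P z} \<in> sets (trees \<Otimes>\<^sub>M trees)"
  using measurable_sets[of P "trees \<Otimes>\<^sub>M trees" "count_space UNIV" "{True}"]
  by (simp add: space_pair_measure vimage_def)

lemma prob_Times: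
  assumes "A \<in> sets Z" "B \<in> sets Z"
  shows "measure (Z \<Otimes>\<^sub>M Z) (A \<times> B) = prob A * prob B"
  using assms by (intro measure_Times_pair prob_space_axioms)

definition surv :: "real \<Rightarrow> real" where
  "surv t = prob {z. t < edge_time z}"

lemma prob_unif_le: "0 \<le> t \<Longrightarrow> t \<le> 1 \<Longrightarrow> measure unif {..t} = t"
  using unif_lessThan(2)[of t] by (simp add: measure_def)

lemma prob_unif_less: "0 \<le> t \<Longrightarrow> t \<le> 1 \<Longrightarrow> measure unif {..<t} = t"
  using unif_lessThan(1)[of t] by (simp add: measure_def)

lemma AE_edge_time:
  "AE z in Z. edge_time z = freeze (fst (z [])) (min (edge_time (sub False z)) (edge_time (sub True z)))"
  using AE_legal by eventually_elim (simp only: edge_time_def branch_time_eq)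

lemma prob_mins_greater: "measure (Z \<Otimes>\<^sub>M Z) {zz. t < mins zz} = (surv t)\<^sup>2"
proof -
  have "{zz. t < mins zz} = {z. t < edge_time z} \<times> {z. t < edge_time z}" by auto
  moreover have "{z. t < edge_time z} \<in> sets Z" by (rule sets_Collect_Z) measurable
  ultimately show ?thesis by (simp only: prob_Times surv_def power2_eq_square)
qed

lemma prob_mins_between:
  assumes "s \<le> t"
  shows "measure (Z \<Otimes>\<^sub>M Z) {zz. s < mins zz \<and> mins zz \<le> t} = (surv s)\<^sup>2 - (surv t)\<^sup>2"
proof -
  have m: "{zz. t < mins zz} \<in> sets (Z \<Otimes>\<^sub>M Z)" for t
    using sets_Collect_ZZ[of "\<lambda>zz. t < mins zz"] sets_pair_measure_cong[OF sets_Z sets_Z] by simp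
  have "{zz. s < mins zz \<and> mins zz \<le> t} = {zz. s < mins zz} - {zz. t < mins zz}" by auto
  then show ?thesis
    using m assms by (simp only: prob_mins_greater[symmetric]) (intro ZZ.finite_measure_Diff; auto)
qed

lemma surv_between:
  assumes "s \<le> t"
  shows "prob {z. s < edge_time z \<and> edge_time z \<le> t} = surv s - surv t"
proof -
  have m: "{z. t < edge_time z} \<in> sets Z" for t by (rule sets_Collect_Z) measurable
  have "{z. s < edge_time z \<and> edge_time z \<le> t} = {z. s < edge_time z} - {z. t < edge_time z}" by auto
  then show ?thesis unfolding surv_def
    using m assms by (simp only:) (intro finite_measure_Diff; auto)
qed

lemma surv_antimono: "s \<le> t \<Longrightarrow> surv t \<le> surv s"
  using surv_between[of s t] measure_nonneg[of Z "{z. s < edge_time z \<and> edge_time z \<le> t}"] by simp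

text \<open>The time of an edge lies in (s, t] when the minimum over its successors does and exceeds
  the label. Bracketing this last condition by label < s and label \<le> t gives a differential
  equation in the form of two inequalities: where \<open>surv\<close> decreases, it must be about 1
  / (2 t).\<close>

lemma surv_increment:
  assumes "0 \<le> s" "s \<le> t" "t \<le> 1"
  shows "s * ((surv s)\<^sup>2 - (surv t)\<^sup>2) \<le> surv s - surv t"
    and "surv s - surv t \<le> t * ((surv s)\<^sup>2 - (surv t)\<^sup>2)"
proof -
  let ?B = "{zz. s < mins zz \<and> mins zz \<le> t}"
  have B: "?B \<in> sets (trees \<Otimes>\<^sub>M trees)" by (rule sets_Collect_ZZ) measurable
  have m: "{z. s < edge_time z \<and> edge_time z \<le> t} \<in> sets Z" by (rule sets_Collect_Z) measurable
  have m1: "{z. fst (z []) \<in> A \<and> (sub False z, sub True z) \<in> ?B} \<in> sets Z" if [measurable]: "A \<in> sets borel" for A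
    by (rule sets_Collect_Z) measurable
  have "prob {z. fst (z []) \<in> {..<s} \<and> (sub False z, sub True z) \<in> ?B} = measure unif {..<s} * measure (Z \<Otimes>\<^sub>M Z) ?B"
    by (rule prob_root_split[OF _ B]) simp
  then have "s * ((surv s)\<^sup>2 - (surv t)\<^sup>2) = prob {z. fst (z []) \<in> {..<s} \<and> (sub False z, sub True z) \<in> ?B}"
    using prob_mins_between[OF assms(2)] prob_unif_less[of s] assms by (simp only: order_trans[OF assms(2,3)])
  also have "\<dots> \<le> prob {z. s < edge_time z \<and> edge_time z \<le> t}"
  proof (rule finite_measure_mono_AE[OF _ m])
    show "AE z in Z. z \<in> {z. fst (z []) \<in> {..<s} \<and> (sub False z, sub True z) \<in> ?B} \<longrightarrow>
        z \<in> {z. s < edge_time z \<and> edge_time z \<le> t}"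
      using AE_edge_time by eventually_elim (auto simp: freeze_def)
  qed
  finally show "s * ((surv s)\<^sup>2 - (surv t)\<^sup>2) \<le> surv s - surv t" using assms by (simp add: surv_between)
  have "surv s - surv t = prob {z. s < edge_time z \<and> edge_time z \<le> t}" using assms by (simp add: surv_between)
  also have "\<dots> \<le> prob {z. fst (z []) \<in> {..t} \<and> (sub False z, sub True z) \<in> ?B}"
  proof (rule finite_measure_mono_AE)
    show "AE z in Z. z \<in> {z. s < edge_time z \<and> edge_time z \<le> t} \<longrightarrow>
        z \<in> {z. fst (z []) \<in> {..t} \<and> (sub False z, sub True z) \<in> ?B}"
      using AE_edge_time by eventually_elim (use assms in \<open>auto simp: freeze_def split: if_splits\<close>)
  qed (rule m1, simp)
  also have "\<dots> = measure unif {..t} * measure (Z \<Otimes>\<^sub>M Z) ?B"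
    by (rule prob_root_split[OF _ B]) simp
  also have "\<dots> = t * ((surv s)\<^sup>2 - (surv t)\<^sup>2)"
    using prob_mins_between[OF assms(2)] prob_unif_le[of t] assms by (simp only: order_trans[OF assms(1,2)])
  finally show "surv s - surv t \<le> t * ((surv s)\<^sup>2 - (surv t)\<^sup>2)" .
qed

lemma surv_le_1: "surv t \<le> 1" by (simp add: surv_def)

lemma surv_0: "surv 0 = 1"
proof -
  have "prob {z. 0 < edge_time z} = prob (space Z)"
  proof (rule finite_measure_eq_AE)
    have "prob {z. fst (z []) \<in> {..0} \<and> (sub False z, sub True z) \<in> UNIV} = 0"
      using prob_root_split[of "{..0}" UNIV] prob_unif_le[of 0] sets.top[of "trees \<Otimes>\<^sub>M trees"]
      by (simp add: space_pair_measure)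
    then have "AE z in Z. \<not> fst (z []) \<le> 0"
      by (subst (asm) prob_eq_0) (auto intro!: sets_Collect_Z)
    then show "AE z in Z. (z \<in> {z. 0 < edge_time z}) = (z \<in> space Z)"
      by eventually_elim (auto simp: edge_time_def freeze_def)
    show "{z. 0 < edge_time z} \<in> sets Z" by (rule sets_Collect_Z) measurable
  qed (rule sets.top)
  then show ?thesis by (simp only: surv_def prob_space)
qed

end

text \<open>An open path of length \<open>n\<close> below a vertex, none of whose vertices is joined to infinity by time \<open>t\<close>;
  hence none of its edges is frozen.\<close>

primrec cluster :: "real \<Rightarrow> nat \<Rightarrow> (bool list \<Rightarrow> real \<times> bool) \<times> (bool list \<Rightarrow> real \<times> bool) \<Rightarrow> bool" where
  "cluster t 0 zz \<longleftrightarrow> t < mins zz"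
| "cluster t (Suc n) zz \<longleftrightarrow> t < mins zz \<and>
     (fst (fst zz []) \<le> t \<and> cluster t n (sub False (fst zz), sub True (fst zz)) \<or>
      fst (snd zz []) \<le> t \<and> cluster t n (sub False (snd zz), sub True (snd zz)))"

lemma cluster_measurable [measurable]: "Measurable.pred (trees \<Otimes>\<^sub>M trees) (cluster t n)"
proof (induction n)
  case 0
  have "Measurable.pred (trees \<Otimes>\<^sub>M trees) (\<lambda>zz. t < mins zz)" by measurable
  then show ?case by (simp only: cluster.simps)
next
  case (Suc n)
  note [measurable] = Suc
  have "Measurable.pred (trees \<Otimes>\<^sub>M trees) (\<lambda>zz. t < mins zz \<and>
     (fst (fst zz []) \<le> t \<and> cluster t n (sub False (fst zz), sub True (fst zz)) \<or>
      fst (snd zz []) \<le> t \<and> cluster t n (sub False (snd zz), sub True (snd zz))))"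
    by measurable
  then show ?case by (simp only: cluster.simps)
qed

lemma cluster_mins: "cluster t n zz \<Longrightarrow> t < mins zz"
  by (cases n) auto

lemma cluster_Suc: "cluster t (Suc n) zz \<Longrightarrow> cluster t n zz"
proof (induction n arbitrary: zz)
  case (Suc n)
  from Suc.prems Suc.IH[of "(sub False (fst zz), sub True (fst zz))"]
    Suc.IH[of "(sub False (snd zz), sub True (snd zz))"]
  show ?case by (simp only: cluster.simps(2)) blast
qed simp

lemma cluster_path:
  assumes "legal z" "cluster t n (sub False z, sub True z)"
  shows "\<exists>l. length l = n \<and> (\<forall>i\<in>{1..n}. fst (z (take i l)) \<le> t \<and> \<not> snd (z (take i l)))"
  using assms
proof (induction n arbitrary: z)
  case 0
  then show ?case by simp
next
  case (Suc n)
  from Suc.prems(2) have "\<exists>b. fst (sub b z []) \<le> t \<and> cluster t n (sub False (sub b z), sub True (sub b z))"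
    by (simp only: cluster.simps fst_conv snd_conv ex_bool_eq) blast
  then obtain b where b: "fst (sub b z []) \<le> t" "cluster t n (sub False (sub b z), sub True (sub b z))"
    by blast
  have leg: "legal (sub b z)" using Suc.prems(1) by (rule legal_sub)
  have "t < branch_time (sub b z)" using cluster_mins[OF b(2)] branch_time_eq[OF leg] by simp
  then have ns: "\<not> snd (sub b z [])" using legal_root(3)[OF leg] b(1) by linarith
  obtain l where l: "length l = n" "\<And>i. i \<in> {1..n} \<Longrightarrow> fst (sub b z (take i l)) \<le> t \<and> \<not> snd (sub b z (take i l))"
    using Suc.IH[OF leg b(2)] by blast
  show ?case
  proof (intro exI[of _ "b # l"] conjI ballI)
    fix i assume i: "i \<in> {1..Suc n}"
    have tk: "z (take i (b # l)) = sub b z (take (i - 1) l)" using i by (simp add: sub_def take_Cons')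
    have "fst (sub b z (take (i - 1) l)) \<le> t \<and> \<not> snd (sub b z (take (i - 1) l))"
    proof (cases "i = 1")
      case True
      then show ?thesis using b(1) ns by simp
    next
      case False
      then show ?thesis using i by (intro l(2)) auto
    qed
    then show "fst (z (take i (b # l))) \<le> t" "\<not> snd (z (take i (b # l)))" unfolding tk by blast+
  qed (simp add: l)
qed

text \<open>The survival recursion of a branching process with mean 2 t g. It reads 2 t g \<pi> -
  t^2 \<pi>^2, so for 2 t g > 1 small positive values increase and the sequence cannot tend to
  0.\<close>

lemma supercritical_recursion:
  fixes \<pi> :: "nat \<Rightarrow> real"
  assumes t: "0 < t" "t \<le> 1" and g: "g \<le> 1" and super: "1 < 2 * t * g"
    and p0: "\<pi> 0 = g\<^sup>2" and pS: "\<And>n. \<pi> (Suc n) = g\<^sup>2 - (g - t * \<pi> n)\<^sup>2"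
  shows "\<not> \<pi> \<longlonglongrightarrow> 0"
proof
  assume lim: "\<pi> \<longlonglongrightarrow> 0"
  have g0: "0 < g"
  proof (rule ccontr)
    assume "\<not> 0 < g"
    then have "t * g \<le> 0" using t by (simp add: mult_nonneg_nonpos)
    with super show False by simp
  qed
  have bd: "0 < \<pi> n \<and> \<pi> n \<le> g\<^sup>2" for n
  proof (induction n)
    case 0 then show ?case using g0 by (simp add: p0)
  next
    case (Suc n)
    have "t * \<pi> n \<le> 1 * g\<^sup>2" using Suc t by (intro mult_mono) auto
    also have "\<dots> \<le> g" using g g0 by (simp add: power2_eq_square)
    finally have "0 \<le> g - t * \<pi> n" by simp
    moreover have "g - t * \<pi> n < g" using Suc t by simp
    ultimately have "(g - t * \<pi> n)\<^sup>2 < g\<^sup>2" by (intro power_strict_mono) auto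
    then show ?case by (simp add: pS)
  qed
  have "eventually (\<lambda>n. \<pi> n < 2 * t * g - 1) sequentially"
    using order_tendstoD(2)[OF lim, of "2 * t * g - 1"] super by simp
  then obtain N where N: "\<And>n. n \<ge> N \<Longrightarrow> \<pi> n < 2 * t * g - 1" unfolding eventually_sequentially by blast
  have inc: "\<pi> n \<le> \<pi> (Suc n)" if "n \<ge> N" for n
  proof -
    have "t\<^sup>2 * \<pi> n \<le> 1 * \<pi> n" using t bd[of n] by (intro mult_right_mono power_le_one) auto
    then have "1 \<le> 2 * t * g - t\<^sup>2 * \<pi> n" using N[OF that] by simp
    then have "1 * \<pi> n \<le> (2 * t * g - t\<^sup>2 * \<pi> n) * \<pi> n" using bd[of n] by (intro mult_right_mono) auto
    also have "\<dots> = \<pi> (Suc n)" by (simp add: pS power2_eq_square algebra_simps)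
    finally show ?thesis by simp
  qed
  have "\<pi> N \<le> \<pi> n" if "n \<ge> N" for n
    using that by (induction n rule: dec_induct) (auto intro: order_trans inc)
  then have "\<pi> N \<le> 0" by (intro LIMSEQ_le_const[OF lim]) auto
  then show False using bd[of N] by simp
qed

context coded_percolation
begin

text \<open>If the mean exceeded 1, clusters of every depth would coexist with positive probability.
  By compactness they would contain an infinite open unfrozen path at time t, although the vertex is
  supposed to join infinity only after t.\<close>

lemma surv_upper:
  assumes t: "0 < t" "t \<le> 1"
  shows "2 * t * surv t \<le> 1"
proof (rule ccontr)
  assume "\<not> ?thesis"
  then have super: "1 < 2 * t * surv t" by simp
  define \<pi> where "\<pi> = (\<lambda>n. measure (Z \<Otimes>\<^sub>M Z) {zz. cluster t n zz})"
  define cl where "cl = (\<lambda>n z. fst (z []) \<le> t \<and> cluster t n (sub False z, sub True z))"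
  have C: "{zz. cluster t n zz} \<in> sets (trees \<Otimes>\<^sub>M trees)" for n by (rule sets_Collect_ZZ) measurable
  have clm [measurable]: "Measurable.pred trees (cl n)" for n unfolding cl_def by measurable
  have cls: "{z. cl n z} \<in> sets Z" for n by (rule sets_Collect_Z) measurable
  have cl_prob: "prob {z. cl n z} = t * \<pi> n" for n
  proof -
    have "prob {z. fst (z []) \<in> {..t} \<and> (sub False z, sub True z) \<in> {zz. cluster t n zz}} =
        measure unif {..t} * measure (Z \<Otimes>\<^sub>M Z) {zz. cluster t n zz}"
      by (rule prob_root_split[OF _ C]) simp
    then show ?thesis using prob_unif_le[of t] t by (simp only: cl_def \<pi>_def mem_Collect_eq atMost_iff less_imp_le)
  qed
  have nm: "{z. t < edge_time z} \<in> sets Z" "{z. t < edge_time z \<and> cl n z} \<in> sets Z"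
    "{z. t < edge_time z \<and> \<not> cl n z} \<in> sets Z" for n
    by (rule sets_Collect_Z; measurable)+
  have cl_edge: "prob {z. t < edge_time z \<and> cl n z} = t * \<pi> n" for n
    unfolding cl_prob[symmetric]
  proof (rule finite_measure_eq_AE)
    show "AE z in Z. (z \<in> {z. t < edge_time z \<and> cl n z}) = (z \<in> {z. cl n z})"
      using AE_edge_time
    proof eventually_elim
      case (elim z)
      have "t < edge_time z" if "cl n z"
      proof -
        have "t < mins (sub False z, sub True z)" "fst (z []) \<le> t"
          using that cluster_mins unfolding cl_def by blast+
        then show ?thesis unfolding elim by (simp add: freeze_def)
      qed
      then show ?case by auto
    qed
  qed (rule nm cls)+
  have ncl: "prob {z. t < edge_time z \<and> \<not> cl n z} = surv t - t * \<pi> n" for n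
  proof -
    have "{z. t < edge_time z \<and> \<not> cl n z} = {z. t < edge_time z} - {z. t < edge_time z \<and> cl n z}" by auto
    then show ?thesis
      unfolding cl_edge[symmetric] surv_def using nm by (simp only:) (intro finite_measure_Diff; auto)
  qed
  have p0: "\<pi> 0 = (surv t)\<^sup>2" unfolding \<pi>_def prob_mins_greater[symmetric] by (rule arg_cong[of _ _ "measure _"]) auto
  have pS: "\<pi> (Suc n) = (surv t)\<^sup>2 - (surv t - t * \<pi> n)\<^sup>2" for n
  proof -
    \<comment> \<open>One successor fails to carry a cluster of depth n although its time is above
      t. This has probability g - t * \<pi> n with g = surv t, since a successor that does carry one
      automatically has time above t.\<close>
    let ?N = "{z. t < edge_time z \<and> \<not> cl n z}"
    have "{zz. cluster t (Suc n) zz} = {zz. t < mins zz} - ?N \<times> ?N"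
    proof (rule set_eqI)
      fix zz :: "(bool list \<Rightarrow> real \<times> bool) \<times> (bool list \<Rightarrow> real \<times> bool)"
      have "zz \<in> ?N \<times> ?N \<longleftrightarrow> (t < edge_time (fst zz) \<and> \<not> cl n (fst zz)) \<and> (t < edge_time (snd zz) \<and> \<not> cl n (snd zz))"
        by (simp only: mem_Times_iff mem_Collect_eq)
      then show "zz \<in> {zz. cluster t (Suc n) zz} \<longleftrightarrow> zz \<in> {zz. t < mins zz} - ?N \<times> ?N"
        by (simp only: Diff_iff mem_Collect_eq cluster.simps(2) cl_def min_less_iff_conj) blast
    qed
    moreover have "measure (Z \<Otimes>\<^sub>M Z) ({zz. t < mins zz} - ?N \<times> ?N) =
       measure (Z \<Otimes>\<^sub>M Z) {zz. t < mins zz} - measure (Z \<Otimes>\<^sub>M Z) (?N \<times> ?N)"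
    proof (rule ZZ.finite_measure_Diff)
      show "{zz. t < mins zz} \<in> sets (Z \<Otimes>\<^sub>M Z)"
        using sets_Collect_ZZ[of "\<lambda>zz. t < mins zz"] sets_pair_measure_cong[OF sets_Z sets_Z] by simp
      show "?N \<times> ?N \<in> sets (Z \<Otimes>\<^sub>M Z)" using nm by (intro pair_measureI)
    qed auto
    ultimately show ?thesis
      by (simp only: \<pi>_def prob_mins_greater prob_Times[OF nm(3) nm(3)] ncl[unfolded \<pi>_def] power2_eq_square)
  qed
  define E where "E = (\<lambda>n. {z. cluster t n (sub False z, sub True z)})"
  have Em: "E n \<in> sets Z" for n unfolding E_def by (rule sets_Collect_Z) measurable
  have E_prob: "prob (E n) = \<pi> n" for n
    using prob_root_sub[OF C[of n]] by (simp only: E_def \<pi>_def mem_Collect_eq)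
  have "decseq E" by (rule decseq_SucI) (auto simp only: E_def mem_Collect_eq dest: cluster_Suc)
  then have "(\<lambda>n. prob (E n)) \<longlonglongrightarrow> prob (\<Inter>n. E n)"
    using Em by (intro finite_Lim_measure_decseq) auto
  moreover have "prob (\<Inter>n. E n) = 0"
  proof -
    have "AE z in Z. z \<notin> (\<Inter>n. E n)"
      using AE_legal
    proof eventually_elim
      case (elim z)
      show ?case
      proof
        assume "z \<in> (\<Inter>n. E n)"
        then have cz: "cluster t n (sub False z, sub True z)" for n by (auto simp: E_def)
        have "opn z t" unfolding opn_iff using cluster_path[OF elim cz] by blast
        then have "branch_time z \<le> t" using t branch_time_le_iff by simp
        moreover have "t < mins (sub False z, sub True z)" by (rule cluster_mins[OF cz[of 0]])
        ultimately show False unfolding branch_time_eq[OF elim] fst_conv snd_conv by (meson not_le)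
      qed
    qed
    moreover have "(\<Inter>n. E n) \<in> sets Z" using Em by auto
    ultimately show ?thesis by (subst prob_eq_0) auto
  qed
  ultimately have "\<pi> \<longlonglongrightarrow> 0" by (simp add: E_prob)
  then show False using supercritical_recursion[OF t surv_le_1 super p0 pS] by blast
qed

text \<open>The increment equation alone allows \<open>surv\<close> to be constant on intervals, so
  the upper bound 1 / (2 t) has to exclude this. If \<open>surv\<close> lay strictly below the bound
  at t, then at the start \<open>s0\<close> of its current level it would have decreased; there the
  increment equation and the bound just before \<open>s0\<close> give 1/2 \<le> s0 * surv t, which
  is at most t * surv t < 1/2.\<close>

lemma surv_eq:
  assumes t: "0 \<le> t" "t \<le> 1"
  shows "surv t = (if t < 1/2 then 1 else 1 / (2 * t))"
proof -
  have jump: "1 \<le> b * (surv a + surv b)" if "0 \<le> a" "a \<le> b" "b \<le> 1" "surv b < surv a" for a b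
  proof -
    have "(surv a - surv b) * 1 \<le> (surv a - surv b) * (b * (surv a + surv b))"
      using surv_increment(2)[OF that(1-3)] by (simp add: power2_eq_square algebra_simps)
    then show ?thesis using that(4) by (subst (asm) mult_le_cancel_left_pos) auto
  qed
  have low: "surv t = 1" if "0 \<le> t" "t < 1/2" for t
  proof (rule ccontr)
    assume "surv t \<noteq> 1"
    then have "surv t < surv 0" using surv_le_1[of t] by (simp add: surv_0)
    then have "1 \<le> t * (1 + surv t)" using jump[of 0 t] that by (simp add: surv_0)
    also have "\<dots> \<le> t * 2" using that surv_le_1[of t] by (intro mult_left_mono) auto
    finally show False using that by simp
  qed
  have up: "surv t \<le> 1 / (2 * t)" if "0 < t" "t \<le> 1" for t
    using surv_upper[OF that] that by (simp add: field_simps)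
  have "surv t = 1 / (2 * t)" if t: "1/2 \<le> t" "t \<le> 1" for t
  proof (rule ccontr)
    assume "surv t \<noteq> 1 / (2 * t)"
    with up[of t] t have lt: "surv t < 1 / (2 * t)" by simp
    define S where "S = {s \<in> {0..t}. surv s = surv t}"
    define s0 where "s0 = Inf S"
    have tS: "t \<in> S" using t by (simp add: S_def)
    have bdd: "bdd_below S" by (rule bdd_belowI[of _ 0]) (simp add: S_def)
    have s0t: "s0 \<le> t" unfolding s0_def using tS bdd by (rule cInf_lower)
    have half: "1/2 \<le> s" if "s \<in> S" for s
    proof (rule ccontr)
      assume "\<not> 1/2 \<le> s"
      then have "surv t = 1" using low[of s] that by (simp add: S_def)
      then show False using lt t by (simp add: field_simps)
    qed
    have s0h: "1/2 \<le> s0" unfolding s0_def using tS half by (intro cInf_greatest) auto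
    \<comment> \<open>\<open>surv\<close> differs at s0 - e from its value at a point of
      \<open>S\<close> below s0 + e, so \<open>jump\<close> applies to these two points; the left
      value is bounded by \<open>surv_upper\<close>. The limit e to 0 avoids any continuity
      assumption, and e < 1/4 keeps s0 - e positive.\<close>
    have key: "1 \<le> (s0 + e) * (1 / (2 * (s0 - e)) + surv t)" if e: "0 < e" "e < 1/4" for e
    proof -
      obtain s' where s': "s' \<in> S" "s' < s0 + e"
        using cInf_lessD[of S "s0 + e"] tS e unfolding s0_def by auto
      define s where "s = s0 - e"
      have s: "1/4 \<le> s" "s < s0" using s0h e by (auto simp: s_def)
      have "s \<notin> S" using cInf_lower[OF _ bdd, of s] s unfolding s0_def by linarith
      then have "surv s \<noteq> surv t" using s s0t by (auto simp: S_def)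
      moreover have "surv t \<le> surv s" using surv_antimono[of s t] s s0t by simp
      ultimately have less: "surv s' < surv s" using s' by (simp add: S_def)
      have s0s': "s0 \<le> s'" unfolding s0_def using s'(1) bdd by (rule cInf_lower)
      have "1 \<le> s' * (surv s + surv s')"
        using s s' s0s' t less by (intro jump) (auto simp: S_def)
      also have "surv s' = surv t" using s' by (simp add: S_def)
      also have "s' * (surv s + surv t) \<le> (s0 + e) * (1 / (2 * s) + surv t)"
        using s' s s0s' s0h s0t t up[of s] measure_nonneg[of Z]
        by (intro mult_mono add_mono) (auto simp: surv_def intro!: add_nonneg_nonneg)
      finally show ?thesis by (simp add: s_def)
    qed
    have "((\<lambda>e. (s0 + e) * (1 / (2 * (s0 - e)) + surv t)) \<longlongrightarrow> (s0 + 0) * (1 / (2 * (s0 - 0)) + surv t)) (at_right 0)"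
      using s0h by (intro tendsto_intros) auto
    moreover have "eventually (\<lambda>e. 1 \<le> (s0 + e) * (1 / (2 * (s0 - e)) + surv t)) (at_right 0)"
      unfolding eventually_at_right_field using key by (intro exI[of _ "1/4"]) auto
    ultimately have "1 \<le> (s0 + 0) * (1 / (2 * (s0 - 0)) + surv t)"
      by (rule tendsto_lowerbound) simp
    then have "1 \<le> s0 * (1 / (2 * s0)) + s0 * surv t" by (simp only: add_0_right diff_0_right distrib_left)
    then have "1/2 \<le> s0 * surv t" using s0h by simp
    also have "\<dots> \<le> t * surv t" using s0t by (intro mult_right_mono) (simp_all add: surv_def)
    also have "\<dots> < t * (1 / (2 * t))" using lt t by (intro mult_strict_left_mono) auto
    finally show False using t by simp
  qed
  with low t show ?thesis by simp
qed

lemma edge_time_cdf: "prob {z. edge_time z \<le> x} = time_cdf x"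
proof -
  have m: "{z. x < edge_time z} \<in> sets Z" for x by (rule sets_Collect_Z) measurable
  have "{z. edge_time z \<le> x} = space Z - {z. x < edge_time z}" by auto
  then have eq: "prob {z. edge_time z \<le> x} = 1 - surv x" for x
  proof -
    have "{z. edge_time z \<le> x} = space Z - {z. x < edge_time z}" by auto
    then show ?thesis unfolding surv_def using prob_compl[OF m[of x]] by (simp only:)
  qed
  consider "x < 0" | "0 \<le> x" "x \<le> 1" | "1 < x" "x < 2" | "2 \<le> x" by linarith
  then show ?thesis
  proof cases
    case 1
    then have "\<not> edge_time z \<le> x" for z using edge_time_cases[of z] by linarith
    then have "{z. edge_time z \<le> x} = {}" by blast
    then show ?thesis using 1 by (simp add: time_cdf_def)
  next
    case 2
    then show ?thesis by (simp add: eq surv_eq time_cdf_def)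
  next
    case 3
    then have "edge_time z \<le> x \<longleftrightarrow> edge_time z \<le> 1" for z using edge_time_cases[of z] by linarith
    then have "prob {z. edge_time z \<le> x} = prob {z. edge_time z \<le> 1}" by simp
    then show ?thesis using 3 by (simp add: eq surv_eq time_cdf_def)
  next
    case 4
    then have "edge_time z \<le> x" for z using edge_time_cases[of z] by linarith
    then have "{z. edge_time z \<le> x} = space Z" by simp
    then show ?thesis using 4 prob_space by (simp only:) (simp add: time_cdf_def)
  qed
qed

end

section \<open>Coupled copies over finitely many generations\<close>

abbreviation labs :: "(bool list \<Rightarrow> real) measure" where
  "labs \<equiv> PiM UNIV (\<lambda>_. borel)"

definition labels_of :: "(bool list \<Rightarrow> real \<times> bool) \<Rightarrow> bool list \<Rightarrow> real" where
  "labels_of z = (\<lambda>l. fst (z l))"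

text \<open>Deeper labels are overwritten by 0 and not dropped, so that all depths share the space
  \<open>labs\<close>.\<close>

definition cutoff :: "nat \<Rightarrow> (bool list \<Rightarrow> real) \<Rightarrow> bool list \<Rightarrow> real" where
  "cutoff n V = (\<lambda>l. if length l < n then V l else 0)"

definition graft :: "real \<Rightarrow> (bool list \<Rightarrow> real) \<Rightarrow> (bool list \<Rightarrow> real) \<Rightarrow> bool list \<Rightarrow> real" where
  "graft u V0 V1 l = (case l of [] \<Rightarrow> u | b # l' \<Rightarrow> if b then V1 l' else V0 l')"

lemma space_labs [simp]: "space labs = UNIV" by (simp add: space_PiM)

lemma labels_of_measurable [measurable]: "labels_of \<in> measurable trees labs"
  unfolding labels_of_def by (rule measurable_PiM_single') auto

lemma cutoff_measurable [measurable]: "cutoff n \<in> measurable labs labs"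
  unfolding cutoff_def by (rule measurable_PiM_single') auto

lemma graft_measurable [measurable]:
  assumes [measurable]: "f \<in> borel_measurable M" "g \<in> measurable M labs" "h \<in> measurable M labs"
  shows "(\<lambda>x. graft (f x) (g x) (h x)) \<in> measurable M labs"
proof (rule measurable_PiM_single')
  fix l :: "bool list"
  have "(\<lambda>x. g x l') \<in> borel_measurable M" "(\<lambda>x. h x l') \<in> borel_measurable M" for l'
    by measurable
  then show "(\<lambda>x. graft (f x) (g x) (h x) l) \<in> borel_measurable M"
    unfolding graft_def using assms(1) by (cases l) (simp_all split: if_splits)
qed simp

lemma cutoff_cutoff: "cutoff n (cutoff (Suc n) V) = cutoff n V"
  by (auto simp: cutoff_def fun_eq_iff)

lemma cutoff_graft:
  "cutoff (Suc n) (labels_of z) =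
     graft (fst (z [])) (cutoff n (labels_of (sub False z))) (cutoff n (labels_of (sub True z)))"
proof
  fix l
  show "cutoff (Suc n) (labels_of z) l =
     graft (fst (z [])) (cutoff n (labels_of (sub False z))) (cutoff n (labels_of (sub True z))) l"
    by (cases l) (auto simp: cutoff_def labels_of_def graft_def sub_def)
qed

definition map3 :: "('a \<Rightarrow> 'b) \<Rightarrow> real \<times> 'a \<times> 'a \<Rightarrow> real \<times> 'b \<times> 'b" where
  "map3 f = (\<lambda>(u, a, b). (u, f a, f b))"

lemma map3_measurable [measurable]:
  assumes [measurable]: "f \<in> measurable A B"
  shows "map3 f \<in> measurable (borel \<Otimes>\<^sub>M (A \<Otimes>\<^sub>M A)) (borel \<Otimes>\<^sub>M (B \<Otimes>\<^sub>M B))"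
  unfolding map3_def by measurable

lemma distr_map3:
  assumes "prob_space A" and f: "f \<in> measurable A B"
  shows "distr (unif \<Otimes>\<^sub>M (A \<Otimes>\<^sub>M A)) (borel \<Otimes>\<^sub>M (B \<Otimes>\<^sub>M B)) (map3 f) =
    unif \<Otimes>\<^sub>M (distr A B f \<Otimes>\<^sub>M distr A B f)"
proof -
  interpret A: prob_space A by fact
  interpret D: prob_space "distr A B f" using f by (rule A.prob_space_distr)
  interpret DD: pair_prob_space "distr A B f" "distr A B f" ..
  have m: "(\<lambda>(x, y). (f x, f y)) \<in> measurable (A \<Otimes>\<^sub>M A) (B \<Otimes>\<^sub>M B)"
    using f by measurable
  have e: "distr A B f \<Otimes>\<^sub>M distr A B f = distr (A \<Otimes>\<^sub>M A) (B \<Otimes>\<^sub>M B) (\<lambda>(x, y). (f x, f y))"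
    using f f D.sigma_finite_measure_axioms by (rule pair_measure_distr)
  have u: "distr unif borel (\<lambda>x. x) = unif" by (rule distr_id2) simp
  have "unif \<Otimes>\<^sub>M (distr A B f \<Otimes>\<^sub>M distr A B f) =
      distr unif borel (\<lambda>x. x) \<Otimes>\<^sub>M distr (A \<Otimes>\<^sub>M A) (B \<Otimes>\<^sub>M B) (\<lambda>(x, y). (f x, f y))"
    by (simp only: e u)
  also have "\<dots> = distr (unif \<Otimes>\<^sub>M (A \<Otimes>\<^sub>M A)) (borel \<Otimes>\<^sub>M (B \<Otimes>\<^sub>M B))
      (\<lambda>(x, y). (x, (case y of (x, y) \<Rightarrow> (f x, f y))))"
    by (rule pair_measure_distr[OF _ m]) (simp, simp only: e[symmetric] DD.sigma_finite_measure_axioms)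
  also have "(\<lambda>(x, y). (x, (case y of (x, y) \<Rightarrow> (f x, f y)))) = map3 f"
    by (auto simp: map3_def fun_eq_iff)
  finally show ?thesis by simp
qed

text \<open>One generation of the recursion with the labels recorded; \<open>join2\<close> below is
  its version for pairs, and either component of \<open>join2\<close> evolves by
  \<open>join\<close>.\<close>

definition join :: "real \<times> ((bool list \<Rightarrow> real) \<times> real) \<times> ((bool list \<Rightarrow> real) \<times> real) \<Rightarrow> (bool list \<Rightarrow> real) \<times> real" where
  "join = (\<lambda>(u, (V0, x0), (V1, x1)). (graft u V0 V1, freeze u (min x0 x1)))"

definition join2 :: "real \<times> ((bool list \<Rightarrow> real) \<times> real \<times> real) \<times> ((bool list \<Rightarrow> real) \<times> real \<times> real) \<Rightarrow>
    (bool list \<Rightarrow> real) \<times> real \<times> real" where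
  "join2 = (\<lambda>(u, (V0, z0), (V1, z1)). (graft u V0 V1, step_pair (u, z0, z1)))"

abbreviation "pairs \<equiv> (borel :: real measure) \<Otimes>\<^sub>M (borel :: real measure)"

lemma step_pair_measurable [measurable]: "step_pair \<in> measurable (borel \<Otimes>\<^sub>M (pairs \<Otimes>\<^sub>M pairs)) pairs"
  unfolding step_pair_def freeze_def by measurable

lemma join_measurable [measurable]:
  "join \<in> measurable (borel \<Otimes>\<^sub>M ((labs \<Otimes>\<^sub>M borel) \<Otimes>\<^sub>M (labs \<Otimes>\<^sub>M borel))) (labs \<Otimes>\<^sub>M borel)"
  unfolding join_def freeze_def split_beta by measurable

lemma join2_measurable [measurable]:
  "join2 \<in> measurable (borel \<Otimes>\<^sub>M ((labs \<Otimes>\<^sub>M pairs) \<Otimes>\<^sub>M (labs \<Otimes>\<^sub>M pairs))) (labs \<Otimes>\<^sub>M pairs)"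
  unfolding join2_def split_beta by measurable

text \<open>The first \<open>n\<close> generations of labels, with independent pairs of law \<open>N\<close> attached below them and
  propagated to the root; only the labels above the pairs are recorded.\<close>

primrec coupled_tree :: "(real \<times> real) measure \<Rightarrow> nat \<Rightarrow> ((bool list \<Rightarrow> real) \<times> real \<times> real) measure" where
  "coupled_tree N 0 = distr N (labs \<Otimes>\<^sub>M pairs) (\<lambda>z. (\<lambda>_. 0, z))"
| "coupled_tree N (Suc n) =
     distr (unif \<Otimes>\<^sub>M (coupled_tree N n \<Otimes>\<^sub>M coupled_tree N n)) (labs \<Otimes>\<^sub>M pairs) join2"

lemma sets_coupled_tree: "sets (coupled_tree N n) = sets (labs \<Otimes>\<^sub>M pairs)"
  by (cases n) simp_all

locale bivariate_law = prob_space N for N :: "(real \<times> real) measure" +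
  assumes sets_N: "sets N = sets pairs"
    and N_fst: "\<And>x. measure N {z. fst z \<le> x} = time_cdf x"
    and N_snd: "\<And>x. measure N {z. snd z \<le> x} = time_cdf x"
    and N_step: "distr (unif \<Otimes>\<^sub>M (N \<Otimes>\<^sub>M N)) pairs step_pair = N"
begin

lemma sets_unif_L: "sets (unif \<Otimes>\<^sub>M (coupled_tree N n \<Otimes>\<^sub>M coupled_tree N n)) =
    sets (borel \<Otimes>\<^sub>M ((labs \<Otimes>\<^sub>M pairs) \<Otimes>\<^sub>M (labs \<Otimes>\<^sub>M pairs)))"
  by (intro sets_pair_measure_cong sets_coupled_tree) simp

lemma const_measurable: "(\<lambda>z. (\<lambda>_. 0, z)) \<in> measurable N (labs \<Otimes>\<^sub>M pairs)"
proof (rule measurable_Pair)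
  show "(\<lambda>z. z) \<in> measurable N pairs" using sets_N by (simp add: measurable_ident_sets)
qed (rule measurable_const, simp)

lemma join2_L: "join2 \<in> measurable (unif \<Otimes>\<^sub>M (coupled_tree N n \<Otimes>\<^sub>M coupled_tree N n)) (labs \<Otimes>\<^sub>M pairs)"
  using join2_measurable by (simp only: measurable_cong_sets[OF sets_unif_L refl])

lemma prob_space_unif_pair: "prob_space A \<Longrightarrow> prob_space (unif \<Otimes>\<^sub>M (A \<Otimes>\<^sub>M A))"
  by (intro prob_space_pair prob_space_unif)

lemma prob_space_L: "prob_space (coupled_tree N n)"
proof (induction n)
  case 0
  show ?case by (simp add: prob_space_distr const_measurable)
next
  case (Suc n)
  show ?case unfolding coupled_tree.simps
    using prob_space.prob_space_distr[OF prob_space_unif_pair[OF Suc] join2_L] .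
qed

lemma measurable_L: "f \<in> measurable (labs \<Otimes>\<^sub>M pairs) M' \<Longrightarrow> f \<in> measurable (coupled_tree N n) M'"
  by (simp only: measurable_cong_sets[OF sets_coupled_tree refl])

text \<open>If an observable of the joined tree depends on the two subtrees only through
  \<open>f\<close>, its law follows from the law of \<open>f\<close> one generation earlier.\<close>

lemma distr_distr_L:
  assumes g: "g \<in> measurable (labs \<Otimes>\<^sub>M pairs) M'"
    and f: "f \<in> measurable (labs \<Otimes>\<^sub>M pairs) B" and h: "h \<in> measurable (borel \<Otimes>\<^sub>M (B \<Otimes>\<^sub>M B)) M'"
    and eq: "\<And>p. g (join2 p) = h (map3 f p)"
  shows "distr (coupled_tree N (Suc n)) M' g =
    distr (unif \<Otimes>\<^sub>M (distr (coupled_tree N n) B f \<Otimes>\<^sub>M distr (coupled_tree N n) B f)) M' h"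
proof -
  let ?P = "unif \<Otimes>\<^sub>M (coupled_tree N n \<Otimes>\<^sub>M coupled_tree N n)"
  have m: "map3 f \<in> measurable ?P (borel \<Otimes>\<^sub>M (B \<Otimes>\<^sub>M B))"
    using map3_measurable[OF f] by (simp only: measurable_cong_sets[OF sets_unif_L refl])
  have "distr (coupled_tree N (Suc n)) M' g = distr ?P M' (g \<circ> join2)"
    unfolding coupled_tree.simps by (rule distr_distr[OF g join2_L])
  also have "g \<circ> join2 = h \<circ> map3 f" by (auto simp: eq fun_eq_iff)
  also have "distr ?P M' (h \<circ> map3 f) = distr (distr ?P (borel \<Otimes>\<^sub>M (B \<Otimes>\<^sub>M B)) (map3 f)) M' h"
    by (rule distr_distr[OF h m, symmetric])
  also have "distr ?P (borel \<Otimes>\<^sub>M (B \<Otimes>\<^sub>M B)) (map3 f) =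
      unif \<Otimes>\<^sub>M (distr (coupled_tree N n) B f \<Otimes>\<^sub>M distr (coupled_tree N n) B f)"
    by (rule distr_map3[OF prob_space_L measurable_L[OF f]])
  finally show ?thesis .
qed

text \<open>Since N solves the bivariate equation, the pair that arrives at the root has law N
  whatever the depth. Hence the probability that the copies differ does not decay.\<close>

lemma L_times: "distr (coupled_tree N n) pairs snd = N"
proof (induction n)
  case 0
  have "distr (coupled_tree N 0) pairs snd = distr N pairs (snd \<circ> (\<lambda>z. (\<lambda>_::bool list. 0::real, z)))"
    unfolding coupled_tree.simps by (rule distr_distr[OF measurable_snd const_measurable])
  also have "\<dots> = distr N pairs (\<lambda>z. z)" by (simp add: comp_def)
  also have "\<dots> = N" by (rule distr_id2) (simp add: sets_N)
  finally show ?case .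
next
  case (Suc n)
  have "distr (coupled_tree N (Suc n)) pairs snd =
     distr (unif \<Otimes>\<^sub>M (distr (coupled_tree N n) pairs snd \<Otimes>\<^sub>M distr (coupled_tree N n) pairs snd)) pairs step_pair"
    by (rule distr_distr_L) (measurable, auto simp: join2_def map3_def)
  then show ?case by (simp only: Suc N_step)
qed

end

text \<open>On \<open>gap\<close> the edge is frozen in the first but not in the second component, so an event \<open>C\<close> of
  the labels must be wrong about one of them; \<open>bad C\<close> is the event that \<open>C\<close> is wrong.\<close>

definition gap :: "(real \<times> (real \<times> real) \<times> (real \<times> real)) set" where
  "gap = {(u, z0, z1). min (fst z0) (fst z1) \<le> u \<and> u < min (snd z0) (snd z1)}"

definition bad :: "(bool list \<Rightarrow> real) set \<Rightarrow>
    (real \<times> ((bool list \<Rightarrow> real) \<times> real) \<times> ((bool list \<Rightarrow> real) \<times> real)) set" where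
  "bad C = {(u, (V0, x0), (V1, x1)). (min x0 x1 \<le> u) \<noteq> (graft u V0 V1 \<in> C)}"

lemma gap_sets: "gap \<in> sets (borel \<Otimes>\<^sub>M (pairs \<Otimes>\<^sub>M pairs))"
proof -
  have "{p \<in> space (borel \<Otimes>\<^sub>M (pairs \<Otimes>\<^sub>M pairs)). min (fst (fst (snd p))) (fst (snd (snd p))) \<le> fst p \<and>
      fst p < min (snd (fst (snd p))) (snd (snd (snd p)))} \<in> sets (borel \<Otimes>\<^sub>M (pairs \<Otimes>\<^sub>M pairs))"
    by measurable
  also have "{p \<in> space (borel \<Otimes>\<^sub>M (pairs \<Otimes>\<^sub>M pairs)). min (fst (fst (snd p))) (fst (snd (snd p))) \<le> fst p \<and>
      fst p < min (snd (fst (snd p))) (snd (snd (snd p)))} = gap"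
    by (auto simp: gap_def space_pair_measure)
  finally show ?thesis .
qed

lemma bad_sets:
  assumes C: "C \<in> sets labs"
  shows "bad C \<in> sets (borel \<Otimes>\<^sub>M ((labs \<Otimes>\<^sub>M borel) \<Otimes>\<^sub>M (labs \<Otimes>\<^sub>M borel)))"
proof -
  have [measurable]: "Measurable.pred labs (\<lambda>V. V \<in> C)" using C by measurable
  let ?S = "borel \<Otimes>\<^sub>M ((labs \<Otimes>\<^sub>M borel) \<Otimes>\<^sub>M (labs \<Otimes>\<^sub>M borel)) ::
    (real \<times> ((bool list \<Rightarrow> real) \<times> real) \<times> ((bool list \<Rightarrow> real) \<times> real)) measure"
  have "{p \<in> space ?S. (min (snd (fst (snd p))) (snd (snd (snd p))) \<le> fst p) \<noteq>
      (graft (fst p) (fst (fst (snd p))) (fst (snd (snd p))) \<in> C)} \<in> sets ?S"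
    by measurable
  also have "{p \<in> space ?S. (min (snd (fst (snd p))) (snd (snd (snd p))) \<le> fst p) \<noteq>
      (graft (fst p) (fst (fst (snd p))) (fst (snd (snd p))) \<in> C)} = bad C"
    by (auto simp: bad_def space_pair_measure)
  finally show ?thesis .
qed

locale nonendogeny = coded_percolation Z + N: bivariate_law N
  for Z :: "(bool list \<Rightarrow> real \<times> bool) measure" and N :: "(real \<times> real) measure"
begin

definition proj :: "(real \<times> real \<Rightarrow> real) \<Rightarrow> (bool list \<Rightarrow> real) \<times> real \<times> real \<Rightarrow> (bool list \<Rightarrow> real) \<times> real" where
  "proj p = (\<lambda>(V, z). (V, p z))"

definition observe :: "nat \<Rightarrow> (bool list \<Rightarrow> real \<times> bool) \<Rightarrow> (bool list \<Rightarrow> real) \<times> real" where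
  "observe n z = (cutoff n (labels_of z), edge_time z)"

lemma observe_measurable [measurable]: "observe n \<in> measurable trees (labs \<Otimes>\<^sub>M borel)"
  unfolding observe_def[abs_def] by measurable

lemma proj_measurable [measurable]: "p = fst \<or> p = snd \<Longrightarrow> proj p \<in> measurable (labs \<Otimes>\<^sub>M pairs) (labs \<Otimes>\<^sub>M borel)"
  unfolding proj_def split_beta by (elim disjE; simp only:; measurable)

lemma observe_Z: "observe n \<in> measurable Z (labs \<Otimes>\<^sub>M borel)"
  using observe_measurable by (simp only: measurable_cong_sets[OF sets_Z refl])

lemma distr_observe_split:
  "unif \<Otimes>\<^sub>M (distr Z (labs \<Otimes>\<^sub>M borel) (observe n) \<Otimes>\<^sub>M distr Z (labs \<Otimes>\<^sub>M borel) (observe n)) =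
    distr Z (borel \<Otimes>\<^sub>M ((labs \<Otimes>\<^sub>M borel) \<Otimes>\<^sub>M (labs \<Otimes>\<^sub>M borel))) (\<lambda>z. map3 (observe n) (root_split z))"
proof -
  have rs: "root_split \<in> measurable Z (borel \<Otimes>\<^sub>M (trees \<Otimes>\<^sub>M trees))"
    using root_split_measurable by (simp only: measurable_cong_sets[OF sets_Z refl])
  have "unif \<Otimes>\<^sub>M (distr Z (labs \<Otimes>\<^sub>M borel) (observe n) \<Otimes>\<^sub>M distr Z (labs \<Otimes>\<^sub>M borel) (observe n)) =
      distr (unif \<Otimes>\<^sub>M (Z \<Otimes>\<^sub>M Z)) (borel \<Otimes>\<^sub>M ((labs \<Otimes>\<^sub>M borel) \<Otimes>\<^sub>M (labs \<Otimes>\<^sub>M borel))) (map3 (observe n))"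
    by (rule distr_map3[OF prob_space_axioms observe_Z, symmetric])
  also have "unif \<Otimes>\<^sub>M (Z \<Otimes>\<^sub>M Z) = distr Z (borel \<Otimes>\<^sub>M (trees \<Otimes>\<^sub>M trees)) root_split" by (rule split[symmetric])
  also have "distr (distr Z (borel \<Otimes>\<^sub>M (trees \<Otimes>\<^sub>M trees)) root_split)
      (borel \<Otimes>\<^sub>M ((labs \<Otimes>\<^sub>M borel) \<Otimes>\<^sub>M (labs \<Otimes>\<^sub>M borel))) (map3 (observe n)) =
     distr Z (borel \<Otimes>\<^sub>M ((labs \<Otimes>\<^sub>M borel) \<Otimes>\<^sub>M (labs \<Otimes>\<^sub>M borel))) (map3 (observe n) \<circ> root_split)"
    by (rule distr_distr[OF map3_measurable[OF observe_measurable] rs])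
  finally show ?thesis by (simp only: comp_def)
qed

text \<open>Seen through one component, the coupled tree is indistinguishable from the percolation.
  At depth 0 this is the forced law of the time, \<open>edge_time_cdf\<close>; afterwards both sides
  obey the same recursion.\<close>

lemma L_marginal:
  assumes p: "p = fst \<or> p = snd"
  shows "distr (coupled_tree N n) (labs \<Otimes>\<^sub>M borel) (proj p) = distr Z (labs \<Otimes>\<^sub>M borel) (observe n)"
proof (induction n)
  case 0
  have pm: "p \<in> measurable N borel"
    using p by (elim disjE) (simp_all add: measurable_cong_sets[OF N.sets_N refl])
  have em: "edge_time \<in> measurable Z borel"
    using edge_time_measurable by (simp only: measurable_cong_sets[OF sets_Z refl])
  have cm: "(\<lambda>x::real. (\<lambda>_::bool list. 0::real, x)) \<in> measurable borel (labs \<Otimes>\<^sub>M borel)"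
    by (intro measurable_Pair measurable_const) auto
  have spN: "space N = UNIV" using sets_eq_imp_space_eq[OF N.sets_N] by (simp add: space_pair_measure)
  have same: "distr N borel p = distr Z borel edge_time"
  proof (rule cdf_unique)
    show "real_distribution (distr N borel p)"
      by (rule N.real_distribution_distr[OF pm])
    show "real_distribution (distr Z borel edge_time)"
      by (rule real_distribution_distr[OF em])
    show "cdf (distr N borel p) = cdf (distr Z borel edge_time)"
    proof
      fix x
      have "cdf (distr N borel p) x = measure N {z. p z \<le> x}"
        unfolding cdf_def by (subst measure_distr[OF pm]) (simp_all add: spN vimage_def)
      also have "\<dots> = time_cdf x" using p N.N_fst N.N_snd by auto
      also have "\<dots> = measure Z {z. edge_time z \<le> x}" by (simp add: edge_time_cdf)
      also have "\<dots> = cdf (distr Z borel edge_time) x"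
        unfolding cdf_def by (subst measure_distr[OF em]) (simp_all add: vimage_def)
      finally show "cdf (distr N borel p) x = cdf (distr Z borel edge_time) x" .
    qed
  qed
  have "distr (coupled_tree N 0) (labs \<Otimes>\<^sub>M borel) (proj p) =
      distr N (labs \<Otimes>\<^sub>M borel) (proj p \<circ> (\<lambda>z. (\<lambda>_::bool list. 0::real, z)))"
    unfolding coupled_tree.simps by (rule distr_distr[OF proj_measurable[OF p] N.const_measurable])
  also have "proj p \<circ> (\<lambda>z. (\<lambda>_. 0, z)) = (\<lambda>x. (\<lambda>_::bool list. 0::real, x)) \<circ> p" by (auto simp: proj_def)
  also have "distr N (labs \<Otimes>\<^sub>M borel) \<dots> = distr (distr N borel p) (labs \<Otimes>\<^sub>M borel) (\<lambda>x. (\<lambda>_::bool list. 0::real, x))"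
    by (rule distr_distr[OF cm pm, symmetric])
  also have "\<dots> = distr Z (labs \<Otimes>\<^sub>M borel) ((\<lambda>x. (\<lambda>_::bool list. 0::real, x)) \<circ> edge_time)"
    unfolding same by (rule distr_distr[OF cm em])
  also have "(\<lambda>x. (\<lambda>_::bool list. 0::real, x)) \<circ> edge_time = observe 0" by (auto simp: observe_def cutoff_def fun_eq_iff)
  finally show ?case .
next
  case (Suc n)
  have "distr (coupled_tree N (Suc n)) (labs \<Otimes>\<^sub>M borel) (proj p) =
     distr (unif \<Otimes>\<^sub>M (distr (coupled_tree N n) (labs \<Otimes>\<^sub>M borel) (proj p) \<Otimes>\<^sub>M
       distr (coupled_tree N n) (labs \<Otimes>\<^sub>M borel) (proj p))) (labs \<Otimes>\<^sub>M borel) join"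
  proof (rule N.distr_distr_L[OF proj_measurable[OF p] proj_measurable[OF p] join_measurable])
    show "proj p (join2 q) = join (map3 (proj p) q)" for q
      using p by (auto simp: proj_def join2_def join_def map3_def step_pair_def split: prod.splits)
  qed
  also have "\<dots> = distr (distr Z (borel \<Otimes>\<^sub>M ((labs \<Otimes>\<^sub>M borel) \<Otimes>\<^sub>M (labs \<Otimes>\<^sub>M borel)))
      (\<lambda>z. map3 (observe n) (root_split z))) (labs \<Otimes>\<^sub>M borel) join"
    by (simp only: Suc distr_observe_split)
  also have "\<dots> = distr Z (labs \<Otimes>\<^sub>M borel) (join \<circ> (\<lambda>z. map3 (observe n) (root_split z)))"
    by (rule distr_distr) measurable
  also have "\<dots> = distr Z (labs \<Otimes>\<^sub>M borel) (observe (Suc n))"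
  proof (rule distr_cong_AE)
    show "AE z in Z. (join \<circ> (\<lambda>z. map3 (observe n) (root_split z))) z = observe (Suc n) z"
      using AE_edge_time
    proof eventually_elim
      case (elim z)
      then show ?case by (simp add: join_def map3_def observe_def root_split_def cutoff_graft)
    qed
  qed (simp, measurable)
  finally show ?case .
qed


lemma measure_bad:
  assumes p: "p = fst \<or> p = snd" and C: "C \<in> sets labs"
  shows "measure (unif \<Otimes>\<^sub>M (coupled_tree N n \<Otimes>\<^sub>M coupled_tree N n))
      (map3 (proj p) -` bad C \<inter> space (unif \<Otimes>\<^sub>M (coupled_tree N n \<Otimes>\<^sub>M coupled_tree N n))) =
    prob {z. snd (z []) \<noteq> (cutoff (Suc n) (labels_of z) \<in> C)}"
proof -
  let ?P = "unif \<Otimes>\<^sub>M (coupled_tree N n \<Otimes>\<^sub>M coupled_tree N n)"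
  let ?S = "borel \<Otimes>\<^sub>M ((labs \<Otimes>\<^sub>M borel) \<Otimes>\<^sub>M (labs \<Otimes>\<^sub>M borel)) ::
    (real \<times> ((bool list \<Rightarrow> real) \<times> real) \<times> ((bool list \<Rightarrow> real) \<times> real)) measure"
  have [measurable]: "Measurable.pred labs (\<lambda>V. V \<in> C)" using C by measurable
  have m: "map3 (proj p) \<in> measurable ?P ?S"
    using map3_measurable[OF proj_measurable[OF p]] by (simp only: measurable_cong_sets[OF N.sets_unif_L refl])
  have m2: "(\<lambda>z. map3 (observe n) (root_split z)) \<in> measurable Z ?S" by measurable
  have "measure ?P (map3 (proj p) -` bad C \<inter> space ?P) = measure (distr ?P ?S (map3 (proj p))) (bad C)"
    by (rule measure_distr[OF m bad_sets[OF C], symmetric])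
  also have "distr ?P ?S (map3 (proj p)) = distr Z ?S (\<lambda>z. map3 (observe n) (root_split z))"
    by (simp only: distr_map3[OF N.prob_space_L N.measurable_L[OF proj_measurable[OF p]]]
        L_marginal[OF p] distr_observe_split)
  also have "measure \<dots> (bad C) = prob ((\<lambda>z. map3 (observe n) (root_split z)) -` bad C \<inter> space Z)"
    by (rule measure_distr[OF m2 bad_sets[OF C]])
  also have "\<dots> = prob {z. snd (z []) \<noteq> (cutoff (Suc n) (labels_of z) \<in> C)}"
  proof (rule finite_measure_eq_AE)
    show "AE z in Z. (z \<in> (\<lambda>z. map3 (observe n) (root_split z)) -` bad C \<inter> space Z) =
        (z \<in> {z. snd (z []) \<noteq> (cutoff (Suc n) (labels_of z) \<in> C)})"
      using AE_legal
    proof eventually_elim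
      case (elim z)
      have "map3 (observe n) (root_split z) \<in> bad C \<longleftrightarrow>
          (branch_time z \<le> fst (z [])) \<noteq> (cutoff (Suc n) (labels_of z) \<in> C)"
        by (simp add: bad_def map3_def observe_def root_split_def cutoff_graft branch_time_eq[OF elim])
      then show ?case using legal_root(3)[OF elim] by simp
    qed
    show "(\<lambda>z. map3 (observe n) (root_split z)) -` bad C \<inter> space Z \<in> sets Z"
      by (rule measurable_sets[OF m2 bad_sets[OF C]])
    show "{z. snd (z []) \<noteq> (cutoff (Suc n) (labels_of z) \<in> C)} \<in> sets Z"
      by (rule sets_Collect_Z) measurable
  qed
  finally show ?thesis .
qed

lemma measure_gap:
  "measure (unif \<Otimes>\<^sub>M (coupled_tree N n \<Otimes>\<^sub>M coupled_tree N n))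
      (map3 snd -` gap \<inter> space (unif \<Otimes>\<^sub>M (coupled_tree N n \<Otimes>\<^sub>M coupled_tree N n))) =
    measure (unif \<Otimes>\<^sub>M (N \<Otimes>\<^sub>M N)) gap"
proof -
  let ?P = "unif \<Otimes>\<^sub>M (coupled_tree N n \<Otimes>\<^sub>M coupled_tree N n)"
  have m: "map3 snd \<in> measurable ?P (borel \<Otimes>\<^sub>M (pairs \<Otimes>\<^sub>M pairs))"
    using map3_measurable[OF measurable_snd] by (simp only: measurable_cong_sets[OF N.sets_unif_L refl])
  have "measure ?P (map3 snd -` gap \<inter> space ?P) = measure (distr ?P (borel \<Otimes>\<^sub>M (pairs \<Otimes>\<^sub>M pairs)) (map3 snd)) gap"
    by (rule measure_distr[OF m gap_sets, symmetric])
  also have "distr ?P (borel \<Otimes>\<^sub>M (pairs \<Otimes>\<^sub>M pairs)) (map3 snd) = unif \<Otimes>\<^sub>M (N \<Otimes>\<^sub>M N)"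
    by (simp only: distr_map3[OF N.prob_space_L N.measurable_L[OF measurable_snd]] N.L_times)
  finally show ?thesis .
qed

text \<open>A union bound over the two components, each of which is misjudged by C as often as the
  percolation itself. The depth is Suc n because the root label is joined to n generations on either
  side.\<close>

lemma gap_le_finite_level:
  assumes C: "C \<in> sets labs"
  shows "measure (unif \<Otimes>\<^sub>M (N \<Otimes>\<^sub>M N)) gap \<le> 2 * prob {z. snd (z []) \<noteq> (cutoff (Suc n) (labels_of z) \<in> C)}"
proof -
  let ?P = "unif \<Otimes>\<^sub>M (coupled_tree N n \<Otimes>\<^sub>M coupled_tree N n)"
  let ?B = "\<lambda>p. map3 (proj p) -` bad C \<inter> space ?P"
  interpret P: prob_space ?P by (rule N.prob_space_unif_pair[OF N.prob_space_L])
  have B: "?B p \<in> sets ?P" if p: "p = fst \<or> p = snd" for p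
  proof -
    have "map3 (proj p) \<in> measurable ?P (borel \<Otimes>\<^sub>M ((labs \<Otimes>\<^sub>M borel) \<Otimes>\<^sub>M (labs \<Otimes>\<^sub>M borel)))"
      using map3_measurable[OF proj_measurable[OF p]] by (simp only: measurable_cong_sets[OF N.sets_unif_L refl])
    then show ?thesis using bad_sets[OF C] by (rule measurable_sets)
  qed
  have "measure (unif \<Otimes>\<^sub>M (N \<Otimes>\<^sub>M N)) gap = measure ?P (map3 snd -` gap \<inter> space ?P)" by (simp only: measure_gap)
  also have "\<dots> \<le> measure ?P (?B fst \<union> ?B snd)"
  proof (rule P.finite_measure_mono)
    show "map3 snd -` gap \<inter> space ?P \<subseteq> ?B fst \<union> ?B snd"
      by (auto simp: gap_def bad_def map3_def proj_def)
    show "?B fst \<union> ?B snd \<in> sets ?P" using B by (intro sets.Un) simp_all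
  qed
  also have "\<dots> \<le> measure ?P (?B fst) + measure ?P (?B snd)"
    by (rule measure_Un_le) (use B in simp_all)
  also have "\<dots> = 2 * prob {z. snd (z []) \<noteq> (cutoff (Suc n) (labels_of z) \<in> C)}"
    by (simp only: measure_bad[OF _ C] simp_thms mult_2)
  finally show ?thesis .
qed

end

section \<open>From finitely many generations to all labels\<close>

lemma cutoff_min: "cutoff m (cutoff n V) = cutoff (min m n) V"
  by (auto simp: cutoff_def fun_eq_iff)

context coded_percolation
begin

lemma labels_approx:
  assumes "C \<in> sets labs" "0 < \<epsilon>"
  shows "\<exists>n C'. C' \<in> sets labs \<and> prob {z. (labels_of z \<in> C) \<noteq> (cutoff n (labels_of z) \<in> C')} < \<epsilon>"
proof -
  have ev: "{z. (labels_of z \<in> A) \<noteq> (cutoff n (labels_of z) \<in> B)} \<in> sets Z"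
    if A: "A \<in> sets labs" and B: "B \<in> sets labs" for A B n
  proof -
    have [measurable]: "Measurable.pred labs (\<lambda>V. V \<in> A)" "Measurable.pred labs (\<lambda>V. V \<in> B)"
      using A B by measurable
    show ?thesis by (rule sets_Collect_Z) measurable
  qed
  let ?G = "{{f \<in> \<Pi>\<^sub>E i\<in>UNIV. space borel. f i \<in> A} | (i :: bool list) (A :: real set). i \<in> UNIV \<and> A \<in> sets borel}"
  have gen: "sets labs = sigma_sets (\<Pi>\<^sub>E i\<in>UNIV. space borel) ?G" by (rule sets_PiM_single)
  have "C \<in> sigma_sets (\<Pi>\<^sub>E i\<in>(UNIV::bool list set). space (borel::real measure)) ?G"
    using assms(1) by (simp only: gen)
  then show ?thesis using assms(2)
  proof (induction arbitrary: \<epsilon> rule: sigma_sets.induct)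
    case (Basic a)
    then obtain i A where a: "a = {f \<in> \<Pi>\<^sub>E i\<in>UNIV. space borel. f i \<in> A}" "A \<in> sets borel" by blast
    have "a \<in> sets labs" unfolding gen using Basic(1) by (rule sigma_sets.Basic)
    moreover have "labels_of z \<in> a \<longleftrightarrow> cutoff (Suc (length i)) (labels_of z) \<in> a" for z
      by (simp add: a cutoff_def)
    then have "{z. (labels_of z \<in> a) \<noteq> (cutoff (Suc (length i)) (labels_of z) \<in> a)} = {}" by blast
    then have "prob {z. (labels_of z \<in> a) \<noteq> (cutoff (Suc (length i)) (labels_of z) \<in> a)} < \<epsilon>"
      using Basic(2) by (simp only: measure_empty)
    ultimately show ?case by blast
  next
    case Empty
    have "{z. (labels_of z \<in> {}) \<noteq> (cutoff 0 (labels_of z) \<in> {})} = {}" by blast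
    then have "prob {z. (labels_of z \<in> {}) \<noteq> (cutoff 0 (labels_of z) \<in> {})} < \<epsilon>"
      using Empty by (simp only: measure_empty)
    then show ?case using sets.empty_sets by blast
  next
    case (Compl a)
    from Compl.IH[OF Compl.prems] obtain n C' where C': "C' \<in> sets labs"
      "prob {z. (labels_of z \<in> a) \<noteq> (cutoff n (labels_of z) \<in> C')} < \<epsilon>" by blast
    have "{z. (labels_of z \<in> (\<Pi>\<^sub>E i\<in>UNIV. space borel) - a) \<noteq> (cutoff n (labels_of z) \<in> space labs - C')} =
       {z. (labels_of z \<in> a) \<noteq> (cutoff n (labels_of z) \<in> C')}"
      by auto
    then have "prob {z. (labels_of z \<in> (\<Pi>\<^sub>E i\<in>UNIV. space borel) - a) \<noteq> (cutoff n (labels_of z) \<in> space labs - C')} < \<epsilon>"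
      using C'(2) by (simp only:)
    moreover have "space labs - C' \<in> sets labs" using C'(1) by (rule sets.compl_sets)
    ultimately show ?case by blast
  next
    case (Union a)
    have a: "a i \<in> sets labs" for i unfolding gen by (rule Union.hyps)
    \<comment> \<open>These errors sum to at most \<epsilon> / 2; the other half of \<epsilon> pays
      for truncating the union at k.\<close>
    define d where "d = (\<lambda>i::nat. \<epsilon> / 2 * (1/2) ^ Suc i)"
    have d: "0 < d i" for i using Union.prems by (simp add: d_def)
    have "\<forall>i. \<exists>q. snd q \<in> sets labs \<and> prob {z. (labels_of z \<in> a i) \<noteq> (cutoff (fst q) (labels_of z) \<in> snd q)} < d i"
    proof
      fix i
      from Union.IH[OF d] obtain n C' where "C' \<in> sets labs"
        "prob {z. (labels_of z \<in> a i) \<noteq> (cutoff n (labels_of z) \<in> C')} < d i" by blast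
      then show "\<exists>q. snd q \<in> sets labs \<and> prob {z. (labels_of z \<in> a i) \<noteq> (cutoff (fst q) (labels_of z) \<in> snd q)} < d i"
        by (intro exI[of _ "(n, C')"]) (simp only: fst_conv snd_conv)
    qed
    from choice[OF this] obtain q where q: "\<And>i. snd (q i) \<in> sets labs"
      "\<And>i. prob {z. (labels_of z \<in> a i) \<noteq> (cutoff (fst (q i)) (labels_of z) \<in> snd (q i))} < d i" by blast
    define n where "n = (\<lambda>i. fst (q i))"
    define C' where "C' = (\<lambda>i. snd (q i))"
    have C': "\<And>i. C' i \<in> sets labs"
      "\<And>i. prob {z. (labels_of z \<in> a i) \<noteq> (cutoff (n i) (labels_of z) \<in> C' i)} < d i"
      using q by (simp_all only: n_def C'_def)
    define A where "A = (\<lambda>k. {z. labels_of z \<in> (\<Union>i<k. a i)})"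
    have pa: "Measurable.pred labs (\<lambda>V. V \<in> (\<Union>i<k. a i))" for k
      using a by (intro pred_sets2[where N = labs] sets.finite_UN) auto
    have Am: "A k \<in> sets Z" for k
      unfolding A_def by (rule sets_Collect_Z, rule measurable_compose[OF labels_of_measurable pa])
    have "incseq A"
    proof (rule incseq_SucI)
      show "A k \<subseteq> A (Suc k)" for k unfolding A_def lessThan_Suc by blast
    qed
    then have "(\<lambda>k. prob (A k)) \<longlonglongrightarrow> prob (\<Union>k. A k)" using Am by (intro finite_Lim_measure_incseq) auto
    then have "eventually (\<lambda>k. prob (\<Union>k. A k) - \<epsilon> / 2 < prob (A k)) sequentially"
      using Union.prems by (intro order_tendstoD(1)) auto
    then obtain k where k: "prob (\<Union>k. A k) - \<epsilon> / 2 < prob (A k)"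
      using eventually_happens'[OF sequentially_bot] by blast
    define m where "m = (\<Sum>i<k. n i)"
    define D where "D = (\<Union>i<k. {V. cutoff (n i) V \<in> C' i})"
    have Ds: "{V. cutoff (n i) V \<in> C' i} \<in> sets labs" for i
      using measurable_sets[OF cutoff_measurable C'(1)[of i], of "n i"] by (simp add: vimage_def)
    have D: "D \<in> sets labs" unfolding D_def using Ds by (intro sets.finite_UN) auto
    have nm: "n i \<le> m" if "i < k" for i unfolding m_def using that by (intro member_le_sum) auto
    let ?E = "\<lambda>i. {z. (labels_of z \<in> a i) \<noteq> (cutoff (n i) (labels_of z) \<in> C' i)}"
    have sub: "{z. (labels_of z \<in> \<Union> (range a)) \<noteq> (cutoff m (labels_of z) \<in> D)} \<subseteq> ((\<Union>k. A k) - A k) \<union> (\<Union>i<k. ?E i)"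
    proof (rule subsetI)
      fix z assume z: "z \<in> {z. (labels_of z \<in> \<Union> (range a)) \<noteq> (cutoff m (labels_of z) \<in> D)}"
      have Dz: "cutoff m (labels_of z) \<in> D \<longleftrightarrow> (\<exists>i<k. cutoff (n i) (labels_of z) \<in> C' i)"
      proof -
        have "cutoff m (labels_of z) \<in> D \<longleftrightarrow> (\<exists>i<k. cutoff (n i) (cutoff m (labels_of z)) \<in> C' i)"
          unfolding D_def by blast
        moreover have "cutoff (n i) (cutoff m (labels_of z)) = cutoff (n i) (labels_of z)" if "i < k" for i
          unfolding cutoff_min using nm[OF that] by (simp only: min_absorb1)
        ultimately show ?thesis by (simp cong: conj_cong)
      qed
      show "z \<in> ((\<Union>k. A k) - A k) \<union> (\<Union>i<k. ?E i)"
      proof (rule ccontr)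
        assume n: "z \<notin> ((\<Union>k. A k) - A k) \<union> (\<Union>i<k. ?E i)"
        then have e: "labels_of z \<in> a i \<longleftrightarrow> cutoff (n i) (labels_of z) \<in> C' i" if "i < k" for i
          using that by blast
        have "labels_of z \<in> \<Union> (range a) \<longleftrightarrow> (\<exists>i<k. labels_of z \<in> a i)"
          using n unfolding A_def by blast
        with z Dz e show False by blast
      qed
    qed
    have Em: "?E i \<in> sets Z" for i by (rule ev[OF a C'(1)])
    have "prob {z. (labels_of z \<in> \<Union> (range a)) \<noteq> (cutoff m (labels_of z) \<in> D)} \<le>
        prob (((\<Union>k. A k) - A k) \<union> (\<Union>i<k. ?E i))"
      using sub Am Em by (intro finite_measure_mono) auto
    also have "\<dots> \<le> prob ((\<Union>k. A k) - A k) + prob (\<Union>i<k. ?E i)"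
      using Am Em by (intro measure_Un_le) auto
    also have "prob ((\<Union>k. A k) - A k) = prob (\<Union>k. A k) - prob (A k)"
      using Am by (intro finite_measure_Diff) auto
    also have "prob (\<Union>i<k. ?E i) \<le> (\<Sum>i<k. prob (?E i))"
      using Em by (intro finite_measure_subadditive_finite) auto
    also have "\<dots> \<le> (\<Sum>i<k. d i)" by (intro sum_mono less_imp_le C'(2))
    also have "\<dots> = \<epsilon> / 2 * (1 - (1/2) ^ k)"
    proof (induction k)
      case (Suc k)
      then show ?case by (simp add: d_def algebra_simps)
    qed simp
    also have "\<dots> \<le> \<epsilon> / 2 * 1" using Union.prems by (intro mult_left_mono) auto
    finally have "prob {z. (labels_of z \<in> \<Union> (range a)) \<noteq> (cutoff m (labels_of z) \<in> D)} < \<epsilon>"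
      using k by simp
    with D show ?case by blast
  qed
qed

end

text \<open>The constant is half the gap probability of the explicit coupling. It involves only N,
  so it is the same for every Z.\<close>

theorem coded_nonendogeny:
  obtains c :: real where "0 < c"
    "\<And>Z C. coded_percolation Z \<Longrightarrow> C \<in> sets labs \<Longrightarrow> c \<le> measure Z {z. snd (z []) \<noteq> (labels_of z \<in> C)}"
proof -
  obtain N :: "(real \<times> real) measure" where N: "prob_space N" "sets N = sets borel"
    "\<And>x. measure N {z. fst z \<le> x} = time_cdf x" "\<And>x. measure N {z. snd z \<le> x} = time_cdf x"
    "distr (unif \<Otimes>\<^sub>M (N \<Otimes>\<^sub>M N)) borel step_pair = N"
    "0 < measure (unif \<Otimes>\<^sub>M (N \<Otimes>\<^sub>M N)) {p \<in> space (unif \<Otimes>\<^sub>M (N \<Otimes>\<^sub>M N)).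
     min (fst (fst (snd p))) (fst (snd (snd p))) \<le> fst p \<and> fst p < min (snd (fst (snd p))) (snd (snd (snd p)))}"
  proof (rule bivariate_fixed_point)
    fix N :: "(real \<times> real) measure"
    assume A: "prob_space N" "sets N = sets borel"
      "\<And>x. measure N {z. fst z \<le> x} = time_cdf x" "\<And>x. measure N {z. snd z \<le> x} = time_cdf x"
      "distr (unif \<Otimes>\<^sub>M (N \<Otimes>\<^sub>M N)) borel step_pair = N"
      "0 < measure (unif \<Otimes>\<^sub>M (N \<Otimes>\<^sub>M N)) {p \<in> space (unif \<Otimes>\<^sub>M (N \<Otimes>\<^sub>M N)).
       min (fst (fst (snd p))) (fst (snd (snd p))) \<le> fst p \<and> fst p < min (snd (fst (snd p))) (snd (snd (snd p)))}"
    show thesis by (rule that[OF A])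
  qed
  have bp: "pairs = (borel :: (real \<times> real) measure)" by (rule borel_prod)
  interpret N: bivariate_law N
    by (intro bivariate_law.intro bivariate_law_axioms.intro) (simp_all only: bp N)
  define c where "c = measure (unif \<Otimes>\<^sub>M (N \<Otimes>\<^sub>M N)) gap"
  show thesis
  proof (rule that[of "c / 2"])
    have "{p \<in> space (unif \<Otimes>\<^sub>M (N \<Otimes>\<^sub>M N)).
     min (fst (fst (snd p))) (fst (snd (snd p))) \<le> fst p \<and> fst p < min (snd (fst (snd p))) (snd (snd (snd p)))} = gap"
      using sets_eq_imp_space_eq[OF N(2)] by (auto simp: gap_def space_pair_measure)
    then show "0 < c / 2" using N(6) by (simp only: c_def)
    fix Z C assume "coded_percolation Z" and C: "C \<in> sets labs"
    interpret Z: coded_percolation Z by fact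
    interpret nonendogeny Z N ..
    show "c / 2 \<le> measure Z {z. snd (z []) \<noteq> (labels_of z \<in> C)}"
    proof (rule field_le_epsilon)
      fix e :: real assume "0 < e"
      from Z.labels_approx[OF C this] obtain n C' where C': "C' \<in> sets labs"
        "Z.prob {z. (labels_of z \<in> C) \<noteq> (cutoff n (labels_of z) \<in> C')} < e" by blast
      define C'' where "C'' = {V. cutoff n V \<in> C'}"
      have C'': "C'' \<in> sets labs"
        using measurable_sets[OF cutoff_measurable C'(1), of n] by (simp add: vimage_def C''_def)
      have eq: "cutoff (Suc n) V \<in> C'' \<longleftrightarrow> cutoff n V \<in> C'" for V by (simp add: C''_def cutoff_cutoff)
      have [measurable]: "Measurable.pred labs (\<lambda>V. V \<in> C)" "Measurable.pred labs (\<lambda>V. V \<in> C')"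
        using C C' by measurable
      have S: "{z. snd (z []) \<noteq> (labels_of z \<in> C)} \<in> sets Z"
        "{z. (labels_of z \<in> C) \<noteq> (cutoff n (labels_of z) \<in> C')} \<in> sets Z"
        by (rule Z.sets_Collect_Z; measurable)+
      have "c \<le> 2 * Z.prob {z. snd (z []) \<noteq> (cutoff (Suc n) (labels_of z) \<in> C'')}"
        unfolding c_def by (rule gap_le_finite_level[OF C''])
      also have "Z.prob {z. snd (z []) \<noteq> (cutoff (Suc n) (labels_of z) \<in> C'')} \<le>
          Z.prob ({z. snd (z []) \<noteq> (labels_of z \<in> C)} \<union> {z. (labels_of z \<in> C) \<noteq> (cutoff n (labels_of z) \<in> C')})"
        unfolding eq using S by (intro Z.finite_measure_mono sets.Un) auto
      also have "\<dots> \<le> Z.prob {z. snd (z []) \<noteq> (labels_of z \<in> C)} +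
          Z.prob {z. (labels_of z \<in> C) \<noteq> (cutoff n (labels_of z) \<in> C')}"
        using S by (intro measure_Un_le)
      finally show "c / 2 \<le> Z.prob {z. snd (z []) \<noteq> (labels_of z \<in> C)} + e" using C'(2) by simp
    qed
  qed
qed

section \<open>The 3-regular tree\<close>

definition edge :: "'v \<times> 'v \<Rightarrow> 'v set" where
  "edge a = {fst a, snd a}"

text \<open>Non-backtracking walks.\<close>

fun nbw :: "'v set set \<Rightarrow> 'v list \<Rightarrow> bool" where
  "nbw E (x # y # z # zs) \<longleftrightarrow> {x, y} \<in> E \<and> x \<noteq> z \<and> nbw E (y # z # zs)"
| "nbw E [x, y] \<longleftrightarrow> {x, y} \<in> E"
| "nbw E xs \<longleftrightarrow> True"

lemma nbw_Cons: "nbw E (x # xs) \<longleftrightarrow>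
    (xs = [] \<or> {x, hd xs} \<in> E \<and> (tl xs = [] \<or> x \<noteq> hd (tl xs)) \<and> nbw E xs)"
  by (cases "(E, x # xs)" rule: nbw.cases) auto

lemma nbw_nth:
  assumes "nbw E xs"
  shows "Suc i < length xs \<Longrightarrow> {xs ! i, xs ! Suc i} \<in> E"
    and "Suc (Suc i) < length xs \<Longrightarrow> xs ! i \<noteq> xs ! Suc (Suc i)"
  using assms
proof (induction xs arbitrary: i)
  case (Cons x xs)
  {
    case 1
    then show ?case using Cons.IH(1)[of "i - 1"] by (cases i; cases xs) (auto simp: nbw_Cons)
  next
    case 2
    then show ?case using Cons.IH(2)[of "i - 1"]
      by (cases i; cases xs; cases "tl xs") (auto simp: nbw_Cons)
  }
qed auto

text \<open>Two walks that leave x by different steps combine to one walk through x. With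
  \<open>nbw_distinct\<close> this separates the vertices reached by different descents.\<close>

lemma nbw_rev_append:
  assumes "nbw E (x # xs)" "nbw E (x # ys)" "xs = [] \<or> ys = [] \<or> hd xs \<noteq> hd ys"
  shows "nbw E (rev xs @ x # ys)"
  using assms
proof (induction xs arbitrary: x ys)
  case (Cons y xs)
  have "nbw E (y # xs)" using Cons.prems(1) by (simp add: nbw_Cons[of E x])
  moreover have "nbw E (y # x # ys)"
    using Cons.prems by (auto simp: nbw_Cons[of E y] nbw_Cons[of E x "y # xs"] insert_commute)
  moreover have "xs = [] \<or> x # ys = [] \<or> hd xs \<noteq> hd (x # ys)"
    using Cons.prems(1) by (auto simp: nbw_Cons[of E x "y # xs"])
  ultimately have "nbw E (rev xs @ y # x # ys)" by (rule Cons.IH)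
  then show ?case by simp
qed simp

section \<open>Coordinates on the tree relative to an oriented edge\<close>

locale regular_tree =
  fixes T :: "'v set" and E :: "'v set set"
  assumes reg: "infinite_regular_tree 3 T E"
begin

lemma simple: "simple_graph T E" and conn: "connected_graph T E" and acyclic: "\<not> graph_cycle E p"
  and degree: "v \<in> T \<Longrightarrow> card {w. {v, w} \<in> E} = 3" and T_nonempty: "T \<noteq> {}"
  using reg by (auto simp: infinite_regular_tree_def tree_def)

lemma edgeD:
  assumes "{v, w} \<in> E"
  shows "v \<in> T" "w \<in> T" "v \<noteq> w"
proof -
  obtain x y where "x \<in> T" "y \<in> T" "x \<noteq> y" "{v, w} = {x, y}"
    using assms simple unfolding simple_graph_def by blast
  then show "v \<in> T" "w \<in> T" "v \<noteq> w" by (auto simp: doubleton_eq_iff)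
qed

text \<open>Take a repetition at the least distance d. The case d = 1 would be a loop and d = 2 a
  backtracking step; for d \<ge> 3 the stretch between the two visits has no further repetition and
  is a cycle.\<close>

lemma nbw_distinct:
  assumes w: "nbw E xs"
  shows "distinct xs"
proof (rule ccontr)
  assume "\<not> distinct xs"
  then obtain i0 j0 where ij0: "i0 < j0" "j0 < length xs" "xs ! i0 = xs ! j0"
    unfolding distinct_conv_nth by (metis linorder_neqE_nat)
  define P where "P = (\<lambda>d. \<exists>i. 0 < d \<and> i + d < length xs \<and> xs ! i = xs ! (i + d))"
  have "P (j0 - i0)" using ij0 by (auto simp: P_def intro!: exI[of _ i0])
  define d where "d = (LEAST d. P d)"
  have "P d" unfolding d_def by (rule LeastI) fact
  then obtain i where i: "0 < d" "i + d < length xs" "xs ! i = xs ! (i + d)" by (auto simp: P_def)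
  have least: "\<not> P d'" if "d' < d" for d' using that not_less_Least unfolding d_def by blast
  have "d \<noteq> 1"
  proof
    assume "d = 1"
    then have "{xs ! i, xs ! i} \<in> E" using nbw_nth(1)[OF w, of i] i by simp
    then show False using edgeD(3) by blast
  qed
  moreover have "d \<noteq> 2"
  proof
    assume "d = 2"
    then show False using nbw_nth(2)[OF w, of i] i by simp
  qed
  ultimately have d3: "3 \<le> d" using i(1) by linarith
  define p where "p = take d (drop i xs)"
  have len: "length p = d" using i by (simp add: p_def)
  have pn: "p ! m = xs ! (i + m)" if "m < d" for m using that i by (simp add: p_def)
  have "distinct p"
    unfolding distinct_conv_nth
  proof (intro allI impI)
    fix m n assume mn: "m < length p" "n < length p" "m \<noteq> n"
    have neq: "p ! m \<noteq> p ! n" if "m < n" "n < d" for m n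
    proof
      assume "p ! m = p ! n"
      then have "xs ! (i + m) = xs ! (i + m + (n - m))" using that by (simp add: pn)
      then have "P (n - m)" using that i unfolding P_def by (intro exI[of _ "i + m"]) auto
      then show False using least[of "n - m"] that by simp
    qed
    show "p ! m \<noteq> p ! n"
      using neq[of m n] neq[of n m] mn len by (cases "m < n") auto
  qed
  moreover have "{p ! m, p ! (Suc m mod length p)} \<in> E" if "m < length p" for m
  proof (cases "Suc m = d")
    case True
    then have "p ! m = xs ! (i + m)" "p ! (Suc m mod length p) = xs ! (i + 0)"
      using len d3 pn[of m] pn[of 0] by auto
    moreover have "xs ! (i + 0) = xs ! Suc (i + m)"
    proof -
      have "Suc (i + m) = i + d" using True by simp
      then show ?thesis using i(3) by (simp only: add_0_right)
    qed
    ultimately show ?thesis using nbw_nth(1)[OF w, of "i + m"] i True by simp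
  next
    case False
    then have "Suc m < d" using that len by simp
    then have "p ! m = xs ! (i + m)" "p ! (Suc m mod length p) = xs ! Suc (i + m)"
      using len pn[of m] pn[of "Suc m"] by auto
    then show ?thesis using nbw_nth(1)[OF w, of "i + m"] i \<open>Suc m < d\<close> by simp
  qed
  ultimately have "graph_cycle E p" unfolding graph_cycle_def using len d3 by simp
  then show False using acyclic by blast
qed

definition rev_edge :: "'v \<times> 'v \<Rightarrow> 'v \<times> 'v" where "rev_edge a = (snd a, fst a)"

lemma rev_edge [simp]: "fst (rev_edge a) = snd a" "snd (rev_edge a) = fst a" "rev_edge (rev_edge a) = a"
  "edge (rev_edge a) = edge a"
  by (auto simp: rev_edge_def edge_def)

lemma mem_orient: "a \<in> orient E \<longleftrightarrow> edge a \<in> E"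
  by (cases a) (simp add: orient_def edge_def)

lemma rev_edge_orient [simp]: "rev_edge a \<in> orient E \<longleftrightarrow> a \<in> orient E"
  by (simp add: mem_orient)

lemma orientD: "a \<in> orient E \<Longrightarrow> fst a \<in> T \<and> snd a \<in> T \<and> fst a \<noteq> snd a \<and> {fst a, snd a} \<in> E"
  using edgeD[of "fst a" "snd a"] by (simp add: mem_orient edge_def)

text \<open>Any fixed order of the two onward neighbours will do; it turns descents from an edge
  into lists of booleans.\<close>

definition kids :: "'v \<times> 'v \<Rightarrow> 'v \<times> 'v" where
  "kids a = (SOME q. fst q \<noteq> snd q \<and> {x. {snd a, x} \<in> E} - {fst a} = {fst q, snd q})"

definition child :: "bool \<Rightarrow> 'v \<times> 'v \<Rightarrow> 'v \<times> 'v" where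
  "child b a = (snd a, if b then snd (kids a) else fst (kids a))"

lemma kids:
  assumes a: "a \<in> orient E"
  shows "fst (kids a) \<noteq> snd (kids a)" "{x. {snd a, x} \<in> E} - {fst a} = {fst (kids a), snd (kids a)}"
proof -
  have "fst a \<in> {x. {snd a, x} \<in> E}" using orientD[OF a] by (simp add: insert_commute)
  moreover have "card {x. {snd a, x} \<in> E} = 3" using degree orientD[OF a] by blast
  ultimately have "card ({x. {snd a, x} \<in> E} - {fst a}) = 2" by simp
  then obtain x y where "x \<noteq> y" "{x. {snd a, x} \<in> E} - {fst a} = {x, y}"
    by (auto simp: card_2_iff)
  then have "\<exists>q. fst q \<noteq> snd q \<and> {x. {snd a, x} \<in> E} - {fst a} = {fst q, snd q}"
    by (intro exI[of _ "(x, y)"]) simp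
  from someI_ex[OF this]
  show "fst (kids a) \<noteq> snd (kids a)" "{x. {snd a, x} \<in> E} - {fst a} = {fst (kids a), snd (kids a)}"
    unfolding kids_def by blast+
qed

lemma fst_child [simp]: "fst (child b a) = snd a" by (simp add: child_def)

lemma snd_child:
  assumes "a \<in> orient E"
  shows "{snd a, snd (child b a)} \<in> E" "snd (child b a) \<noteq> fst a"
proof -
  have "snd (child b a) \<in> {x. {snd a, x} \<in> E} - {fst a}"
    unfolding kids(2)[OF assms] by (simp add: child_def)
  then show "{snd a, snd (child b a)} \<in> E" "snd (child b a) \<noteq> fst a" by auto
qed

lemma child_orient [simp]: "a \<in> orient E \<Longrightarrow> child b a \<in> orient E"
  using snd_child(1)[of a b] by (simp add: mem_orient edge_def)

lemma child_inj: "a \<in> orient E \<Longrightarrow> snd (child b a) = snd (child b' a) \<Longrightarrow> b = b'"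
  using kids(1)[of a] by (auto simp: child_def split: if_splits)

lemma nbr_cases:
  assumes "a \<in> orient E" "{snd a, x} \<in> E"
  obtains "x = fst a" | b where "(snd a, x) = child b a"
proof (cases "x = fst a")
  case False
  then have "x \<in> {fst (kids a), snd (kids a)}" unfolding kids(2)[OF assms(1), symmetric] using assms(2) by simp
  then have "(snd a, x) = child False a \<or> (snd a, x) = child True a" by (auto simp: child_def)
  then show thesis using that(2) by blast
qed (rule that(1))

definition desc :: "'v \<times> 'v \<Rightarrow> bool list \<Rightarrow> 'v \<times> 'v" where
  "desc a l = fold child l a"

lemma desc_simps [simp]: "desc a [] = a" "desc a (b # l) = desc (child b a) l"
  "desc a (l @ l') = desc (desc a l) l'"
  by (simp_all add: desc_def)

lemma desc_orient [simp]: "a \<in> orient E \<Longrightarrow> desc a l \<in> orient E"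
  by (induction l arbitrary: a) auto

text \<open>Starts at \<open>fst a\<close>, so that \<open>nbw E (trail a l)\<close> also records
  that the first turn does not go back across a.\<close>

primrec trail :: "'v \<times> 'v \<Rightarrow> bool list \<Rightarrow> 'v list" where
  "trail a [] = [fst a, snd a]"
| "trail a (b # l) = fst a # trail (child b a) l"

lemma trail_Cons: "\<exists>xs. trail a l = fst a # snd a # xs"
proof (cases l)
  case (Cons b l')
  then show ?thesis by (cases l') auto
qed simp

lemma trail_last: "last (trail a l) = snd (desc a l)"
proof (induction l arbitrary: a)
  case (Cons b l)
  have "trail (child b a) l \<noteq> []" using trail_Cons[of "child b a" l] by auto
  then show ?case by (simp add: Cons)
qed simp

lemmas trail_ends = trail_Cons trail_last

lemma nbw_trail: "a \<in> orient E \<Longrightarrow> nbw E (trail a l)"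
proof (induction l arbitrary: a)
  case Nil
  then show ?case by (simp add: mem_orient edge_def)
next
  case (Cons b l)
  obtain xs where xs: "trail (child b a) l = snd a # snd (child b a) # xs"
    using trail_ends(1)[of "child b a" l] by auto
  have "nbw E (trail (child b a) l)" using Cons by simp
  then show ?case using snd_child[OF Cons.prems, of b] orientD[OF Cons.prems]
    by (auto simp: xs nbw_Cons[of E "fst a"])
qed

text \<open>Coordinates of all vertices relative to a: the boolean chooses the side of a, the list
  the descent on this side. Adjacency in these coordinates does not depend on a, so equating the
  coordinates for two edges gives an automorphism.\<close>

definition enc :: "'v \<times> 'v \<Rightarrow> bool \<times> bool list \<Rightarrow> 'v" where
  "enc a p = snd (desc (if fst p then a else rev_edge a) (snd p))"

lemma last_distinct_neq: "distinct (xs @ x # ys) \<Longrightarrow> ys \<noteq> [] \<Longrightarrow> last ys \<noteq> x"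
  by (metis distinct.simps(2) distinct_append last_in_set)

lemma desc_vertex_inj:
  assumes a: "a \<in> orient E" and eq: "snd (desc a l) = snd (desc a l')"
  shows "l = l'"
proof (rule ccontr)
  assume "l \<noteq> l'"
  \<comment> \<open>The two descents part at the end of their longest common prefix. If both go on,
    the reversed one followed by the other is non-backtracking, so its two ends differ; if one stops
    there, a single trail is enough.\<close>
  define m where "m = longest_common_prefix l l'"
  obtain k where k: "l = m @ k" using longest_common_prefix_prefix1[of l l'] by (auto simp: m_def prefix_def)
  obtain k' where k': "l' = m @ k'" using longest_common_prefix_prefix2[of l l'] by (auto simp: m_def prefix_def)
  define c where "c = desc a m"
  have c: "c \<in> orient E" using a by (simp add: c_def)
  have pre: "snd (desc c (b # k1)) \<noteq> snd c" for b k1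
  proof -
    obtain xs where xs: "trail (child b c) k1 = snd c # snd (child b c) # xs"
      using trail_ends(1)[of "child b c" k1] by auto
    have "distinct (trail (child b c) k1)" using c by (intro nbw_distinct nbw_trail) simp
    then have "last (snd (child b c) # xs) \<noteq> snd c"
      using last_distinct_neq[of "[]" "snd c" "snd (child b c) # xs"] by (simp add: xs)
    then show ?thesis using trail_ends(2)[of "child b c" k1] by (simp add: xs)
  qed
  have eqc: "snd (desc c k) = snd (desc c k')" using eq by (simp add: k k' c_def)
  show False
  proof (cases k)
    case Nil
    then show False using pre eqc \<open>l \<noteq> l'\<close> k k' by (cases k') auto
  next
    case (Cons b k1)
    show False
    proof (cases k')
      case Nil
      then show False using pre eqc Cons by auto
    next
      case (Cons b' k2)
      have "b \<noteq> b'"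
      proof
        assume "b = b'"
        then have "prefix (m @ [b]) l" "prefix (m @ [b]) l'"
          using \<open>k = b # k1\<close> Cons k k' by (auto simp: prefix_def)
        then have "prefix (m @ [b]) m" unfolding m_def by (rule longest_common_prefix_max_prefix)
        then show False by (simp add: prefix_def)
      qed
      obtain xs where xs: "trail (child b c) k1 = snd c # snd (child b c) # xs"
        using trail_ends(1)[of "child b c" k1] by auto
      obtain ys where ys: "trail (child b' c) k2 = snd c # snd (child b' c) # ys"
        using trail_ends(1)[of "child b' c" k2] by auto
      have "nbw E (rev (snd (child b c) # xs) @ snd c # (snd (child b' c) # ys))"
      proof (rule nbw_rev_append)
        show "nbw E (snd c # snd (child b c) # xs)" unfolding xs[symmetric] using c by (intro nbw_trail) simp
        show "nbw E (snd c # snd (child b' c) # ys)" unfolding ys[symmetric] using c by (intro nbw_trail) simp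
        show "snd (child b c) # xs = [] \<or> snd (child b' c) # ys = [] \<or>
            hd (snd (child b c) # xs) \<noteq> hd (snd (child b' c) # ys)"
          using child_inj[OF c] \<open>b \<noteq> b'\<close> by auto
      qed
      then have "distinct (rev (snd (child b c) # xs) @ snd c # (snd (child b' c) # ys))" by (rule nbw_distinct)
      then have disj: "set (snd (child b c) # xs) \<inter> set (snd (child b' c) # ys) = {}" by auto
      have "snd (desc c k) = last (snd (child b c) # xs)"
        using trail_ends(2)[of "child b c" k1] \<open>k = b # k1\<close> by (simp add: xs)
      moreover have "snd (desc c k') = last (snd (child b' c) # ys)"
        using trail_ends(2)[of "child b' c" k2] Cons by (simp add: ys)
      ultimately show False using disj eqc last_in_set[of "snd (child b c) # xs"] last_in_set[of "snd (child b' c) # ys"]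
        by (metis IntI empty_iff list.discI)
    qed
  qed
qed

text \<open>A trail on one side of a, reversed and continued by a trail on the other side, is a
  single non-backtracking walk across a.\<close>

lemma desc_vertex_sides:
  assumes a: "a \<in> orient E"
  shows "snd (desc a l) \<noteq> snd (desc (rev_edge a) l')"
proof -
  obtain ys where ys: "trail a l = fst a # snd a # ys" using trail_ends(1)[of a l] by auto
  obtain xs where xs: "trail (rev_edge a) l' = snd a # fst a # xs" using trail_ends(1)[of "rev_edge a" l'] by auto
  have n1: "nbw E (fst a # snd a # ys)" unfolding ys[symmetric] using a by (rule nbw_trail)
  have n2: "nbw E (snd a # fst a # xs)" unfolding xs[symmetric] using a by (intro nbw_trail) simp
  have "nbw E (rev xs @ fst a # (snd a # ys))"
    by (rule nbw_rev_append) (use n1 n2 in \<open>auto simp: nbw_Cons[of E "snd a"]\<close>)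
  then have d: "distinct (rev xs @ fst a # (snd a # ys))" by (rule nbw_distinct)
  have "snd (desc a l) = last (snd a # ys)" using trail_ends(2)[of a l] by (simp add: ys)
  then have 1: "snd (desc a l) \<in> set (snd a # ys)" using last_in_set[of "snd a # ys"] by simp
  have "snd (desc (rev_edge a) l') = last (fst a # xs)" using trail_ends(2)[of "rev_edge a" l'] by (simp add: xs)
  then have 2: "snd (desc (rev_edge a) l') \<in> set (fst a # xs)" using last_in_set[of "fst a # xs"] by simp
  have "set (fst a # xs) \<inter> set (snd a # ys) = {}" using d by auto
  with 1 2 show ?thesis by (metis IntI empty_iff)
qed

lemma enc_inj: "a \<in> orient E \<Longrightarrow> inj (enc a)"
proof (rule injI)
  fix p q assume a: "a \<in> orient E" and eq: "enc a p = enc a q"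
  obtain s l s' l' where pq: "p = (s, l)" "q = (s', l')" by (cases p, cases q)
  have ra: "rev_edge a \<in> orient E" using a by simp
  show "p = q"
    using eq desc_vertex_inj[OF a, of l l'] desc_vertex_inj[OF ra, of l l']
      desc_vertex_sides[OF a, of l l'] desc_vertex_sides[OF a, of l' l]
    by (cases s; cases s') (auto simp: enc_def pq)
qed

end

context regular_tree
begin

lemma enc_simps [simp]: "enc a (True, l) = snd (desc a l)" "enc a (False, l) = snd (desc (rev_edge a) l)"
  by (simp_all add: enc_def)

lemma fst_desc_snoc: "fst (desc a (l @ [b])) = snd (desc a l)"
  by simp

lemma enc_T: "a \<in> orient E \<Longrightarrow> enc a p \<in> T"
  using orientD[of "desc a (snd p)"] orientD[of "desc (rev_edge a) (snd p)"] by (simp add: enc_def)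

text \<open>The edge relation in the coordinates of \<open>enc\<close>; the second alternative is
  the edge a itself.\<close>

definition adj :: "bool \<times> bool list \<Rightarrow> bool \<times> bool list \<Rightarrow> bool" where
  "adj p q \<longleftrightarrow> fst p = fst q \<and> (\<exists>b. snd q = snd p @ [b] \<or> snd p = snd q @ [b]) \<or>
     fst p \<noteq> fst q \<and> snd p = [] \<and> snd q = []"

lemma enc_parent:
  assumes a: "a \<in> orient E"
  shows "{enc a (s, l), enc a (s, l @ [b])} \<in> E"
  using snd_child(1)[of "desc a l" b] snd_child(1)[of "desc (rev_edge a) l" b] a by (cases s) simp_all

lemma enc_root:
  assumes a: "a \<in> orient E" and "s \<noteq> s'"
  shows "{enc a (s, []), enc a (s', [])} \<in> E"
  using orientD[OF a] assms(2) by (cases s; cases s') (auto simp: insert_commute)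

lemma adj_edge:
  assumes a: "a \<in> orient E" and "adj p q"
  shows "{enc a p, enc a q} \<in> E"
proof -
  obtain s l s' l' where pq: "p = (s, l)" "q = (s', l')" by (cases p, cases q)
  consider b where "s = s'" "l' = l @ [b]" | b where "s = s'" "l = l' @ [b]" | "s \<noteq> s'" "l = []" "l' = []"
    using assms(2) unfolding adj_def pq by auto
  then show ?thesis
  proof cases
    case 1 then show ?thesis using enc_parent[OF a] pq by simp
  next
    case 2 then show ?thesis using enc_parent[OF a, of s' l'] pq by (simp add: insert_commute)
  next
    case 3 then show ?thesis using enc_root[OF a] pq by simp
  qed
qed

lemma enc_nbr:
  assumes a: "a \<in> orient E" and x: "{enc a p, x} \<in> E"
  shows "\<exists>q. adj p q \<and> x = enc a q"
proof -
  obtain s l where p: "p = (s, l)" by (cases p)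
  define c where "c = (if s then a else rev_edge a)"
  have c: "c \<in> orient E" using a by (simp add: c_def)
  have enc: "enc a (s, l') = snd (desc c l')" for l' by (simp add: c_def enc_def)
  have "{snd (desc c l), x} \<in> E" using x by (simp add: p enc)
  with desc_orient[OF c] show ?thesis
  proof (rule nbr_cases)
    fix b assume "(snd (desc c l), x) = child b (desc c l)"
    then have "x = enc a (s, l @ [b])" unfolding enc by (simp, metis snd_conv)
    then show ?thesis by (intro exI[of _ "(s, l @ [b])"]) (simp add: p adj_def)
  next
    assume x: "x = fst (desc c l)"
    show ?thesis
    proof (cases l rule: rev_cases)
      case Nil
      then have "x = enc a (\<not> s, [])" using x by (cases s) (simp_all add: c_def)
      then show ?thesis using Nil by (intro exI[of _ "(\<not> s, [])"]) (simp add: p adj_def)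
    next
      case (snoc l' b)
      then have "x = enc a (s, l')" using x by (simp add: enc)
      then show ?thesis using snoc by (intro exI[of _ "(s, l')"]) (simp add: p adj_def)
    qed
  qed
qed

lemma edge_adj: "a \<in> orient E \<Longrightarrow> {enc a p, enc a q} \<in> E \<longleftrightarrow> adj p q"
  using enc_nbr[of a p "enc a q"] enc_inj[of a] adj_edge[of a p q] by (metis injD)

lemma range_enc:
  assumes a: "a \<in> orient E"
  shows "range (enc a) = T"
proof
  show "range (enc a) \<subseteq> T" using enc_T[OF a] by auto
  show "T \<subseteq> range (enc a)"
  proof
    fix v assume v: "v \<in> T"
    have "(snd a, v) \<in> (orient E)\<^sup>*" using conn v orientD[OF a] unfolding connected_graph_def by blast
    then show "v \<in> range (enc a)"
    proof (induction rule: rtrancl_induct)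
      case base
      have "snd a = enc a (True, [])" by simp
      then show ?case by blast
    next
      case (step y z)
      then obtain p where "y = enc a p" by blast
      then show ?case using step(2) enc_nbr[OF a, of p z] by (auto simp: orient_def)
    qed
  qed
qed

lemma bij_enc: "a \<in> orient E \<Longrightarrow> bij_betw (enc a) UNIV T"
  by (simp add: bij_betw_def enc_inj range_enc)

text \<open>Witnesses that automorphisms act transitively on oriented edges. It carries every
  descent from a to the same descent from a', so the chosen orders of successors are
  respected.\<close>

definition shift :: "'v \<times> 'v \<Rightarrow> 'v \<times> 'v \<Rightarrow> 'v \<Rightarrow> 'v" where
  "shift a a' v = enc a' (inv (enc a) v)"

lemma shift_enc: "a \<in> orient E \<Longrightarrow> shift a a' (enc a p) = enc a' p"
  by (simp add: shift_def inv_f_f enc_inj)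

lemma shift_automorphism:
  assumes a: "a \<in> orient E" and a': "a' \<in> orient E"
  shows "automorphism T E (shift a a')"
  unfolding automorphism_def
proof (intro conjI ballI)
  have "shift a a' = enc a' \<circ> inv (enc a)" by (auto simp: shift_def)
  moreover have "bij_betw (inv (enc a)) T UNIV"
    using bij_betw_inv_into[OF bij_enc[OF a]] .
  ultimately show "bij_betw (shift a a') T T" using bij_betw_trans[OF _ bij_enc[OF a']] by metis
  fix v w assume "v \<in> T" "w \<in> T"
  then obtain p q where "v = enc a p" "w = enc a q" using range_enc[OF a] by blast
  then show "{shift a a' v, shift a a' w} \<in> E \<longleftrightarrow> {v, w} \<in> E"
    by (simp add: shift_enc a a' edge_adj)
qed

lemma shift_desc:
  assumes a: "a \<in> orient E"
  shows "shift a a' (fst (desc a l)) = fst (desc a' l)" "shift a a' (snd (desc a l)) = snd (desc a' l)"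
proof -
  show s: "shift a a' (snd (desc a l)) = snd (desc a' l)" for l
    using shift_enc[OF a, of a' "(True, l)"] by simp
  have r: "shift a a' (fst a) = fst a'"
    using shift_enc[OF a, of a' "(False, [])"] by simp
  show "shift a a' (fst (desc a l)) = fst (desc a' l)"
  proof (cases l rule: rev_cases)
    case (snoc l' b)
    then show ?thesis using s[of l'] by simp
  qed (simp add: r)
qed

lemma T_edge_exists: "\<exists>a. a \<in> orient E"
proof -
  obtain v where "v \<in> T" using T_nonempty by blast
  then have "{w. {v, w} \<in> E} \<noteq> {}" using degree[of v] by force
  then obtain w where "{v, w} \<in> E" by blast
  then show ?thesis by (auto simp: orient_def)
qed

lemma E_cases:
  assumes a: "a \<in> orient E" and e: "e \<in> E"
  obtains l where "e = edge (desc a l)" | l where "e = edge (desc (rev_edge a) l)"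
proof -
  obtain v w where vw: "v \<in> T" "w \<in> T" "e = {v, w}" using simple e unfolding simple_graph_def by blast
  then obtain p q where pq: "v = enc a p" "w = enc a q" using range_enc[OF a] by blast
  have "adj p q" using e vw pq edge_adj[OF a] by simp
  then have sub: "\<exists>l. e = edge (desc a l) \<or> e = edge (desc (rev_edge a) l)"
    if "fst p = fst q" "snd q = snd p @ [b]" "e = {enc a p, enc a q}" for p q b
  proof -
    obtain s l where p: "p = (s, l)" by (cases p)
    then have q: "q = (s, l @ [b])" using that by (cases q) auto
    show ?thesis
    proof (cases s)
      case True
      then have "e = edge (desc a (l @ [b]))" using that(3) by (simp add: p q edge_def)
      then show ?thesis by blast
    next
      case False
      then have "e = edge (desc (rev_edge a) (l @ [b]))" using that(3) by (simp add: p q edge_def)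
      then show ?thesis by blast
    qed
  qed
  have "\<exists>l. e = edge (desc a l) \<or> e = edge (desc (rev_edge a) l)"
  proof (cases "fst p = fst q")
    case True
    with \<open>adj p q\<close> obtain b where "snd q = snd p @ [b] \<or> snd p = snd q @ [b]" by (auto simp: adj_def)
    then show ?thesis using sub[of p q b] sub[of q p b] True vw(3) pq by (auto simp: insert_commute)
  next
    case False
    with \<open>adj p q\<close> have "snd p = []" "snd q = []" by (auto simp: adj_def)
    then have "e = edge (desc a [])" using False vw(3) pq
      by (cases p; cases q; cases "fst p"; cases "fst q") (auto simp: edge_def)
    then show ?thesis by blast
  qed
  then show thesis using that by blast
qed

text \<open>The finite subtrees to which the independence hypothesis is applied. Radius 0 is a
  single vertex and yields the recursion; large radii have many boundary edges, all descendants of a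
  except the reversal of a.\<close>

definition ball_side :: "'v \<times> 'v \<Rightarrow> nat \<Rightarrow> 'v set" where
  "ball_side a n = {snd (desc a l) | l. length l \<le> n}"

lemma finite_ball_side: "finite (ball_side a n)"
proof -
  have "finite {l::bool list. length l \<le> n}" using finite_lists_length_le[of "UNIV :: bool set" n] by simp
  moreover have "ball_side a n = (\<lambda>l. snd (desc a l)) ` {l. length l \<le> n}" by (auto simp: ball_side_def)
  ultimately show ?thesis by simp
qed

lemma ball_side_mem: "a \<in> orient E \<Longrightarrow> snd (desc a l) \<in> ball_side a n \<longleftrightarrow> length l \<le> n"
  using desc_vertex_inj[of a l] by (auto simp: ball_side_def)

lemma root_notin_ball_side: "a \<in> orient E \<Longrightarrow> fst a \<notin> ball_side a n"
proof
  assume a: "a \<in> orient E" and "fst a \<in> ball_side a n"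
  then obtain l where "fst a = snd (desc a l)" by (auto simp: ball_side_def)
  then show False using desc_vertex_sides[OF a, of l "[]"] by simp
qed

lemma subtree_ball_side:
  assumes a: "a \<in> orient E"
  shows "subtree T E (ball_side a n)"
  unfolding subtree_def tree_def
proof (intro conjI)
  let ?S = "ball_side a n" let ?F = "edges_within E (ball_side a n)"
  show S: "?S \<subseteq> T" using orientD[OF desc_orient[OF a]] by (auto simp: ball_side_def)
  show "?S \<noteq> {}" using ball_side_mem[OF a, of "[]" n] by (metis empty_iff le0 list.size(3))
  show "simple_graph ?S ?F"
    unfolding simple_graph_def
  proof
    fix e assume e: "e \<in> ?F"
    then have eE: "e \<in> E" and eS: "e \<subseteq> ?S" by (simp_all add: edges_within_def)
    from eE simple obtain v w where vw: "v \<noteq> w" "e = {v, w}" unfolding simple_graph_def by blast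
    then show "\<exists>v\<in>?S. \<exists>w\<in>?S. v \<noteq> w \<and> e = {v, w}" using eS
      by (intro bexI[of _ v] bexI[of _ w]) simp_all
  qed
  show "\<nexists>p. graph_cycle ?F p"
  proof
    assume "\<exists>p. graph_cycle ?F p"
    then obtain p where "graph_cycle ?F p" by blast
    then have "graph_cycle E p" unfolding graph_cycle_def edges_within_def by blast
    then show False using acyclic by blast
  qed
  have root: "(snd a, snd (desc a l)) \<in> (orient ?F)\<^sup>* \<and> (snd (desc a l), snd a) \<in> (orient ?F)\<^sup>*" if "length l \<le> n" for l
    using that
  proof (induction l rule: rev_induct)
    case (snoc b l)
    have "{snd (desc a l), snd (desc a (l @ [b]))} \<in> E" using enc_parent[OF a, of True l b] by simp
    moreover have "snd (desc a l) \<in> ?S" "snd (desc a (l @ [b])) \<in> ?S"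
      using snoc.prems ball_side_mem[OF a, of l n] ball_side_mem[OF a, of "l @ [b]" n] by simp_all
    ultimately have F: "{snd (desc a l), snd (desc a (l @ [b]))} \<in> ?F" by (simp add: edges_within_def)
    then have o1: "(snd (desc a l), snd (desc a (l @ [b]))) \<in> orient ?F" by (simp add: orient_def)
    have o2: "(snd (desc a (l @ [b])), snd (desc a l)) \<in> orient ?F"
      using F by (simp add: orient_def insert_commute)
    have "length l \<le> n" using snoc.prems by simp
    then have "(snd a, snd (desc a l)) \<in> (orient ?F)\<^sup>*" "(snd (desc a l), snd a) \<in> (orient ?F)\<^sup>*"
      using snoc.IH by blast+
    then show ?case using rtrancl_into_rtrancl[OF _ o1] converse_rtrancl_into_rtrancl[OF o2] by blast
  qed simp
  show "connected_graph ?S ?F"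
    unfolding connected_graph_def
  proof (intro ballI)
    fix v w assume "v \<in> ?S" "w \<in> ?S"
    then obtain l l' where "v = snd (desc a l)" "length l \<le> n" "w = snd (desc a l')" "length l' \<le> n"
      by (auto simp: ball_side_def)
    then have "(v, snd a) \<in> (orient ?F)\<^sup>*" "(snd a, w) \<in> (orient ?F)\<^sup>*" using root[of l] root[of l'] by simp_all
    then show "(v, w) \<in> (orient ?F)\<^sup>*" by (rule rtrancl_trans)
  qed
qed

lemma boundary_ball_side:
  assumes a: "a \<in> orient E"
  shows "boundary T E (ball_side a n) = insert (rev_edge a) (desc a ` {l. length l = Suc n})"
proof
  show "boundary T E (ball_side a n) \<subseteq> insert (rev_edge a) (desc a ` {l. length l = Suc n})"
  proof
    fix d assume "d \<in> boundary T E (ball_side a n)"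
    then obtain x y where d: "d = (x, y)" "{x, y} \<in> E" "x \<in> ball_side a n" "y \<notin> ball_side a n"
      by (auto simp: boundary_def orient_def)
    then obtain l where l: "x = snd (desc a l)" "length l \<le> n" by (auto simp: ball_side_def)
    have "{snd (desc a l), y} \<in> E" using d l by simp
    with desc_orient[OF a] show "d \<in> insert (rev_edge a) (desc a ` {l. length l = Suc n})"
    proof (rule nbr_cases)
      assume y: "y = fst (desc a l)"
      show ?thesis
      proof (cases l rule: rev_cases)
        case Nil
        then show ?thesis using d l y by (simp add: rev_edge_def)
      next
        case (snoc l' b)
        then have "y = snd (desc a l')" "length l' \<le> n" using y l by auto
        then show ?thesis using d by (auto simp: ball_side_def)
      qed
    next
      fix b assume b: "(snd (desc a l), y) = child b (desc a l)"
      then have db: "d = desc a (l @ [b])" using d l by simp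
      then have "y = snd (desc a (l @ [b]))" using d(1) by (metis snd_conv)
      then have "\<not> length (l @ [b]) \<le> n" using d(4) ball_side_mem[OF a] by blast
      then have "length (l @ [b]) = Suc n" using l by simp
      then show ?thesis using db by blast
    qed
  qed
  have "rev_edge a \<in> boundary T E (ball_side a n)"
  proof -
    have "rev_edge a \<in> orient E" using a by simp
    moreover have "fst (rev_edge a) \<in> ball_side a n" using ball_side_mem[OF a, of "[]" n] by simp
    moreover have "snd (rev_edge a) \<in> T - ball_side a n"
      using root_notin_ball_side[OF a] orientD[OF a] by simp
    ultimately show ?thesis unfolding boundary_def by (simp only: mem_Collect_eq split_beta prod.collapse simp_thms)
  qed
  moreover have "desc a l \<in> boundary T E (ball_side a n)" if l: "length l = Suc n" for l
  proof -
    obtain l' b where lb: "l = l' @ [b]" using l by (cases l rule: rev_cases) auto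
    have "fst (desc a l) \<in> ball_side a n" unfolding lb fst_desc_snoc using ball_side_mem[OF a] l lb by simp
    moreover have "snd (desc a l) \<notin> ball_side a n" using ball_side_mem[OF a] l by simp
    moreover have "desc a l \<in> orient E" using a by simp
    ultimately show ?thesis using orientD[of "desc a l"] unfolding boundary_def
      by (simp only: mem_Collect_eq split_beta Diff_iff prod.collapse simp_thms)
  qed
  ultimately show "insert (rev_edge a) (desc a ` {l. length l = Suc n}) \<subseteq> boundary T E (ball_side a n)" by auto
qed

lemma desc_inj: "a \<in> orient E \<Longrightarrow> inj (desc a)"
proof (rule injI)
  fix l l' assume a: "a \<in> orient E" and "desc a l = desc a l'"
  then have "snd (desc a l) = snd (desc a l')" by (simp only:)
  with a show "l = l'" by (rule desc_vertex_inj)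
qed

lemma ray_desc:
  assumes "ray E r"
  shows "\<exists>s. \<forall>n. r n = desc (r 0) (map s [0..<n])"
proof -
  have "\<exists>b. r (Suc n) = child b (r n)" for n
  proof -
    have r: "r n \<in> orient E" "r (Suc n) \<in> orient E" "fst (r (Suc n)) = snd (r n)" "snd (r (Suc n)) \<noteq> fst (r n)"
    proof -
      have *: "\<forall>n. r n \<in> orient E" "\<forall>n\<ge>1. fst (r n) = snd (r (n - 1)) \<and> snd (r n) \<noteq> fst (r (n - 1))"
        using assms unfolding ray_def by blast+
      show "r n \<in> orient E" "r (Suc n) \<in> orient E" using *(1) by blast+
      show "fst (r (Suc n)) = snd (r n)" "snd (r (Suc n)) \<noteq> fst (r n)"
        using spec[OF *(2), of "Suc n"] by simp_all
    qed
    have "{snd (r n), snd (r (Suc n))} \<in> E" using orientD[OF r(2)] r(3) by simp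
    with r(1) show ?thesis
    proof (rule nbr_cases)
      assume "snd (r (Suc n)) = fst (r n)" then show ?thesis using r(4) by blast
    next
      fix b assume "(snd (r n), snd (r (Suc n))) = child b (r n)"
      then have "r (Suc n) = child b (r n)" using r(3) by (simp add: prod_eq_iff)
      then show ?thesis by blast
    qed
  qed
  then have "\<forall>n. \<exists>b. r (Suc n) = child b (r n)" by blast
  from choice[OF this] obtain s where s: "\<And>n. r (Suc n) = child (s n) (r n)" by blast
  have "r n = desc (r 0) (map s [0..<n])" for n
    by (induction n) (simp_all add: s)
  then show ?thesis by blast
qed

lemma desc_ray:
  assumes a: "a \<in> orient E"
  shows "ray E (\<lambda>n. desc a (map s [0..<n]))"
  unfolding ray_def
proof (intro conjI allI impI)
  fix n :: nat assume "1 \<le> n"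
  then obtain k where k: "n = Suc k" by (cases n) auto
  show "fst (desc a (map s [0..<n])) = snd (desc a (map s [0..<n - 1]))"
    "snd (desc a (map s [0..<n])) \<noteq> fst (desc a (map s [0..<n - 1]))"
    using snd_child(2)[OF desc_orient[OF a]] by (simp_all add: k)
qed (use a in simp)

lemma descendants_eq:
  assumes a: "a \<in> orient E"
  shows "descendants E a = range (desc a)"
proof
  show "descendants E a \<subseteq> range (desc a)"
  proof
    fix d assume "d \<in> descendants E a"
    then obtain r n where r: "d = r n" "ray E r" "r 0 = a" unfolding descendants_def by blast
    from ray_desc[OF r(2)] obtain s where "\<And>n. r n = desc (r 0) (map s [0..<n])" by blast
    then have "d = desc a (map s [0..<n])" using r by simp
    then show "d \<in> range (desc a)" by blast
  qed
  show "range (desc a) \<subseteq> descendants E a"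
  proof
    fix d assume "d \<in> range (desc a)"
    then obtain l where l: "d = desc a l" by blast
    define s where "s = (\<lambda>i. i < length l \<and> l ! i)"
    have "map s [0..<length l] = l" by (rule nth_equalityI) (auto simp: s_def)
    then have "d = (\<lambda>n. desc a (map s [0..<n])) (length l)" using l by simp
    then show "d \<in> descendants E a"
      unfolding descendants_def using desc_ray[OF a, of s]
      by (intro CollectI exI[of _ "\<lambda>n. desc a (map s [0..<n])"] exI[of _ "length l"]) simp
  qed
qed

section \<open>Frozen edges read off along the binary tree beyond an edge\<close>

definition code :: "('v set \<Rightarrow> real) \<Rightarrow> ('v \<times> 'v) set \<Rightarrow> 'v \<times> 'v \<Rightarrow> bool list \<Rightarrow> real \<times> bool" where
  "code u D a = (\<lambda>l. (u (edge (desc a l)), desc a l \<in> D))"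

lemma opn_code:
  assumes a: "a \<in> orient E"
  shows "opn (code u D a) t \<longleftrightarrow> (\<exists>r. ray E r \<and> r 0 = a \<and> (\<forall>n\<ge>1. u (edge (r n)) \<le> t \<and> r n \<notin> D))"
proof
  assume "opn (code u D a) t"
  then obtain s where "\<And>n. n \<ge> 1 \<Longrightarrow> u (edge (desc a (map s [0..<n]))) \<le> t \<and> desc a (map s [0..<n]) \<notin> D"
    unfolding opn_def code_def by auto
  then show "\<exists>r. ray E r \<and> r 0 = a \<and> (\<forall>n\<ge>1. u (edge (r n)) \<le> t \<and> r n \<notin> D)"
    using desc_ray[OF a, of s] by (intro exI[of _ "\<lambda>n. desc a (map s [0..<n])"]) auto
next
  assume "\<exists>r. ray E r \<and> r 0 = a \<and> (\<forall>n\<ge>1. u (edge (r n)) \<le> t \<and> r n \<notin> D)"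
  then obtain r where r: "ray E r" "r 0 = a" "\<And>n. n \<ge> 1 \<Longrightarrow> u (edge (r n)) \<le> t \<and> r n \<notin> D" by blast
  obtain s where "\<And>n. r n = desc a (map s [0..<n])" using ray_desc[OF r(1)] r(2) by blast
  then show "opn (code u D a) t" unfolding opn_def code_def using r(3) by (intro exI[of _ s]) auto
qed

lemma code_append: "(\<lambda>l'. code u D a (l @ l')) = code u D (desc a l)"
  by (simp add: code_def fun_eq_iff)

lemma code_sub: "sub b (code u D a) = code u D (child b a)"
  by (simp add: code_def sub_def fun_eq_iff)

end

context regular_tree
begin

text \<open>Were s at most the label of the child, its path would exist at the time of this label
  and the child would be frozen. So the label is below s, and the child can be put in front of the
  path.\<close>

lemma opn_code_prepend:
  assumes a: "a \<in> orient E" and o: "opn (code u D (child b a)) s"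
    and "child b a \<notin> D" and ok: "child b a \<in> D \<longleftrightarrow> opn (code u D (child b a)) (u (edge (child b a)))"
  shows "opn (code u D a) s"
proof -
  have "\<not> s \<le> u (edge (child b a))"
  proof
    assume "s \<le> u (edge (child b a))"
    with o have "opn (code u D (child b a)) (u (edge (child b a)))" by (rule opn_mono)
    with ok assms(3) show False by simp
  qed
  then have "fst (code u D (child b a) []) \<le> s \<and> \<not> snd (code u D (child b a) []) \<and> opn (code u D (child b a)) s"
    using o assms(3) by (simp add: code_def)
  then show ?thesis unfolding opn_step[of "code u D a"] code_sub by blast
qed

text \<open>If \<open>a\<close> freezes, consider the ray from \<open>a\<close> that percolates first, say at time \<open>t0\<close>. Were the
  reversal of one of its edges frozen, the ray witnessing this would branch off and percolate from
  \<open>a\<close> before time \<open>t0\<close>.\<close>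

lemma frozen_iff_unoriented:
  assumes ok: "\<And>d. d \<in> orient E \<Longrightarrow> d \<in> D \<longleftrightarrow> opn (code u D d) (u (edge d))"
    and bounds: "\<And>e. e \<in> E \<Longrightarrow> 0 \<le> u e \<and> u e \<le> 1" and a: "a \<in> orient E"
  shows "a \<in> D \<longleftrightarrow> opn (code u {c. c \<in> D \<or> rev_edge c \<in> D} a) (u (edge a))"
proof
  assume "opn (code u {c. c \<in> D \<or> rev_edge c \<in> D} a) (u (edge a))"
  then obtain r where "ray E r" "r 0 = a"
    "\<And>n. n \<ge> 1 \<Longrightarrow> u (edge (r n)) \<le> u (edge a) \<and> r n \<notin> {c. c \<in> D \<or> rev_edge c \<in> D}"
    unfolding opn_code[OF a] by blast
  then have "opn (code u D a) (u (edge a))" unfolding opn_code[OF a] by (intro exI[of _ r]) simp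
  then show "a \<in> D" using ok[OF a] by simp
next
  assume "a \<in> D"
  then have oa: "opn (code u D a) (u (edge a))" using ok[OF a] by simp
  have ua: "0 \<le> u (edge a)" "u (edge a) \<le> 1" using bounds a by (auto simp: mem_orient)
  \<comment> \<open>The earliest time is attained, so there is a ray with labels at most t0 and no
    frozen edge. What has to be shown is that no reversal of its edges is frozen either.\<close>
  define t0 where "t0 = branch_time (code u D a)"
  have t0u: "t0 \<le> u (edge a)" using branch_time_le_iff[OF ua] oa by (simp add: t0_def)
  then have t0: "0 \<le> t0" "t0 \<le> 1" using branch_time_cases[of "code u D a"] ua by (auto simp: t0_def)
  have ot0: "opn (code u D a) t0" using branch_time_le_iff[OF t0, of "code u D a"] by (simp add: t0_def)
  then obtain r where r: "ray E r" "r 0 = a" "\<And>n. n \<ge> 1 \<Longrightarrow> u (edge (r n)) \<le> t0 \<and> r n \<notin> D"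
    unfolding opn_code[OF a] by blast
  from ray_desc[OF r(1)] obtain sg where sg: "\<And>n. r n = desc (r 0) (map sg [0..<n])" by blast
  have rS: "r (Suc n) = child (sg n) (r n)" for n
  proof -
    have "r (Suc n) = desc (r 0) (map sg [0..<Suc n])" by (rule sg)
    also have "\<dots> = child (sg n) (desc (r 0) (map sg [0..<n]))" by simp
    also have "desc (r 0) (map sg [0..<n]) = r n" by (rule sg[symmetric])
    finally show ?thesis .
  qed
  have ro: "r n \<in> orient E" for n using r(1) unfolding ray_def by blast
  have "rev_edge (r n) \<notin> D" if n: "n \<ge> 1" for n
  proof
    assume rv: "rev_edge (r n) \<in> D"
    define s where "s = u (edge (r n))"
    have s01: "0 \<le> s" "s \<le> 1" using bounds ro by (auto simp: s_def mem_orient)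
    have "ray E (\<lambda>i. r (n + i))"
      unfolding ray_def
    proof (intro conjI allI impI)
      show "r (n + i) \<in> orient E" for i by (rule ro)
      fix i :: nat assume "1 \<le> i"
      then obtain k where k: "i = Suc k" by (cases i) auto
      have "\<forall>i\<ge>1. fst (r i) = snd (r (i - 1)) \<and> snd (r i) \<noteq> fst (r (i - 1))"
        using r(1) unfolding ray_def by blast
      from spec[OF this, of "Suc (n + k)"]
      show "fst (r (n + i)) = snd (r (n + (i - 1)))" "snd (r (n + i)) \<noteq> fst (r (n + (i - 1)))"
        by (simp_all add: k)
    qed
    then have orn: "opn (code u D (r n)) t0"
      unfolding opn_code[OF ro] using r(3) by (intro exI[of _ "\<lambda>i. r (n + i)"]) simp
    have "\<not> opn (code u D (r n)) s" using ok[OF ro[of n]] r(3)[OF n] by (simp add: s_def)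
    then have st: "s < t0" using opn_mono[OF orn, of s] by linarith
    have "opn (code u D (rev_edge (r n))) s"
      using ok[of "rev_edge (r n)"] rv ro[of n] by (simp add: s_def)
    then obtain q where q: "ray E q" "q 0 = rev_edge (r n)" "\<And>i. i \<ge> 1 \<Longrightarrow> u (edge (q i)) \<le> s \<and> q i \<notin> D"
      unfolding opn_code[OF iffD2[OF rev_edge_orient ro[of n]]] by blast
    have qo: "q i \<in> orient E" and qS: "fst (q (Suc i)) = snd (q i)" "snd (q (Suc i)) \<noteq> fst (q i)" for i
    proof -
      have *: "\<forall>i. q i \<in> orient E" "\<forall>i\<ge>1. fst (q i) = snd (q (i - 1)) \<and> snd (q i) \<noteq> fst (q (i - 1))"
        using q(1) unfolding ray_def by blast+
      show "q i \<in> orient E" using *(1) by blast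
      show "fst (q (Suc i)) = snd (q i)" "snd (q (Suc i)) \<noteq> fst (q i)" using spec[OF *(2), of "Suc i"] by simp_all
    qed
    have "q n \<noteq> rev_edge (r 0)"
    proof
      assume "q n = rev_edge (r 0)"
      then have "u (edge a) \<le> s" using q(3)[OF n] r(2) by simp
      then show False using st t0u by simp
    qed
    then have ex: "\<exists>j. j \<le> n \<and> q j \<noteq> rev_edge (r (n - j))" by (intro exI[of _ n]) simp
    \<comment> \<open>The witnessing ray \<open>q\<close> may first retrace \<open>r\<close>
      backwards; j is the first index at which it has left it. It leaves by step n, for otherwise it
      would cross a, whose label is at least t0 > s.\<close>
    define j where "j = (LEAST j. j \<le> n \<and> q j \<noteq> rev_edge (r (n - j)))"
    have j: "j \<le> n" "q j \<noteq> rev_edge (r (n - j))" using LeastI_ex[OF ex] by (simp_all add: j_def)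
    have "j \<noteq> 0" using j q(2) by (intro notI) simp
    then obtain i where i: "j = Suc i" by (cases j) auto
    have "q i = rev_edge (r (n - i))"
      using not_less_Least[of i "\<lambda>j. j \<le> n \<and> q j \<noteq> rev_edge (r (n - j))"] i j by (simp add: j_def[symmetric])
    moreover define k where "k = n - j"
    moreover have "n - i = Suc k" using i j by (simp add: k_def)
    ultimately have qi: "q i = rev_edge (r (Suc k))" by simp
    have fj: "fst (q j) = snd (r k)" using qS(1)[of i] by (simp add: i qi rS)
    have sj: "snd (q j) \<noteq> fst (r k)"
    proof
      assume "snd (q j) = fst (r k)"
      then have "q j = rev_edge (r k)" using fj by (simp add: rev_edge_def prod_eq_iff)
      then show False using j by (simp add: k_def)
    qed
    \<comment> \<open>The edge \<open>r k\<close> followed by \<open>q\<close> after its departure.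
      Its later edges are unfrozen with labels at most s, so \<open>opn_code_prepend\<close> moves
      the start back along \<open>r\<close> to a and yields a path by time s < t0.\<close>
    define r' where "r' = case_nat (r k) (\<lambda>i. q (j + i))"
    have "ray E r'"
      unfolding ray_def
    proof (intro conjI allI impI)
      show "r' i \<in> orient E" for i by (cases i) (simp_all add: r'_def ro qo)
      fix m :: nat assume "1 \<le> m"
      then obtain m' where m': "m = Suc m'" by (cases m) auto
      show "fst (r' m) = snd (r' (m - 1))" "snd (r' m) \<noteq> fst (r' (m - 1))"
        using fj sj qS[of "j + (m' - 1)"] by (cases m'; simp add: m' r'_def)+
    qed
    moreover have "u (edge (r' m)) \<le> s \<and> r' m \<notin> D" if "m \<ge> 1" for m
      using that q(3)[of "j + (m - 1)"] i by (cases m) (simp_all add: r'_def)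
    moreover have "r' 0 = r k" by (simp add: r'_def)
    ultimately have ork: "opn (code u D (r k)) s" unfolding opn_code[OF ro] by blast
    have "opn (code u D (r 0)) s" if "opn (code u D (r k)) s" for k
      using that
    proof (induction k)
      case (Suc k)
      have "opn (code u D (r k)) s"
      proof (rule opn_code_prepend[OF ro, where b = "sg k"])
        show "opn (code u D (child (sg k) (r k))) s" using Suc.prems by (simp add: rS)
        show "child (sg k) (r k) \<notin> D" using r(3)[of "Suc k"] by (simp add: rS)
        show "child (sg k) (r k) \<in> D \<longleftrightarrow> opn (code u D (child (sg k) (r k))) (u (edge (child (sg k) (r k))))"
          by (rule ok) (simp add: ro)
      qed
      then show ?case by (rule Suc.IH)
    qed
    from this[OF ork] have "t0 \<le> s" using branch_time_le_iff[OF s01] by (simp add: t0_def r(2))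
    then show False using st by simp
  qed
  then have "\<exists>r. ray E r \<and> r 0 = a \<and> (\<forall>n\<ge>1. u (edge (r n)) \<le> t0 \<and> r n \<notin> {c. c \<in> D \<or> rev_edge c \<in> D})"
    using r by (intro exI[of _ r]) simp
  then have "opn (code u {c. c \<in> D \<or> rev_edge c \<in> D} a) t0" unfolding opn_code[OF a] .
  then show "opn (code u {c. c \<in> D \<or> rev_edge c \<in> D} a) (u (edge a))" using t0u by (rule opn_mono)
qed

end

section \<open>Measurability and self-similarity beyond an edge\<close>

lemma space_subset_space [simp]: "space (subset_space A) = Pow A"
  by (simp add: subset_space_def space_measure_of_conv)

lemma sets_subset_space:
  "sets (subset_space A) = sigma_sets (Pow A) ((\<lambda>a. {B \<in> Pow A. a \<in> B}) ` A)"
  unfolding subset_space_def by (rule sets_measure_of) auto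

lemma subset_space_mem: "a \<in> A \<Longrightarrow> {B \<in> space (subset_space A). a \<in> B} \<in> sets (subset_space A)"
  unfolding sets_subset_space by (rule sigma_sets.Basic) auto

lemma measurable_subset_spaceI:
  assumes "\<And>x. x \<in> space M \<Longrightarrow> f x \<subseteq> A" "\<And>a. a \<in> A \<Longrightarrow> {x \<in> space M. a \<in> f x} \<in> sets M"
  shows "f \<in> measurable M (subset_space A)"
  unfolding subset_space_def
proof (rule measurable_measure_of)
  show "(\<lambda>a. {B \<in> Pow A. a \<in> B}) ` A \<subseteq> Pow (Pow A)" by auto
  show "f \<in> space M \<rightarrow> Pow A" using assms(1) by auto
  fix Y assume "Y \<in> (\<lambda>a. {B \<in> Pow A. a \<in> B}) ` A"
  then obtain a where a: "a \<in> A" "Y = {B \<in> Pow A. a \<in> B}" by blast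
  have "f -` Y \<inter> space M = {x \<in> space M. a \<in> f x}" using assms(1) a by auto
  then show "f -` Y \<inter> space M \<in> sets M" using assms(2)[OF a(1)] by simp
qed

lemma measurable_subset_space_mem:
  assumes "f \<in> measurable M (subset_space A)" "a \<in> A"
  shows "{x \<in> space M. a \<in> f x} \<in> sets M"
proof -
  have "f -` {B \<in> space (subset_space A). a \<in> B} \<inter> space M = {x \<in> space M. a \<in> f x}"
    using measurable_space[OF assms(1)] by auto
  then show ?thesis using measurable_sets[OF assms(1) subset_space_mem[OF assms(2)]] by simp
qed

lemma opn_measurable':
  assumes [measurable]: "h \<in> measurable M trees" "t \<in> borel_measurable M"
  shows "Measurable.pred M (\<lambda>x. opn (h x) (t x))"
proof -
  have [measurable]: "(\<lambda>x. h x l) \<in> measurable M (borel \<Otimes>\<^sub>M count_space UNIV)" for l by measurable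
  show ?thesis unfolding opn_iff by measurable
qed

lemma legal_measurable: "Measurable.pred trees legal"
proof -
  have [measurable]: "Measurable.pred trees (\<lambda>z. opn (\<lambda>l'. z (l @ l')) (fst (z l)))" for l
  proof (rule opn_measurable')
    show "(\<lambda>z l'. z (l @ l')) \<in> measurable trees trees"
      by (rule measurable_PiM_single') (auto simp: space_pair_measure)
  qed measurable
  have "legal = (\<lambda>z. \<forall>l. 0 \<le> fst (z l) \<and> fst (z l) \<le> 1 \<and>
      (snd (z l) \<and> opn (\<lambda>l'. z (l @ l')) (fst (z l)) \<or>
       \<not> snd (z l) \<and> \<not> opn (\<lambda>l'. z (l @ l')) (fst (z l))))"
    unfolding legal_def by blast
  also have "Measurable.pred trees \<dots>" by measurable
  finally show ?thesis .
qed

locale tree_percolation = regular_tree T E + frozen_percolation M T E U Fv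
  for M :: "'a measure" and T :: "'v set" and E :: "'v set set"
    and U :: "'v set \<Rightarrow> 'a \<Rightarrow> real" and Fv :: "'a \<Rightarrow> ('v \<times> 'v) set"
begin

lemma U_measurable: "e \<in> E \<Longrightarrow> U e \<in> borel_measurable M"
  using labels_indep by (auto simp: indep_vars_def)

lemma Fv_mem: "a \<in> orient E \<Longrightarrow> {\<omega> \<in> space M. a \<in> Fv \<omega>} \<in> events"
  by (rule measurable_subset_space_mem[OF F_measurable])

lemma labels_measurable: "L \<subseteq> E \<Longrightarrow> labels U L \<in> measurable M (label_space L)"
  unfolding labels_def by (rule measurable_restrict) (use U_measurable in auto)

definition cd :: "'v \<times> 'v \<Rightarrow> 'a \<Rightarrow> bool list \<Rightarrow> real \<times> bool" where
  "cd a \<omega> = code (\<lambda>e. U e \<omega>) (Fv \<omega>) a"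

lemma edge_desc_E: "a \<in> orient E \<Longrightarrow> edge (desc a l) \<in> E"
  using desc_orient mem_orient by blast

lemma code_measurable:
  assumes "\<And>l. edge (desc a l) \<in> L" "\<And>l. desc a l \<in> A"
  shows "(\<lambda>p. code (fst p) (snd p) a) \<in> measurable (label_space L \<Otimes>\<^sub>M subset_space A) trees"
  unfolding code_def
proof (rule measurable_PiM_single')
  fix l
  have 1: "(\<lambda>p. fst p (edge (desc a l))) \<in> borel_measurable (label_space L \<Otimes>\<^sub>M subset_space A)"
    by (rule measurable_compose[OF measurable_fst measurable_component_singleton[OF assms(1)]])
  have "Measurable.pred (subset_space A) (\<lambda>D. desc a l \<in> D)"
    using subset_space_mem[OF assms(2)[of l]] by (simp add: pred_def)
  then have 2: "(\<lambda>p. desc a l \<in> snd p) \<in> measurable (label_space L \<Otimes>\<^sub>M subset_space A) (count_space UNIV)"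
    by (rule measurable_compose[OF measurable_snd])
  show "(\<lambda>p. (fst p (edge (desc a l)), desc a l \<in> snd p)) \<in>
      measurable (label_space L \<Otimes>\<^sub>M subset_space A) (borel \<Otimes>\<^sub>M count_space UNIV)"
    using 1 2 by (rule measurable_Pair)
qed (simp add: space_pair_measure)

lemma joint_measurable: "(\<lambda>\<omega>. (labels U E \<omega>, Fv \<omega>)) \<in> measurable M (label_space E \<Otimes>\<^sub>M subset_space (orient E))"
  by (intro measurable_Pair labels_measurable F_measurable) simp

lemma cd_eq: "a \<in> orient E \<Longrightarrow> cd a \<omega> = code (labels U E \<omega>) (Fv \<omega>) a"
  by (simp add: cd_def code_def labels_def edge_desc_E)

lemma cd_measurable:
  assumes a: "a \<in> orient E"
  shows "cd a \<in> measurable M trees"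
proof -
  have "(\<lambda>p. code (fst p) (snd p) a) \<in> measurable (label_space E \<Otimes>\<^sub>M subset_space (orient E)) trees"
    by (rule code_measurable) (use a in \<open>simp_all add: edge_desc_E\<close>)
  from measurable_compose[OF joint_measurable this]
  have "(\<lambda>\<omega>. code (labels U E \<omega>) (Fv \<omega>) a) \<in> measurable M trees" by simp
  moreover have "cd a = (\<lambda>\<omega>. code (labels U E \<omega>) (Fv \<omega>) a)" by (rule ext, rule cd_eq[OF a])
  ultimately show ?thesis by simp
qed

text \<open>The automorphism \<open>shift a a'\<close> matches the descents from a and a', so
  pulling the pair back along it turns the configuration beyond a into the one beyond a'. Invariance
  of the joint law does the rest.\<close>

lemma law_eq:
  assumes a: "a \<in> orient E" and a': "a' \<in> orient E"
  shows "distr M trees (cd a) = distr M trees (cd a')"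
proof -
  define \<phi> where "\<phi> = shift a a'"
  have aut: "automorphism T E \<phi>" unfolding \<phi>_def using a a' by (rule shift_automorphism)
  let ?S = "label_space E \<Otimes>\<^sub>M subset_space (orient E)"
  let ?H = "\<lambda>p. code (fst p) (snd p) a"
  let ?U = "\<lambda>e. U (\<phi> ` e)" let ?F = "\<lambda>\<omega>. {(v, w) \<in> orient E. (\<phi> v, \<phi> w) \<in> Fv \<omega>}"
  have H: "?H \<in> measurable ?S trees" by (rule code_measurable) (use a in \<open>auto simp: edge_desc_E\<close>)
  have phiE: "\<phi> ` e \<in> E" if "e \<in> E" for e
  proof -
    obtain v w where vw: "v \<in> T" "w \<in> T" "e = {v, w}" using simple \<open>e \<in> E\<close> unfolding simple_graph_def by blast
    then have "{\<phi> v, \<phi> w} \<in> E" using aut \<open>e \<in> E\<close> unfolding automorphism_def by blast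
    then show ?thesis by (simp add: vw(3))
  qed
  have phio: "(\<phi> v, \<phi> w) \<in> orient E" if "(v, w) \<in> orient E" for v w
    using phiE[of "{v, w}"] that by (simp add: orient_def)
  have m: "(\<lambda>\<omega>. (labels ?U E \<omega>, ?F \<omega>)) \<in> measurable M ?S"
  proof (rule measurable_Pair)
    show "labels ?U E \<in> measurable M (label_space E)"
      unfolding labels_def by (rule measurable_restrict) (use U_measurable phiE in auto)
    show "?F \<in> measurable M (subset_space (orient E))"
    proof (rule measurable_subset_spaceI)
      fix d assume d: "d \<in> orient E"
      obtain v w where vw: "d = (v, w)" by (cases d)
      have "{\<omega> \<in> space M. d \<in> ?F \<omega>} = {\<omega> \<in> space M. (\<phi> v, \<phi> w) \<in> Fv \<omega>}" using d by (auto simp: vw)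
      then show "{\<omega> \<in> space M. d \<in> ?F \<omega>} \<in> events" using Fv_mem[OF phio] d vw by simp
    qed auto
  qed
  have "distr M trees (cd a) = distr M trees (?H \<circ> (\<lambda>\<omega>. (labels U E \<omega>, Fv \<omega>)))"
    using a by (intro distr_cong) (simp_all add: cd_eq)
  also have "\<dots> = distr (joint_law M E (orient E) U Fv) trees ?H"
    unfolding joint_law_def by (rule distr_distr[OF H joint_measurable, symmetric])
  also have "joint_law M E (orient E) U Fv = joint_law M E (orient E) ?U ?F" by (rule invariant[OF aut, symmetric])
  also have "distr \<dots> trees ?H = distr M trees (?H \<circ> (\<lambda>\<omega>. (labels ?U E \<omega>, ?F \<omega>)))"
    unfolding joint_law_def by (rule distr_distr[OF H m])
  also have "\<dots> = distr M trees (cd a')"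
  proof (rule distr_cong)
    fix \<omega>
    have "code (labels ?U E \<omega>) (?F \<omega>) a l = cd a' \<omega> l" for l
    proof -
      have "\<phi> ` edge (desc a l) = edge (desc a' l)"
        using shift_desc[OF a, of a' l] by (simp add: edge_def \<phi>_def)
      moreover have "desc a l \<in> ?F \<omega> \<longleftrightarrow> desc a' l \<in> Fv \<omega>"
      proof -
        have "desc a l \<in> ?F \<omega> \<longleftrightarrow> (\<phi> (fst (desc a l)), \<phi> (snd (desc a l))) \<in> Fv \<omega>"
          using desc_orient[OF a, of l] by (simp add: split_beta)
        also have "(\<phi> (fst (desc a l)), \<phi> (snd (desc a l))) = desc a' l"
          using shift_desc[OF a, of a' l] by (simp add: \<phi>_def)
        finally show ?thesis .
      qed
      ultimately show ?thesis using edge_desc_E[OF a, of l] by (simp add: code_def cd_def labels_def)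
    qed
    then show "(?H \<circ> (\<lambda>\<omega>. (labels ?U E \<omega>, ?F \<omega>))) \<omega> = cd a' \<omega>" by (simp add: fun_eq_iff)
  qed simp_all
  finally show ?thesis .
qed


end

context tree_percolation
begin

abbreviation side_algebra :: "'v \<times> 'v \<Rightarrow> 'a set set" where
  "side_algebra a \<equiv> sets (vimage_algebra (space M)
     (\<lambda>\<omega>. (labels U (unorient (descendants E a)) \<omega>, Fv \<omega> \<inter> descendants E a))
     (label_space (unorient (descendants E a)) \<Otimes>\<^sub>M subset_space (descendants E a)))"

lemma unorient_descendants: "a \<in> orient E \<Longrightarrow> unorient (descendants E a) = range (\<lambda>l. edge (desc a l))"
proof -
  assume a: "a \<in> orient E"
  show ?thesis unfolding unorient_def descendants_eq[OF a]
  proof (intro equalityI subsetI)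
    fix e assume "e \<in> {{v, w} | v w. (v, w) \<in> range (desc a)}"
    then obtain v w l where "e = {v, w}" "(v, w) = desc a l" by blast
    then have "e = edge (desc a l)" unfolding edge_def by (metis fst_conv snd_conv)
    then show "e \<in> range (\<lambda>l. edge (desc a l))" by blast
  next
    fix e assume "e \<in> range (\<lambda>l. edge (desc a l))"
    then obtain l where "e = {fst (desc a l), snd (desc a l)}" unfolding edge_def by blast
    moreover have "(fst (desc a l), snd (desc a l)) \<in> range (desc a)" by simp
    ultimately show "e \<in> {{v, w} | v w. (v, w) \<in> range (desc a)}" by blast
  qed
qed

lemma side_full: "space M \<in> side_algebra a"
  using sets.top[of "vimage_algebra (space M)
     (\<lambda>\<omega>. (labels U (unorient (descendants E a)) \<omega>, Fv \<omega> \<inter> descendants E a))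
     (label_space (unorient (descendants E a)) \<Otimes>\<^sub>M subset_space (descendants E a))"]
  by (simp only: space_vimage_algebra)

lemma space_side: "(\<lambda>\<omega>. (labels U L \<omega>, Fv \<omega> \<inter> A)) \<in> space M \<rightarrow> space (label_space L \<Otimes>\<^sub>M subset_space A)"
  by (simp add: space_pair_measure space_PiM labels_def)

lemma cd_side:
  assumes a: "a \<in> orient E" and B: "B \<in> sets trees"
  shows "cd a -` B \<inter> space M \<in> side_algebra a"
proof -
  let ?L = "unorient (descendants E a)" and ?A = "descendants E a"
  have mL: "edge (desc a l) \<in> ?L" for l unfolding unorient_descendants[OF a] by simp
  have mA: "desc a l \<in> ?A" for l unfolding descendants_eq[OF a] by simp
  have H: "(\<lambda>p. code (fst p) (snd p) a) \<in> measurable (label_space ?L \<Otimes>\<^sub>M subset_space ?A) trees"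
    by (rule code_measurable) (rule mL, rule mA)
  have V: "(\<lambda>\<omega>. (labels U ?L \<omega>, Fv \<omega> \<inter> ?A)) \<in> measurable
      (vimage_algebra (space M) (\<lambda>\<omega>. (labels U ?L \<omega>, Fv \<omega> \<inter> ?A)) (label_space ?L \<Otimes>\<^sub>M subset_space ?A))
      (label_space ?L \<Otimes>\<^sub>M subset_space ?A)"
    by (rule measurable_vimage_algebra1[OF space_side])
  have "cd a \<omega> = code (labels U ?L \<omega>) (Fv \<omega> \<inter> ?A) a" for \<omega>
    by (simp add: cd_def code_def labels_def mL mA)
  then have "cd a = (\<lambda>\<omega>. code (fst (labels U ?L \<omega>, Fv \<omega> \<inter> ?A)) (snd (labels U ?L \<omega>, Fv \<omega> \<inter> ?A)) a)"
    by (intro ext) simp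
  then have "cd a \<in> measurable (vimage_algebra (space M) (\<lambda>\<omega>. (labels U ?L \<omega>, Fv \<omega> \<inter> ?A))
      (label_space ?L \<Otimes>\<^sub>M subset_space ?A)) trees"
    using measurable_compose[OF V H] by simp
  from measurable_sets[OF this B] show ?thesis by simp
qed

lemma label_side:
  assumes a: "a \<in> orient E" and A: "A \<in> sets borel"
  shows "U (edge (desc a l)) -` A \<inter> space M \<in> side_algebra a"
proof -
  have m: "(\<lambda>z. fst (z l)) -` A \<inter> space trees \<in> sets trees"
    by (rule measurable_sets[OF root_label_measurable A])
  have "cd a -` ((\<lambda>z. fst (z l)) -` A \<inter> space trees) \<inter> space M = U (edge (desc a l)) -` A \<inter> space M"
    by (auto simp: cd_def code_def)
  then show ?thesis using cd_side[OF a m] by simp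
qed

lemma subset_singleton: "a \<in> orient E \<Longrightarrow> ball_side a 0 = {snd a}"
  by (auto simp: ball_side_def)

lemma boundary_vertex:
  assumes a: "a \<in> orient E"
  shows "boundary T E {snd a} = {rev_edge a, child False a, child True a}"
proof -
  have "{l::bool list. length l = Suc 0} = {[False], [True]}"
    by (auto simp: length_Suc_conv)
  then show ?thesis using boundary_ball_side[OF a, of 0] by (simp add: subset_singleton[OF a])
qed

text \<open>The independence hypothesis for the one-vertex subtree at \<open>snd a\<close>, whose
  three boundary edges are the reversal of a and the two successors of a.\<close>

lemma side_independent:
  assumes a: "a \<in> orient E" and A: "A \<in> side_algebra (rev_edge a)"
    and B: "B \<in> side_algebra (child False a)" and C: "C \<in> side_algebra (child True a)"
  shows "prob (A \<inter> B \<inter> C) = prob A * prob B * prob C"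
proof -
  have sub: "subtree T E {snd a}" using subtree_ball_side[OF a, of 0] by (simp add: subset_singleton[OF a])
  let ?F = "\<lambda>i. case i of None \<Rightarrow> sets (label_algebra M U (edges_within E {snd a}))
     | Some a \<Rightarrow> side_algebra a"
  let ?J = "{Some (rev_edge a), Some (child False a), Some (child True a)}"
  have ind: "indep_sets ?F (insert None (Some ` {rev_edge a, child False a, child True a}))"
    using markov[OF sub] unfolding boundary_vertex[OF a] by simp
  have nb: "child b a \<noteq> rev_edge a" for b
  proof
    assume "child b a = rev_edge a"
    then have "snd (child b a) = fst a" by simp
    then show False using snd_child(2)[OF a] by blast
  qed
  have ne: "child False a \<noteq> child True a"
  proof
    assume "child False a = child True a"
    then have "snd (child False a) = snd (child True a)" by simp
    then show False using child_inj[OF a] by blast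
  qed
  define f where "f = (\<lambda>i. if i = Some (rev_edge a) then A else if i = Some (child False a) then B else C)"
  have f: "f (Some (rev_edge a)) = A" "f (Some (child False a)) = B" "f (Some (child True a)) = C"
    using nb ne by (simp_all add: f_def)
  have "prob (\<Inter>j\<in>?J. f j) = (\<Prod>j\<in>?J. prob (f j))"
  proof (rule indep_setsD[OF ind])
    show "\<forall>j\<in>?J. f j \<in> ?F j" using A B C by (simp add: f)
  qed auto
  moreover have "(\<Inter>j\<in>?J. f j) = A \<inter> B \<inter> C" by (simp add: f Int_assoc)
  moreover have "(\<Prod>j\<in>?J. prob (f j)) = prob A * prob B * prob C"
    using nb[symmetric] ne by (simp add: f)
  ultimately show ?thesis by simp
qed

lemma distr_label: "e \<in> E \<Longrightarrow> distr M borel (U e) = unif"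
  by (rule labels_uniform)

text \<open>Independence at the vertex \<open>snd a\<close> separates the label of a from the two
  subtrees and these from each other; \<open>law_eq\<close> identifies their laws with the law
  beyond a.\<close>

lemma law_split:
  assumes a: "a \<in> orient E"
  shows "distr (distr M trees (cd a)) (borel \<Otimes>\<^sub>M (trees \<Otimes>\<^sub>M trees)) root_split =
    unif \<Otimes>\<^sub>M (distr M trees (cd a) \<Otimes>\<^sub>M distr M trees (cd a))"
proof -
  let ?c0 = "child False a" and ?c1 = "child True a"
  have c: "?c0 \<in> orient E" "?c1 \<in> orient E" using a by simp_all
  have ra: "rev_edge a \<in> orient E" using a by simp
  define X where "X = (\<lambda>\<omega>. (cd ?c0 \<omega>, cd ?c1 \<omega>))"
  have Um: "U (edge a) \<in> borel_measurable M" using a U_measurable mem_orient by blast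
  have Xm: "X \<in> measurable M (trees \<Otimes>\<^sub>M trees)" unfolding X_def by (intro measurable_Pair cd_measurable c)
  let ?D0 = "distr M trees (cd ?c0)" and ?D1 = "distr M trees (cd ?c1)"
  interpret D0: prob_space ?D0 by (rule prob_space_distr[OF cd_measurable[OF c(1)]])
  interpret D1: prob_space ?D1 by (rule prob_space_distr[OF cd_measurable[OF c(2)]])
  interpret DX: prob_space "distr M (trees \<Otimes>\<^sub>M trees) X" by (rule prob_space_distr[OF Xm])
  interpret DU: prob_space "distr M borel (U (edge a))" by (rule prob_space_distr[OF Um])
  \<comment> \<open>The label of a does not lie inside the vertex \<open>snd a\<close>; it is the
    root label seen from the reversed edge, so it belongs to that side.\<close>
  have Ua: "U (edge a) -` A \<inter> space M \<in> side_algebra (rev_edge a)" if "A \<in> sets borel" for A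
    using label_side[OF ra that, of "[]"] by simp
  note full = side_full
  have X_law: "?D0 \<Otimes>\<^sub>M ?D1 = distr M (trees \<Otimes>\<^sub>M trees) X"
  proof (rule pair_measure_eqI)
    fix B C assume "B \<in> sets ?D0" "C \<in> sets ?D1"
    then have B: "B \<in> sets trees" and C: "C \<in> sets trees" by simp_all
    have "prob (space M \<inter> (cd ?c0 -` B \<inter> space M) \<inter> (cd ?c1 -` C \<inter> space M)) =
        prob (space M) * prob (cd ?c0 -` B \<inter> space M) * prob (cd ?c1 -` C \<inter> space M)"
      by (rule side_independent[OF a full cd_side[OF c(1) B] cd_side[OF c(2) C]])
    moreover have "X -` (B \<times> C) \<inter> space M = space M \<inter> (cd ?c0 -` B \<inter> space M) \<inter> (cd ?c1 -` C \<inter> space M)"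
      by (auto simp: X_def)
    ultimately show "emeasure ?D0 B * emeasure ?D1 C = emeasure (distr M (trees \<Otimes>\<^sub>M trees) X) (B \<times> C)"
      using B C cd_measurable[OF c(1)] cd_measurable[OF c(2)] Xm
      by (simp add: emeasure_distr emeasure_eq_measure prob_space ennreal_mult)
  qed (simp_all add: D0.sigma_finite_measure_axioms D1.sigma_finite_measure_axioms)
  have indep: "prob ((U (edge a) -` A \<inter> space M) \<inter> (X -` Q \<inter> space M)) =
      prob (U (edge a) -` A \<inter> space M) * prob (X -` Q \<inter> space M)"
    if A: "A \<in> sets borel" and Q: "Q \<in> sets (trees \<Otimes>\<^sub>M trees)" for A Q
  proof -
    let ?R = "{B \<times> C | B C. B \<in> sets trees \<and> C \<in> sets trees}"
    have gen: "sets (trees \<Otimes>\<^sub>M trees) = sigma_sets (space trees \<times> space trees) ?R"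
      by (rule sets_pair_measure)
    have "Int_stable ?R" by (rule Int_stable_pair_measure_generator)
    moreover have "?R \<subseteq> Pow (space trees \<times> space trees)" by auto
    moreover have "Q \<in> sigma_sets (space trees \<times> space trees) ?R" using Q by (simp only: gen)
    ultimately show ?thesis
    proof (induction rule: sigma_sets_induct_disjoint)
      case (basic P)
      then obtain B C where P: "P = B \<times> C" and B: "B \<in> sets trees" and C: "C \<in> sets trees" by blast
      have e: "X -` P \<inter> space M = space M \<inter> (cd ?c0 -` B \<inter> space M) \<inter> (cd ?c1 -` C \<inter> space M)"
        by (auto simp: X_def P)
      have e2: "(U (edge a) -` A \<inter> space M) \<inter> (X -` P \<inter> space M) =
          (U (edge a) -` A \<inter> space M) \<inter> (cd ?c0 -` B \<inter> space M) \<inter> (cd ?c1 -` C \<inter> space M)"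
        by (auto simp: X_def P)
      show ?case unfolding e2 unfolding e
        by (simp only: side_independent[OF a full cd_side[OF c(1) B] cd_side[OF c(2) C]]
            side_independent[OF a Ua[OF A] cd_side[OF c(1) B] cd_side[OF c(2) C]] prob_space mult_1 mult.assoc)
    next
      case empty
      show ?case by simp
    next
      case (compl P)
      then have P: "P \<in> sets (trees \<Otimes>\<^sub>M trees)" by (simp only: gen)
      let ?U = "U (edge a) -` A \<inter> space M" and ?P = "X -` P \<inter> space M"
      have Us: "?U \<in> events" using Um A by (rule measurable_sets)
      have Ps: "?P \<in> events" using Xm P by (rule measurable_sets)
      have e: "X -` (space trees \<times> space trees - P) \<inter> space M = space M - ?P" by auto
      have "?U \<inter> (space M - ?P) = ?U - ?U \<inter> ?P" by auto
      then have "prob (?U \<inter> (space M - ?P)) = prob ?U - prob (?U \<inter> ?P)"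
        using finite_measure_Diff[of ?U "?U \<inter> ?P"] Us Ps by auto
      also have "\<dots> = prob ?U * (1 - prob ?P)" unfolding compl.IH by (simp add: right_diff_distrib)
      also have "1 - prob ?P = prob (space M - ?P)" using prob_compl[OF Ps] by simp
      finally show ?case unfolding e .
    next
      case (union P)
      let ?U = "U (edge a) -` A \<inter> space M"
      have Us: "?U \<in> events" using Um A by (rule measurable_sets)
      have Ps: "X -` P i \<inter> space M \<in> events" for i
      proof -
        have "P i \<in> sets (trees \<Otimes>\<^sub>M trees)" using union.hyps(2) by (simp only: gen) blast
        then show ?thesis by (rule measurable_sets[OF Xm])
      qed
      have dj: "disjoint_family (\<lambda>i. X -` P i \<inter> space M)" "disjoint_family (\<lambda>i. ?U \<inter> (X -` P i \<inter> space M))"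
        using union.hyps(1) by (fastforce simp: disjoint_family_on_def)+
      have "(\<lambda>i. prob (X -` P i \<inter> space M)) sums prob (\<Union>i. X -` P i \<inter> space M)"
        using Ps dj(1) by (intro finite_measure_UNION) auto
      then have "(\<lambda>i. prob ?U * prob (X -` P i \<inter> space M)) sums (prob ?U * prob (\<Union>i. X -` P i \<inter> space M))"
        by (rule sums_mult)
      moreover have "(\<lambda>i. prob (?U \<inter> (X -` P i \<inter> space M))) sums prob (\<Union>i. ?U \<inter> (X -` P i \<inter> space M))"
        using Ps Us dj(2) by (intro finite_measure_UNION) auto
      ultimately have "prob (\<Union>i. ?U \<inter> (X -` P i \<inter> space M)) = prob ?U * prob (\<Union>i. X -` P i \<inter> space M)"
        unfolding union.IH by (rule sums_unique2[rotated])
      moreover have "(\<Union>i. ?U \<inter> (X -` P i \<inter> space M)) = ?U \<inter> (X -` \<Union> (range P) \<inter> space M)"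
        "(\<Union>i. X -` P i \<inter> space M) = X -` \<Union> (range P) \<inter> space M" by auto
      ultimately show ?case by simp
    qed
  qed
  have all: "distr M borel (U (edge a)) \<Otimes>\<^sub>M distr M (trees \<Otimes>\<^sub>M trees) X =
      distr M (borel \<Otimes>\<^sub>M (trees \<Otimes>\<^sub>M trees)) (\<lambda>\<omega>. (U (edge a) \<omega>, X \<omega>))"
  proof (rule pair_measure_eqI)
    fix A Q assume "A \<in> sets (distr M borel (U (edge a)))" "Q \<in> sets (distr M (trees \<Otimes>\<^sub>M trees) X)"
    then have A: "A \<in> sets borel" and Q: "Q \<in> sets (trees \<Otimes>\<^sub>M trees)" by simp_all
    have "(\<lambda>\<omega>. (U (edge a) \<omega>, X \<omega>)) -` (A \<times> Q) \<inter> space M = (U (edge a) -` A \<inter> space M) \<inter> (X -` Q \<inter> space M)"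
      by auto
    then show "emeasure (distr M borel (U (edge a))) A * emeasure (distr M (trees \<Otimes>\<^sub>M trees) X) Q =
        emeasure (distr M (borel \<Otimes>\<^sub>M (trees \<Otimes>\<^sub>M trees)) (\<lambda>\<omega>. (U (edge a) \<omega>, X \<omega>))) (A \<times> Q)"
      using A Q Um Xm indep[OF A Q] measurable_Pair[OF Um Xm]
      by (simp add: emeasure_distr emeasure_eq_measure ennreal_mult)
  qed (simp_all add: DU.sigma_finite_measure_axioms DX.sigma_finite_measure_axioms)
  have "distr (distr M trees (cd a)) (borel \<Otimes>\<^sub>M (trees \<Otimes>\<^sub>M trees)) root_split =
      distr M (borel \<Otimes>\<^sub>M (trees \<Otimes>\<^sub>M trees)) (root_split \<circ> cd a)"
    by (rule distr_distr[OF root_split_measurable cd_measurable[OF a]])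
  also have "root_split \<circ> cd a = (\<lambda>\<omega>. (U (edge a) \<omega>, X \<omega>))"
    by (rule ext) (simp add: root_split_def X_def cd_def code_sub, simp add: code_def)
  also have "distr M (borel \<Otimes>\<^sub>M (trees \<Otimes>\<^sub>M trees)) \<dots> =
      distr M borel (U (edge a)) \<Otimes>\<^sub>M (?D0 \<Otimes>\<^sub>M ?D1)" by (simp only: all X_law)
  also have "distr M borel (U (edge a)) = unif" using a distr_label mem_orient by blast
  also have "?D0 = distr M trees (cd a)" by (rule law_eq[OF c(1) a])
  also have "?D1 = distr M trees (cd a)" by (rule law_eq[OF c(2) a])
  finally show ?thesis .
qed

lemma AE_label_bounds: "e \<in> E \<Longrightarrow> AE \<omega> in M. 0 \<le> U e \<omega> \<and> U e \<omega> \<le> 1"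
proof -
  assume e: "e \<in> E"
  have "AE u in distr M borel (U e). 0 \<le> u \<and> u \<le> 1"
    unfolding distr_label[OF e] using AE_unif by eventually_elim simp
  then show ?thesis by (rule AE_distrD[OF U_measurable[OF e]])
qed

lemma countable_orient: "countable (orient E)"
proof -
  obtain a where a: "a \<in> orient E" using T_edge_exists by blast
  have "countable T" unfolding range_enc[OF a, symmetric] by simp
  moreover have "orient E \<subseteq> T \<times> T" using orientD by fastforce
  ultimately show ?thesis by (meson countable_SIGMA countable_subset)
qed

lemma countable_E: "countable E"
proof -
  have "E \<subseteq> edge ` orient E"
  proof
    fix e assume e: "e \<in> E"
    then obtain v w where "e = {v, w}" using simple unfolding simple_graph_def by blast
    then have "e = edge (v, w)" "(v, w) \<in> orient E" using e by (simp_all add: edge_def orient_def)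
    then show "e \<in> edge ` orient E" by blast
  qed
  then show ?thesis using countable_orient by (meson countable_image countable_subset)
qed

lemma AE_all_bounds: "AE \<omega> in M. \<forall>e\<in>E. 0 \<le> U e \<omega> \<and> U e \<omega> \<le> 1"
  by (subst AE_ball_countable[OF countable_E]) (use AE_label_bounds in blast)

lemma AE_frozen:
  "AE \<omega> in M. \<forall>a\<in>orient E. a \<in> Fv \<omega> \<longleftrightarrow> opn (cd a \<omega>) (U (edge a) \<omega>)"
  using frozen_iff
proof eventually_elim
  case (elim \<omega>)
  show ?case
  proof
    fix a assume a: "a \<in> orient E"
    obtain v w where vw: "a = (v, w)" by (cases a)
    have "a \<in> Fv \<omega> \<longleftrightarrow> (\<exists>r. ray E r \<and> r 0 = a \<and> (\<forall>n\<ge>1. r n \<in> opened U E \<omega> (U {v, w} \<omega>) - Fv \<omega>))"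
      using bspec[OF elim a] by (simp add: vw)
    also have "\<dots> \<longleftrightarrow> (\<exists>r. ray E r \<and> r 0 = a \<and> (\<forall>n\<ge>1. U (edge (r n)) \<omega> \<le> U (edge a) \<omega> \<and> r n \<notin> Fv \<omega>))"
    proof (rule ex_cong1, rule conj_cong[OF refl], rule conj_cong[OF refl])
      fix r assume "ray E r"
      then have "r n \<in> orient E" for n unfolding ray_def by blast
      then have "r n \<in> opened U E \<omega> (U {v, w} \<omega>) - Fv \<omega> \<longleftrightarrow> U (edge (r n)) \<omega> \<le> U (edge a) \<omega> \<and> r n \<notin> Fv \<omega>" for n
        by (simp add: opened_def split_beta edge_def vw)
      then show "(\<forall>n\<ge>1. r n \<in> opened U E \<omega> (U {v, w} \<omega>) - Fv \<omega>) \<longleftrightarrow>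
          (\<forall>n\<ge>1. U (edge (r n)) \<omega> \<le> U (edge a) \<omega> \<and> r n \<notin> Fv \<omega>)" by blast
    qed
    also have "\<dots> \<longleftrightarrow> opn (cd a \<omega>) (U (edge a) \<omega>)" unfolding cd_def opn_code[OF a] ..
    finally show "a \<in> Fv \<omega> \<longleftrightarrow> opn (cd a \<omega>) (U (edge a) \<omega>)" .
  qed
qed

lemma AE_legal_cd:
  assumes a: "a \<in> orient E"
  shows "AE \<omega> in M. legal (cd a \<omega>)"
  using AE_frozen AE_all_bounds
proof eventually_elim
  case (elim \<omega>)
  show ?case unfolding legal_def
  proof
    fix l
    have d: "desc a l \<in> orient E" using a by simp
    have "fst (cd a \<omega> l) = U (edge (desc a l)) \<omega>" "snd (cd a \<omega> l) \<longleftrightarrow> desc a l \<in> Fv \<omega>"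
      by (simp_all add: cd_def code_def)
    moreover have "(\<lambda>l'. cd a \<omega> (l @ l')) = cd (desc a l) \<omega>" unfolding cd_def by (rule code_append)
    moreover have "edge (desc a l) \<in> E" using a by (rule edge_desc_E)
    ultimately show "0 \<le> fst (cd a \<omega> l) \<and> fst (cd a \<omega> l) \<le> 1 \<and>
        (snd (cd a \<omega> l) \<longleftrightarrow> opn (\<lambda>l'. cd a \<omega> (l @ l')) (fst (cd a \<omega> l)))"
      using elim d by (simp only:)
  qed
qed

lemma law_coded: "a \<in> orient E \<Longrightarrow> coded_percolation (distr M trees (cd a))"
proof (intro coded_percolation.intro coded_percolation_axioms.intro)
  assume a: "a \<in> orient E"
  show "prob_space (distr M trees (cd a))" by (rule prob_space_distr[OF cd_measurable[OF a]])
  show "distr (distr M trees (cd a)) (borel \<Otimes>\<^sub>M (trees \<Otimes>\<^sub>M trees)) root_split =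
    unif \<Otimes>\<^sub>M (distr M trees (cd a) \<Otimes>\<^sub>M distr M trees (cd a))" by (rule law_split[OF a])
  have "{z \<in> space trees. legal z} \<in> sets trees" using legal_measurable by (simp add: pred_def)
  then show "AE z in distr M trees (cd a). legal z"
    using AE_legal_cd[OF a] by (subst AE_distr_iff[OF cd_measurable[OF a]])
qed simp

end

text \<open>The order of the quantifiers matters: one c serves all edges, so that its effect can be
  multiplied over a growing boundary.\<close>

theorem tree_nonendogeny:
  obtains c :: real where "0 < c"
    "\<And>(M :: 'a measure) (T :: 'v set) E U Fv a C. tree_percolation M T E U Fv \<Longrightarrow> a \<in> orient E \<Longrightarrow> C \<in> sets labs \<Longrightarrow>
      c \<le> measure M {\<omega> \<in> space M. (a \<in> Fv \<omega>) \<noteq> (labels_of (tree_percolation.cd E U Fv a \<omega>) \<in> C)}"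
proof -
  obtain c :: real where c: "0 < c"
    "\<And>Z C. coded_percolation Z \<Longrightarrow> C \<in> sets labs \<Longrightarrow> c \<le> measure Z {z. snd (z []) \<noteq> (labels_of z \<in> C)}"
  proof (rule coded_nonendogeny)
    fix c :: real
    assume A: "0 < c" "\<And>Z C. coded_percolation Z \<Longrightarrow> C \<in> sets labs \<Longrightarrow>
      c \<le> measure Z {z. snd (z []) \<noteq> (labels_of z \<in> C)}"
    show thesis by (rule that[OF A])
  qed
  show thesis
  proof (rule that[OF c(1)])
    fix M :: "'a measure" and T :: "'v set" and E U Fv a C
    assume "tree_percolation M T E U Fv" and a: "a \<in> orient E" and C: "C \<in> sets labs"
    interpret tree_percolation M T E U Fv by fact
    have [measurable]: "Measurable.pred labs (\<lambda>V. V \<in> C)" using C by measurable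
    have S: "{z. snd (z []) \<noteq> (labels_of z \<in> C)} \<in> sets trees"
    proof -
      have "{z \<in> space trees. snd (z []) \<noteq> (labels_of z \<in> C)} \<in> sets trees" by measurable
      then show ?thesis by simp
    qed
    have "c \<le> measure (distr M trees (cd a)) {z. snd (z []) \<noteq> (labels_of z \<in> C)}"
      by (rule c(2)[OF law_coded[OF a] C])
    also have "\<dots> = measure M (cd a -` {z. snd (z []) \<noteq> (labels_of z \<in> C)} \<inter> space M)"
      by (rule measure_distr[OF cd_measurable[OF a] S])
    also have "cd a -` {z. snd (z []) \<noteq> (labels_of z \<in> C)} \<inter> space M =
        {\<omega> \<in> space M. (a \<in> Fv \<omega>) \<noteq> (labels_of (cd a \<omega>) \<in> C)}"
    proof -
      have "snd (cd a \<omega> []) \<longleftrightarrow> a \<in> Fv \<omega>" for \<omega> by (simp add: cd_def code_def)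
      then show ?thesis by auto
    qed
    finally show "c \<le> measure M {\<omega> \<in> space M. (a \<in> Fv \<omega>) \<noteq> (labels_of (cd a \<omega>) \<in> C)}" .
  qed
qed

section \<open>Conditionally independent copies\<close>

text \<open>Conditional expectations are determined only almost everywhere; this version lies in \<open>[0, 1]\<close> everywhere.\<close>

definition cprob :: "'a measure \<Rightarrow> 'a measure \<Rightarrow> 'a set \<Rightarrow> 'a \<Rightarrow> real" where
  "cprob M N D \<omega> = max 0 (min 1 (real_cond_exp M N (indicator D) \<omega>))"

lemma cprob_bounds: "0 \<le> cprob M N D \<omega>" "cprob M N D \<omega> \<le> 1"
  by (simp_all add: cprob_def)

lemma cprob_measurable: "cprob M N D \<in> borel_measurable N"
  unfolding cprob_def[abs_def] by (intro borel_measurable_max borel_measurable_min borel_measurable_const borel_measurable_cond_exp)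

context prob_space
begin

lemma integrable_bounded01:
  assumes "g \<in> borel_measurable M" "\<And>\<omega>. 0 \<le> g \<omega>" "\<And>\<omega>. g \<omega> \<le> (1::real)"
  shows "integrable M g"
  by (rule integrable_const_bound[where B = 1]) (use assms in auto)

lemma subalgebra_sigma_finite: "subalgebra M N \<Longrightarrow> sigma_finite_subalgebra M N"
  by (intro finite_measure_subalgebra_is_sigma_finite finite_measure_subalgebra.intro
      finite_measure_subalgebra_axioms.intro finite_measure_axioms)

lemma cprob_AE:
  assumes N: "subalgebra M N" and D: "D \<in> events"
  shows "AE \<omega> in M. real_cond_exp M N (indicator D) \<omega> = cprob M N D \<omega>"
proof -
  interpret N: sigma_finite_subalgebra M N using N by (rule subalgebra_sigma_finite)
  have i: "integrable M (indicator D :: 'a \<Rightarrow> real)" using D by (intro integrable_bounded01) auto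
  have "AE \<omega> in M. 0 \<le> real_cond_exp M N (indicator D) \<omega>"
    by (rule N.real_cond_exp_ge_c[OF i]) simp
  moreover have "AE \<omega> in M. real_cond_exp M N (indicator D) \<omega> \<le> 1"
    by (rule N.real_cond_exp_le_c[OF i]) (auto simp: indicator_def)
  ultimately show ?thesis by eventually_elim (simp add: cprob_def)
qed

lemma cprob_integral:
  assumes N: "subalgebra M N" and D: "D \<in> events"
    and h: "h \<in> borel_measurable N" "\<And>\<omega>. 0 \<le> h \<omega>" "\<And>\<omega>. h \<omega> \<le> (1::real)"
  shows "(\<integral>\<omega>. h \<omega> * cprob M N D \<omega> \<partial>M) = (\<integral>\<omega>. h \<omega> * indicator D \<omega> \<partial>M)"
proof -
  interpret N: sigma_finite_subalgebra M N using N by (rule subalgebra_sigma_finite)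
  have hM: "h \<in> borel_measurable M" using N h(1) by (rule measurable_from_subalg)
  have D': "(indicator D :: 'a \<Rightarrow> real) \<in> borel_measurable M" using D by simp
  have cM: "cprob M N D \<in> borel_measurable M" using N cprob_measurable by (rule measurable_from_subalg)
  have i: "integrable M (\<lambda>\<omega>. h \<omega> * indicator D \<omega>)"
  proof (rule integrable_bounded01)
    show "(\<lambda>\<omega>. h \<omega> * indicator D \<omega>) \<in> borel_measurable M" using hM D' by (rule borel_measurable_times)
  qed (simp_all add: indicator_def h)
  have "(\<integral>\<omega>. h \<omega> * cprob M N D \<omega> \<partial>M) = (\<integral>\<omega>. h \<omega> * real_cond_exp M N (indicator D) \<omega> \<partial>M)"
  proof (rule integral_cong_AE)
    show "AE \<omega> in M. h \<omega> * cprob M N D \<omega> = h \<omega> * real_cond_exp M N (indicator D) \<omega>"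
      using cprob_AE[OF N D] by eventually_elim simp
  qed (intro borel_measurable_times hM cM borel_measurable_cond_exp2)+
  also have "\<dots> = (\<integral>\<omega>. h \<omega> * indicator D \<omega> \<partial>M)"
    by (rule N.real_cond_exp_intg(2)[OF i h(1) D'])
  finally show ?thesis .
qed

lemma cprob_unique:
  assumes N: "subalgebra M N" and D: "D \<in> events"
    and g: "g \<in> borel_measurable N" "\<And>\<omega>. 0 \<le> g \<omega>" "\<And>\<omega>. g \<omega> \<le> (1::real)"
    and eq: "\<And>A. A \<in> sets N \<Longrightarrow> (\<integral>\<omega>. indicator A \<omega> * g \<omega> \<partial>M) = prob (A \<inter> D)"
  shows "AE \<omega> in M. cprob M N D \<omega> = g \<omega>"
proof -
  interpret N: sigma_finite_subalgebra M N using N by (rule subalgebra_sigma_finite)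
  have gM: "g \<in> borel_measurable M" using N g(1) by (rule measurable_from_subalg)
  have "AE \<omega> in M. real_cond_exp M N (indicator D) \<omega> = g \<omega>"
  proof (rule N.real_cond_exp_charact)
    fix A assume A: "A \<in> sets N"
    then have AM: "A \<in> events" using N by (auto simp: subalgebra_def)
    have "(\<integral>\<omega>\<in>A. indicator D \<omega> \<partial>M) = (\<integral>\<omega>. indicator (A \<inter> D) \<omega> \<partial>M)"
      unfolding set_lebesgue_integral_def by (rule Bochner_Integration.integral_cong) (simp_all add: indicator_def)
    also have "\<dots> = prob (A \<inter> D)" using AM D by simp
    also have "\<dots> = (\<integral>\<omega>\<in>A. g \<omega> \<partial>M)" using eq[OF A] unfolding set_lebesgue_integral_def by simp
    finally show "(\<integral>\<omega>\<in>A. indicator D \<omega> \<partial>M) = (\<integral>\<omega>\<in>A. g \<omega> \<partial>M)" .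
  next
    show "integrable M (indicator D :: 'a \<Rightarrow> real)" using D by (intro integrable_bounded01) auto
    show "integrable M g" using gM g(2,3) by (rule integrable_bounded01)
  qed (rule g(1))
  with cprob_AE[OF N D] show ?thesis by eventually_elim simp
qed

lemma emeasure_weighted_distr:
  assumes g: "g \<in> borel_measurable M" "\<And>\<omega>. 0 \<le> g \<omega>" "\<And>\<omega>. g \<omega> \<le> (1::real)"
    and X: "X \<in> measurable M N" and Q: "Q \<in> sets N"
  shows "emeasure (distr (density M (\<lambda>\<omega>. ennreal (g \<omega>))) N X) Q =
    ennreal (\<integral>\<omega>. indicator (X -` Q \<inter> space M) \<omega> * g \<omega> \<partial>M)"
proof -
  have X': "X \<in> measurable (density M (\<lambda>\<omega>. ennreal (g \<omega>))) N" using X by simp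
  have S: "X -` Q \<inter> space M \<in> events" using X Q by (rule measurable_sets)
  have "emeasure (distr (density M (\<lambda>\<omega>. ennreal (g \<omega>))) N X) Q =
      emeasure (density M (\<lambda>\<omega>. ennreal (g \<omega>))) (X -` Q \<inter> space M)"
    using emeasure_distr[OF X' Q] by simp
  also have "\<dots> = (\<integral>\<^sup>+\<omega>. ennreal (g \<omega>) * indicator (X -` Q \<inter> space M) \<omega> \<partial>M)"
    using g(1) S by (intro emeasure_density) auto
  also have "\<dots> = (\<integral>\<^sup>+\<omega>. ennreal (indicator (X -` Q \<inter> space M) \<omega> * g \<omega>) \<partial>M)"
    by (intro nn_integral_cong) (auto simp: indicator_def)
  also have "\<dots> = ennreal (\<integral>\<omega>. indicator (X -` Q \<inter> space M) \<omega> * g \<omega> \<partial>M)"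
  proof (rule nn_integral_eq_integral)
    show "integrable M (\<lambda>\<omega>. indicator (X -` Q \<inter> space M) \<omega> * g \<omega>)"
    proof (rule integrable_bounded01)
      show "(\<lambda>\<omega>. indicator (X -` Q \<inter> space M) \<omega> * g \<omega>) \<in> borel_measurable M"
        using S g(1) by (intro borel_measurable_times borel_measurable_indicator)
    qed (simp_all add: indicator_def g)
  qed (simp add: g)
  finally show ?thesis .
qed

text \<open>The weights are densities, so both sides are finite measures of R, and finite measures
  that agree on rectangles are equal.\<close>

lemma weighted_pair_eqI:
  assumes X: "X \<in> measurable M (A \<Otimes>\<^sub>M B)"
    and g1: "g1 \<in> borel_measurable M" "\<And>\<omega>. 0 \<le> g1 \<omega>" "\<And>\<omega>. g1 \<omega> \<le> (1::real)"
    and g2: "g2 \<in> borel_measurable M" "\<And>\<omega>. 0 \<le> g2 \<omega>" "\<And>\<omega>. g2 \<omega> \<le> (1::real)"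
    and eq: "\<And>P Q. P \<in> sets A \<Longrightarrow> Q \<in> sets B \<Longrightarrow>
      (\<integral>\<omega>. indicator (X -` (P \<times> Q) \<inter> space M) \<omega> * g1 \<omega> \<partial>M) = (\<integral>\<omega>. indicator (X -` (P \<times> Q) \<inter> space M) \<omega> * g2 \<omega> \<partial>M)"
    and R: "R \<in> sets (A \<Otimes>\<^sub>M B)"
  shows "(\<integral>\<omega>. indicator (X -` R \<inter> space M) \<omega> * g1 \<omega> \<partial>M) = (\<integral>\<omega>. indicator (X -` R \<inter> space M) \<omega> * g2 \<omega> \<partial>M)"
proof -
  let ?D1 = "distr (density M (\<lambda>\<omega>. ennreal (g1 \<omega>))) (A \<Otimes>\<^sub>M B) X"
  let ?D2 = "distr (density M (\<lambda>\<omega>. ennreal (g2 \<omega>))) (A \<Otimes>\<^sub>M B) X"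
  let ?E = "{P \<times> Q | P Q. P \<in> sets A \<and> Q \<in> sets B}"
  have gen: "sets (A \<Otimes>\<^sub>M B) = sigma_sets (space A \<times> space B) ?E" by (rule sets_pair_measure)
  have e1: "emeasure ?D1 Q = ennreal (\<integral>\<omega>. indicator (X -` Q \<inter> space M) \<omega> * g1 \<omega> \<partial>M)" if "Q \<in> sets (A \<Otimes>\<^sub>M B)" for Q
    by (rule emeasure_weighted_distr[OF g1 X that])
  have e2: "emeasure ?D2 Q = ennreal (\<integral>\<omega>. indicator (X -` Q \<inter> space M) \<omega> * g2 \<omega> \<partial>M)" if "Q \<in> sets (A \<Otimes>\<^sub>M B)" for Q
    by (rule emeasure_weighted_distr[OF g2 X that])
  have "?D1 = ?D2"
  proof (rule measure_eqI_generator_eq[where E = ?E and \<Omega> = "space A \<times> space B" and A = "\<lambda>_. space A \<times> space B"])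
    show "Int_stable ?E" by (rule Int_stable_pair_measure_generator)
    show "?E \<subseteq> Pow (space A \<times> space B)" by (rule pair_measure_closed)
    show "emeasure ?D1 Y = emeasure ?D2 Y" if "Y \<in> ?E" for Y
    proof -
      from that obtain P Q where PQ: "Y = P \<times> Q" "P \<in> sets A" "Q \<in> sets B" by blast
      then have "Y \<in> sets (A \<Otimes>\<^sub>M B)" by simp
      then show ?thesis using eq[OF PQ(2,3)] by (simp only: e1 e2 PQ(1))
    qed
    show "sets ?D1 = sigma_sets (space A \<times> space B) ?E" "sets ?D2 = sigma_sets (space A \<times> space B) ?E"
      by (simp_all only: sets_distr gen)
    show "range (\<lambda>_. space A \<times> space B) \<subseteq> ?E" by blast
    have "space A \<times> space B \<in> sets (A \<Otimes>\<^sub>M B)" by (rule pair_measureI[OF sets.top sets.top])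
    from e1[OF this] show "emeasure ?D1 (space A \<times> space B) \<noteq> \<infinity>" by (simp only: ennreal_neq_top infinity_ennreal_def not_False_eq_True)
    show "(\<Union>i. space A \<times> space B) = space A \<times> space B" by blast
  qed
  then have "ennreal (\<integral>\<omega>. indicator (X -` R \<inter> space M) \<omega> * g1 \<omega> \<partial>M) = ennreal (\<integral>\<omega>. indicator (X -` R \<inter> space M) \<omega> * g2 \<omega> \<partial>M)"
    using e1[OF R] e2[OF R] by (simp only:)
  then show ?thesis
  proof (rule ennreal_inj[THEN iffD1, rotated -1])
    show "0 \<le> (\<integral>\<omega>. indicator (X -` R \<inter> space M) \<omega> * g1 \<omega> \<partial>M)"
      by (intro Bochner_Integration.integral_nonneg mult_nonneg_nonneg g1(2)) simp
    show "0 \<le> (\<integral>\<omega>. indicator (X -` R \<inter> space M) \<omega> * g2 \<omega> \<partial>M)"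
      by (intro Bochner_Integration.integral_nonneg mult_nonneg_nonneg g2(2)) simp
  qed
qed

lemma integral_indicator_prob:
  assumes "S \<in> events" "D \<in> events"
  shows "(\<integral>\<omega>. indicator S \<omega> * indicator D \<omega> \<partial>M) = prob (S \<inter> D)"
proof -
  have "(\<lambda>\<omega>. indicator S \<omega> * indicator D \<omega> :: real) = indicator (S \<inter> D)"
    by (auto simp: indicator_def fun_eq_iff)
  then show ?thesis using assms by simp
qed

lemma subalgebra_vimage: "L \<in> measurable M S \<Longrightarrow> subalgebra M (vimage_algebra (space M) L S)"
  unfolding subalgebra_def
proof (intro conjI)
  assume L: "L \<in> measurable M S"
  show "sets (vimage_algebra (space M) L S) \<subseteq> sets M"
    using L by (subst sets_vimage_algebra2) (auto simp: measurable_space intro: measurable_sets)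
qed simp

text \<open>Given L, the pairs (L, X) and (L, Y) are still independent, and their equal joint laws
  give them the same conditional probability of B; the product is a square. The hypothesis concerns
  events of X and of Y only, so it has to be extended from rectangles to B, one pair at a
  time.\<close>

lemma cond_indep_joint:
  assumes L: "L \<in> measurable M S" and X: "X \<in> measurable M K" and Y: "Y \<in> measurable M K"
    and ci: "cond_indep_given M (vimage_algebra (space M) L S) K X K Y"
    and law: "distr M (S \<Otimes>\<^sub>M K) (\<lambda>\<omega>. (L \<omega>, X \<omega>)) = distr M (S \<Otimes>\<^sub>M K) (\<lambda>\<omega>. (L \<omega>, Y \<omega>))"
    and B: "B \<in> sets (S \<Otimes>\<^sub>M K)"
  shows "prob {\<omega> \<in> space M. (L \<omega>, X \<omega>) \<in> B \<and> (L \<omega>, Y \<omega>) \<in> B} =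
    (\<integral>\<omega>. (cprob M (vimage_algebra (space M) L S) {\<omega> \<in> space M. (L \<omega>, X \<omega>) \<in> B} \<omega>)\<^sup>2 \<partial>M)"
proof -
  let ?N = "vimage_algebra (space M) L S"
  have N: "subalgebra M ?N" using L by (rule subalgebra_vimage)
  define JX where "JX = (\<lambda>\<omega>. (L \<omega>, X \<omega>))"
  define JY where "JY = (\<lambda>\<omega>. (L \<omega>, Y \<omega>))"
  have JXm: "JX \<in> measurable M (S \<Otimes>\<^sub>M K)" unfolding JX_def using L X by (rule measurable_Pair)
  have JYm: "JY \<in> measurable M (S \<Otimes>\<^sub>M K)" unfolding JY_def using L Y by (rule measurable_Pair)
  have Lev: "L -` P \<inter> space M \<in> events" if "P \<in> sets S" for P using L that by (rule measurable_sets)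
  have LN: "L -` P \<inter> space M \<in> sets ?N" if "P \<in> sets S" for P
    using that by (rule in_vimage_algebra)
  have Xev: "X -` Q \<inter> space M \<in> events" "Y -` Q \<inter> space M \<in> events" if "Q \<in> sets K" for Q
    using X Y that by (auto intro: measurable_sets)
  have JXev: "JX -` R \<inter> space M \<in> events" if "R \<in> sets (S \<Otimes>\<^sub>M K)" for R using JXm that by (rule measurable_sets)
  have JYev: "JY -` R \<inter> space M \<in> events" if "R \<in> sets (S \<Otimes>\<^sub>M K)" for R using JYm that by (rule measurable_sets)
  have cM: "cprob M ?N D \<in> borel_measurable M" for D using N cprob_measurable by (rule measurable_from_subalg)
  have prodci: "AE \<omega> in M. cprob M ?N ((X -` Q \<inter> space M) \<inter> (Y -` Q' \<inter> space M)) \<omega> =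
      cprob M ?N (X -` Q \<inter> space M) \<omega> * cprob M ?N (Y -` Q' \<inter> space M) \<omega>"
    if Q: "Q \<in> sets K" "Q' \<in> sets K" for Q Q'
  proof -
    have "AE \<omega> in M. real_cond_exp M ?N (indicator {x \<in> space M. X x \<in> Q \<and> Y x \<in> Q'}) \<omega> =
        real_cond_exp M ?N (indicator {x \<in> space M. X x \<in> Q}) \<omega> *
        real_cond_exp M ?N (indicator {x \<in> space M. Y x \<in> Q'}) \<omega>"
      using ci Q unfolding cond_indep_given_def by blast
    moreover have "{x \<in> space M. X x \<in> Q \<and> Y x \<in> Q'} = (X -` Q \<inter> space M) \<inter> (Y -` Q' \<inter> space M)"
      "{x \<in> space M. X x \<in> Q} = X -` Q \<inter> space M" "{x \<in> space M. Y x \<in> Q'} = Y -` Q' \<inter> space M" by auto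
    ultimately have "AE \<omega> in M. real_cond_exp M ?N (indicator ((X -` Q \<inter> space M) \<inter> (Y -` Q' \<inter> space M))) \<omega> =
        real_cond_exp M ?N (indicator (X -` Q \<inter> space M)) \<omega> *
        real_cond_exp M ?N (indicator (Y -` Q' \<inter> space M)) \<omega>" by (simp only:)
    with cprob_AE[OF N sets.Int[OF Xev(1)[OF Q(1)] Xev(2)[OF Q(2)]]] cprob_AE[OF N Xev(1)[OF Q(1)]] cprob_AE[OF N Xev(2)[OF Q(2)]]
    show ?thesis by eventually_elim simp
  qed
  have restrict: "AE \<omega> in M. cprob M ?N ((L -` P \<inter> space M) \<inter> D) \<omega> = indicator (L -` P \<inter> space M) \<omega> * cprob M ?N D \<omega>"
    if P: "P \<in> sets S" and D: "D \<in> events" for P D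
  proof (rule cprob_unique[OF N])
    show "(L -` P \<inter> space M) \<inter> D \<in> events" using Lev[OF P] D by blast
    show "(\<lambda>\<omega>. indicator (L -` P \<inter> space M) \<omega> * cprob M ?N D \<omega>) \<in> borel_measurable ?N"
      using LN[OF P] cprob_measurable by (intro borel_measurable_times borel_measurable_indicator)
    fix A assume A: "A \<in> sets ?N"
    have "(\<integral>\<omega>. indicator A \<omega> * (indicator (L -` P \<inter> space M) \<omega> * cprob M ?N D \<omega>) \<partial>M) =
        (\<integral>\<omega>. indicator (A \<inter> (L -` P \<inter> space M)) \<omega> * cprob M ?N D \<omega> \<partial>M)"
      by (simp add: indicator_inter_arith mult.assoc)
    also have "\<dots> = (\<integral>\<omega>. indicator (A \<inter> (L -` P \<inter> space M)) \<omega> * indicator D \<omega> \<partial>M)"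
      using sets.Int[OF A LN[OF P]] by (intro cprob_integral[OF N D] borel_measurable_indicator) (simp_all add: indicator_def)
    also have "\<dots> = prob ((A \<inter> (L -` P \<inter> space M)) \<inter> D)"
    proof (rule integral_indicator_prob[OF _ D])
      have "A \<in> events" using A N by (auto simp: subalgebra_def)
      then show "A \<inter> (L -` P \<inter> space M) \<in> events" using Lev[OF P] by (rule sets.Int)
    qed
    finally show "(\<integral>\<omega>. indicator A \<omega> * (indicator (L -` P \<inter> space M) \<omega> * cprob M ?N D \<omega>) \<partial>M) =
        prob (A \<inter> ((L -` P \<inter> space M) \<inter> D))" by (simp only: Int_assoc)
  qed (auto simp: indicator_def cprob_bounds)
  \<comment> \<open>First pass: any event of (L, X) against a rectangle for (L, Y). The parts that
    depend on L come out of the conditional probabilities.\<close>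
  have step1: "(\<integral>\<omega>. indicator (JX -` R \<inter> space M) \<omega> * indicator (JY -` (P' \<times> Q') \<inter> space M) \<omega> \<partial>M) =
      (\<integral>\<omega>. indicator (JX -` R \<inter> space M) \<omega> * cprob M ?N (JY -` (P' \<times> Q') \<inter> space M) \<omega> \<partial>M)"
    if R: "R \<in> sets (S \<Otimes>\<^sub>M K)" and P': "P' \<in> sets S" and Q': "Q' \<in> sets K" for R P' Q'
  proof (rule weighted_pair_eqI[OF JXm])
    have PQ': "P' \<times> Q' \<in> sets (S \<Otimes>\<^sub>M K)" using P' Q' by simp
    show "(indicator (JY -` (P' \<times> Q') \<inter> space M) :: 'a \<Rightarrow> real) \<in> borel_measurable M"
      using JYev[OF PQ'] by simp
    show "cprob M ?N (JY -` (P' \<times> Q') \<inter> space M) \<in> borel_measurable M" by (rule cM)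
    fix P Q assume P: "P \<in> sets S" and Q: "Q \<in> sets K"
    let ?l = "L -` P \<inter> space M" and ?l' = "L -` P' \<inter> space M"
    let ?x = "X -` Q \<inter> space M" and ?y = "Y -` Q' \<inter> space M"
    have JXe: "JX -` (P \<times> Q) \<inter> space M = ?l \<inter> ?x" by (auto simp: JX_def)
    have JYe: "JY -` (P' \<times> Q') \<inter> space M = ?l' \<inter> ?y" by (auto simp: JY_def)
    have hN: "indicator (?l \<inter> ?l') \<in> borel_measurable ?N" using sets.Int[OF LN[OF P] LN[OF P']] by (rule borel_measurable_indicator)
    note ev = sets.Int[OF Lev[OF P] Xev(1)[OF Q]] sets.Int[OF Lev[OF P'] Xev(2)[OF Q']]
      sets.Int[OF Lev[OF P] Lev[OF P']] sets.Int[OF Xev(1)[OF Q] Xev(2)[OF Q']]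
    have "(\<integral>\<omega>. indicat_real (?l \<inter> ?x) \<omega> * indicator (?l' \<inter> ?y) \<omega> \<partial>M) = prob ((?l \<inter> ?x) \<inter> (?l' \<inter> ?y))"
      using ev(1,2) by (rule integral_indicator_prob)
    also have "(?l \<inter> ?x) \<inter> (?l' \<inter> ?y) = (?l \<inter> ?l') \<inter> (?x \<inter> ?y)" by blast
    also have "prob \<dots> = (\<integral>\<omega>. indicator (?l \<inter> ?l') \<omega> * indicator (?x \<inter> ?y) \<omega> \<partial>M)"
      using ev(3,4) by (rule integral_indicator_prob[symmetric])
    also have "\<dots> = (\<integral>\<omega>. indicator (?l \<inter> ?l') \<omega> * cprob M ?N (?x \<inter> ?y) \<omega> \<partial>M)"
      by (rule cprob_integral[OF N ev(4) hN, symmetric]) (simp_all add: indicator_def)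
    also have "\<dots> = (\<integral>\<omega>. (indicator (?l \<inter> ?l') \<omega> * cprob M ?N ?y \<omega>) * cprob M ?N ?x \<omega> \<partial>M)"
    proof (rule integral_cong_AE)
      show "AE \<omega> in M. indicator (?l \<inter> ?l') \<omega> * cprob M ?N (?x \<inter> ?y) \<omega> =
          (indicator (?l \<inter> ?l') \<omega> * cprob M ?N ?y \<omega>) * cprob M ?N ?x \<omega>"
        using prodci[OF Q Q'] by eventually_elim simp
      have lm: "indicator (?l \<inter> ?l') \<in> borel_measurable M"
        using ev(3) by (rule borel_measurable_indicator)
      show "(\<lambda>\<omega>. indicator (?l \<inter> ?l') \<omega> * cprob M ?N (?x \<inter> ?y) \<omega>) \<in> borel_measurable M"
        "(\<lambda>\<omega>. (indicator (?l \<inter> ?l') \<omega> * cprob M ?N ?y \<omega>) * cprob M ?N ?x \<omega>) \<in> borel_measurable M"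
        by (intro borel_measurable_times lm cM)+
    qed
    also have "\<dots> = (\<integral>\<omega>. (indicator (?l \<inter> ?l') \<omega> * cprob M ?N ?y \<omega>) * indicator ?x \<omega> \<partial>M)"
      by (rule cprob_integral[OF N Xev(1)[OF Q] borel_measurable_times[OF hN cprob_measurable]])
        (simp_all add: indicator_def cprob_bounds)
    also have "\<dots> = (\<integral>\<omega>. indicator (?l \<inter> ?x) \<omega> * (indicator ?l' \<omega> * cprob M ?N ?y \<omega>) \<partial>M)"
      by (rule Bochner_Integration.integral_cong) (auto simp: indicator_def)
    also have "\<dots> = (\<integral>\<omega>. indicator (?l \<inter> ?x) \<omega> * cprob M ?N (?l' \<inter> ?y) \<omega> \<partial>M)"
    proof (rule integral_cong_AE)
      show "AE \<omega> in M. indicator (?l \<inter> ?x) \<omega> * (indicator ?l' \<omega> * cprob M ?N ?y \<omega>) =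
          indicator (?l \<inter> ?x) \<omega> * cprob M ?N (?l' \<inter> ?y) \<omega>"
        using restrict[OF P' Xev(2)[OF Q']] by eventually_elim simp
      have lm: "indicator (?l \<inter> ?x) \<in> borel_measurable M" "indicator ?l' \<in> borel_measurable M"
        using ev(1) Lev[OF P'] by (simp_all only: borel_measurable_indicator)
      show "(\<lambda>\<omega>. indicator (?l \<inter> ?x) \<omega> * (indicator ?l' \<omega> * cprob M ?N ?y \<omega>)) \<in> borel_measurable M"
        "(\<lambda>\<omega>. indicator (?l \<inter> ?x) \<omega> * cprob M ?N (?l' \<inter> ?y) \<omega>) \<in> borel_measurable M"
        by (intro borel_measurable_times lm cM)+
    qed
    finally show "(\<integral>\<omega>. indicator (JX -` (P \<times> Q) \<inter> space M) \<omega> * indicator (JY -` (P' \<times> Q') \<inter> space M) \<omega> \<partial>M) =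
      (\<integral>\<omega>. indicator (JX -` (P \<times> Q) \<inter> space M) \<omega> * cprob M ?N (JY -` (P' \<times> Q') \<inter> space M) \<omega> \<partial>M)"
      by (simp only: JXe JYe)
  qed (use R in \<open>auto simp: cprob_bounds\<close>)
  \<comment> \<open>Conditional expectation is self-adjoint. This exchanges the roles of the two
    pairs, so the second pass can vary the other one.\<close>
  have swap: "(\<integral>\<omega>. indicator D \<omega> * cprob M ?N D' \<omega> \<partial>M) = (\<integral>\<omega>. indicator D' \<omega> * cprob M ?N D \<omega> \<partial>M)"
    if D: "D \<in> events" and D': "D' \<in> events" for D D'
  proof -
    have "(\<integral>\<omega>. cprob M ?N D' \<omega> * indicator D \<omega> \<partial>M) = (\<integral>\<omega>. cprob M ?N D' \<omega> * cprob M ?N D \<omega> \<partial>M)"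
      by (rule cprob_integral[OF N D cprob_measurable, symmetric]) (simp_all add: cprob_bounds)
    also have "\<dots> = (\<integral>\<omega>. cprob M ?N D \<omega> * cprob M ?N D' \<omega> \<partial>M)" by (simp only: mult.commute)
    also have "\<dots> = (\<integral>\<omega>. cprob M ?N D \<omega> * indicator D' \<omega> \<partial>M)"
      by (rule cprob_integral[OF N D' cprob_measurable]) (simp_all add: cprob_bounds)
    finally show ?thesis by (simp only: mult.commute)
  qed
  let ?DX = "JX -` B \<inter> space M" and ?DY = "JY -` B \<inter> space M"
  \<comment> \<open>Second pass: the event of (L, X) is now B itself, and any event of (L, Y) is
    reached from rectangles.\<close>
  have step2: "(\<integral>\<omega>. indicator (JY -` R \<inter> space M) \<omega> * indicator ?DX \<omega> \<partial>M) =
      (\<integral>\<omega>. indicator (JY -` R \<inter> space M) \<omega> * cprob M ?N ?DX \<omega> \<partial>M)"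
    if R: "R \<in> sets (S \<Otimes>\<^sub>M K)" for R
  proof (rule weighted_pair_eqI[OF JYm])
    show "(indicator ?DX :: 'a \<Rightarrow> real) \<in> borel_measurable M" using JXev[OF B] by simp
    fix P Q assume P: "P \<in> sets S" and Q: "Q \<in> sets K"
    then have PQ: "P \<times> Q \<in> sets (S \<Otimes>\<^sub>M K)" by simp
    have "(\<integral>\<omega>. indicator (JY -` (P \<times> Q) \<inter> space M) \<omega> * indicator ?DX \<omega> \<partial>M) =
        (\<integral>\<omega>. indicat_real ?DX \<omega> * indicator (JY -` (P \<times> Q) \<inter> space M) \<omega> \<partial>M)" by (simp only: mult.commute)
    also have "\<dots> = (\<integral>\<omega>. indicator ?DX \<omega> * cprob M ?N (JY -` (P \<times> Q) \<inter> space M) \<omega> \<partial>M)" by (rule step1[OF B P Q])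
    also have "\<dots> = (\<integral>\<omega>. indicator (JY -` (P \<times> Q) \<inter> space M) \<omega> * cprob M ?N ?DX \<omega> \<partial>M)"
      by (rule swap[OF JXev[OF B] JYev[OF PQ]])
    finally show "(\<integral>\<omega>. indicator (JY -` (P \<times> Q) \<inter> space M) \<omega> * indicator ?DX \<omega> \<partial>M) =
      (\<integral>\<omega>. indicator (JY -` (P \<times> Q) \<inter> space M) \<omega> * cprob M ?N ?DX \<omega> \<partial>M)" .
  qed (use R cM in \<open>auto simp: cprob_bounds\<close>)
  \<comment> \<open>Conditional probabilities given L are determined by the joint law with L, which
    is the same for X and Y.\<close>
  have same: "AE \<omega> in M. cprob M ?N ?DY \<omega> = cprob M ?N ?DX \<omega>"
  proof (rule cprob_unique[OF N JYev[OF B] cprob_measurable])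
    fix A assume A: "A \<in> sets ?N"
    then obtain P where P: "P \<in> sets S" "A = L -` P \<inter> space M"
      using L by (subst (asm) sets_vimage_algebra2) (auto dest: measurable_space)
    have Aev: "A \<in> events" using Lev P by simp
    have PB: "(P \<times> space K) \<inter> B \<in> sets (S \<Otimes>\<^sub>M K)" using P B by (intro sets.Int) auto
    have "(\<integral>\<omega>. indicator A \<omega> * cprob M ?N ?DX \<omega> \<partial>M) = (\<integral>\<omega>. indicator A \<omega> * indicator ?DX \<omega> \<partial>M)"
      using A by (intro cprob_integral[OF N JXev[OF B]] borel_measurable_indicator) auto
    also have "\<dots> = prob (A \<inter> ?DX)" by (rule integral_indicator_prob[OF Aev JXev[OF B]])
    also have "A \<inter> ?DX = JX -` ((P \<times> space K) \<inter> B) \<inter> space M"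
      using X by (auto simp: JX_def P(2) dest: measurable_space)
    also have "prob \<dots> = measure (distr M (S \<Otimes>\<^sub>M K) JX) ((P \<times> space K) \<inter> B)"
      by (rule measure_distr[OF JXm PB, symmetric])
    also have "\<dots> = measure (distr M (S \<Otimes>\<^sub>M K) JY) ((P \<times> space K) \<inter> B)"
      using law by (simp only: JX_def JY_def)
    also have "\<dots> = prob (JY -` ((P \<times> space K) \<inter> B) \<inter> space M)" by (rule measure_distr[OF JYm PB])
    also have "JY -` ((P \<times> space K) \<inter> B) \<inter> space M = A \<inter> ?DY"
      using Y by (auto simp: JY_def P(2) dest: measurable_space)
    finally show "(\<integral>\<omega>. indicator A \<omega> * cprob M ?N ?DX \<omega> \<partial>M) = prob (A \<inter> ?DY)" .
  qed (simp_all add: cprob_bounds)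
  have "prob {\<omega> \<in> space M. (L \<omega>, X \<omega>) \<in> B \<and> (L \<omega>, Y \<omega>) \<in> B} = prob (?DY \<inter> ?DX)"
    by (rule arg_cong[of _ _ prob]) (auto simp: JX_def JY_def)
  also have "\<dots> = (\<integral>\<omega>. indicator ?DY \<omega> * indicator ?DX \<omega> \<partial>M)"
    by (rule integral_indicator_prob[OF JYev[OF B] JXev[OF B], symmetric])
  also have "\<dots> = (\<integral>\<omega>. indicator ?DY \<omega> * cprob M ?N ?DX \<omega> \<partial>M)" by (rule step2[OF B])
  also have "\<dots> = (\<integral>\<omega>. cprob M ?N ?DX \<omega> * indicator ?DY \<omega> \<partial>M)" by (simp only: mult.commute)
  also have "\<dots> = (\<integral>\<omega>. cprob M ?N ?DX \<omega> * cprob M ?N ?DY \<omega> \<partial>M)"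
    by (rule cprob_integral[OF N JYev[OF B] cprob_measurable, symmetric]) (simp_all add: cprob_bounds)
  also have "\<dots> = (\<integral>\<omega>. (cprob M ?N ?DX \<omega>)\<^sup>2 \<partial>M)"
  proof (rule integral_cong_AE)
    show "AE \<omega> in M. cprob M ?N ?DX \<omega> * cprob M ?N ?DY \<omega> = (cprob M ?N ?DX \<omega>)\<^sup>2"
      using same by eventually_elim (simp add: power2_eq_square)
  qed (intro borel_measurable_times borel_measurable_power cM)+
  also have "?DX = {\<omega> \<in> space M. (L \<omega>, X \<omega>) \<in> B}" by (auto simp: JX_def)
  finally show ?thesis .
qed

end

section \<open>Frozen boundary edges given all labels\<close>

lemma prod_indicator:
  "finite I \<Longrightarrow> (\<Prod>a\<in>I. indicator (X a) \<omega>) = (indicator {\<omega>. \<forall>a\<in>I. \<omega> \<in> X a} \<omega> :: real)"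
  by (induction I rule: finite_induct) (simp_all add: indicator_def)

context tree_percolation
begin

abbreviation side_measure :: "'v \<times> 'v \<Rightarrow> 'a measure" where
  "side_measure a \<equiv> vimage_algebra (space M)
     (\<lambda>\<omega>. (labels U (unorient (descendants E a)) \<omega>, Fv \<omega> \<inter> descendants E a))
     (label_space (unorient (descendants E a)) \<Otimes>\<^sub>M subset_space (descendants E a))"

lemma sides_events:
  assumes S: "subtree T E S" "finite S"
  shows "a \<in> boundary T E S \<Longrightarrow> side_algebra a \<subseteq> events"
    and "sets (label_algebra M U (edges_within E S)) \<subseteq> events"
proof -
  let ?F = "\<lambda>i. case i of None \<Rightarrow> sets (label_algebra M U (edges_within E S)) | Some a \<Rightarrow> side_algebra a"
  have "indep_sets ?F (insert None (Some ` boundary T E S))" by (rule markov[OF S])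
  then have *: "\<forall>i\<in>insert None (Some ` boundary T E S). ?F i \<subseteq> events" unfolding indep_sets_def by (rule conjunct1)
  show "a \<in> boundary T E S \<Longrightarrow> side_algebra a \<subseteq> events" using bspec[OF *, of "Some a"] by simp
  show "sets (label_algebra M U (edges_within E S)) \<subseteq> events" using bspec[OF *, of None] by simp
qed

lemma sides_integral:
  assumes S: "subtree T E S" "finite S" and fin: "finite (boundary T E S)"
    and H: "H \<in> sets (label_algebra M U (edges_within E S))"
    and f: "\<And>a. a \<in> boundary T E S \<Longrightarrow> f a \<in> borel_measurable (side_measure a)"
      "\<And>a \<omega>. 0 \<le> f a \<omega>" "\<And>a \<omega>. f a \<omega> \<le> (1::real)"
  shows "(\<integral>\<omega>. indicator H \<omega> * (\<Prod>a\<in>boundary T E S. f a \<omega>) \<partial>M) = prob H * (\<Prod>a\<in>boundary T E S. \<integral>\<omega>. f a \<omega> \<partial>M)"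
proof -
  let ?I = "boundary T E S"
  define X where "X = (\<lambda>i. case i of None \<Rightarrow> indicat_real H | Some a \<Rightarrow> f a)"
  let ?F = "\<lambda>i. case i of None \<Rightarrow> sets (label_algebra M U (edges_within E S)) | Some a \<Rightarrow> side_algebra a"
  have ind: "indep_sets ?F (insert None (Some ` ?I))" by (rule markov[OF S])
  have sub: "X i -` A \<inter> space M \<in> ?F i" if i: "i \<in> insert None (Some ` ?I)" and A: "A \<in> sets borel" for i A
  proof (cases i)
    case None
    have "indicat_real H \<in> borel_measurable (label_algebra M U (edges_within E S))"
      using H by (rule borel_measurable_indicator)
    from measurable_sets[OF this A] show ?thesis by (simp add: None X_def label_algebra_def)
  next
    case (Some a)
    then have "a \<in> ?I" using i by blast
    from measurable_sets[OF f(1)[OF this] A] show ?thesis by (simp add: Some X_def)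
  qed
  have Fev: "?F i \<subseteq> events" if "i \<in> insert None (Some ` ?I)" for i
    using ind that unfolding indep_sets_def by blast
  have Xm: "X i \<in> borel_measurable M" if i: "i \<in> insert None (Some ` ?I)" for i
  proof (rule measurableI)
    show "X i -` A \<inter> space M \<in> events" if "A \<in> sets borel" for A using sub[OF i that] Fev[OF i] by blast
  qed simp
  have X01: "0 \<le> X i \<omega>" "X i \<omega> \<le> 1" for i \<omega>
    by (cases i; simp add: X_def f(2,3))+
  have iv: "indep_vars (\<lambda>_. borel) X (insert None (Some ` ?I))"
    unfolding indep_vars_def2
  proof (intro conjI ballI Xm)
    show "indep_sets (\<lambda>i. {X i -` A \<inter> space M |A. A \<in> sets borel}) (insert None (Some ` ?I))"
      by (rule indep_sets_mono_sets[OF ind]) (use sub in blast)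
  qed
  have "(\<integral>\<omega>. (\<Prod>i\<in>insert None (Some ` ?I). X i \<omega>) \<partial>M) = (\<Prod>i\<in>insert None (Some ` ?I). \<integral>\<omega>. X i \<omega> \<partial>M)"
    using fin by (intro indep_vars_lebesgue_integral iv integrable_bounded01 Xm X01) auto
  moreover have e: "(\<Prod>i\<in>insert None (Some ` ?I). g i) = g None * (\<Prod>a\<in>?I. g (Some a))" for g :: "('v \<times> 'v) option \<Rightarrow> real"
    using fin by (simp add: prod.reindex)
  moreover have "(\<integral>\<omega>. X None \<omega> \<partial>M) = prob H"
    using Xm[of None] Fev[of None] H by (auto simp: X_def)
  ultimately show ?thesis by (simp add: X_def)
qed

text \<open>Generated by the labels of a and of all edges beyond it. It is contained both in the
  side algebra of a and in the algebra of all labels.\<close>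

definition own_labels :: "'v \<times> 'v \<Rightarrow> 'a measure" where
  "own_labels a = vimage_algebra (space M) (\<lambda>\<omega>. labels_of (cd a \<omega>)) labs"

lemma space_own_labels [simp]: "space (own_labels a) = space M" by (simp add: own_labels_def)

lemma sets_own_labels:
  "sets (own_labels a) = {(\<lambda>\<omega>. labels_of (cd a \<omega>)) -` C \<inter> space M | C. C \<in> sets labs}"
  unfolding own_labels_def by (rule sets_vimage_algebra2) (simp add: space_PiM)

lemma own_labels_side: "a \<in> orient E \<Longrightarrow> sets (own_labels a) \<subseteq> side_algebra a"
proof
  fix A assume a: "a \<in> orient E" and "A \<in> sets (own_labels a)"
  then obtain C where C: "C \<in> sets labs" "A = (\<lambda>\<omega>. labels_of (cd a \<omega>)) -` C \<inter> space M"
    unfolding sets_own_labels by blast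
  have "A = cd a -` (labels_of -` C \<inter> space trees) \<inter> space M" by (auto simp: C(2))
  then show "A \<in> side_algebra a" using cd_side[OF a measurable_sets[OF labels_of_measurable C(1)]] by simp
qed

lemma own_labels_sub: "a \<in> orient E \<Longrightarrow> subalgebra M (own_labels a)"
  unfolding own_labels_def by (rule subalgebra_vimage) (rule measurable_compose[OF cd_measurable labels_of_measurable])

lemma all_labels_sub: "subalgebra M (label_algebra M U E)"
  unfolding label_algebra_def by (rule subalgebra_vimage) (simp add: labels_measurable)

lemma own_labels_all: "a \<in> orient E \<Longrightarrow> sets (own_labels a) \<subseteq> sets (label_algebra M U E)"
proof
  fix A assume a: "a \<in> orient E" and "A \<in> sets (own_labels a)"
  then obtain C where C: "C \<in> sets labs" "A = (\<lambda>\<omega>. labels_of (cd a \<omega>)) -` C \<inter> space M"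
    unfolding sets_own_labels by blast
  have m: "(\<lambda>f l. f (edge (desc a l))) \<in> measurable (label_space E) labs"
    by (rule measurable_PiM_single') (auto intro!: measurable_component_singleton edge_desc_E a)
  have "labels_of (cd a \<omega>) = (\<lambda>l. labels U E \<omega> (edge (desc a l)))" for \<omega>
    by (simp add: labels_of_def cd_def code_def labels_def edge_desc_E[OF a])
  then have "A = labels U E -` ((\<lambda>f l. f (edge (desc a l))) -` C \<inter> space (label_space E)) \<inter> space M"
    by (auto simp: C(2) labels_def space_PiM)
  then show "A \<in> sets (label_algebra M U E)"
    unfolding label_algebra_def using in_vimage_algebra[OF measurable_sets[OF m C(1)]] by simp
qed

lemma measurable_own_labels_mono:
  assumes "f \<in> borel_measurable (own_labels a)" "sets (own_labels a) \<subseteq> sets N" "space N = space M"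
  shows "f \<in> borel_measurable N"
  using assms by (intro measurable_from_subalg[OF _ assms(1)]) (simp add: subalgebra_def)

lemma own_label_event:
  assumes A: "A \<in> sets borel"
  shows "U (edge (desc a l)) -` A \<inter> space M \<in> sets (own_labels a)"
proof -
  have m: "(\<lambda>V. V l) -` A \<inter> space labs \<in> sets labs" by (rule measurable_sets[OF _ A]) simp
  have "U (edge (desc a l)) -` A \<inter> space M = (\<lambda>\<omega>. labels_of (cd a \<omega>)) -` ((\<lambda>V. V l) -` A \<inter> space labs) \<inter> space M"
    by (auto simp: labels_of_def cd_def code_def space_PiM)
  then show ?thesis unfolding sets_own_labels using m by blast
qed

lemma frozen_side: "a \<in> orient E \<Longrightarrow> {\<omega> \<in> space M. a \<in> Fv \<omega>} \<in> side_algebra a"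
proof -
  assume a: "a \<in> orient E"
  have "{z \<in> space trees. snd (z [])} \<in> sets trees" by measurable
  from cd_side[OF a this] show ?thesis
    by (simp add: cd_def code_def vimage_def Int_def conj_commute)
qed

text \<open>Conditions on the labels beyond a only. These functions are therefore independent over
  the boundary of a subtree, while \<open>cprob_pattern\<close> shows that conditioning on all
  labels gives the same probabilities.\<close>

definition freezing :: "'v \<times> 'v \<Rightarrow> 'a \<Rightarrow> real" where
  "freezing a = cprob M (own_labels a) {\<omega> \<in> space M. a \<in> Fv \<omega>}"

lemma freezing_bounds: "0 \<le> freezing a \<omega>" "freezing a \<omega> \<le> 1"
  by (simp_all add: freezing_def cprob_bounds)

lemma freezing_own: "freezing a \<in> borel_measurable (own_labels a)"
  unfolding freezing_def by (rule cprob_measurable)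

text \<open>The factor of a in the conditional probability that, among the boundary edges, exactly
  those in \<epsilon> are frozen.\<close>

definition pattern :: "('v \<times> 'v) set \<Rightarrow> 'v \<times> 'v \<Rightarrow> 'a \<Rightarrow> real" where
  "pattern \<epsilon> a \<omega> = (if a \<in> \<epsilon> then freezing a \<omega> else 1 - freezing a \<omega>)"

lemma pattern_bounds: "0 \<le> pattern \<epsilon> a \<omega>" "pattern \<epsilon> a \<omega> \<le> 1"
  by (simp_all add: pattern_def freezing_bounds)

lemma pattern_own: "pattern \<epsilon> a \<in> borel_measurable (own_labels a)"
  unfolding pattern_def[abs_def] using freezing_own by (cases "a \<in> \<epsilon>") simp_all

lemma pattern_integral:
  assumes a: "a \<in> orient E" and H: "H \<in> sets (own_labels a)"
  shows "(\<integral>\<omega>. indicator H \<omega> * pattern \<epsilon> a \<omega> \<partial>M) = prob (H \<inter> {\<omega> \<in> space M. a \<in> Fv \<omega> \<longleftrightarrow> a \<in> \<epsilon>})"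
proof -
  note N = own_labels_sub[OF a] and D = Fv_mem[OF a]
  let ?D = "{\<omega> \<in> space M. a \<in> Fv \<omega>}"
  have Hev: "H \<in> events" using H N by (auto simp: subalgebra_def)
  have fM: "freezing a \<in> borel_measurable M" using N freezing_own by (rule measurable_from_subalg)
  have "(\<integral>\<omega>. indicator H \<omega> * freezing a \<omega> \<partial>M) = (\<integral>\<omega>. indicator H \<omega> * indicator ?D \<omega> \<partial>M)"
    unfolding freezing_def by (rule cprob_integral[OF N D borel_measurable_indicator[OF H]]) simp_all
  also have "\<dots> = prob (H \<inter> ?D)" by (rule integral_indicator_prob[OF Hev D])
  finally have pos: "(\<integral>\<omega>. indicator H \<omega> * freezing a \<omega> \<partial>M) = prob (H \<inter> ?D)" .
  show ?thesis
  proof (cases "a \<in> \<epsilon>")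
    case True
    then show ?thesis using pos by (simp add: pattern_def)
  next
    case False
    have i: "integrable M (\<lambda>\<omega>. indicat_real H \<omega> * freezing a \<omega>)"
    proof (rule integrable_bounded01)
      show "(\<lambda>\<omega>. indicat_real H \<omega> * freezing a \<omega>) \<in> borel_measurable M"
        using Hev fM by (intro borel_measurable_times borel_measurable_indicator)
    qed (simp_all add: indicator_def freezing_bounds)
    have "(\<integral>\<omega>. indicator H \<omega> * pattern \<epsilon> a \<omega> \<partial>M) = (\<integral>\<omega>. indicat_real H \<omega> - indicat_real H \<omega> * freezing a \<omega> \<partial>M)"
      using False by (simp add: pattern_def right_diff_distrib)
    also have "\<dots> = (\<integral>\<omega>. indicat_real H \<omega> \<partial>M) - (\<integral>\<omega>. indicat_real H \<omega> * freezing a \<omega> \<partial>M)"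
      using Hev by (intro Bochner_Integration.integral_diff i integrable_bounded01 borel_measurable_indicator) simp_all
    also have "\<dots> = prob H - prob (H \<inter> ?D)" using Hev pos by simp
    also have "\<dots> = prob (H - H \<inter> ?D)" using Hev D by (subst finite_measure_Diff) auto
    also have "H - H \<inter> ?D = H \<inter> {\<omega> \<in> space M. a \<in> Fv \<omega> \<longleftrightarrow> a \<in> \<epsilon>}"
      using False sets.sets_into_space[OF Hev] by auto
    finally show ?thesis .
  qed
qed

text \<open>Every label is seen either inside the ball or from one of its boundary edges. The edge a
  itself is not inside, as \<open>fst a\<close> is outside the ball; it is counted with the boundary
  edge \<open>rev_edge a\<close>.\<close>

lemma edge_location:
  assumes a: "a \<in> orient E" and e: "e \<in> E"
  shows "e \<in> edges_within E (ball_side a n) \<or>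
    (\<exists>d\<in>boundary T E (ball_side a n). e \<in> range (\<lambda>l. edge (desc d l)))"
  using a e
proof (cases rule: E_cases)
  case (1 l)
  consider "length l \<ge> Suc n" | "l = []" | l' b where "l = l' @ [b]" "length l \<le> n"
    by (cases "Suc n \<le> length l"; cases l rule: rev_cases) auto
  then show ?thesis
  proof cases
    case 1
    have "desc a l = desc (desc a (take (Suc n) l)) (drop (Suc n) l)"
      using desc_simps(3)[of a "take (Suc n) l" "drop (Suc n) l"] by (simp only: append_take_drop_id)
    then have "e \<in> range (\<lambda>l'. edge (desc (desc a (take (Suc n) l)) l'))"
      using \<open>e = edge (desc a l)\<close> by (intro image_eqI[of _ _ "drop (Suc n) l"]) (simp only:, simp only: UNIV_I)
    moreover have "length (take (Suc n) l) = Suc n" using 1 by simp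
    then have "desc a (take (Suc n) l) \<in> boundary T E (ball_side a n)"
      unfolding boundary_ball_side[OF a] by (intro insertI2 imageI CollectI)
    ultimately show ?thesis by (intro disjI2 bexI)
  next
    case 2
    then have "e = edge (desc (rev_edge a) [])" using \<open>e = edge (desc a l)\<close> by simp
    moreover have "rev_edge a \<in> boundary T E (ball_side a n)" unfolding boundary_ball_side[OF a] by simp
    ultimately show ?thesis by blast
  next
    case (3 l' b)
    have "fst (desc a l) = snd (desc a l')" by (simp only: 3(1) fst_desc_snoc)
    moreover have "snd (desc a l') \<in> ball_side a n" "snd (desc a l) \<in> ball_side a n"
      using 3 by (simp_all only: ball_side_mem[OF a] length_append list.size)
    ultimately have "e \<subseteq> ball_side a n"
      unfolding \<open>e = edge (desc a l)\<close> edge_def by simp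
    then show ?thesis using e by (simp add: edges_within_def)
  qed
next
  case (2 l)
  moreover have "rev_edge a \<in> boundary T E (ball_side a n)" unfolding boundary_ball_side[OF a] by simp
  ultimately show ?thesis by blast
qed

lemma finite_boundary:
  assumes a: "a \<in> orient E"
  shows "finite (boundary T E (ball_side a n))"
  unfolding boundary_ball_side[OF a] using finite_lists_length_eq[of "UNIV :: bool set" "Suc n"] by simp

lemma boundary_orient: "boundary T E S \<subseteq> orient E"
  unfolding boundary_def by blast

lemma label_within:
  assumes e: "e \<in> edges_within E S" and A: "A \<in> sets borel"
  shows "U e -` A \<inter> space M \<in> sets (label_algebra M U (edges_within E S))"
proof -
  have m: "(\<lambda>f. f e) -` A \<inter> space (label_space (edges_within E S)) \<in> sets (label_space (edges_within E S))"
    by (rule measurable_sets[OF measurable_component_singleton[OF e] A])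
  have "U e -` A \<inter> space M = labels U (edges_within E S) -` ((\<lambda>f. f e) -` A \<inter> space (label_space (edges_within E S))) \<inter> space M"
    using e by (auto simp: labels_def space_PiM)
  then show ?thesis unfolding label_algebra_def using in_vimage_algebra[OF m] by simp
qed

text \<open>Weighted by the product on the one hand and by the indicator of D on the other, the law
  of the labels gives two finite measures, and these need only be compared on cylinders. A cylinder
  splits into a part inside the ball and one part beyond each boundary edge, so independence reduces
  the comparison to the definition of \<open>freezing\<close> at each edge.\<close>

lemma cprob_pattern:
  assumes a0: "a0 \<in> orient E" and I: "I = boundary T E (ball_side a0 n)"
    and D: "D \<in> events" "AE \<omega> in M. \<omega> \<in> D \<longleftrightarrow> (\<forall>a\<in>I. a \<in> Fv \<omega> \<longleftrightarrow> a \<in> \<epsilon>)"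
  shows "AE \<omega> in M. cprob M (label_algebra M U E) D \<omega> = (\<Prod>a\<in>I. pattern \<epsilon> a \<omega>)"
proof (rule cprob_unique[OF all_labels_sub D(1)])
  let ?W = "\<lambda>\<omega>. \<Prod>a\<in>I. pattern \<epsilon> a \<omega>"
  let ?S = "ball_side a0 n"
  have finI: "finite I" unfolding I using a0 by (rule finite_boundary)
  have Io: "a \<in> orient E" if "a \<in> I" for a using that boundary_orient unfolding I by blast
  note side = sides_integral[OF subtree_ball_side[OF a0, of n] finite_ball_side finite_boundary[OF a0], folded I]
  note ev = sides_events[OF subtree_ball_side[OF a0, of n] finite_ball_side, folded I]
  show WN: "?W \<in> borel_measurable (label_algebra M U E)"
  proof (rule borel_measurable_prod)
    fix a assume "a \<in> I"
    then show "pattern \<epsilon> a \<in> borel_measurable (label_algebra M U E)"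
      by (intro measurable_own_labels_mono[OF pattern_own own_labels_all] Io) (simp_all add: label_algebra_def)
  qed
  have WM: "?W \<in> borel_measurable M" using all_labels_sub WN by (rule measurable_from_subalg)
  show W0: "0 \<le> ?W \<omega>" for \<omega> by (intro prod_nonneg) (simp add: pattern_bounds)
  show W1: "?W \<omega> \<le> 1" for \<omega> by (intro prod_le_1) (simp add: pattern_bounds)
  have DM: "indicat_real D \<in> borel_measurable M" using D(1) by (rule borel_measurable_indicator)
  have Lm: "labels U E \<in> measurable M (label_space E)" by (rule labels_measurable) simp
  let ?P = "distr (density M (\<lambda>\<omega>. ennreal (?W \<omega>))) (label_space E) (labels U E)"
  let ?Q = "distr (density M (\<lambda>\<omega>. ennreal (indicat_real D \<omega>))) (label_space E) (labels U E)"
  note eP = emeasure_weighted_distr[OF WM W0 W1 Lm]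
  have eQ: "emeasure ?Q B = ennreal (prob ((labels U E -` B \<inter> space M) \<inter> D))" if B: "B \<in> sets (label_space E)" for B
    using emeasure_weighted_distr[OF DM _ _ Lm B] integral_indicator_prob[OF measurable_sets[OF Lm B] D(1)] by simp
  have "?P = ?Q"
  proof (rule measure_eqI_PiM_infinite)
    show "finite_measure ?P"
    proof
      have "emeasure ?P (space (label_space E)) \<noteq> \<infinity>" by (subst eP) simp_all
      then show "emeasure ?P (space ?P) \<noteq> \<infinity>" by simp
    qed
    fix A :: "'v set \<Rightarrow> real set" and J
    assume J: "finite J" "J \<subseteq> E" and A: "\<And>e. e \<in> J \<Longrightarrow> A e \<in> sets borel"
    let ?B = "prod_emb E (\<lambda>_. borel) J (Pi\<^sub>E J A)"
    have B: "?B \<in> sets (label_space E)" using J A by (intro sets_PiM_I) auto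
    have pre: "labels U E -` ?B \<inter> space M = {\<omega> \<in> space M. \<forall>e\<in>J. U e \<omega> \<in> A e}"
      using J(2) by (auto simp: prod_emb_def labels_def PiE_iff space_PiM extensional_def restrict_def subset_iff)
    \<comment> \<open>The labels constrained by the cylinder are distributed: those in
      \<open>K\<close> lie inside the ball, each other one is assigned to a boundary edge \<kappa> e
      from which it is seen. \<open>H0\<close> and \<open>H a\<close> are the resulting
      constraints.\<close>
    define K where "K = {e\<in>J. e \<in> edges_within E ?S}"
    have "\<forall>e\<in>J - K. \<exists>d\<in>I. e \<in> range (\<lambda>l. edge (desc d l))"
      using edge_location[OF a0, of _ n] J(2) unfolding K_def I by blast
    then obtain \<kappa> where k: "\<forall>e\<in>J - K. \<kappa> e \<in> I \<and> e \<in> range (\<lambda>l. edge (desc (\<kappa> e) l))"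
      unfolding Bex_def by (rule bchoice[THEN exE])
    have \<kappa>: "\<kappa> e \<in> I" "e \<in> range (\<lambda>l. edge (desc (\<kappa> e) l))" if "e \<in> J - K" for e
      using bspec[OF k that] by (rule conjunct1, rule conjunct2)
    define H0 where "H0 = {\<omega> \<in> space M. \<forall>e\<in>K. U e \<omega> \<in> A e}"
    define H where "H = (\<lambda>a. {\<omega> \<in> space M. \<forall>e\<in>{e\<in>J - K. \<kappa> e = a}. U e \<omega> \<in> A e})"
    have finK: "finite K" unfolding K_def using J(1) by simp
    have H0: "H0 \<in> sets (label_algebra M U (edges_within E ?S))"
    proof -
      have "{\<omega> \<in> space (label_algebra M U (edges_within E ?S)). \<forall>e\<in>K. U e \<omega> \<in> A e} \<in> sets (label_algebra M U (edges_within E ?S))"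
      proof (rule sets.sets_Collect_finite_All[OF _ finK])
        fix e assume e: "e \<in> K"
        then have "U e -` A e \<inter> space M \<in> sets (label_algebra M U (edges_within E ?S))"
          by (intro label_within A) (simp_all add: K_def)
        then show "{\<omega> \<in> space (label_algebra M U (edges_within E ?S)). U e \<omega> \<in> A e} \<in> sets (label_algebra M U (edges_within E ?S))"
          by (simp add: label_algebra_def vimage_def Int_def conj_commute)
      qed
      then show ?thesis by (simp add: H0_def label_algebra_def)
    qed
    have H: "H a \<in> sets (own_labels a)" for a
    proof -
      have "{\<omega> \<in> space (own_labels a). \<forall>e\<in>{e\<in>J - K. \<kappa> e = a}. U e \<omega> \<in> A e} \<in> sets (own_labels a)"
      proof (rule sets.sets_Collect_finite_All)
        show "finite {e\<in>J - K. \<kappa> e = a}" using J(1) by simp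
        fix e assume e: "e \<in> {e\<in>J - K. \<kappa> e = a}"
        then obtain l where l: "e = edge (desc a l)" using \<kappa>(2)[of e] by blast
        have "U e -` A e \<inter> space M \<in> sets (own_labels a)" using own_label_event[OF A, of e a l] e l by simp
        then show "{\<omega> \<in> space (own_labels a). U e \<omega> \<in> A e} \<in> sets (own_labels a)"
          by (simp add: vimage_def Int_def conj_commute)
      qed
      then show ?thesis by (simp add: H_def)
    qed
    have H': "H a \<in> sets (side_measure a)" if "a \<in> I" for a
      by (rule subsetD[OF own_labels_side[OF Io[OF that]] H])
    let ?G = "\<lambda>a. H a \<inter> {\<omega> \<in> space M. a \<in> Fv \<omega> \<longleftrightarrow> a \<in> \<epsilon>}"
    have G: "?G a \<in> sets (side_measure a)" if "a \<in> I" for a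
    proof (intro sets.Int H' that)
      note f = frozen_side[OF Io[OF that]]
      show "{\<omega> \<in> space M. a \<in> Fv \<omega> \<longleftrightarrow> a \<in> \<epsilon>} \<in> side_algebra a"
      proof (cases "a \<in> \<epsilon>")
        case True
        then show ?thesis using f by (simp only: simp_thms)
      next
        case False
        have "space (side_measure a) - {\<omega> \<in> space M. a \<in> Fv \<omega>} \<in> side_algebra a"
          using f by (rule sets.compl_sets)
        moreover have "space (side_measure a) - {\<omega> \<in> space M. a \<in> Fv \<omega>} = {\<omega> \<in> space M. a \<in> Fv \<omega> \<longleftrightarrow> a \<in> \<epsilon>}"
          using False by auto
        ultimately show ?thesis by (simp only:)
      qed
    qed
    have split: "(\<forall>e\<in>J. U e \<omega> \<in> A e) \<longleftrightarrow> (\<forall>e\<in>K. U e \<omega> \<in> A e) \<and> (\<forall>a\<in>I. \<forall>e\<in>{e\<in>J - K. \<kappa> e = a}. U e \<omega> \<in> A e)" for \<omega>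
      using \<kappa>(1) by (auto simp: K_def)
    have i1: "indicat_real (labels U E -` ?B \<inter> space M) \<omega> = indicator H0 \<omega> * (\<Prod>a\<in>I. indicator (H a) \<omega>)" if "\<omega> \<in> space M" for \<omega>
      unfolding prod_indicator[OF finI] pre using that split[of \<omega>] by (simp add: indicator_def H0_def H_def)
    have "(\<integral>\<omega>. indicator (labels U E -` ?B \<inter> space M) \<omega> * ?W \<omega> \<partial>M) =
        (\<integral>\<omega>. indicator H0 \<omega> * (\<Prod>a\<in>I. indicator (H a) \<omega> * pattern \<epsilon> a \<omega>) \<partial>M)"
      by (rule Bochner_Integration.integral_cong) (simp_all add: i1 prod.distrib)
    also have "\<dots> = prob H0 * (\<Prod>a\<in>I. \<integral>\<omega>. indicator (H a) \<omega> * pattern \<epsilon> a \<omega> \<partial>M)"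
    proof (rule side[OF H0])
      fix a assume a: "a \<in> I"
      have "pattern \<epsilon> a \<in> borel_measurable (side_measure a)"
        by (rule measurable_own_labels_mono[OF pattern_own own_labels_side[OF Io[OF a]]]) simp
      then show "(\<lambda>\<omega>. indicator (H a) \<omega> * pattern \<epsilon> a \<omega>) \<in> borel_measurable (side_measure a)"
        using H'[OF a] by (intro borel_measurable_times borel_measurable_indicator)
    qed (simp_all add: indicator_def pattern_bounds)
    also have "(\<Prod>a\<in>I. \<integral>\<omega>. indicator (H a) \<omega> * pattern \<epsilon> a \<omega> \<partial>M) = (\<Prod>a\<in>I. \<integral>\<omega>. indicator (?G a) \<omega> \<partial>M)"
    proof (rule prod.cong[OF refl])
      fix a assume a: "a \<in> I"
      have "?G a \<in> events" by (rule subsetD[OF ev(1)[OF a] G[OF a]])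
      then show "(\<integral>\<omega>. indicator (H a) \<omega> * pattern \<epsilon> a \<omega> \<partial>M) = (\<integral>\<omega>. indicator (?G a) \<omega> \<partial>M)"
        using pattern_integral[OF Io[OF a] H[of a], of \<epsilon>] by simp
    qed
    also have "prob H0 * \<dots> = (\<integral>\<omega>. indicator H0 \<omega> * (\<Prod>a\<in>I. indicator (?G a) \<omega>) \<partial>M)"
    proof (rule side[OF H0, symmetric])
      show "indicat_real (?G a) \<in> borel_measurable (side_measure a)" if "a \<in> I" for a
        by (rule borel_measurable_indicator[OF G[OF that]])
    qed (simp_all add: indicator_def)
    also have "\<dots> = (\<integral>\<omega>. indicat_real (labels U E -` ?B \<inter> space M) \<omega> * indicator D \<omega> \<partial>M)"
    proof (rule integral_cong_AE)
      have "AE \<omega> in M. \<omega> \<in> space M" by simp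
      with D(2) show "AE \<omega> in M. indicator H0 \<omega> * (\<Prod>a\<in>I. indicator (?G a) \<omega>) =
          indicat_real (labels U E -` ?B \<inter> space M) \<omega> * indicator D \<omega>"
      proof eventually_elim
        case (elim \<omega>)
        have "(\<forall>a\<in>I. \<omega> \<in> ?G a) \<longleftrightarrow> (\<forall>a\<in>I. \<omega> \<in> H a) \<and> (\<forall>a\<in>I. a \<in> Fv \<omega> \<longleftrightarrow> a \<in> \<epsilon>)"
          using elim(2) by blast
        then have "(\<forall>a\<in>I. \<omega> \<in> ?G a) \<longleftrightarrow> (\<forall>a\<in>I. \<omega> \<in> H a) \<and> \<omega> \<in> D" by (simp only: elim(1))
        then show ?case unfolding i1[OF elim(2)] prod_indicator[OF finI]
          by (simp only: indicator_def mem_Collect_eq conj_assoc flip: of_bool_conj)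
      qed
      have "H0 \<in> events" by (rule subsetD[OF ev(2) H0])
      moreover have "?G a \<in> events" if "a \<in> I" for a by (rule subsetD[OF ev(1)[OF that] G[OF that]])
      ultimately show "(\<lambda>\<omega>. indicator H0 \<omega> * (\<Prod>a\<in>I. indicat_real (?G a) \<omega>)) \<in> borel_measurable M"
        by (intro borel_measurable_times borel_measurable_indicator borel_measurable_prod)
      show "(\<lambda>\<omega>. indicat_real (labels U E -` ?B \<inter> space M) \<omega> * indicator D \<omega>) \<in> borel_measurable M"
        by (intro borel_measurable_times borel_measurable_indicator measurable_sets[OF Lm B] D(1))
    qed
    also have "\<dots> = prob ((labels U E -` ?B \<inter> space M) \<inter> D)"
      by (rule integral_indicator_prob[OF measurable_sets[OF Lm B] D(1)])
    finally show "emeasure ?P ?B = emeasure ?Q ?B" by (simp only: eP[OF B] eQ[OF B])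
  qed (simp_all only: sets_distr)
  fix A assume "A \<in> sets (label_algebra M U E)"
  then obtain B where B: "B \<in> sets (label_space E)" "A = labels U E -` B \<inter> space M"
    unfolding label_algebra_def by (subst (asm) sets_vimage_algebra2) (auto simp: labels_def space_PiM)
  have "ennreal (\<integral>\<omega>. indicator A \<omega> * ?W \<omega> \<partial>M) = ennreal (prob (A \<inter> D))"
    using eP[OF B(1)] eQ[OF B(1)] \<open>?P = ?Q\<close> by (simp only: B(2))
  moreover have "0 \<le> (\<integral>\<omega>. indicator A \<omega> * ?W \<omega> \<partial>M)"
    by (intro Bochner_Integration.integral_nonneg mult_nonneg_nonneg W0) simp
  ultimately show "(\<integral>\<omega>. indicator A \<omega> * ?W \<omega> \<partial>M) = prob (A \<inter> D)" by (simp add: ennreal_inj)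
qed

end

section \<open>Two copies agree with vanishing probability\<close>

context tree_percolation
begin

definition frozen :: "'a \<Rightarrow> 'v set set" where
  "frozen \<omega> = {{v, w} | v w. {v, w} \<in> E \<and> ((v, w) \<in> Fv \<omega> \<or> (w, v) \<in> Fv \<omega>)}"

lemma edge_frozen: "a \<in> orient E \<Longrightarrow> edge a \<in> frozen \<omega> \<longleftrightarrow> a \<in> Fv \<omega> \<or> rev_edge a \<in> Fv \<omega>"
proof -
  assume a: "a \<in> orient E"
  obtain v w where vw: "a = (v, w)" by (cases a)
  have E: "{v, w} \<in> E" using a by (simp add: vw orient_def)
  have "edge a = {v, w}" "rev_edge a = (w, v)" by (simp_all add: vw edge_def rev_edge_def)
  moreover have "{v, w} \<in> frozen \<omega> \<longleftrightarrow> (v, w) \<in> Fv \<omega> \<or> (w, v) \<in> Fv \<omega>"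
  proof
    assume "{v, w} \<in> frozen \<omega>"
    then obtain x y where "{v, w} = {x, y}" "(x, y) \<in> Fv \<omega> \<or> (y, x) \<in> Fv \<omega>" unfolding frozen_def by blast
    then show "(v, w) \<in> Fv \<omega> \<or> (w, v) \<in> Fv \<omega>" by (auto simp: doubleton_eq_iff)
  qed (use E in \<open>unfold frozen_def, blast\<close>)
  ultimately show ?thesis by (simp add: vw)
qed

lemma frozen_measurable: "frozen \<in> measurable M (subset_space E)"
proof (rule measurable_subset_spaceI)
  show "frozen \<omega> \<subseteq> E" for \<omega> unfolding frozen_def by blast
  fix e assume e: "e \<in> E"
  then obtain v w where "e = {v, w}" using simple unfolding simple_graph_def by blast
  then have ed: "e = edge (v, w)" "(v, w) \<in> orient E" using e by (simp_all add: edge_def orient_def)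
  have "{\<omega> \<in> space M. e \<in> frozen \<omega>} = {\<omega> \<in> space M. (v, w) \<in> Fv \<omega>} \<union> {\<omega> \<in> space M. rev_edge (v, w) \<in> Fv \<omega>}"
    unfolding ed(1) edge_frozen[OF ed(2)] by blast
  then show "{\<omega> \<in> space M. e \<in> frozen \<omega>} \<in> events"
    using Fv_mem[OF ed(2)] Fv_mem[of "rev_edge (v, w)"] ed(2) by (simp add: sets.Un)
qed

text \<open>The frozen oriented edges as a function of labels and unoriented frozen edges, by way of
  \<open>frozen_iff_unoriented\<close>.\<close>

definition recover :: "'v \<times> 'v \<Rightarrow> (('v set \<Rightarrow> real) \<times> 'v set set) set" where
  "recover a = {p \<in> space (label_space E \<Otimes>\<^sub>M subset_space E).
     opn (\<lambda>l. (fst p (edge (desc a l)), edge (desc a l) \<in> snd p)) (fst p (edge a))}"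

lemma recover_sets:
  assumes a: "a \<in> orient E"
  shows "recover a \<in> sets (label_space E \<Otimes>\<^sub>M subset_space E)"
proof -
  have u: "(\<lambda>p. fst p e) \<in> borel_measurable (label_space E \<Otimes>\<^sub>M subset_space E)" if "e \<in> E" for e
    by (rule measurable_compose[OF measurable_fst measurable_component_singleton[OF that]])
  have h: "(\<lambda>p l. (fst p (edge (desc a l)), edge (desc a l) \<in> snd p)) \<in> measurable (label_space E \<Otimes>\<^sub>M subset_space E) trees"
  proof (rule measurable_PiM_single')
    fix l
    have e: "edge (desc a l) \<in> E" by (rule edge_desc_E[OF a])
    have "Measurable.pred (subset_space E) (\<lambda>D. edge (desc a l) \<in> D)"
      using subset_space_mem[OF e] by (simp add: pred_def)
    then have "(\<lambda>p. edge (desc a l) \<in> snd p) \<in> measurable (label_space E \<Otimes>\<^sub>M subset_space E) (count_space UNIV)"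
      by (rule measurable_compose[OF measurable_snd])
    then show "(\<lambda>p. (fst p (edge (desc a l)), edge (desc a l) \<in> snd p)) \<in>
        measurable (label_space E \<Otimes>\<^sub>M subset_space E) (borel \<Otimes>\<^sub>M count_space UNIV)"
      by (rule measurable_Pair[OF u[OF e]])
  qed (simp add: space_pair_measure)
  have "edge a \<in> E" using a mem_orient by blast
  then show ?thesis unfolding recover_def using opn_measurable'[OF h u] by (simp add: pred_def)
qed

lemma labels_frozen_space: "\<omega> \<in> space M \<Longrightarrow> (labels U E \<omega>, frozen \<omega>) \<in> space (label_space E \<Otimes>\<^sub>M subset_space E)"
  by (rule measurable_space[OF measurable_Pair[OF labels_measurable frozen_measurable]]) auto

lemma AE_recover:
  "AE \<omega> in M. \<forall>a\<in>orient E. a \<in> Fv \<omega> \<longleftrightarrow> (labels U E \<omega>, frozen \<omega>) \<in> recover a"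
proof -
  have "AE \<omega> in M. \<omega> \<in> space M" by simp
  with AE_frozen AE_all_bounds show ?thesis
  proof eventually_elim
    case (elim \<omega>)
    show ?case
    proof
      fix a assume a: "a \<in> orient E"
      let ?u = "\<lambda>e. U e \<omega>"
      have "a \<in> Fv \<omega> \<longleftrightarrow> opn (code ?u {c. c \<in> Fv \<omega> \<or> rev_edge c \<in> Fv \<omega>} a) (?u (edge a))"
      proof (rule frozen_iff_unoriented[OF _ _ a])
        show "d \<in> Fv \<omega> \<longleftrightarrow> opn (code ?u (Fv \<omega>) d) (?u (edge d))" if "d \<in> orient E" for d
          using bspec[OF elim(1) that] unfolding cd_def .
        show "0 \<le> ?u e \<and> ?u e \<le> 1" if "e \<in> E" for e using bspec[OF elim(2) that] .
      qed
      moreover have "code ?u {c. c \<in> Fv \<omega> \<or> rev_edge c \<in> Fv \<omega>} a =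
          (\<lambda>l. (labels U E \<omega> (edge (desc a l)), edge (desc a l) \<in> frozen \<omega>))"
        by (rule ext) (simp add: code_def labels_def edge_desc_E[OF a] edge_frozen[OF desc_orient[OF a]])
      moreover have "?u (edge a) = labels U E \<omega> (edge a)" using a by (simp add: labels_def mem_orient)
      ultimately show "a \<in> Fv \<omega> \<longleftrightarrow> (labels U E \<omega>, frozen \<omega>) \<in> recover a"
        using labels_frozen_space[OF elim(3)] by (simp add: recover_def)
    qed
  qed
qed

text \<open>The bound c is tested on the best guess from the labels: declare a frozen when \<beta> =
  freezing a exceeds 1/2. Its error probability is the mean of min \<beta> (1 - \<beta>), which is
  at most the mean of 2 \<beta> (1 - \<beta>) = 1 - (\<beta>^2 + (1 - \<beta>)^2).\<close>

lemma freezing_gap: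
  assumes a: "a \<in> orient E"
    and c: "\<And>C. C \<in> sets labs \<Longrightarrow> c \<le> prob {\<omega> \<in> space M. (a \<in> Fv \<omega>) \<noteq> (labels_of (cd a \<omega>) \<in> C)}"
  shows "(\<integral>\<omega>. (freezing a \<omega>)\<^sup>2 + (1 - freezing a \<omega>)\<^sup>2 \<partial>M) \<le> 1 - c"
proof -
  let ?\<beta> = "freezing a"
  have \<beta>M: "?\<beta> \<in> borel_measurable M" using own_labels_sub[OF a] freezing_own by (rule measurable_from_subalg)
  \<comment> \<open>Measurable with respect to \<open>own_labels a\<close>, hence the preimage of
    some C in \<open>labs\<close>, to which hypothesis \<open>c\<close> applies.\<close>
  define H where "H = {\<omega> \<in> space M. 1 / 2 < ?\<beta> \<omega>}"
  have HN: "H \<in> sets (own_labels a)"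
    using borel_measurable_less[OF borel_measurable_const freezing_own[of a], of "1 / 2"] by (simp add: H_def)
  have HN': "space M - H \<in> sets (own_labels a)" using sets.compl_sets[OF HN] by simp
  have Hev: "H \<in> events" "space M - H \<in> events" using own_labels_sub[OF a] HN HN' by (auto simp: subalgebra_def)
  obtain C where C: "C \<in> sets labs" "H = (\<lambda>\<omega>. labels_of (cd a \<omega>)) -` C \<inter> space M"
    using HN unfolding sets_own_labels by blast
  let ?D1 = "{\<omega> \<in> space M. a \<in> Fv \<omega> \<longleftrightarrow> a \<in> {}}" and ?D2 = "{\<omega> \<in> space M. a \<in> Fv \<omega> \<longleftrightarrow> a \<in> {a}}"
  have D2: "?D2 \<in> events" using Fv_mem[OF a] by simp
  have "?D1 = space M - ?D2" by auto
  then have D1: "?D1 \<in> events" using D2 by (simp only: sets.compl_sets)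
  have pm: "pattern \<epsilon> a \<in> borel_measurable M" for \<epsilon>
    using own_labels_sub[OF a] pattern_own by (rule measurable_from_subalg)
  have i: "integrable M (\<lambda>\<omega>. indicat_real A \<omega> * pattern \<epsilon> a \<omega>)" if "A \<in> events" for A \<epsilon>
  proof (rule integrable_bounded01)
    show "(\<lambda>\<omega>. indicat_real A \<omega> * pattern \<epsilon> a \<omega>) \<in> borel_measurable M"
      using that pm by (intro borel_measurable_times borel_measurable_indicator)
  qed (simp_all add: indicator_def pattern_bounds)
  have sq: "x\<^sup>2 + (1 - x)\<^sup>2 = 1 - 2 * x * (1 - x)" for x :: real by (simp add: power2_eq_square algebra_simps)
  have s01: "0 \<le> 2 * ?\<beta> \<omega> * (1 - ?\<beta> \<omega>)" for \<omega> by (simp add: freezing_bounds)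
  have i2: "integrable M (\<lambda>\<omega>. (?\<beta> \<omega>)\<^sup>2 + (1 - ?\<beta> \<omega>)\<^sup>2)"
  proof (rule integrable_bounded01)
    show "(\<lambda>\<omega>. (?\<beta> \<omega>)\<^sup>2 + (1 - ?\<beta> \<omega>)\<^sup>2) \<in> borel_measurable M" using \<beta>M by simp
    show "(?\<beta> \<omega>)\<^sup>2 + (1 - ?\<beta> \<omega>)\<^sup>2 \<le> 1" for \<omega> using s01[of \<omega>] by (simp add: sq)
  qed simp
  have "c \<le> prob {\<omega> \<in> space M. (a \<in> Fv \<omega>) \<noteq> (labels_of (cd a \<omega>) \<in> C)}" by (rule c[OF C(1)])
  also have "{\<omega> \<in> space M. (a \<in> Fv \<omega>) \<noteq> (labels_of (cd a \<omega>) \<in> C)} = (H \<inter> ?D1) \<union> ((space M - H) \<inter> ?D2)"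
    unfolding C(2) by auto
  also have "prob \<dots> \<le> prob (H \<inter> ?D1) + prob ((space M - H) \<inter> ?D2)"
    using Hev D1 D2 by (intro measure_Un_le sets.Int)
  also have "\<dots> = (\<integral>\<omega>. indicator H \<omega> * pattern {} a \<omega> \<partial>M) + (\<integral>\<omega>. indicator (space M - H) \<omega> * pattern {a} a \<omega> \<partial>M)"
    by (simp only: pattern_integral[OF a HN] pattern_integral[OF a HN'])
  also have "\<dots> = (\<integral>\<omega>. indicator H \<omega> * pattern {} a \<omega> + indicator (space M - H) \<omega> * pattern {a} a \<omega> \<partial>M)"
    by (rule Bochner_Integration.integral_add[OF i[OF Hev(1)] i[OF Hev(2)], symmetric])
  also have "\<dots> \<le> (\<integral>\<omega>. 1 - ((?\<beta> \<omega>)\<^sup>2 + (1 - ?\<beta> \<omega>)\<^sup>2) \<partial>M)"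
  proof (rule integral_mono)
    show "integrable M (\<lambda>\<omega>. indicat_real H \<omega> * pattern {} a \<omega> + indicat_real (space M - H) \<omega> * pattern {a} a \<omega>)"
      by (rule Bochner_Integration.integrable_add[OF i[OF Hev(1)] i[OF Hev(2)]])
    show "integrable M (\<lambda>\<omega>. 1 - ((?\<beta> \<omega>)\<^sup>2 + (1 - ?\<beta> \<omega>)\<^sup>2))"
      by (rule Bochner_Integration.integrable_diff[OF _ i2]) simp
    fix \<omega> assume \<omega>: "\<omega> \<in> space M"
    note b = freezing_bounds[of a \<omega>]
    show "indicat_real H \<omega> * pattern {} a \<omega> + indicat_real (space M - H) \<omega> * pattern {a} a \<omega> \<le>
        1 - ((?\<beta> \<omega>)\<^sup>2 + (1 - ?\<beta> \<omega>)\<^sup>2)"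
    proof (cases "\<omega> \<in> H")
      case True
      then have "1 * (1 - ?\<beta> \<omega>) \<le> (2 * ?\<beta> \<omega>) * (1 - ?\<beta> \<omega>)"
        using b by (intro mult_right_mono) (simp_all add: H_def)
      then show ?thesis using True by (simp add: sq pattern_def)
    next
      case False
      then have "?\<beta> \<omega> * 1 \<le> ?\<beta> \<omega> * (2 * (1 - ?\<beta> \<omega>))"
        using b \<omega> by (intro mult_left_mono) (simp_all add: H_def)
      then have "?\<beta> \<omega> \<le> 2 * ?\<beta> \<omega> * (1 - ?\<beta> \<omega>)"
        by (simp only: mult_1_right mult.left_commute[of "?\<beta> \<omega>" 2] mult.assoc)
      then show ?thesis using False \<omega> by (simp add: sq pattern_def)
    qed
  qed
  also have "\<dots> = 1 - (\<integral>\<omega>. (?\<beta> \<omega>)\<^sup>2 + (1 - ?\<beta> \<omega>)\<^sup>2 \<partial>M)"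
    by (subst Bochner_Integration.integral_diff[OF _ i2]) (simp_all add: prob_space)
  finally show ?thesis by simp
qed

text \<open>Summed over the patterns, the squares of the pattern probabilities factorise.\<close>

lemma agreement_bound:
  assumes copy: "cond_indep_copy M E U frozen F'" and a0: "a0 \<in> orient E"
    and I: "I = boundary T E (ball_side a0 n)"
    and gap: "\<And>a. a \<in> I \<Longrightarrow> (\<integral>\<omega>. (freezing a \<omega>)\<^sup>2 + (1 - freezing a \<omega>)\<^sup>2 \<partial>M) \<le> 1 - c"
  shows "{\<omega> \<in> space M. \<forall>a\<in>I. (labels U E \<omega>, frozen \<omega>) \<in> recover a \<longleftrightarrow> (labels U E \<omega>, F' \<omega>) \<in> recover a} \<in> events"
    and "prob {\<omega> \<in> space M. \<forall>a\<in>I. (labels U E \<omega>, frozen \<omega>) \<in> recover a \<longleftrightarrow> (labels U E \<omega>, F' \<omega>) \<in> recover a}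
      \<le> (1 - c) ^ card I"
proof -
  let ?K = "label_space E \<Otimes>\<^sub>M subset_space E"
  let ?X = "\<lambda>\<omega>. (labels U E \<omega>, frozen \<omega>)" and ?Y = "\<lambda>\<omega>. (labels U E \<omega>, F' \<omega>)"
  let ?A = "{\<omega> \<in> space M. \<forall>a\<in>I. ?X \<omega> \<in> recover a \<longleftrightarrow> ?Y \<omega> \<in> recover a}"
  have finI: "finite I" unfolding I using a0 by (rule finite_boundary)
  have Io: "a \<in> orient E" if "a \<in> I" for a using that boundary_orient unfolding I by blast
  have Lm: "labels U E \<in> measurable M (label_space E)" by (rule labels_measurable) simp
  have F'm: "F' \<in> measurable M (subset_space E)" and law: "joint_law M E E U F' = joint_law M E E U frozen"
    and ci: "cond_indep_given M (label_algebra M U E) (subset_space E) frozen (subset_space E) F'"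
    using copy[unfolded cond_indep_copy_def] by (rule conjunct1, rule conjunct1[OF conjunct2], rule conjunct2[OF conjunct2])
  have Xm: "?X \<in> measurable M ?K" by (rule measurable_Pair[OF Lm frozen_measurable])
  have Ym: "?Y \<in> measurable M ?K" by (rule measurable_Pair[OF Lm F'm])
  have XR: "{\<omega> \<in> space M. ?X \<omega> \<in> R} \<in> events" "{\<omega> \<in> space M. ?Y \<omega> \<in> R} \<in> events" if "R \<in> sets ?K" for R
  proof -
    have "?X -` R \<inter> space M = {\<omega> \<in> space M. ?X \<omega> \<in> R}" "?Y -` R \<inter> space M = {\<omega> \<in> space M. ?Y \<omega> \<in> R}" by blast+
    then show "{\<omega> \<in> space M. ?X \<omega> \<in> R} \<in> events" "{\<omega> \<in> space M. ?Y \<omega> \<in> R} \<in> events"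
      using measurable_sets[OF Xm that] measurable_sets[OF Ym that] by (simp_all only:)
  qed
  \<comment> \<open>The set of pairs of labels and unoriented edges that show the pattern \<epsilon>
    on the boundary. Stated through \<open>recover\<close>, the same set describes both copies; for
    the first one it is almost surely the pattern of frozen oriented edges.\<close>
  define B where "B \<epsilon> = {p \<in> space ?K. \<forall>a\<in>I. p \<in> recover a \<longleftrightarrow> a \<in> \<epsilon>}" for \<epsilon>
  have B: "B \<epsilon> \<in> sets ?K" for \<epsilon>
    unfolding B_def
  proof (rule sets.sets_Collect_finite_All[OF _ finI])
    fix a assume a: "a \<in> I"
    note r = recover_sets[OF Io[OF a]]
    have "recover a = {p \<in> space ?K. p \<in> recover a}" unfolding recover_def by blast
    then have r': "{p \<in> space ?K. p \<in> recover a} \<in> sets ?K" using r by (simp only:)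
    show "{p \<in> space ?K. p \<in> recover a \<longleftrightarrow> a \<in> \<epsilon>} \<in> sets ?K"
    proof (cases "a \<in> \<epsilon>")
      case True
      then show ?thesis using r' by (simp only: simp_thms)
    next
      case False
      then show ?thesis using sets.sets_Collect_neg[OF r'] by (simp only: simp_thms)
    qed
  qed
  define D where "D \<epsilon> = {\<omega> \<in> space M. ?X \<omega> \<in> B \<epsilon>}" for \<epsilon>
  define P where "P \<epsilon> = {\<omega> \<in> space M. ?X \<omega> \<in> B \<epsilon> \<and> ?Y \<omega> \<in> B \<epsilon>}" for \<epsilon>
  have D: "D \<epsilon> \<in> events" for \<epsilon> unfolding D_def by (rule XR[OF B])
  have P: "P \<epsilon> \<in> events" for \<epsilon>
  proof -
    have "P \<epsilon> = {\<omega> \<in> space M. ?X \<omega> \<in> B \<epsilon>} \<inter> {\<omega> \<in> space M. ?Y \<omega> \<in> B \<epsilon>}" unfolding P_def by blast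
    then show ?thesis using XR[OF B] by simp
  qed
  have AP: "?A = (\<Union>\<epsilon>\<in>Pow I. P \<epsilon>)"
  proof (intro equalityI subsetI)
    fix \<omega> assume \<omega>: "\<omega> \<in> ?A"
    then have wM: "\<omega> \<in> space M" by (simp only: mem_Collect_eq)
    have XY: "?X \<omega> \<in> space ?K" "?Y \<omega> \<in> space ?K" using measurable_space[OF Xm wM] measurable_space[OF Ym wM] .
    have ag: "\<forall>a\<in>I. ?X \<omega> \<in> recover a \<longleftrightarrow> ?Y \<omega> \<in> recover a"
      using \<omega> unfolding mem_Collect_eq by (rule conjunct2)
    have "?X \<omega> \<in> B {a\<in>I. ?X \<omega> \<in> recover a}" unfolding B_def using XY(1) by blast
    moreover have "?Y \<omega> \<in> B {a\<in>I. ?X \<omega> \<in> recover a}" unfolding B_def using XY(2) ag by blast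
    ultimately have "\<omega> \<in> P {a\<in>I. ?X \<omega> \<in> recover a}" unfolding P_def using wM by blast
    then show "\<omega> \<in> (\<Union>\<epsilon>\<in>Pow I. P \<epsilon>)" by (rule UN_I[rotated]) blast
  next
    fix \<omega> assume "\<omega> \<in> (\<Union>\<epsilon>\<in>Pow I. P \<epsilon>)"
    then obtain \<epsilon> where "\<omega> \<in> P \<epsilon>" by blast
    then have "\<omega> \<in> space M" "?X \<omega> \<in> B \<epsilon>" "?Y \<omega> \<in> B \<epsilon>" unfolding P_def by blast+
    then show "\<omega> \<in> ?A" unfolding B_def by blast
  qed
  show "?A \<in> events" unfolding AP using finI P by (intro sets.finite_UN) simp_all
  have AED: "AE \<omega> in M. \<omega> \<in> D \<epsilon> \<longleftrightarrow> (\<forall>a\<in>I. a \<in> Fv \<omega> \<longleftrightarrow> a \<in> \<epsilon>)" for \<epsilon>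
  proof -
    have "AE \<omega> in M. \<omega> \<in> space M" by simp
    with AE_recover show ?thesis
    proof eventually_elim
      case (elim \<omega>)
      have "(\<forall>a\<in>I. a \<in> Fv \<omega> \<longleftrightarrow> a \<in> \<epsilon>) \<longleftrightarrow> (\<forall>a\<in>I. ?X \<omega> \<in> recover a \<longleftrightarrow> a \<in> \<epsilon>)"
        by (rule ball_cong[OF refl]) (simp only: bspec[OF elim(1) Io])
      then show ?case using elim(2) measurable_space[OF Xm elim(2)] by (simp add: D_def B_def)
    qed
  qed
  have pm: "pattern \<epsilon> a \<in> borel_measurable M" if "a \<in> I" for a \<epsilon>
    using own_labels_sub[OF Io[OF that]] pattern_own by (rule measurable_from_subalg)
  have pmm: "(\<lambda>\<omega>. \<Prod>a\<in>I. (pattern \<epsilon> a \<omega>)\<^sup>2) \<in> borel_measurable M" for \<epsilon>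
    using pm by (intro borel_measurable_prod borel_measurable_power)
  have probP: "prob (P \<epsilon>) = (\<integral>\<omega>. (\<Prod>a\<in>I. (pattern \<epsilon> a \<omega>)\<^sup>2) \<partial>M)" for \<epsilon>
  proof -
    have "prob (P \<epsilon>) = (\<integral>\<omega>. (cprob M (label_algebra M U E) (D \<epsilon>) \<omega>)\<^sup>2 \<partial>M)"
      unfolding P_def D_def label_algebra_def
    proof (rule cond_indep_joint[OF Lm frozen_measurable F'm _ _ B])
      show "cond_indep_given M (vimage_algebra (space M) (labels U E) (label_space E)) (subset_space E) frozen (subset_space E) F'"
        using ci unfolding label_algebra_def .
      show "distr M ?K ?X = distr M ?K ?Y" using law unfolding joint_law_def by (rule sym)
    qed
    also have "\<dots> = (\<integral>\<omega>. (\<Prod>a\<in>I. (pattern \<epsilon> a \<omega>)\<^sup>2) \<partial>M)"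
    proof (rule integral_cong_AE)
      show "AE \<omega> in M. (cprob M (label_algebra M U E) (D \<epsilon>) \<omega>)\<^sup>2 = (\<Prod>a\<in>I. (pattern \<epsilon> a \<omega>)\<^sup>2)"
        using cprob_pattern[OF a0 I D[of \<epsilon>] AED[of \<epsilon>]] by eventually_elim (simp add: prod_power_distrib)
      show "(\<lambda>\<omega>. (cprob M (label_algebra M U E) (D \<epsilon>) \<omega>)\<^sup>2) \<in> borel_measurable M"
        by (intro borel_measurable_power measurable_from_subalg[OF all_labels_sub cprob_measurable])
    qed (rule pmm)
    finally show ?thesis .
  qed
  \<comment> \<open>The product of sums of two terms, expanded over the subsets \<epsilon> of I.
    This turns a sum over exponentially many patterns into a single product over edges, whose
    integral factorises.\<close>
  have sumP: "(\<Sum>\<epsilon>\<in>Pow I. \<Prod>a\<in>I. (pattern \<epsilon> a \<omega>)\<^sup>2) = (\<Prod>a\<in>I. (freezing a \<omega>)\<^sup>2 + (1 - freezing a \<omega>)\<^sup>2)" for \<omega>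
    unfolding prod_add[OF finI]
  proof (rule sum.cong[OF refl])
    fix \<epsilon> assume "\<epsilon> \<in> Pow I"
    then have "\<epsilon> \<subseteq> I" by simp
    then have "(\<Prod>a\<in>I. (pattern \<epsilon> a \<omega>)\<^sup>2) = (\<Prod>a\<in>I - \<epsilon>. (pattern \<epsilon> a \<omega>)\<^sup>2) * (\<Prod>a\<in>\<epsilon>. (pattern \<epsilon> a \<omega>)\<^sup>2)"
      by (rule prod.subset_diff[OF _ finI])
    then show "(\<Prod>a\<in>I. (pattern \<epsilon> a \<omega>)\<^sup>2) = (\<Prod>a\<in>\<epsilon>. (freezing a \<omega>)\<^sup>2) * (\<Prod>a\<in>I - \<epsilon>. (1 - freezing a \<omega>)\<^sup>2)"
      by (simp add: pattern_def mult.commute)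
  qed
  have f01: "0 \<le> (freezing a \<omega>)\<^sup>2 + (1 - freezing a \<omega>)\<^sup>2" "(freezing a \<omega>)\<^sup>2 + (1 - freezing a \<omega>)\<^sup>2 \<le> 1" for a \<omega>
  proof -
    have "0 \<le> freezing a \<omega> * (1 - freezing a \<omega>)" by (simp add: freezing_bounds)
    then show "(freezing a \<omega>)\<^sup>2 + (1 - freezing a \<omega>)\<^sup>2 \<le> 1" by (simp add: power2_eq_square algebra_simps)
  qed simp
  have "prob ?A \<le> (\<Sum>\<epsilon>\<in>Pow I. prob (P \<epsilon>))"
    unfolding AP using finI P by (intro measure_UNION_le) auto
  also have "\<dots> = (\<integral>\<omega>. (\<Sum>\<epsilon>\<in>Pow I. \<Prod>a\<in>I. (pattern \<epsilon> a \<omega>)\<^sup>2) \<partial>M)"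
    unfolding probP
  proof (rule Bochner_Integration.integral_sum[symmetric])
    show "integrable M (\<lambda>\<omega>. \<Prod>a\<in>I. (pattern \<epsilon> a \<omega>)\<^sup>2)" for \<epsilon>
      by (rule integrable_bounded01[OF pmm])
        (auto intro!: prod_nonneg prod_le_1 simp: pattern_bounds power_le_one)
  qed
  also have "\<dots> = (\<integral>\<omega>. indicator (space M) \<omega> * (\<Prod>a\<in>I. (freezing a \<omega>)\<^sup>2 + (1 - freezing a \<omega>)\<^sup>2) \<partial>M)"
    unfolding sumP by (rule Bochner_Integration.integral_cong) simp_all
  also have "\<dots> = prob (space M) * (\<Prod>a\<in>I. \<integral>\<omega>. (freezing a \<omega>)\<^sup>2 + (1 - freezing a \<omega>)\<^sup>2 \<partial>M)"
    unfolding I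
  proof (rule sides_integral[OF subtree_ball_side[OF a0] finite_ball_side finite_boundary[OF a0]])
    show "space M \<in> sets (label_algebra M U (edges_within E (ball_side a0 n)))"
      using sets.top[of "label_algebra M U (edges_within E (ball_side a0 n))"] by (simp add: label_algebra_def)
    fix a assume "a \<in> boundary T E (ball_side a0 n)"
    then have "a \<in> orient E" using boundary_orient by blast
    then have "freezing a \<in> borel_measurable (side_measure a)"
      by (intro measurable_own_labels_mono[OF freezing_own own_labels_side]) simp_all
    then show "(\<lambda>\<omega>. (freezing a \<omega>)\<^sup>2 + (1 - freezing a \<omega>)\<^sup>2) \<in> borel_measurable (side_measure a)" by simp
  qed (rule f01)+
  also have "\<dots> = (\<Prod>a\<in>I. \<integral>\<omega>. (freezing a \<omega>)\<^sup>2 + (1 - freezing a \<omega>)\<^sup>2 \<partial>M)" by (simp add: prob_space)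
  also have "\<dots> \<le> (\<Prod>a\<in>I. 1 - c)"
    by (intro prod_mono conjI gap Bochner_Integration.integral_nonneg f01)
  finally show "prob ?A \<le> (1 - c) ^ card I" by simp
qed

text \<open>Equal copies agree on the boundary of every ball. The boundaries have at least 2 ^ (n +
  1) edges, so the agreement probabilities, at most 1 - c to this power, tend to 0; bounding the
  number of edges below by n is enough for that.\<close>

lemma copies_differ:
  assumes c: "0 < c"
    and gap: "\<And>a C. a \<in> orient E \<Longrightarrow> C \<in> sets labs \<Longrightarrow>
      c \<le> prob {\<omega> \<in> space M. (a \<in> Fv \<omega>) \<noteq> (labels_of (cd a \<omega>) \<in> C)}"
    and copy: "cond_indep_copy M E U frozen F'"
  shows "AE \<omega> in M. frozen \<omega> \<noteq> F' \<omega>"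
proof -
  obtain a0 where a0: "a0 \<in> orient E" using T_edge_exists by blast
  define A where "A n = {\<omega> \<in> space M. \<forall>a\<in>boundary T E (ball_side a0 n).
    (labels U E \<omega>, frozen \<omega>) \<in> recover a \<longleftrightarrow> (labels U E \<omega>, F' \<omega>) \<in> recover a}" for n
  have c1: "c \<le> 1" using gap[OF a0 sets.top] prob_le_1 by (rule order_trans)
  have g: "(\<integral>\<omega>. (freezing a \<omega>)\<^sup>2 + (1 - freezing a \<omega>)\<^sup>2 \<partial>M) \<le> 1 - c" if "a \<in> boundary T E S" for a S
    using that boundary_orient by (intro freezing_gap gap) blast+
  have A: "A n \<in> events" "prob (A n) \<le> (1 - c) ^ card (boundary T E (ball_side a0 n))" for n
    unfolding A_def by (rule agreement_bound[OF copy a0 refl g], assumption)+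
  have card: "n \<le> card (boundary T E (ball_side a0 n))" for n
  proof -
    have "n \<le> Suc n" by simp
    also have "\<dots> \<le> 2 ^ Suc n" by (rule less_imp_le, rule less_exp)
    also have "\<dots> = card {l :: bool list. length l = Suc n}"
      using card_lists_length_eq[of "UNIV :: bool set" "Suc n"] by simp
    also have "\<dots> = card (desc a0 ` {l. length l = Suc n})"
      by (rule card_image[symmetric], rule inj_on_subset[OF desc_inj[OF a0]]) simp
    also have "\<dots> \<le> card (boundary T E (ball_side a0 n))"
      using boundary_ball_side[OF a0, of n] by (intro card_mono finite_boundary[OF a0]) auto
    finally show ?thesis .
  qed
  have "(\<Inter>n. A n) \<in> events" using A(1) by (intro sets.countable_INT) auto
  moreover have "prob (\<Inter>n. A n) = 0"
  proof (rule antisym)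
    have lim: "(\<lambda>n. (1 - c) ^ n) \<longlonglongrightarrow> 0" using c c1 by (intro LIMSEQ_realpow_zero) simp_all
    have "prob (\<Inter>n. A n) \<le> (1 - c) ^ n" for n
    proof -
      have "prob (\<Inter>n. A n) \<le> prob (A n)" using A(1) by (intro finite_measure_mono) auto
      also note A(2)
      also have "(1 - c) ^ card (boundary T E (ball_side a0 n)) \<le> (1 - c) ^ n"
        using c c1 card by (intro power_decreasing) simp_all
      finally show ?thesis .
    qed
    then show "prob (\<Inter>n. A n) \<le> 0" by (intro LIMSEQ_le_const[OF lim] exI allI impI)
  qed simp
  ultimately have "(\<Inter>n. A n) \<in> null_sets M" by (simp add: null_sets_def emeasure_eq_measure)
  then show ?thesis by (rule AE_I') (auto simp: A_def)
qed

text \<open>If \<open>frozen\<close> were a function of the labels, conditional probabilities of its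
  events would be indicators. It would then be a conditionally independent copy of itself and so
  differ from itself almost surely.\<close>

lemma frozen_not_measurable:
  assumes copies: "\<And>F'. cond_indep_copy M E U frozen F' \<Longrightarrow> AE \<omega> in M. frozen \<omega> \<noteq> F' \<omega>"
  shows "frozen \<notin> measurable (label_algebra M U E) (subset_space E)"
proof
  let ?N = "label_algebra M U E"
  assume m: "frozen \<in> measurable ?N (subset_space E)"
  interpret N: sigma_finite_subalgebra M ?N by (rule subalgebra_sigma_finite[OF all_labels_sub])
  have ev: "{x \<in> space M. frozen x \<in> A} \<in> sets ?N" if "A \<in> sets (subset_space E)" for A
    using measurable_sets[OF m that] by (simp add: label_algebra_def vimage_def Int_def conj_commute)
  have ce: "AE \<omega> in M. real_cond_exp M ?N (indicator D) \<omega> = indicator D \<omega>" if "D \<in> sets ?N" for D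
  proof (rule N.real_cond_exp_F_meas)
    have "D \<in> events" using that all_labels_sub by (auto simp: subalgebra_def)
    then show "integrable M (indicat_real D)" by (intro integrable_bounded01) simp_all
    show "indicat_real D \<in> borel_measurable ?N" using that by (rule borel_measurable_indicator)
  qed
  have "cond_indep_given M ?N (subset_space E) frozen (subset_space E) frozen"
    unfolding cond_indep_given_def
  proof (intro ballI)
    fix A B assume AB: "A \<in> sets (subset_space E)" "B \<in> sets (subset_space E)"
    let ?A = "{x \<in> space M. frozen x \<in> A}" and ?B = "{x \<in> space M. frozen x \<in> B}"
    have e: "{x \<in> space M. frozen x \<in> A \<and> frozen x \<in> B} = ?A \<inter> ?B" by blast
    show "AE \<omega> in M. real_cond_exp M ?N (indicator {x \<in> space M. frozen x \<in> A \<and> frozen x \<in> B}) \<omega> =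
        real_cond_exp M ?N (indicator ?A) \<omega> * real_cond_exp M ?N (indicator ?B) \<omega>"
      unfolding e using ce[OF sets.Int[OF ev[OF AB(1)] ev[OF AB(2)]]] ce[OF ev[OF AB(1)]] ce[OF ev[OF AB(2)]]
      by eventually_elim (simp only: indicator_inter_arith)
  qed
  then have "cond_indep_copy M E U frozen frozen"
    unfolding cond_indep_copy_def using frozen_measurable by blast
  from copies[OF this] have "AE \<omega> in M. False" by simp
  then show False by simp
qed

end

theorem theorem3:
  fixes M :: "'a measure"
    and T :: "'v set"
    and E :: "'v set set"
    and U :: "'v set \<Rightarrow> 'a \<Rightarrow> real"
    and Fvec :: "'a \<Rightarrow> ('v \<times> 'v) set"
    and F :: "'a \<Rightarrow> 'v set set"
  assumes "infinite_regular_tree 3 T E"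
    and "frozen_percolation M T E U Fvec"
    and "F = (\<lambda>\<omega>. {{v, w} | v w. {v, w} \<in> E \<and> ((v, w) \<in> Fvec \<omega> \<or> (w, v) \<in> Fvec \<omega>)})"
  shows "(\<forall>F'. cond_indep_copy M E U F F' \<longrightarrow> (AE \<omega> in M. F \<omega> \<noteq> F' \<omega>)) \<and>
         F \<notin> label_algebra M U E \<rightarrow>\<^sub>M subset_space E"
proof -
  interpret tree_percolation M T E U Fvec
    by (intro tree_percolation.intro regular_tree.intro assms)
  have F: "F = frozen" unfolding assms(3) frozen_def[abs_def] ..
  have copies: "AE \<omega> in M. frozen \<omega> \<noteq> F' \<omega>" if "cond_indep_copy M E U frozen F'" for F'
  proof (rule tree_nonendogeny[where 'a = 'a and 'v = 'v])
    fix c :: real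
    assume c: "0 < c" "\<And>(M :: 'a measure) (T :: 'v set) E U Fv a C. tree_percolation M T E U Fv \<Longrightarrow> a \<in> orient E \<Longrightarrow>
      C \<in> sets labs \<Longrightarrow> c \<le> measure M {\<omega> \<in> space M. (a \<in> Fv \<omega>) \<noteq> (labels_of (tree_percolation.cd E U Fv a \<omega>) \<in> C)}"
    show ?thesis
      by (rule copies_differ[OF c(1) c(2)[OF tree_percolation_axioms] that])
  qed
  show ?thesis unfolding F using copies frozen_not_measurable[OF copies] by blast
qed

end
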